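(* Let $t\in\Bbbk$ and let $R=\Bbbk[z][x,y;\sigma,a]$ be the classical generalized Weyl algebra with $\sigma(z)=z-1$ and $a=z(z-t)$ (so $\deg_z(a)=2$). Let $G$ be the group of automorphisms of $R$ generated by $\Omega$ and all the maps $\Theta_\lambda$ ($\lambda\in\Bbbk^\times$), $\Psi_{1,\lambda}$ and $\Phi_{1,\lambda}$ ($\lambda\in\Bbbk$). Then the group $\operatorname{Aut}_{\mathrm{fl}}(R)$ of filtered automorphisms of $R$ equals $G$. Moreover, if $g\in\operatorname{Aut}_{\mathrm{fl}}(R)$, then $\operatorname{hdet}(g)=1$.
   Context: $\Bbbk$ is an algebraically closed field of characteristic zero; all algebras are $\Bbbk$-algebras. Classical GWA: $R=\Bbbk[z][x,y;\sigma,a]$, with $\sigma(z)=z-1$, is the ring obtained by adjoining to $\Bbbk[z]$ the variables $x,y$ subject to $xy=\sigma(a)$, $yx=a$, $xd=\sigma(d)x$, $yd=\sigma^{-1}(d)y$ for all $d\in\Bbbk[z]$. Standard filtration: the filtration on $R$ defined by $\deg x=\deg y=\deg_z(a)=2$, $\deg z=2$; its associated graded ring is $\operatorname{gr}R\cong\Bbbk[x,y,z]/(yx-z^2)$. A filtered automorphism is a $\Bbbk$-algebra automorphism $\phi$ with $\deg(\phi(r))=\deg(r)$ for all $r\in R$. The following are automorphisms of $R$: $\Theta_\lambda$: $x\mapsto\lambda x$, $y\mapsto\lambda^{-1}y$, $z\mapsto z$; $\Psi_{1,\lambda}$: $x\mapsto x$, $y\mapsto y-2\lambda z+\lambda^2x+\lambda(t+1)$,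 $z\mapsto z-\lambda x$; $\Phi_{1,\lambda}$: $x\mapsto x+2\lambda z+\lambda^2y-\lambda(t+1)$, $y\mapsto y$, $z\mapsto z+\lambda y$; $\Omega$: $x\mapsto y$, $y\mapsto x$, $z\mapsto 1+t-z$. Homological determinant: for a noetherian connected graded AS-Gorenstein algebra $A$ of injective dimension $d$ with graded maximal ideal $\mathfrak m$, one has $H^d_{\mathfrak m}(A)\cong A'(\ell)$, where $A'$ is the graded $\Bbbk$-dual of $A$ and $(\ell)$ a degree shift. A graded automorphism $g$ of $A$ induces a $g$-linear map on $H^d_{\mathfrak m}(A)$, which under this identification equals $c\,(g^{-1})'$ for some $c\in\Bbbk^\times$; one sets $\operatorname{hdet}_A(g)=c^{-1}$. For a filtered automorphism $g$ of a filtered algebra $R$ with $\operatorname{gr}R$ noetherian AS-Gorenstein, $\operatorname{hdet}_R(g):=\operatorname{hdet}_{\operatorname{gr}R}(\operatorname{gr}g)$, where $\operatorname{gr}g$ is the induced graded automorphism. *)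

theory Defs
  imports
    "HOL-Computational_Algebra.Polynomial"
    "HOL-Library.Poly_Mapping"
    "HOL-Algebra.Bij"
    "HOL-Algebra.Generated_Groups"
    "HOL-Algebra.Module"
    "HOL-Algebra.QuotRing"
begin

text \<open>
  An algebra over the field \<open>'k\<close>, not necessarily commutative, is an HOL-Algebra record of type
  \<open>('k, 'r) module\<close>: a ring together with a scalar multiplication by the elements of \<open>'k\<close>.
\<close>

section \<open>Algebra endomorphisms and automorphisms\<close>

text \<open>As in \<^theory>\<open>HOL-Algebra.Bij\<close>, maps are extensional so that function equality is equality on
  the carrier.\<close>

definition alg_endos :: "('k, 'r, 'm) module_scheme \<Rightarrow> ('r \<Rightarrow> 'r) set" where
  "alg_endos R = {\<phi> \<in> ring_hom R R \<inter> extensional (carrier R).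
     \<forall>c. \<forall>r\<in>carrier R. \<phi> (c \<odot>\<^bsub>R\<^esub> r) = c \<odot>\<^bsub>R\<^esub> \<phi> r}"

definition alg_auts :: "('k, 'r, 'm) module_scheme \<Rightarrow> ('r \<Rightarrow> 'r) set" where
  "alg_auts R = alg_endos R \<inter> Bij (carrier R)"

definition alg_aut_group :: "('k, 'r, 'm) module_scheme \<Rightarrow> ('r \<Rightarrow> 'r) monoid" where
  "alg_aut_group R = BijGroup (carrier R) \<lparr>carrier := alg_auts R\<rparr>"


section \<open>The free algebra on three letters\<close>

datatype gen = GX | GY | GZ

datatype word = Word (letters: "gen list")

instantiation word :: monoid_add
begin

definition zero_word :: word where "0 = Word []"

definition plus_word :: "word \<Rightarrow> word \<Rightarrow> word" where
  "v + w = Word (letters v @ letters w)"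

instance
  by standard (simp_all add: zero_word_def plus_word_def)

end

text \<open>Since addition of words is concatenation, the convolution product of
  \<^theory>\<open>HOL-Library.Poly_Mapping\<close> is the product of noncommutative polynomials.\<close>

type_synonym 'k free_poly = "word \<Rightarrow>\<^sub>0 'k"

definition const_fp :: "'k \<Rightarrow> 'k::ring_1 free_poly" where
  "const_fp c = Poly_Mapping.single 0 c"

definition var :: "gen \<Rightarrow> 'k::ring_1 free_poly" where
  "var g = Poly_Mapping.single (Word [g]) 1"

definition poly_in_Z :: "'k::ring_1 poly \<Rightarrow> 'k free_poly" where
  "poly_in_Z d = (\<Sum>i\<le>degree d. const_fp (coeff d i) * var GZ ^ i)"

definition free_ring :: "'k::ring_1 free_poly ring" where
  "free_ring = \<lparr>carrier = UNIV, mult = (*), one = 1, zero = 0, add = (+)\<rparr>"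


section \<open>Generalized Weyl algebras over \<open>k[z]\<close>\<close>

text \<open>\<open>k[z][x,y;\<sigma>,a]\<close> for a bijective \<open>\<sigma>\<close>.\<close>

definition gwa_relations :: "('k::field poly \<Rightarrow> 'k poly) \<Rightarrow> 'k poly \<Rightarrow> 'k free_poly set" where
  "gwa_relations \<sigma> a =
     {var GX * var GY - poly_in_Z (\<sigma> a), var GY * var GX - poly_in_Z a}
     \<union> (\<Union>d. {var GX * poly_in_Z d - poly_in_Z (\<sigma> d) * var GX})
     \<union> (\<Union>d. {var GY * poly_in_Z d - poly_in_Z (inv_into UNIV \<sigma> d) * var GY})"

definition gwa_ideal :: "('k::field poly \<Rightarrow> 'k poly) \<Rightarrow> 'k poly \<Rightarrow> 'k free_poly set" where
  "gwa_ideal \<sigma> a = Idl\<^bsub>free_ring\<^esub> (gwa_relations \<sigma> a)"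

definition gwa_class ::
    "('k::field poly \<Rightarrow> 'k poly) \<Rightarrow> 'k poly \<Rightarrow> 'k free_poly \<Rightarrow> 'k free_poly set" where
  "gwa_class \<sigma> a p = gwa_ideal \<sigma> a +>\<^bsub>free_ring\<^esub> p"

definition gwa ::
    "('k::field poly \<Rightarrow> 'k poly) \<Rightarrow> 'k poly \<Rightarrow> ('k, 'k free_poly set) module" where
  "gwa \<sigma> a = (let Q = free_ring Quot gwa_ideal \<sigma> a in
     \<lparr>carrier = carrier Q, mult = mult Q, one = one Q, zero = zero Q, add = add Q,
      smult = (\<lambda>c r. gwa_class \<sigma> a (const_fp c) \<otimes>\<^bsub>Q\<^esub> r)\<rparr>)"

definition shift_aut :: "'k::field poly \<Rightarrow> 'k poly" where
  "shift_aut d = pcompose d [:-1, 1:]"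

text \<open>\<open>deg x = deg y = deg\<^sub>z(a)\<close> and \<open>deg z = 2\<close>; the \<open>n\<close>-th filtered piece is spanned by the words
  of weight at most \<open>n\<close>.\<close>

fun gen_weight :: "'k::field poly \<Rightarrow> gen \<Rightarrow> nat" where
  "gen_weight a GX = degree a"
| "gen_weight a GY = degree a"
| "gen_weight a GZ = 2"

definition word_weight :: "'k::field poly \<Rightarrow> word \<Rightarrow> nat" where
  "word_weight a w = sum_list (map (gen_weight a) (letters w))"

definition std_filtration ::
    "('k::field poly \<Rightarrow> 'k poly) \<Rightarrow> 'k poly \<Rightarrow> nat \<Rightarrow> 'k free_poly set set" where
  "std_filtration \<sigma> a n =
     gwa_class \<sigma> a ` {p. \<forall>w \<in> Poly_Mapping.keys p. word_weight a w \<le> n}"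


section \<open>Filtered algebras\<close>

text \<open>Assigning degree \<open>0\<close> to the zero element is harmless: an automorphism fixes \<open>0\<close>.\<close>

definition fdeg :: "(nat \<Rightarrow> 'r set) \<Rightarrow> 'r \<Rightarrow> nat" where
  "fdeg F r = (LEAST n. r \<in> F n)"

definition filtered_auts ::
    "('k, 'r, 'm) module_scheme \<Rightarrow> (nat \<Rightarrow> 'r set) \<Rightarrow> ('r \<Rightarrow> 'r) set" where
  "filtered_auts R F = {\<phi> \<in> alg_auts R. \<forall>r\<in>carrier R. fdeg F (\<phi> r) = fdeg F r}"

record ('k, 'a) graded_alg = "('k, 'a) module" +
  part :: "nat \<Rightarrow> 'a set"

text \<open>
  The associated graded algebra is the direct sum of the \<open>F n / F (n - 1)\<close>, where \<open>F (-1) = 0\<close>.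
  Its elements are the sequences \<open>u\<close> of cosets \<open>u n = F (n - 1) + s n\<close> with \<open>s n \<in> F n\<close> that are
  eventually the zero coset. The operations are computed on representatives.
\<close>

definition F_prev :: "('k, 'r, 'm) module_scheme \<Rightarrow> (nat \<Rightarrow> 'r set) \<Rightarrow> nat \<Rightarrow> 'r set" where
  "F_prev R F n = (case n of 0 \<Rightarrow> {\<zero>\<^bsub>R\<^esub>} | Suc m \<Rightarrow> F m)"

definition gr_class ::
    "('k, 'r, 'm) module_scheme \<Rightarrow> (nat \<Rightarrow> 'r set) \<Rightarrow> (nat \<Rightarrow> 'r) \<Rightarrow> nat \<Rightarrow> 'r set" where
  "gr_class R F s = (\<lambda>n. F_prev R F n +>\<^bsub>R\<^esub> s n)"

definition gr_rep :: "(nat \<Rightarrow> 'r set) \<Rightarrow> nat \<Rightarrow> 'r" where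
  "gr_rep u n = (SOME r. r \<in> u n)"

definition gr_carrier :: "('k, 'r, 'm) module_scheme \<Rightarrow> (nat \<Rightarrow> 'r set) \<Rightarrow> (nat \<Rightarrow> 'r set) set" where
  "gr_carrier R F = {gr_class R F s | s. (\<forall>n. s n \<in> F n) \<and> finite {n. s n \<noteq> \<zero>\<^bsub>R\<^esub>}}"

definition gr_alg ::
    "('k, 'r, 'm) module_scheme \<Rightarrow> (nat \<Rightarrow> 'r set) \<Rightarrow> ('k, nat \<Rightarrow> 'r set) graded_alg" where
  "gr_alg R F =
     \<lparr>carrier = gr_carrier R F,
      mult = (\<lambda>u v. gr_class R F
                (\<lambda>n. \<Oplus>\<^bsub>R\<^esub>i\<in>{..n}. gr_rep u i \<otimes>\<^bsub>R\<^esub> gr_rep v (n - i))),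
      one = gr_class R F (\<lambda>n. if n = 0 then \<one>\<^bsub>R\<^esub> else \<zero>\<^bsub>R\<^esub>),
      zero = gr_class R F (\<lambda>n. \<zero>\<^bsub>R\<^esub>),
      add = (\<lambda>u v. gr_class R F (\<lambda>n. gr_rep u n \<oplus>\<^bsub>R\<^esub> gr_rep v n)),
      smult = (\<lambda>c u. gr_class R F (\<lambda>n. c \<odot>\<^bsub>R\<^esub> gr_rep u n)),
      part = (\<lambda>n. {u \<in> gr_carrier R F. \<forall>m. m \<noteq> n \<longrightarrow> u m = F_prev R F m})\<rparr>"

definition gr_map ::
    "('k, 'r, 'm) module_scheme \<Rightarrow> (nat \<Rightarrow> 'r set) \<Rightarrow> ('r \<Rightarrow> 'r)
      \<Rightarrow> (nat \<Rightarrow> 'r set) \<Rightarrow> nat \<Rightarrow> 'r set" where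
  "gr_map R F g = (\<lambda>u \<in> gr_carrier R F. \<lambda>n. g ` u n)"


section \<open>Graded Ext from the bar resolution\<close>

definition int_part :: "('k, 'a, 'm) graded_alg_scheme \<Rightarrow> int \<Rightarrow> 'a set" where
  "int_part A e = (if e < 0 then {\<zero>\<^bsub>A\<^esub>} else part A (nat e))"

definition graded_left_ideal :: "('k, 'a, 'm) graded_alg_scheme \<Rightarrow> 'a set \<Rightarrow> bool" where
  "graded_left_ideal A J \<longleftrightarrow>
     additive_subgroup J A \<and>
     (\<forall>a\<in>carrier A. \<forall>b\<in>J. a \<otimes>\<^bsub>A\<^esub> b \<in> J) \<and>
     (\<forall>b\<in>J. \<exists>N s. finite N \<and> (\<forall>n\<in>N. s n \<in> J \<inter> part A n) \<and> b = (\<Oplus>\<^bsub>A\<^esub>n\<in>N. s n))"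

text \<open>\<open>A\<^sub>\<ge>\<^sub>n\<close>\<close>

definition tail_ideal :: "('k, 'a, 'm) graded_alg_scheme \<Rightarrow> nat \<Rightarrow> 'a set" where
  "tail_ideal A n = {\<Oplus>\<^bsub>A\<^esub>m\<in>N. s m | N s. finite N \<and> N \<subseteq> {n..} \<and> (\<forall>m\<in>N. s m \<in> part A m)}"

text \<open>
  For a graded left ideal \<open>J\<close>, the graded left module \<open>M = A/J\<close> has the bar resolution with terms
  \<open>A \<otimes> A\<^sup>\<otimes>\<^sup>i \<otimes> M\<close> (tensor products over \<open>k\<close>), which is free because \<open>k\<close> is a field. Graded \<open>A\<close>-linear
  maps from its \<open>i\<close>-th term to \<open>A\<close> are multilinear maps \<open>A\<^sup>i \<times> M \<rightarrow> A\<close>, i.e. multilinear maps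
  \<open>f (a\<^sub>1, \<dots>, a\<^sub>i, m)\<close> on \<open>A\<^sup>i \<times> A\<close> vanishing for \<open>m \<in> J\<close>. The argument tuples are
  represented by lists. Cocycles modulo coboundaries of degree \<open>e\<close> form the degree \<open>e\<close> part of the
  graded \<open>Ext\<^sup>i(A/J, A)\<close> of left modules.
\<close>

definition bar_args :: "('k, 'a, 'm) graded_alg_scheme \<Rightarrow> nat \<Rightarrow> 'a list set" where
  "bar_args A i = {xs. set xs \<subseteq> carrier A \<and> length xs = Suc i}"

definition bar_cochains ::
    "('k, 'a, 'm) graded_alg_scheme \<Rightarrow> 'a set \<Rightarrow> nat \<Rightarrow> int \<Rightarrow> ('a list \<Rightarrow> 'a) set" where
  "bar_cochains A J i e = {f \<in> bar_args A i \<rightarrow>\<^sub>E carrier A.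
     (\<forall>xs\<in>bar_args A i. \<forall>p\<le>i. \<forall>a\<in>carrier A. \<forall>b\<in>carrier A.
        f (xs[p := a \<oplus>\<^bsub>A\<^esub> b]) = f (xs[p := a]) \<oplus>\<^bsub>A\<^esub> f (xs[p := b])) \<and>
     (\<forall>xs\<in>bar_args A i. \<forall>p\<le>i. \<forall>a\<in>carrier A. \<forall>c.
        f (xs[p := c \<odot>\<^bsub>A\<^esub> a]) = c \<odot>\<^bsub>A\<^esub> f (xs[p := a])) \<and>
     (\<forall>xs\<in>bar_args A i. last xs \<in> J \<longrightarrow> f xs = \<zero>\<^bsub>A\<^esub>) \<and>
     (\<forall>xs\<in>bar_args A i. \<forall>ns. list_all2 (\<lambda>x n. x \<in> part A n) xs ns \<longrightarrow>
        f xs \<in> int_part A (int (sum_list ns) + e))}"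

definition merge_at :: "('k, 'a, 'm) graded_alg_scheme \<Rightarrow> nat \<Rightarrow> 'a list \<Rightarrow> 'a list" where
  "merge_at A j xs = take j xs @ (xs ! j \<otimes>\<^bsub>A\<^esub> xs ! Suc j) # drop (Suc (Suc j)) xs"

definition bar_diff ::
    "('k::field, 'a, 'm) graded_alg_scheme \<Rightarrow> nat \<Rightarrow> ('a list \<Rightarrow> 'a) \<Rightarrow> 'a list \<Rightarrow> 'a" where
  "bar_diff A i f = (\<lambda>xs \<in> bar_args A (Suc i).
     hd xs \<otimes>\<^bsub>A\<^esub> f (tl xs) \<oplus>\<^bsub>A\<^esub> (\<Oplus>\<^bsub>A\<^esub>j\<in>{..i}. (-1) ^ Suc j \<odot>\<^bsub>A\<^esub> f (merge_at A j xs)))"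

definition bar_zero :: "('k, 'a, 'm) graded_alg_scheme \<Rightarrow> nat \<Rightarrow> 'a list \<Rightarrow> 'a" where
  "bar_zero A i = (\<lambda>xs \<in> bar_args A i. \<zero>\<^bsub>A\<^esub>)"

definition bar_cocycles ::
    "('k::field, 'a, 'm) graded_alg_scheme \<Rightarrow> 'a set \<Rightarrow> nat \<Rightarrow> int \<Rightarrow> ('a list \<Rightarrow> 'a) set" where
  "bar_cocycles A J i e = {f \<in> bar_cochains A J i e. bar_diff A i f = bar_zero A (Suc i)}"

definition bar_coboundaries ::
    "('k::field, 'a, 'm) graded_alg_scheme \<Rightarrow> 'a set \<Rightarrow> nat \<Rightarrow> int \<Rightarrow> ('a list \<Rightarrow> 'a) set" where
  "bar_coboundaries A J i e =
     (case i of 0 \<Rightarrow> {bar_zero A 0} | Suc j \<Rightarrow> bar_diff A j ` bar_cochains A J j e)"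

text \<open>Injective dimension of the graded left module \<open>A\<close>: the least \<open>d\<close> such that
  \<open>Ext\<^sup>i(M, A) = 0\<close> for all \<open>i > d\<close> and all \<open>M\<close>, where by the graded Baer criterion the cyclic
  graded modules \<open>M = A/J\<close> suffice. (Meaningful only if such a \<open>d\<close> exists.)\<close>

definition inj_dim :: "('k::field, 'a, 'm) graded_alg_scheme \<Rightarrow> nat" where
  "inj_dim A = (LEAST d. \<forall>J. graded_left_ideal A J \<longrightarrow>
     (\<forall>i>d. \<forall>e. bar_cocycles A J i e \<subseteq> bar_coboundaries A J i e))"


section \<open>Local cohomology and the homological determinant\<close>

text \<open>
  \<open>H\<^sup>i\<^sub>m(A)\<close> is the direct limit over \<open>n\<close> of \<open>Ext\<^sup>i(A/A\<^sub>\<ge>\<^sub>n, A)\<close>. The transition maps are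
  induced by inclusions of the spaces of cochains, so the limit in degree \<open>e\<close> is the quotient of
  the union of the cocycle spaces by the union of the coboundary spaces.
\<close>

definition lc_cocycles ::
    "('k::field, 'a, 'm) graded_alg_scheme \<Rightarrow> nat \<Rightarrow> int \<Rightarrow> ('a list \<Rightarrow> 'a) set" where
  "lc_cocycles A i e = (\<Union>n. bar_cocycles A (tail_ideal A n) i e)"

definition lc_coboundaries ::
    "('k::field, 'a, 'm) graded_alg_scheme \<Rightarrow> nat \<Rightarrow> int \<Rightarrow> ('a list \<Rightarrow> 'a) set" where
  "lc_coboundaries A i e = (\<Union>n. bar_coboundaries A (tail_ideal A n) i e)"

definition bar_add ::
    "('k, 'a, 'm) graded_alg_scheme \<Rightarrow> nat \<Rightarrow> ('a list \<Rightarrow> 'a) \<Rightarrow> ('a list \<Rightarrow> 'a) \<Rightarrow> 'a list \<Rightarrow> 'a" where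
  "bar_add A i f h = (\<lambda>xs \<in> bar_args A i. f xs \<oplus>\<^bsub>A\<^esub> h xs)"

definition bar_smult ::
    "('k, 'a, 'm) graded_alg_scheme \<Rightarrow> nat \<Rightarrow> 'k \<Rightarrow> ('a list \<Rightarrow> 'a) \<Rightarrow> 'a list \<Rightarrow> 'a" where
  "bar_smult A i c f = (\<lambda>xs \<in> bar_args A i. c \<odot>\<^bsub>A\<^esub> f xs)"

text \<open>The left \<open>A\<close>-action on \<open>Ext\<^sup>i(A/A\<^sub>\<ge>\<^sub>n, A)\<close> comes from right multiplication on the bimodule
  \<open>A/A\<^sub>\<ge>\<^sub>n\<close>: \<open>(b f)(a\<^sub>1, \<dots>, a\<^sub>i, m) = f(a\<^sub>1, \<dots>, a\<^sub>i, m b)\<close>.\<close>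

definition bar_act ::
    "('k, 'a, 'm) graded_alg_scheme \<Rightarrow> nat \<Rightarrow> 'a \<Rightarrow> ('a list \<Rightarrow> 'a) \<Rightarrow> 'a list \<Rightarrow> 'a" where
  "bar_act A i b f = (\<lambda>xs \<in> bar_args A i. f (butlast xs @ [last xs \<otimes>\<^bsub>A\<^esub> b]))"

text \<open>The \<open>g\<close>-linear map induced by an automorphism \<open>g\<close> by functoriality in all arguments:
  \<open>f \<mapsto> g \<circ> f \<circ> (g\<^sup>-\<^sup>1 \<times> \<dots> \<times> g\<^sup>-\<^sup>1)\<close>.\<close>

definition bar_push ::
    "('k, 'a, 'm) graded_alg_scheme \<Rightarrow> nat \<Rightarrow> ('a \<Rightarrow> 'a) \<Rightarrow> ('a list \<Rightarrow> 'a) \<Rightarrow> 'a list \<Rightarrow> 'a" where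
  "bar_push A i g f = (\<lambda>xs \<in> bar_args A i. g (f (map (inv_into (carrier A) g) xs)))"

text \<open>The degree \<open>j\<close> part of the graded dual \<open>A'\<close> consists of the functionals supported in degree
  \<open>-j\<close>; the left action is \<open>(b \<psi>)(a) = \<psi>(a b)\<close>, and \<open>A'(l)\<close> has degree \<open>e\<close> part
  \<open>A'\<^sub>e\<^sub>+\<^sub>l\<close>.\<close>

definition dual_part :: "('k::field, 'a, 'm) graded_alg_scheme \<Rightarrow> int \<Rightarrow> ('a \<Rightarrow> 'k) set" where
  "dual_part A j = {\<psi> \<in> extensional (carrier A).
     (\<forall>a\<in>carrier A. \<forall>b\<in>carrier A. \<psi> (a \<oplus>\<^bsub>A\<^esub> b) = \<psi> a + \<psi> b) \<and>
     (\<forall>c. \<forall>a\<in>carrier A. \<psi> (c \<odot>\<^bsub>A\<^esub> a) = c * \<psi> a) \<and>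
     (\<forall>n. int n \<noteq> - j \<longrightarrow> (\<forall>a\<in>part A n. \<psi> a = 0))}"

text \<open>\<open>\<Phi>\<close> induces an isomorphism \<open>H\<^sup>d\<^sub>m(A) \<cong> A'(l)\<close> of graded left \<open>A\<close>-modules.\<close>

definition lc_dual_iso ::
    "('k::field, 'a, 'm) graded_alg_scheme \<Rightarrow> nat \<Rightarrow> int
      \<Rightarrow> (int \<Rightarrow> ('a list \<Rightarrow> 'a) \<Rightarrow> 'a \<Rightarrow> 'k) \<Rightarrow> bool" where
  "lc_dual_iso A d l \<Phi> \<longleftrightarrow>
     (\<forall>e. \<Phi> e ` lc_cocycles A d e = dual_part A (e + l)) \<and>
     (\<forall>e. \<forall>f\<in>lc_cocycles A d e. \<forall>h\<in>lc_cocycles A d e. \<forall>a\<in>carrier A.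
        \<Phi> e (bar_add A d f h) a = \<Phi> e f a + \<Phi> e h a) \<and>
     (\<forall>e c. \<forall>f\<in>lc_cocycles A d e. \<forall>a\<in>carrier A. \<Phi> e (bar_smult A d c f) a = c * \<Phi> e f a) \<and>
     (\<forall>e. \<forall>f\<in>lc_cocycles A d e.
        (\<forall>a\<in>carrier A. \<Phi> e f a = 0) \<longleftrightarrow> f \<in> lc_coboundaries A d e) \<and>
     (\<forall>e n. \<forall>f\<in>lc_cocycles A d e. \<forall>b\<in>part A n. \<forall>a\<in>carrier A.
        \<Phi> (e + int n) (bar_act A d b f) a = \<Phi> e f (a \<otimes>\<^bsub>A\<^esub> b))"

text \<open>Meaningful for noetherian connected graded AS-Gorenstein \<open>A\<close>; the isomorphism is then unique
  up to a nonzero scalar, hence \<open>c\<close> does not depend on it.\<close>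

definition hdet :: "('k::field, 'a, 'm) graded_alg_scheme \<Rightarrow> ('a \<Rightarrow> 'a) \<Rightarrow> 'k" where
  "hdet A g = (THE h. \<exists>c l \<Phi>. c \<noteq> 0 \<and> lc_dual_iso A (inj_dim A) l \<Phi> \<and>
     (\<forall>e. \<forall>f\<in>lc_cocycles A (inj_dim A) e. \<forall>a\<in>carrier A.
        \<Phi> e (bar_push A (inj_dim A) g f) a = c * \<Phi> e f (inv_into (carrier A) g a)) \<and>
     h = inverse c)"

definition filtered_hdet ::
    "('k::field, 'r, 'm) module_scheme \<Rightarrow> (nat \<Rightarrow> 'r set) \<Rightarrow> ('r \<Rightarrow> 'r) \<Rightarrow> 'k" where
  "filtered_hdet R F g = hdet (gr_alg R F) (gr_map R F g)"


section \<open>The algebra with \<open>a = z (z - t)\<close> and its automorphisms\<close>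

definition a_poly :: "'k::field \<Rightarrow> 'k poly" where
  "a_poly t = [:0, 1:] * [:- t, 1:]"

definition R_alg :: "'k::field \<Rightarrow> ('k, 'k free_poly set) module" where
  "R_alg t = gwa shift_aut (a_poly t)"

definition R_filt :: "'k::field \<Rightarrow> nat \<Rightarrow> 'k free_poly set set" where
  "R_filt t = std_filtration shift_aut (a_poly t)"

definition R_gen :: "'k::field \<Rightarrow> gen \<Rightarrow> 'k free_poly set" where
  "R_gen t g = gwa_class shift_aut (a_poly t) (var g)"

text \<open>The algebra endomorphism of \<open>R\<close> given by \<open>x \<mapsto> u\<close>, \<open>y \<mapsto> v\<close>, \<open>z \<mapsto> w\<close>.\<close>

definition R_map ::
    "'k::field \<Rightarrow> 'k free_poly set \<Rightarrow> 'k free_poly set \<Rightarrow> 'k free_poly set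
      \<Rightarrow> 'k free_poly set \<Rightarrow> 'k free_poly set" where
  "R_map t u v w = (THE \<phi>. \<phi> \<in> alg_endos (R_alg t) \<and>
     \<phi> (R_gen t GX) = u \<and> \<phi> (R_gen t GY) = v \<and> \<phi> (R_gen t GZ) = w)"

definition Theta_aut :: "'k::field \<Rightarrow> 'k \<Rightarrow> 'k free_poly set \<Rightarrow> 'k free_poly set" where
  "Theta_aut t \<mu> =
     (let R = R_alg t; x = R_gen t GX; y = R_gen t GY; z = R_gen t GZ in
      R_map t (\<mu> \<odot>\<^bsub>R\<^esub> x) (inverse \<mu> \<odot>\<^bsub>R\<^esub> y) z)"

definition Psi_aut :: "'k::field \<Rightarrow> 'k \<Rightarrow> 'k free_poly set \<Rightarrow> 'k free_poly set" where
  "Psi_aut t \<mu> =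
     (let R = R_alg t; x = R_gen t GX; y = R_gen t GY; z = R_gen t GZ in
      R_map t x
        (y \<ominus>\<^bsub>R\<^esub> (2 * \<mu>) \<odot>\<^bsub>R\<^esub> z \<oplus>\<^bsub>R\<^esub> \<mu>\<^sup>2 \<odot>\<^bsub>R\<^esub> x \<oplus>\<^bsub>R\<^esub> (\<mu> * (t + 1)) \<odot>\<^bsub>R\<^esub> \<one>\<^bsub>R\<^esub>)
        (z \<ominus>\<^bsub>R\<^esub> \<mu> \<odot>\<^bsub>R\<^esub> x))"

definition Phi_aut :: "'k::field \<Rightarrow> 'k \<Rightarrow> 'k free_poly set \<Rightarrow> 'k free_poly set" where
  "Phi_aut t \<mu> =
     (let R = R_alg t; x = R_gen t GX; y = R_gen t GY; z = R_gen t GZ in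
      R_map t
        (x \<oplus>\<^bsub>R\<^esub> (2 * \<mu>) \<odot>\<^bsub>R\<^esub> z \<oplus>\<^bsub>R\<^esub> \<mu>\<^sup>2 \<odot>\<^bsub>R\<^esub> y \<ominus>\<^bsub>R\<^esub> (\<mu> * (t + 1)) \<odot>\<^bsub>R\<^esub> \<one>\<^bsub>R\<^esub>)
        y
        (z \<oplus>\<^bsub>R\<^esub> \<mu> \<odot>\<^bsub>R\<^esub> y))"

definition Omega_aut :: "'k::field \<Rightarrow> 'k free_poly set \<Rightarrow> 'k free_poly set" where
  "Omega_aut t =
     (let R = R_alg t; x = R_gen t GX; y = R_gen t GY; z = R_gen t GZ in
      R_map t y x ((1 + t) \<odot>\<^bsub>R\<^esub> \<one>\<^bsub>R\<^esub> \<ominus>\<^bsub>R\<^esub> z))"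

definition G_gens :: "'k::field \<Rightarrow> ('k free_poly set \<Rightarrow> 'k free_poly set) set" where
  "G_gens t = {Omega_aut t} \<union> Theta_aut t ` {\<mu>. \<mu> \<noteq> 0} \<union> range (Psi_aut t) \<union> range (Phi_aut t)"

end

theory Submission
  imports Defs "HOL-Library.Function_Algebras"
begin

text \<open>
  To describe the group, put \<open>h = 2 z - (1 + t)\<close>. The defining relations give \<open>[h, x] = 2 x\<close>, \<open>[h, y] = - 2 y\<close>
  and \<open>[y, x] = h\<close>, so \<open>x, h, y\<close> span a copy of \<open>sl\<^sub>2\<close> which together with \<open>1\<close> spans the filtered piece of
  degree \<open>2\<close>. A filtered automorphism maps this piece to itself. Since \<open>sl\<^sub>2\<close> is its own commutator algebra,
  the images of \<open>x, h, y\<close> have no constant term (\<open>filtered_aut_acts\<close>). Thus a filtered automorphism acts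
  linearly on \<open>sl\<^sub>2\<close> and preserves the bracket, and it is determined by this action. The automorphisms \<open>\<Theta>, \<Psi>, \<Phi>, \<Omega>\<close>
  act in this way by explicit matrices. They suffice to undo any given action: the image \<open>a x + b h + c y\<close> of \<open>x\<close>
  satisfies \<open>b\<^sup>2 = a c\<close> and is moved to \<open>x\<close> by \<open>\<Theta> \<Phi>\<close> or by \<open>\<Theta> \<Omega>\<close>; then \<open>h\<close> is sent to \<open>h + p x\<close>, which some \<open>\<Psi>\<close>
  moves to \<open>h\<close>; then the bracket forces \<open>y\<close> to be fixed (\<open>fauts_gen_group\<close>).

  The homological determinant is a multiplicative function \<open>\<chi>\<close> with nonzero values
  (\<open>filtered_hdet_mult\<close>), and any such function is trivial on the group: \<open>\<Theta>\<^sub>2\<close> conjugates \<open>\<Psi>\<^sub>\<lambda>\<close> to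
  \<open>\<Psi>\<^sub>2\<^sub>\<lambda>\<close>, which is the square of \<open>\<Psi>\<^sub>\<lambda>\<close>, so \<open>\<chi>(\<Psi>\<^sub>\<lambda>) = 1\<close>; \<open>\<Phi>\<^sub>\<lambda>\<close> is the conjugate of \<open>\<Psi>\<^sub>\<lambda>\<close> by \<open>\<Omega>\<close>;
  \<open>\<Omega> = \<Phi>\<^sub>1 \<Psi>\<^sub>1 \<Phi>\<^sub>1\<close>; finally \<open>\<Omega>\<close> conjugates \<open>\<Theta>\<^sub>\<mu>\<close> to its inverse, so \<open>\<chi>(\<Theta>\<^sub>\<mu>)\<^sup>2 = 1\<close>, and every \<open>\<Theta>\<^sub>\<mu>\<close> is a
  square because \<open>\<mu>\<close> is one (\<open>chi_generators\<close>).

  Most of the work goes into multiplicativity. The associated graded algebra is \<open>A = k[x, y, z]/(x y - z\<^sup>2)\<close>. It has injective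
  dimension \<open>2\<close> (\<open>inj_dim_cone\<close>) and \<open>H\<^sup>2\<^sub>m(A)\<close> is \<open>A'(2)\<close> (\<open>cone_duality\<close>), for the following reason. Let
  \<open>P = k[x, y]\<close>. The algebra \<open>A\<close> is free over \<open>P\<close> on \<open>1, z\<close>, and \<open>a + b z \<mapsto> b\<close> is a Frobenius form, so a
  cochain of the bar resolution with values in \<open>A\<close> is the same as a function with one more argument and values in
  \<open>P\<close> that is \<open>P\<close>-linear in the first argument and \<open>k\<close>-linear in the others. If \<open>P\<close>-linearity is dropped, the
  functions form a complex that is exact except at its beginning, because the bar resolution is contractible over
  \<open>k\<close>. The failures of linearity in \<open>x\<close> and in \<open>y\<close> are two commuting operators on this complex, which are
  surjective on functions of at least two arguments. The double complex that they form shows that \<open>Ext\<^sup>i(A/J, A)\<close>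
  is the cohomology of the Koszul complex of the two operators on \<open>Hom\<^sub>k(A/J, P)\<close>. It vanishes for \<open>i > 2\<close>, and
  \<open>Ext\<^sup>2\<close> is the cokernel, which for \<open>J = A\<^sub>\<ge>\<^sub>n\<close> is identified with the dual of \<open>A/J\<close> by a residue functional.
  The part of degree \<open>-2\<close> of \<open>H\<^sup>2\<^sub>m(A)\<close> is one-dimensional, a graded automorphism acts on it by a scalar, and the
  homological determinant is the inverse of that scalar (\<open>hdet_cone\<close>).
\<close>

section \<open>The quadric cone\<close>

text \<open>
  Polynomials in \<open>x\<close> and \<open>y\<close> are polynomials in the outer variable \<open>x\<close> with coefficients in \<open>k[y]\<close>.
\<close>
abbreviation cf :: "'k::zero poly poly \<Rightarrow> nat \<Rightarrow> nat \<Rightarrow> 'k" where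
  "cf p i j \<equiv> coeff (coeff p i) j"

definition PX :: "'k::comm_ring_1 poly poly" where "PX = [:0, 1:]"
definition PY :: "'k::comm_ring_1 poly poly" where "PY = [:[:0, 1:]:]"

abbreviation psc :: "'k::comm_ring_1 \<Rightarrow> 'k poly poly \<Rightarrow> 'k poly poly" where
  "psc c \<equiv> Polynomial.smult [:c:]"

lemma cf_eqI: "(\<And>i j. cf p i j = cf q i j) \<Longrightarrow> p = q"
  by (simp add: poly_eq_iff)

lemma cf_PX: "cf (PX * p) i j = (case i of 0 \<Rightarrow> 0 | Suc i' \<Rightarrow> cf p i' j)"
  by (simp add: PX_def coeff_pCons split: nat.split)

lemma cf_PY: "cf (PY * p) i j = (case j of 0 \<Rightarrow> 0 | Suc j' \<Rightarrow> cf p i j')"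
  by (simp add: PY_def coeff_pCons split: nat.split)

lemma cf_PX_pow: "cf (PX ^ n * p) i j = (if n \<le> i then cf p (i - n) j else 0)"
proof (induction n arbitrary: i)
  case (Suc n)
  then show ?case by (cases i) (simp_all add: cf_PX mult.assoc)
qed simp

lemma cf_PY_pow: "cf (PY ^ n * p) i j = (if n \<le> j then cf p i (j - n) else 0)"
proof (induction n arbitrary: j)
  case (Suc n)
  then show ?case by (cases j) (simp_all add: cf_PY mult.assoc)
qed simp

lemma psc_sum: "psc c (sum f S) = (\<Sum>i\<in>S. psc c (f i))"
  by (induction S rule: infinite_finite_induct) (auto simp: smult_add_right)

lemma cf_const: "cf [:[:c:]:] i j = (if i = 0 \<and> j = 0 then c else 0)"
  by (simp add: coeff_pCons split: nat.split)

lemma cf_one: "cf 1 i j = (if i = 0 \<and> j = 0 then 1 else 0)"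
  by (simp add: one_pCons coeff_pCons split: nat.split)

text \<open>
  Homogeneous polynomials, with \<open>x\<close> and \<open>y\<close> in degree \<open>2\<close>. Degrees are integers because cochains can have
  negative degree.
\<close>
definition Pdeg :: "int \<Rightarrow> 'k::comm_ring_1 poly poly set" where
  "Pdeg n = {p. \<forall>i j. cf p i j \<noteq> 0 \<longrightarrow> 2 * int (i + j) = n}"

lemma Pdeg_0 [simp]: "0 \<in> Pdeg n" by (simp add: Pdeg_def)
lemma Pdeg_add: "p \<in> Pdeg n \<Longrightarrow> q \<in> Pdeg n \<Longrightarrow> p + q \<in> Pdeg n"
  by (auto simp: Pdeg_def) (metis add.left_neutral)
lemma Pdeg_uminus: "p \<in> Pdeg n \<Longrightarrow> - p \<in> Pdeg n"
  by (auto simp: Pdeg_def)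
lemma Pdeg_diff: "p \<in> Pdeg n \<Longrightarrow> q \<in> Pdeg n \<Longrightarrow> p - q \<in> Pdeg n"
  using Pdeg_add[of p n "- q"] Pdeg_uminus[of q n] by simp
lemma Pdeg_psc: "p \<in> Pdeg n \<Longrightarrow> psc c p \<in> Pdeg n"
  by (auto simp: Pdeg_def) (metis mult_zero_right)
lemma Pdeg_sum: "(\<And>i. i \<in> S \<Longrightarrow> f i \<in> Pdeg n) \<Longrightarrow> sum f S \<in> Pdeg n"
  by (induction S rule: infinite_finite_induct) (auto intro: Pdeg_add)

lemma Pdeg_mult:
  assumes p: "p \<in> Pdeg n" and q: "q \<in> Pdeg m"
  shows "p * q \<in> Pdeg (n + m)"
proof -
  have "2 * int (i + j) = n + m" if "cf (p * q) i j \<noteq> 0" for i j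
  proof -
    have "(\<Sum>r\<le>i. \<Sum>s\<le>j. cf p r s * cf q (i - r) (j - s)) \<noteq> 0"
      using that by (simp add: coeff_mult coeff_sum)
    then obtain r where r: "r \<le> i" "(\<Sum>s\<le>j. cf p r s * cf q (i - r) (j - s)) \<noteq> 0"
      by (metis (no_types, lifting) atMost_iff sum.neutral)
    then obtain s where s: "s \<le> j" "cf p r s * cf q (i - r) (j - s) \<noteq> 0"
      by (metis (no_types, lifting) atMost_iff sum.neutral)
    then have "cf p r s \<noteq> 0" "cf q (i - r) (j - s) \<noteq> 0" by auto
    then have "2 * int (r + s) = n" "2 * int (i - r + (j - s)) = m"
      using p q by (auto simp: Pdeg_def)
    then show ?thesis using r(1) s(1) by (simp add: of_nat_diff)
  qed
  then show ?thesis by (auto simp: Pdeg_def)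
qed

lemma PX_Pdeg: "PX \<in> Pdeg 2"
  by (auto simp: Pdeg_def PX_def one_pCons coeff_pCons split: nat.splits)
lemma PY_Pdeg: "PY \<in> Pdeg 2"
  by (auto simp: Pdeg_def PY_def one_pCons coeff_pCons split: nat.splits)

text \<open>
  The quotients of division by \<open>x\<close> and by \<open>y\<close> with remainder. As left inverses of multiplication by a
  variable they make it possible to solve equations with the linearity defects below.
\<close>
definition PDx :: "'k::comm_ring_1 poly poly \<Rightarrow> 'k poly poly" where "PDx = poly_shift 1"
definition PDy :: "'k::comm_ring_1 poly poly \<Rightarrow> 'k poly poly" where "PDy = map_poly (poly_shift 1)"

lemma cf_PDx: "cf (PDx p) i j = cf p (Suc i) j"
  by (simp add: PDx_def coeff_poly_shift)
lemma cf_PDy: "cf (PDy p) i j = cf p i (Suc j)"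
  by (simp add: PDy_def coeff_map_poly coeff_poly_shift)

lemma PDx_Pdeg: "p \<in> Pdeg n \<Longrightarrow> PDx p \<in> Pdeg (n - 2)"
  by (fastforce simp: Pdeg_def cf_PDx)
lemma PDy_Pdeg: "p \<in> Pdeg n \<Longrightarrow> PDy p \<in> Pdeg (n - 2)"
  by (fastforce simp: Pdeg_def cf_PDy)

lemma PDx_lin: "PDx (psc c p + q) = psc c (PDx p) + PDx q"
  by (rule cf_eqI) (simp add: cf_PDx)
lemma PDy_lin: "PDy (psc c p + q) = psc c (PDy p) + PDy q"
  by (rule cf_eqI) (simp add: cf_PDy)

lemma cf_bounded: "\<exists>N. \<forall>i j. cf p i j \<noteq> 0 \<longrightarrow> i + j < N"
proof -
  have "i + j < Suc (degree p + (\<Sum>i\<le>degree p. degree (coeff p i)))" if "cf p i j \<noteq> 0" for i j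
  proof -
    have i: "i \<le> degree p" using that by (metis coeff_0 le_degree)
    have "j \<le> degree (coeff p i)" using that by (simp add: le_degree)
    also have "\<dots> \<le> (\<Sum>i\<le>degree p. degree (coeff p i))"
      by (rule member_le_sum) (use i in auto)
    finally show ?thesis using i by linarith
  qed
  then show ?thesis by blast
qed

(* The type of polynomials is cut out by the zero of the coefficient type. *)
declare [[typedef_overloaded]]

text \<open>
  \<open>k[x, y, z]/(x y - z\<^sup>2)\<close> as the free module over \<open>k[x, y]\<close> with basis \<open>1, z\<close>. The two components behave like the real
  and the imaginary part of a complex number, with \<open>z\<^sup>2 = x y\<close> in place of \<open>i\<^sup>2 = - 1\<close>.
\<close>
datatype 'k cone = Cone (cre: "'k poly poly") (cim: "'k poly poly")

instantiation cone :: (comm_ring_1) comm_ring_1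
begin
definition "0 = Cone 0 0"
definition "1 = Cone 1 0"
definition "a + b = Cone (cre a + cre b) (cim a + cim b)"
definition "- a = Cone (- cre a) (- cim a)"
definition "a - b = Cone (cre a - cre b) (cim a - cim b)"
definition "a * b = Cone (cre a * cre b + PX * PY * (cim a * cim b)) (cre a * cim b + cim a * cre b)"
instance
  by standard
    (simp_all add: zero_cone_def one_cone_def plus_cone_def uminus_cone_def minus_cone_def
      times_cone_def algebra_simps)
end

lemma cone_sel [simp]:
  "cre 0 = 0" "cim 0 = 0" "cre 1 = 1" "cim 1 = 0"
  "cre (a + b) = cre a + cre b" "cim (a + b) = cim a + cim b"
  "cre (- a) = - cre a" "cim (- a) = - cim a"
  "cre (a - b) = cre a - cre b" "cim (a - b) = cim a - cim b"
  "cre (a * b) = cre a * cre b + PX * PY * (cim a * cim b)"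
  "cim (a * b) = cre a * cim b + cim a * cre b"
  by (simp_all add: zero_cone_def one_cone_def plus_cone_def uminus_cone_def minus_cone_def
      times_cone_def)

lemma cone_sum [simp]: "cre (sum f S) = (\<Sum>i\<in>S. cre (f i))" "cim (sum f S) = (\<Sum>i\<in>S. cim (f i))"
  by (induction S rule: infinite_finite_induct; simp)+

lemma cone_eqI: "cre a = cre b \<Longrightarrow> cim a = cim b \<Longrightarrow> a = b"
  by (cases a; cases b) simp

definition CP :: "'k::comm_ring_1 poly poly \<Rightarrow> 'k cone" where "CP p = Cone p 0"
definition CX :: "'k::comm_ring_1 cone" where "CX = CP PX"
definition CY :: "'k::comm_ring_1 cone" where "CY = CP PY"
definition CZ :: "'k::comm_ring_1 cone" where "CZ = Cone 0 1"
definition csc :: "'k::comm_ring_1 \<Rightarrow> 'k cone \<Rightarrow> 'k cone" where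
  "csc c a = CP [:[:c:]:] * a"

lemma CP_sel [simp]: "cre (CP p) = p" "cim (CP p) = 0" by (simp_all add: CP_def)
lemma CXYZ_sel [simp]: "cre CX = PX" "cim CX = 0" "cre CY = PY" "cim CY = 0" "cre CZ = 0" "cim CZ = 1"
  by (simp_all add: CX_def CY_def CZ_def)
lemma csc_sel [simp]: "cre (csc c a) = psc c (cre a)" "cim (csc c a) = psc c (cim a)"
  by (simp_all add: csc_def)

lemma CZ_square: "CZ * CZ = CX * CY"
  by (rule cone_eqI) simp_all

lemma csc_simps [simp]:
  "csc c 0 = 0" "csc 0 a = 0" "csc 1 a = a" "csc c (a + b) = csc c a + csc c b"
  "csc c (a - b) = csc c a - csc c b" "csc c (- a) = - csc c a"
  "csc c (csc d a) = csc (c * d) a" "csc c a * b = csc c (a * b)" "a * csc c b = csc c (a * b)"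
  by (rule cone_eqI; simp add: smult_add_right smult_diff_right pCons_one algebra_simps)+

lemma csc_add_left: "csc (c + d) a = csc c a + csc d a"
  by (rule cone_eqI; rule cf_eqI; simp add: algebra_simps)
lemma csc_minus_left: "csc (- c) a = - csc c a"
  by (rule cone_eqI; rule cf_eqI; simp add: algebra_simps)

text \<open>
  The shift by \<open>2\<close> in the second component is the degree of \<open>z\<close>.
\<close>
definition Cdeg :: "int \<Rightarrow> 'k::comm_ring_1 cone set" where
  "Cdeg n = {a. cre a \<in> Pdeg n \<and> cim a \<in> Pdeg (n - 2)}"

lemma Cdeg_0 [simp]: "0 \<in> Cdeg n" by (simp add: Cdeg_def)
lemma Cdeg_add: "a \<in> Cdeg n \<Longrightarrow> b \<in> Cdeg n \<Longrightarrow> a + b \<in> Cdeg n"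
  by (auto simp: Cdeg_def intro: Pdeg_add)
lemma Cdeg_csc: "a \<in> Cdeg n \<Longrightarrow> csc c a \<in> Cdeg n"
  by (auto simp: Cdeg_def intro: Pdeg_psc)
lemma Cdeg_sum: "(\<And>i. i \<in> S \<Longrightarrow> f i \<in> Cdeg n) \<Longrightarrow> sum f S \<in> Cdeg n"
  by (induction S rule: infinite_finite_induct) (auto intro: Cdeg_add)

lemma Cdeg_mult:
  assumes a: "a \<in> Cdeg n" and b: "b \<in> Cdeg m"
  shows "a * b \<in> Cdeg (n + m)"
proof -
  have "cre a * cre b \<in> Pdeg (n + m)" using a b by (auto simp: Cdeg_def intro: Pdeg_mult)
  moreover have "PX * PY * (cim a * cim b) \<in> Pdeg ((2 + 2) + ((n - 2) + (m - 2)))"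
    using a b by (intro Pdeg_mult PX_Pdeg PY_Pdeg) (auto simp: Cdeg_def)
  moreover have "cre a * cim b \<in> Pdeg (n + (m - 2))" "cim a * cre b \<in> Pdeg ((n - 2) + m)"
    using a b by (intro Pdeg_mult; simp add: Cdeg_def)+
  ultimately show ?thesis by (auto simp: Cdeg_def algebra_simps intro!: Pdeg_add)
qed

lemma one_Pdeg: "1 \<in> Pdeg 0"
  by (auto simp: Pdeg_def cf_one split: if_splits)
lemma one_Cdeg: "1 \<in> Cdeg 0"
  by (simp add: Cdeg_def one_Pdeg)
lemma CX_Cdeg: "CX \<in> Cdeg 2" by (simp add: Cdeg_def PX_Pdeg)
lemma CY_Cdeg: "CY \<in> Cdeg 2" by (simp add: Cdeg_def PY_Pdeg)
lemma CZ_Cdeg: "CZ \<in> Cdeg 2" by (simp add: Cdeg_def one_Pdeg)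

lemma Pdeg_neg: "p \<in> Pdeg n \<Longrightarrow> n < 0 \<Longrightarrow> p = 0"
  by (rule cf_eqI) (auto simp: Pdeg_def)

lemma Cdeg_neg: "a \<in> Cdeg n \<Longrightarrow> n < 0 \<Longrightarrow> a = 0"
  by (rule cone_eqI) (auto simp: Cdeg_def dest: Pdeg_neg)

lemma Pdeg_zero_const: "p \<in> Pdeg 0 \<Longrightarrow> p = [:[:cf p 0 0:]:]"
  by (rule cf_eqI) (force simp: Pdeg_def coeff_pCons split: nat.split)

lemma Cdeg_zero_const: "a \<in> Cdeg 0 \<Longrightarrow> a = csc (cf (cre a) 0 0) 1"
  by (rule cone_eqI) (auto simp: Cdeg_def dest: Pdeg_neg Pdeg_zero_const)

definition CDx :: "'k::comm_ring_1 cone \<Rightarrow> 'k cone" where "CDx a = Cone (PDx (cre a)) (PDx (cim a))"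
definition CDy :: "'k::comm_ring_1 cone \<Rightarrow> 'k cone" where "CDy a = Cone (PDy (cre a)) (PDy (cim a))"

lemma CD_Cdeg: "a \<in> Cdeg n \<Longrightarrow> CDx a \<in> Cdeg (n - 2)" "a \<in> Cdeg n \<Longrightarrow> CDy a \<in> Cdeg (n - 2)"
  using PDx_Pdeg[of "cre a" n] PDx_Pdeg[of "cim a" "n - 2"] PDy_Pdeg[of "cre a" n] PDy_Pdeg[of "cim a" "n - 2"]
  by (auto simp: Cdeg_def CDx_def CDy_def)

lemma CD_lin:
  "CDx (csc c a + b) = csc c (CDx a) + CDx b" "CDy (csc c a + b) = csc c (CDy a) + CDy b"
  by (rule cone_eqI; simp add: CDx_def CDy_def PDx_lin PDy_lin)+

lemma CDx_CX: "CDx (CX * a) = a"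
  by (rule cone_eqI; rule cf_eqI; simp add: CDx_def cf_PDx cf_PX)
lemma CDy_CY: "CDy (CY * a) = a"
  by (rule cone_eqI; rule cf_eqI; simp add: CDy_def cf_PDy cf_PY)
lemma CDy_CX: "CDy (CX * a) = CX * CDy a"
  by (rule cone_eqI; rule cf_eqI; simp add: CDy_def cf_PDy cf_PX split: nat.split)

lemma CD_pow_cf:
  "cf (cre ((CDx ^^ n) a)) i j = cf (cre a) (i + n) j" "cf (cim ((CDx ^^ n) a)) i j = cf (cim a) (i + n) j"
  "cf (cre ((CDy ^^ n) a)) i j = cf (cre a) i (j + n)" "cf (cim ((CDy ^^ n) a)) i j = cf (cim a) i (j + n)"
  by (induction n arbitrary: i j) (simp_all add: CDx_def CDy_def cf_PDx cf_PDy)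

text \<open>
  Repeated division reaches zero, so the geometric series that solve the linearity equations are finite.
\<close>
lemma CD_nilpotent: "\<exists>N. (CDx ^^ N) a = 0" "\<exists>N. (CDy ^^ N) a = 0"
proof -
  obtain M1 where 1: "\<And>i j. cf (cre a) i j \<noteq> 0 \<Longrightarrow> i + j < M1" using cf_bounded by blast
  obtain M2 where 2: "\<And>i j. cf (cim a) i j \<noteq> 0 \<Longrightarrow> i + j < M2" using cf_bounded by blast
  have "(CDx ^^ (M1 + M2)) a = 0" "(CDy ^^ (M1 + M2)) a = 0"
    by (rule cone_eqI; rule cf_eqI; unfold CD_pow_cf; use 1 2 in fastforce)+
  then show "\<exists>N. (CDx ^^ N) a = 0" "\<exists>N. (CDy ^^ N) a = 0" by blast+
qed

subsection \<open>Homogeneous components\<close>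

definition homP :: "int \<Rightarrow> 'k::comm_ring_1 poly poly \<Rightarrow> 'k poly poly" where
  "homP n p = (if even n \<and> n \<ge> 0
     then \<Sum>i\<le>nat (n div 2). monom (monom (cf p i (nat (n div 2) - i)) (nat (n div 2) - i)) i else 0)"

lemma cf_homP: "cf (homP n p) i j = (if 2 * int (i + j) = n then cf p i j else 0)"
proof (cases "even n \<and> n \<ge> 0")
  case True
  then obtain m where m: "n = 2 * int m" by (metis evenE nonneg_int_cases zero_le_mult_iff zero_less_numeral not_le)
  have "cf (homP n p) i j = (\<Sum>r\<le>m. if r = i then (if m - r = j then cf p r (m - r) else 0) else 0)"
    by (auto simp: homP_def m coeff_sum intro: sum.cong)
  also have "\<dots> = (if i \<le> m \<and> m - i = j then cf p i (m - i) else 0)"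
    by (simp add: sum.delta)
  also have "\<dots> = (if 2 * int (i + j) = n then cf p i j else 0)"
    by (auto simp: m)
  finally show ?thesis .
next
  case False
  then show ?thesis by (auto simp: homP_def)
qed

definition hcomp :: "int \<Rightarrow> 'k::comm_ring_1 cone \<Rightarrow> 'k cone" where
  "hcomp n a = Cone (homP n (cre a)) (homP (n - 2) (cim a))"

lemma hcomp_sel [simp]: "cre (hcomp n a) = homP n (cre a)" "cim (hcomp n a) = homP (n - 2) (cim a)"
  by (simp_all add: hcomp_def)

lemma homP_Pdeg: "homP n p \<in> Pdeg n"
  by (auto simp: Pdeg_def cf_homP split: if_splits)
lemma hcomp_Cdeg: "hcomp n a \<in> Cdeg n"
  by (simp add: Cdeg_def homP_Pdeg)

lemma homP_of_Pdeg: "p \<in> Pdeg m \<Longrightarrow> homP n p = (if n = m then p else 0)"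
  by (rule cf_eqI) (auto simp: cf_homP Pdeg_def)
lemma hcomp_of_Cdeg: "a \<in> Cdeg m \<Longrightarrow> hcomp n a = (if n = m then a else 0)"
  by (rule cone_eqI) (auto simp: Cdeg_def homP_of_Pdeg)

lemma hcomp_add: "hcomp n (a + b) = hcomp n a + hcomp n b"
  by (rule cone_eqI; rule cf_eqI; simp add: cf_homP)
lemma hcomp_csc: "hcomp n (csc c a) = csc c (hcomp n a)"
  by (rule cone_eqI; rule cf_eqI; simp add: cf_homP)
lemma hcomp_0 [simp]: "hcomp n 0 = 0"
  by (rule cone_eqI; rule cf_eqI; simp add: cf_homP)
lemma hcomp_sum: "hcomp n (sum f S) = (\<Sum>i\<in>S. hcomp n (f i))"
  by (induction S rule: infinite_finite_induct) (auto simp: hcomp_add)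

lemma hcomp_bounded: "\<exists>N. \<forall>n\<ge>N. hcomp (int n) a = 0"
proof -
  obtain M1 where 1: "\<And>i j. cf (cre a) i j \<noteq> 0 \<Longrightarrow> i + j < M1" using cf_bounded by blast
  obtain M2 where 2: "\<And>i j. cf (cim a) i j \<noteq> 0 \<Longrightarrow> i + j < M2" using cf_bounded by blast
  have "hcomp (int n) a = 0" if "n \<ge> 2 * M1 + 2 * M2 + 2" for n
    by (rule cone_eqI; rule cf_eqI; simp add: cf_homP; use 1 2 that in fastforce)
  then show ?thesis by blast
qed

lemma hcomp_sum_eq:
  assumes "\<And>n. n \<ge> N \<Longrightarrow> hcomp (int n) a = 0"
  shows "(\<Sum>n<N. hcomp (int n) a) = a"
proof (rule cone_eqI; rule cf_eqI)
  fix i j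
  have *: "cf (cre a) i j = 0" if "N \<le> 2 * (i + j)"
    using arg_cong[OF assms[OF that], of "\<lambda>a. cf (cre a) i j"] by (simp add: cf_homP)
  have "cf (cre (\<Sum>n<N. hcomp (int n) a)) i j = (\<Sum>n<N. if n = 2 * (i + j) then cf (cre a) i j else 0)"
    by (unfold cone_sum hcomp_sel coeff_sum cf_homP) (rule sum.cong; auto)
  also have "\<dots> = cf (cre a) i j" using * by (auto simp: sum.delta)
  finally show "cf (cre (\<Sum>n<N. hcomp (int n) a)) i j = cf (cre a) i j" .
  have *: "cf (cim a) i j = 0" if "N \<le> 2 * (i + j) + 2"
    using arg_cong[OF assms[OF that], of "\<lambda>a. cf (cim a) i j"] by (simp add: cf_homP)
  have "cf (cim (\<Sum>n<N. hcomp (int n) a)) i j = (\<Sum>n<N. if n = 2 * (i + j) + 2 then cf (cim a) i j else 0)"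
    by (unfold cone_sum hcomp_sel coeff_sum cf_homP) (rule sum.cong; auto)
  also have "\<dots> = cf (cim a) i j" using * by (auto simp: sum.delta)
  finally show "cf (cim (\<Sum>n<N. hcomp (int n) a)) i j = cf (cim a) i j" .
qed

lemma cone_decomposition: "\<exists>N. a = (\<Sum>n<N. hcomp (int n) a)"
  using hcomp_bounded[of a] hcomp_sum_eq by metis

lemma hcomp_eqI: "(\<And>n. hcomp (int n) a = hcomp (int n) b) \<Longrightarrow> a = b"
proof -
  assume *: "\<And>n. hcomp (int n) a = hcomp (int n) b"
  obtain N where N: "\<And>n. n \<ge> N \<Longrightarrow> hcomp (int n) a = 0" using hcomp_bounded by blast
  show ?thesis using hcomp_sum_eq[of N a] hcomp_sum_eq[of N b] N * by simp
qed

lemma hcomp_neg: "n < 0 \<Longrightarrow> hcomp n a = 0"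
  using hcomp_Cdeg Cdeg_neg by blast

text \<open>
  \<open>A\<^sub>\<ge>\<^sub>n\<close>
\<close>
definition Ctail :: "nat \<Rightarrow> 'k::comm_ring_1 cone set" where
  "Ctail n = {a. \<forall>m<int n. hcomp m a = 0}"

lemma Cdeg_Ctail: "a \<in> Cdeg (int n) \<Longrightarrow> a \<in> Ctail n"
  by (auto simp: Ctail_def hcomp_of_Cdeg)

lemma Ctail_0 [simp]: "Ctail 0 = UNIV"
  by (auto simp: Ctail_def hcomp_neg)

lemma Ctail_mono: "n \<le> m \<Longrightarrow> Ctail m \<subseteq> Ctail n"
  by (auto simp: Ctail_def)

lemma Ctail_zero [simp]: "0 \<in> Ctail n" by (simp add: Ctail_def)
lemma Ctail_add: "a \<in> Ctail n \<Longrightarrow> b \<in> Ctail n \<Longrightarrow> a + b \<in> Ctail n"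
  by (simp add: Ctail_def hcomp_add)
lemma Ctail_sum: "(\<And>i. i \<in> S \<Longrightarrow> f i \<in> Ctail n) \<Longrightarrow> sum f S \<in> Ctail n"
  by (induction S rule: infinite_finite_induct) (auto intro: Ctail_add)
lemma Ctail_csc: "a \<in> Ctail n \<Longrightarrow> csc c a \<in> Ctail n"
  by (simp add: Ctail_def hcomp_csc)

lemma Ctail_mult:
  assumes a: "a \<in> Ctail n" and b: "b \<in> Ctail m"
  shows "a * b \<in> Ctail (n + m)"
proof -
  obtain N M where N: "a = (\<Sum>i<N. hcomp (int i) a)" and M: "b = (\<Sum>i<M. hcomp (int i) b)"
    using cone_decomposition by metis
  have "hcomp (int i) a * hcomp (int j) b \<in> Ctail (n + m)" for i j
  proof (cases "i < n \<or> j < m")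
    case True
    then have "hcomp (int i) a = 0 \<or> hcomp (int j) b = 0" using a b by (auto simp: Ctail_def)
    then show ?thesis by auto
  next
    case False
    have "hcomp (int i) a * hcomp (int j) b \<in> Cdeg (int (i + j))"
      using Cdeg_mult[OF hcomp_Cdeg hcomp_Cdeg] by simp
    then show ?thesis using Cdeg_Ctail Ctail_mono[of "n + m" "i + j"] False by fastforce
  qed
  then have "(\<Sum>i<N. hcomp (int i) a) * (\<Sum>i<M. hcomp (int i) b) \<in> Ctail (n + m)"
    by (auto simp: sum_product intro!: Ctail_sum)
  then show ?thesis using N M by simp
qed

lemma Ctail_powers: "m \<in> Ctail d \<Longrightarrow> CX ^ i * CY ^ j * m \<in> Ctail (2 * (i + j) + d)"
proof -
  have X: "CX ^ i \<in> Ctail (2 * i)"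
  proof (induction i)
    case (Suc i)
    then show ?case using Ctail_mult[OF Cdeg_Ctail[of CX 2] Suc] by (simp add: CX_Cdeg)
  qed simp
  have Y: "CY ^ j \<in> Ctail (2 * j)"
  proof (induction j)
    case (Suc j)
    then show ?case using Ctail_mult[OF Cdeg_Ctail[of CY 2] Suc] by (simp add: CY_Cdeg)
  qed simp
  assume "m \<in> Ctail d"
  then show ?thesis using Ctail_mult[OF Ctail_mult[OF X Y]] by (simp add: algebra_simps)
qed

lemma Ctail_split: "a \<in> Ctail n \<Longrightarrow> \<exists>N. a = (\<Sum>m\<in>{n..<N}. hcomp (int m) a)"
proof -
  assume a: "a \<in> Ctail n"
  obtain N where N: "a = (\<Sum>i<N. hcomp (int i) a)" using cone_decomposition by blast
  have "(\<Sum>i<N. hcomp (int i) a) = (\<Sum>i\<in>{n..<N}. hcomp (int i) a)"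
    by (rule sum.mono_neutral_right) (use a in \<open>auto simp: Ctail_def\<close>)
  then show ?thesis using N by metis
qed

section \<open>Bar cochains as functions with an extra argument\<close>

text \<open>
  A function of several arguments stands for a map on a term \<open>A \<otimes> \<dots> \<otimes> M\<close> of the bar resolution of \<open>M\<close>, whose leftmost
  factor carries the action of \<open>A\<close>. Composition with the bar differential multiplies neighbouring arguments, with
  alternating signs, and there is no separate leading term.
\<close>
fun bdiff :: "('a::comm_ring_1 list \<Rightarrow> 'p::ab_group_add) \<Rightarrow> 'a list \<Rightarrow> 'p" where
  "bdiff \<phi> (a # b # xs) = \<phi> (a * b # xs) - bdiff (\<lambda>ys. \<phi> (a # ys)) (b # xs)"
| "bdiff \<phi> [] = 0"
| "bdiff \<phi> [a] = 0"

text \<open>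
  Dual to the contracting homotopy \<open>m \<mapsto> 1 \<otimes> m\<close> of the bar resolution, which is linear over \<open>k\<close> only.
\<close>
definition insert_one :: "('a::comm_ring_1 list \<Rightarrow> 'p) \<Rightarrow> 'a list \<Rightarrow> 'p" where
  "insert_one \<phi> xs = \<phi> (1 # xs)"

text \<open>
  The failure of \<open>\<phi>\<close> to turn multiplication of its first argument by \<open>p\<close> into multiplication by \<open>q\<close>.
\<close>
definition lin_defect :: "'a::comm_ring_1 \<Rightarrow> 'p::comm_ring_1 \<Rightarrow> ('a list \<Rightarrow> 'p) \<Rightarrow> 'a list \<Rightarrow> 'p" where
  "lin_defect p q \<phi> xs = (case xs of [] \<Rightarrow> 0 | a # ys \<Rightarrow> q * \<phi> (a # ys) - \<phi> (p * a # ys))"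

lemma lin_defect_simps [simp]: "lin_defect p q \<phi> [] = 0" "lin_defect p q \<phi> (a # ys) = q * \<phi> (a # ys) - \<phi> (p * a # ys)"
  by (simp_all add: lin_defect_def)

lemma bdiff_cong:
  "(\<And>ys. ys \<noteq> [] \<Longrightarrow> Suc (length ys) = length xs \<Longrightarrow> \<phi> ys = \<psi> ys) \<Longrightarrow> bdiff \<phi> xs = bdiff \<psi> xs"
proof (induction \<phi> xs arbitrary: \<psi> rule: bdiff.induct)
  case (1 \<phi> a b xs)
  have "bdiff (\<lambda>ys. \<phi> (a # ys)) (b # xs) = bdiff (\<lambda>ys. \<psi> (a # ys)) (b # xs)"
    using 1(2) by (intro "1.IH") auto
  then show ?case using 1(2) by simp
qed auto

lemma bdiff_diff: "bdiff (\<lambda>ys. \<phi> ys - \<psi> ys) xs = bdiff \<phi> xs - bdiff \<psi> xs"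
  by (induction \<phi> xs arbitrary: \<psi> rule: bdiff.induct) auto

lemma bdiff_zero: "bdiff (\<lambda>ys. 0) xs = 0"
  using bdiff_diff[of "\<lambda>_. 0" "\<lambda>_. 0" xs] by simp

lemma bdiff_add: "bdiff (\<lambda>ys. \<phi> ys + \<psi> ys) xs = bdiff \<phi> xs + bdiff \<psi> xs"
  by (induction \<phi> xs arbitrary: \<psi> rule: bdiff.induct) auto

lemma bdiff_times: "bdiff (\<lambda>ys. q * \<phi> ys) xs = (q :: 'p::comm_ring_1) * bdiff \<phi> xs"
  by (induction \<phi> xs rule: bdiff.induct) (auto simp: algebra_simps)

lemma bdiff_mult_first:
  "bdiff (\<lambda>ys. \<phi> (p * hd ys # tl ys)) (a # xs) = bdiff \<phi> (p * a # xs)"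
  by (cases xs) (auto intro!: bdiff_cong simp: mult.assoc)

lemma bdiff_bdiff:
  fixes \<phi> :: "'a::comm_ring_1 list \<Rightarrow> 'p::ab_group_add"
  shows "bdiff (bdiff \<phi>) xs = 0"
proof (induction \<phi> xs rule: bdiff.induct)
  case (1 \<phi> a b xs)
  have "bdiff (\<lambda>ys. bdiff \<phi> (a # ys)) (b # xs)
      = bdiff (\<lambda>ys. \<phi> (a * hd ys # tl ys) - bdiff (\<lambda>zs. \<phi> (a # zs)) ys) (b # xs)"
  proof (rule bdiff_cong)
    fix ys :: "'a list" assume "ys \<noteq> []"
    then show "bdiff \<phi> (a # ys) = \<phi> (a * hd ys # tl ys) - bdiff (\<lambda>zs. \<phi> (a # zs)) ys" by (cases ys) auto
  qed
  then show ?case using 1 by (simp add: bdiff_diff bdiff_mult_first)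
qed auto

lemma bdiff_lin_defect: "bdiff (lin_defect p q \<phi>) xs = lin_defect p q (bdiff \<phi>) xs"
proof (cases xs)
  case (Cons a ys)
  have "bdiff (lin_defect p q \<phi>) (a # ys) = bdiff (\<lambda>zs. q * \<phi> zs - \<phi> (p * hd zs # tl zs)) (a # ys)"
    by (rule bdiff_cong) (auto simp: neq_Nil_conv)
  then show ?thesis by (simp add: Cons bdiff_diff bdiff_times bdiff_mult_first)
qed simp

text \<open>
  The homotopy identity. It makes the complex of all \<open>k\<close>-multilinear functions exact in all positive lengths.
\<close>
lemma insert_one_bdiff: "xs \<noteq> [] \<Longrightarrow> insert_one (bdiff \<phi>) xs = \<phi> xs - bdiff (insert_one \<phi>) xs"
  by (cases xs) (auto simp: insert_one_def[abs_def])

lemma lin_defect_commute: "lin_defect p q (lin_defect p' q' \<phi>) xs = lin_defect p' q' (lin_defect p q \<phi>) xs"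
  by (cases xs) (auto simp: algebra_simps)

lemma lin_defect_diff: "lin_defect p q (\<lambda>ys. \<phi> ys - \<psi> ys) xs = lin_defect p q \<phi> xs - lin_defect p q \<psi> xs"
  by (cases xs) (auto simp: algebra_simps)

lemma lin_defect_add: "lin_defect p q (\<lambda>ys. \<phi> ys + \<psi> ys) xs = lin_defect p q \<phi> xs + lin_defect p q \<psi> xs"
  by (cases xs) (auto simp: algebra_simps)

subsection \<open>Multilinear graded cochains\<close>

type_synonym 'k cochain = "'k cone list \<Rightarrow> 'k poly poly"

definition mlin :: "'k::comm_ring_1 cochain \<Rightarrow> bool" where
  "mlin \<phi> \<longleftrightarrow> (\<forall>us vs c a b. \<phi> (us @ (csc c a + b) # vs) = psc c (\<phi> (us @ a # vs)) + \<phi> (us @ b # vs))"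

definition vanishes_on :: "'k::comm_ring_1 cone set \<Rightarrow> 'k cochain \<Rightarrow> bool" where
  "vanishes_on J \<phi> \<longleftrightarrow> (\<forall>xs. xs \<noteq> [] \<longrightarrow> last xs \<in> J \<longrightarrow> \<phi> xs = 0)"

definition of_degree :: "int \<Rightarrow> 'k::comm_ring_1 cochain \<Rightarrow> bool" where
  "of_degree e \<phi> \<longleftrightarrow> (\<forall>xs ms. list_all2 (\<lambda>x m. x \<in> Cdeg m) xs ms \<longrightarrow> \<phi> xs \<in> Pdeg (sum_list ms + e))"

definition on_length :: "nat \<Rightarrow> 'k::comm_ring_1 cochain \<Rightarrow> bool" where
  "on_length n \<phi> \<longleftrightarrow> (\<forall>xs. length xs \<noteq> n \<longrightarrow> \<phi> xs = 0)"

text \<open>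
  The graded dual \<open>Hom\<^sub>k(A\<^sup>\<otimes>\<^sup>n\<^sup>-\<^sup>1 \<otimes> A/J, P)\<close> in degree \<open>e\<close>. Functions are total on lists; the value \<open>0\<close> at all other
  lengths makes equality of functions equality of cochains.
\<close>
definition dual_cochain :: "'k::comm_ring_1 cone set \<Rightarrow> nat \<Rightarrow> int \<Rightarrow> 'k cochain \<Rightarrow> bool" where
  "dual_cochain J n e \<phi> \<longleftrightarrow> on_length n \<phi> \<and> mlin \<phi> \<and> vanishes_on J \<phi> \<and> of_degree e \<phi>"

definition ideal_like :: "'k::comm_ring_1 cone set \<Rightarrow> bool" where
  "ideal_like J \<longleftrightarrow> (\<forall>a. \<forall>b\<in>J. a * b \<in> J)"

lemma mlinD: "mlin \<phi> \<Longrightarrow> \<phi> (us @ (csc c a + b) # vs) = psc c (\<phi> (us @ a # vs)) + \<phi> (us @ b # vs)"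
  by (simp add: mlin_def)
lemma mlinD1: "mlin \<phi> \<Longrightarrow> \<phi> ((csc c a + b) # vs) = psc c (\<phi> (a # vs)) + \<phi> (b # vs)"
  using mlinD[of \<phi> "[]"] by simp
lemma mlin_zero: "mlin \<phi> \<Longrightarrow> \<phi> (us @ 0 # vs) = 0"
  using mlinD[of \<phi> us 1 0 0 vs] by (simp add: pCons_one)
lemma mlin_zero1: "mlin \<phi> \<Longrightarrow> \<phi> (0 # vs) = 0"
  using mlin_zero[of \<phi> "[]"] by simp
lemma mlin_add1: "mlin \<phi> \<Longrightarrow> \<phi> ((a + b) # vs) = \<phi> (a # vs) + \<phi> (b # vs)"
  using mlinD1[of \<phi> 1 a b vs] by (simp add: pCons_one)
lemma mlin_csc1: "mlin \<phi> \<Longrightarrow> \<phi> (csc c a # vs) = psc c (\<phi> (a # vs))"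
  using mlinD1[of \<phi> c a 0 vs] by (simp add: mlin_zero1)

lemma mlin_Cons: "mlin \<phi> \<Longrightarrow> mlin (\<lambda>ys. \<phi> (a # ys))"
  unfolding mlin_def by (metis append_Cons)

lemma mlin_diff: "mlin \<phi> \<Longrightarrow> mlin \<psi> \<Longrightarrow> mlin (\<lambda>ys. \<phi> ys - \<psi> ys)"
  by (simp add: mlin_def smult_diff_right algebra_simps)
lemma mlin_add: "mlin \<phi> \<Longrightarrow> mlin \<psi> \<Longrightarrow> mlin (\<lambda>ys. \<phi> ys + \<psi> ys)"
  by (simp add: mlin_def smult_add_right algebra_simps)

lemma bdiff_psc: "bdiff (\<lambda>ys. psc c (\<phi> ys)) xs = psc c (bdiff \<phi> xs)"
  by (induction \<phi> xs rule: bdiff.induct) (auto simp: smult_diff_right)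

lemma mlin_bdiff: "mlin \<phi> \<Longrightarrow> mlin (bdiff \<phi>)"
proof -
  have "bdiff \<phi> (us @ (csc c a + b) # vs) = psc c (bdiff \<phi> (us @ a # vs)) + bdiff \<phi> (us @ b # vs)"
    if "mlin \<phi>" for \<phi> us vs c a and b :: "'a cone"
    using that
  proof (induction us arbitrary: \<phi>)
    case Nil
    show ?case
    proof (cases vs)
      case (Cons v vs')
      have "bdiff (\<lambda>ys. \<phi> ((csc c a + b) # ys)) (v # vs')
          = bdiff (\<lambda>ys. psc c (\<phi> (a # ys)) + \<phi> (b # ys)) (v # vs')"
        by (simp only: mlinD1[OF Nil])
      moreover have "\<phi> ((csc c a + b) * v # vs') = psc c (\<phi> (a * v # vs')) + \<phi> (b * v # vs')"
        using mlinD1[OF Nil, of c "a * v" "b * v"] by (simp add: distrib_right)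
      ultimately show ?thesis
        by (simp add: Cons bdiff_add bdiff_psc smult_diff_right algebra_simps)
    qed simp
  next
    case (Cons u us)
    note IH = Cons.IH[OF mlin_Cons[OF Cons.prems, of u]]
    show ?case
    proof (cases us)
      case Nil
      have "\<phi> (u * (csc c a + b) # vs) = psc c (\<phi> (u * a # vs)) + \<phi> (u * b # vs)"
        using mlinD1[OF Cons.prems, of c "u * a" "u * b"] by (simp add: distrib_left)
      then show ?thesis using IH by (simp add: Nil smult_diff_right algebra_simps)
    next
      case (Cons u' us')
      have "\<phi> (u * u' # us' @ (csc c a + b) # vs)
          = psc c (\<phi> (u * u' # us' @ a # vs)) + \<phi> (u * u' # us' @ b # vs)"
        using mlinD[OF Cons.prems, of "u * u' # us'"] by simp
      then show ?thesis using IH by (simp add: Cons smult_diff_right algebra_simps)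
    qed
  qed
  then show "mlin \<phi> \<Longrightarrow> mlin (bdiff \<phi>)" by (simp add: mlin_def)
qed

lemma vanishes_on_bdiff:
  assumes J: "ideal_like J" and "vanishes_on J \<phi>"
  shows "vanishes_on J (bdiff \<phi>)"
proof -
  have "bdiff \<phi> xs = 0" if "vanishes_on J \<phi>" "xs \<noteq> []" "last xs \<in> J" for xs
    using that
  proof (induction \<phi> xs rule: bdiff.induct)
    case (1 \<phi> a b xs)
    have "bdiff (\<lambda>ys. \<phi> (a # ys)) (b # xs) = 0"
      by (rule "1.IH") (use 1(2-) in \<open>auto simp: vanishes_on_def\<close>)
    moreover have "last (a * b # xs) \<in> J"
      using 1(4) J by (cases "xs = []") (auto simp: ideal_like_def)
    then have "\<phi> (a * b # xs) = 0" using 1(2) by (auto simp: vanishes_on_def)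
    ultimately show ?case by simp
  qed auto
  then show ?thesis using assms by (auto simp: vanishes_on_def)
qed

lemma of_degree_Cons: "of_degree e \<phi> \<Longrightarrow> a \<in> Cdeg m \<Longrightarrow> of_degree (e + m) (\<lambda>ys. \<phi> (a # ys))"
  unfolding of_degree_def
proof safe
  fix xs :: "'a cone list" and ms
  assume *: "\<forall>xs ms. list_all2 (\<lambda>x m. x \<in> Cdeg m) xs ms \<longrightarrow> \<phi> xs \<in> Pdeg (sum_list ms + e)"
    "a \<in> Cdeg m" "list_all2 (\<lambda>x m. x \<in> Cdeg m) xs ms"
  then show "\<phi> (a # xs) \<in> Pdeg (sum_list ms + (e + m))"
    using *(1)[rule_format, of "a # xs" "m # ms"] by (simp add: algebra_simps)
qed

lemma of_degree_bdiff: "of_degree e \<phi> \<Longrightarrow> of_degree e (bdiff \<phi>)"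
proof -
  have "bdiff \<phi> xs \<in> Pdeg (sum_list ms + e)"
    if "of_degree e \<phi>" "list_all2 (\<lambda>x m. x \<in> Cdeg m) xs ms" for xs ms
    using that
  proof (induction \<phi> xs arbitrary: ms e rule: bdiff.induct)
    case (1 \<phi> a b xs)
    then obtain m n ms' where ms: "ms = m # n # ms'" "a \<in> Cdeg m" "b \<in> Cdeg n"
      "list_all2 (\<lambda>x m. x \<in> Cdeg m) xs ms'"
      by (auto simp: list_all2_Cons1)
    have "bdiff (\<lambda>ys. \<phi> (a # ys)) (b # xs) \<in> Pdeg (sum_list (n # ms') + (e + m))"
      by (rule "1.IH") (use 1(2) ms in \<open>auto intro: of_degree_Cons\<close>)
    moreover have "\<phi> (a * b # xs) \<in> Pdeg (sum_list ((m + n) # ms') + e)"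
      using 1(2) ms Cdeg_mult unfolding of_degree_def by (metis list_all2_Cons)
    ultimately show ?case by (auto simp: ms algebra_simps intro!: Pdeg_diff)
  qed auto
  then show "of_degree e \<phi> \<Longrightarrow> of_degree e (bdiff \<phi>)" by (simp add: of_degree_def)
qed

lemma on_length_bdiff: "on_length n \<phi> \<Longrightarrow> on_length (Suc n) (bdiff \<phi>)"
  unfolding on_length_def
proof safe
  fix xs :: "'a cone list"
  assume "\<forall>xs. length xs \<noteq> n \<longrightarrow> \<phi> xs = 0" "length xs \<noteq> Suc n"
  then have "bdiff \<phi> xs = bdiff (\<lambda>_. 0) xs" by (intro bdiff_cong) auto
  then show "bdiff \<phi> xs = 0" by (simp add: bdiff_zero)
qed

lemma dual_cochain_bdiff: "ideal_like J \<Longrightarrow> dual_cochain J n e \<phi> \<Longrightarrow> dual_cochain J (Suc n) e (bdiff \<phi>)"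
  by (auto simp: dual_cochain_def intro: on_length_bdiff mlin_bdiff vanishes_on_bdiff of_degree_bdiff)

lemma dual_cochain_diff: "dual_cochain J n e \<phi> \<Longrightarrow> dual_cochain J n e \<psi> \<Longrightarrow> dual_cochain J n e (\<lambda>ys. \<phi> ys - \<psi> ys)"
  by (auto simp: dual_cochain_def on_length_def mlin_diff vanishes_on_def of_degree_def intro: Pdeg_diff)
lemma dual_cochain_add: "dual_cochain J n e \<phi> \<Longrightarrow> dual_cochain J n e \<psi> \<Longrightarrow> dual_cochain J n e (\<lambda>ys. \<phi> ys + \<psi> ys)"
  by (auto simp: dual_cochain_def on_length_def mlin_add vanishes_on_def of_degree_def intro: Pdeg_add)
lemma dual_cochain_zero: "dual_cochain J n e (\<lambda>ys. 0)"
  by (auto simp: dual_cochain_def on_length_def mlin_def vanishes_on_def of_degree_def)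
lemma dual_cochain_uminus: "dual_cochain J n e \<phi> \<Longrightarrow> dual_cochain J n e (\<lambda>ys. - \<phi> ys)"
  using dual_cochain_diff[OF dual_cochain_zero, of J n e \<phi>] by simp

lemma mlin_insert_one: "mlin \<phi> \<Longrightarrow> mlin (insert_one \<phi>)"
  using mlin_Cons[of \<phi> 1] by (simp add: insert_one_def[abs_def])

lemma dual_cochain_insert_one: "dual_cochain J (Suc n) e \<phi> \<Longrightarrow> dual_cochain J n e (insert_one \<phi>)"
  using of_degree_Cons[OF _ one_Cdeg, of e \<phi>] mlin_insert_one[of \<phi>]
  by (auto simp: dual_cochain_def insert_one_def[abs_def] on_length_def vanishes_on_def)

lemma Pdeg_times: "p \<in> Pdeg d \<Longrightarrow> q \<in> Pdeg n \<Longrightarrow> n + d = m \<Longrightarrow> p * q \<in> Pdeg m"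
  using Pdeg_mult by (metis add.commute)

lemma dual_cochain_lin_defect:
  assumes J: "ideal_like J" and \<phi>: "dual_cochain J n e \<phi>" and p: "p \<in> Cdeg d" and q: "q \<in> Pdeg d"
  shows "dual_cochain J n (e + d) (lin_defect p q \<phi>)"
  unfolding dual_cochain_def
proof (intro conjI)
  have \<phi>': "on_length n \<phi>" "mlin \<phi>" "vanishes_on J \<phi>" "of_degree e \<phi>" using \<phi> by (auto simp: dual_cochain_def)
  show "on_length n (lin_defect p q \<phi>)"
    using \<phi>'(1) by (auto simp: on_length_def lin_defect_def split: list.split)
  show "mlin (lin_defect p q \<phi>)"
    unfolding mlin_def
  proof safe
    fix us vs c a and b :: "'a cone"
    show "lin_defect p q \<phi> (us @ (csc c a + b) # vs) = psc c (lin_defect p q \<phi> (us @ a # vs)) + lin_defect p q \<phi> (us @ b # vs)"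
    proof (cases us)
      case Nil
      have "\<phi> (p * (csc c a + b) # vs) = psc c (\<phi> (p * a # vs)) + \<phi> (p * b # vs)"
        using mlinD1[OF \<phi>'(2), of c "p * a" "p * b"] by (simp add: distrib_left)
      then show ?thesis using mlinD1[OF \<phi>'(2)] by (simp add: Nil smult_diff_right algebra_simps)
    next
      case (Cons u us')
      show ?thesis using mlinD[OF \<phi>'(2), of "u # us'"] mlinD[OF \<phi>'(2), of "p * u # us'"]
        by (simp add: Cons smult_diff_right algebra_simps)
    qed
  qed
  show "vanishes_on J (lin_defect p q \<phi>)"
    unfolding vanishes_on_def
  proof safe
    fix xs :: "'a cone list" assume xs: "xs \<noteq> []" "last xs \<in> J"
    then obtain a ys where ys: "xs = a # ys" by (cases xs) auto
    then have "last (p * a # ys) \<in> J" using xs J by (auto simp: ideal_like_def)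
    then have "\<phi> (p * a # ys) = 0" "\<phi> (a # ys) = 0" using \<phi>'(3) xs ys by (auto simp: vanishes_on_def)
    then show "lin_defect p q \<phi> xs = 0" by (simp add: ys)
  qed
  show "of_degree (e + d) (lin_defect p q \<phi>)"
    unfolding of_degree_def
  proof safe
    fix xs :: "'a cone list" and ms assume *: "list_all2 (\<lambda>x m. x \<in> Cdeg m) xs ms"
    show "lin_defect p q \<phi> xs \<in> Pdeg (sum_list ms + (e + d))"
    proof (cases xs)
      case (Cons a ys)
      then obtain m ms' where ms: "ms = m # ms'" "a \<in> Cdeg m" "list_all2 (\<lambda>x m. x \<in> Cdeg m) ys ms'"
        using * by (auto simp: list_all2_Cons1)
      have "\<phi> (a # ys) \<in> Pdeg (sum_list ms + e)" using \<phi>'(4) * Cons by (auto simp: of_degree_def)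
      then have "q * \<phi> (a # ys) \<in> Pdeg (sum_list ms + (e + d))" by (rule Pdeg_times[OF q]) simp
      moreover have "\<phi> (p * a # ys) \<in> Pdeg (sum_list ((d + m) # ms') + e)"
        using \<phi>'(4) ms Cdeg_mult[OF p ms(2)] unfolding of_degree_def by (metis list_all2_Cons)
      ultimately show ?thesis by (auto simp: Cons ms algebra_simps intro!: Pdeg_diff)
    qed simp
  qed
qed

subsection \<open>Division operators\<close>

definition nil_order :: "('a::zero \<Rightarrow> 'a) \<Rightarrow> 'a \<Rightarrow> nat" where
  "nil_order D a = (LEAST N. (D ^^ N) a = 0)"

text \<open>
  A solution \<open>\<psi>\<close> of \<open>q \<psi>(a, \<dots>) - \<psi>(p a, \<dots>) = \<phi>(a, \<dots>)\<close>: as \<open>D\<close> inverts multiplication by \<open>p\<close>, the series telescopes.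
\<close>
definition quot :: "('k::comm_ring_1 cone \<Rightarrow> 'k cone) \<Rightarrow> 'k poly poly \<Rightarrow> 'k cochain \<Rightarrow> 'k cochain" where
  "quot D q \<phi> xs = (case xs of [] \<Rightarrow> 0 | a # ys \<Rightarrow>
     - (\<Sum>k<nil_order D a. q ^ k * \<phi> ((D ^^ Suc k) a # ys)))"

text \<open>
  Only the existence of a locally nilpotent homogeneous left inverse \<open>D\<close> of multiplication by \<open>p\<close> matters.
\<close>
locale division =
  fixes p :: "'k::comm_ring_1 cone" and q :: "'k poly poly" and D :: "'k cone \<Rightarrow> 'k cone" and d :: int
  assumes D_lin: "D (csc c a + b) = csc c (D a) + D b"
    and D_p: "D (p * a) = a"
    and D_nil: "\<exists>N. (D ^^ N) a = 0"
    and p_Cdeg: "p \<in> Cdeg d" and q_Pdeg: "q \<in> Pdeg d"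
    and D_Cdeg: "a \<in> Cdeg n \<Longrightarrow> D a \<in> Cdeg (n - d)"
begin

lemma D_0: "D 0 = 0"
  using D_lin[of 1 0 0] by simp

lemma D_pow_lin: "(D ^^ n) (csc c a + b) = csc c ((D ^^ n) a) + (D ^^ n) b"
  by (induction n) (simp_all add: D_lin)

lemma D_pow_0: "(D ^^ n) 0 = 0"
  by (induction n) (simp_all add: D_0)

lemma D_pow_beyond: "n \<ge> nil_order D a \<Longrightarrow> (D ^^ n) a = 0"
proof -
  assume n: "n \<ge> nil_order D a"
  have "(D ^^ nil_order D a) a = 0" unfolding nil_order_def using D_nil by (rule LeastI_ex)
  then have "(D ^^ (n - nil_order D a)) ((D ^^ nil_order D a) a) = 0" by (simp add: D_pow_0)
  then show ?thesis using n by (metis comp_apply funpow_add le_add_diff_inverse2)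
qed

lemma quot_eq:
  assumes "mlin \<phi>" "N \<ge> nil_order D a"
  shows "quot D q \<phi> (a # ys) = - (\<Sum>k<N. q ^ k * \<phi> ((D ^^ Suc k) a # ys))"
proof -
  have "(\<Sum>k<N. q ^ k * \<phi> ((D ^^ Suc k) a # ys))
      = (\<Sum>k<nil_order D a. q ^ k * \<phi> ((D ^^ Suc k) a # ys))"
    using assms(2) D_pow_beyond mlin_zero1[OF assms(1)]
    by (intro sum.mono_neutral_right) (auto simp del: funpow.simps)
  then show ?thesis by (simp add: quot_def)
qed

lemma lin_defect_quot:
  assumes "mlin \<phi>"
  shows "lin_defect p q (quot D q \<phi>) (a # ys) = \<phi> (a # ys)"
proof -
  define M where "M = nil_order D a + nil_order D (p * a)"
  have "(D ^^ Suc k) (p * a) = (D ^^ k) a" for k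
    by (simp add: funpow_Suc_right D_p del: funpow.simps)
  then have "quot D q \<phi> (p * a # ys) = - (\<Sum>k<Suc M. q ^ k * \<phi> ((D ^^ k) a # ys))"
    using quot_eq[OF assms, of "p * a" "Suc M" ys] by (simp add: M_def del: funpow.simps)
  also have "\<dots> = - \<phi> (a # ys) - q * (\<Sum>k<M. q ^ k * \<phi> ((D ^^ Suc k) a # ys))"
    by (simp add: sum.lessThan_Suc_shift sum_distrib_left mult.assoc del: sum.lessThan_Suc)
  finally have "quot D q \<phi> (p * a # ys) = - \<phi> (a # ys) + q * quot D q \<phi> (a # ys)"
    using quot_eq[OF assms, of a M ys] by (simp add: M_def del: funpow.simps)
  then show ?thesis by simp
qed

text \<open>
  Two arguments are needed: with a single one, the division would act on the argument that is taken modulo \<open>J\<close>,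
  and \<open>D\<close> does not preserve \<open>J\<close>. This is where the cohomology of the Koszul complex survives.
\<close>
lemma dual_cochain_quot:
  assumes \<phi>: "dual_cochain J n e \<phi>" and n: "n \<ge> 2"
  shows "dual_cochain J n (e - d) (quot D q \<phi>)"
  unfolding dual_cochain_def
proof (intro conjI)
  have \<phi>': "on_length n \<phi>" "mlin \<phi>" "vanishes_on J \<phi>" "of_degree e \<phi>" using \<phi> by (auto simp: dual_cochain_def)
  show "on_length n (quot D q \<phi>)"
    using \<phi>'(1) by (auto simp: on_length_def quot_def split: list.split)
  show "mlin (quot D q \<phi>)"
    unfolding mlin_def
  proof safe
    fix us vs c a and b :: "'k cone"
    show "quot D q \<phi> (us @ (csc c a + b) # vs) = psc c (quot D q \<phi> (us @ a # vs)) + quot D q \<phi> (us @ b # vs)"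
    proof (cases us)
      case Nil
      define N where "N = nil_order D a + nil_order D b + nil_order D (csc c a + b)"
      have "psc c (- (\<Sum>k<N. q ^ k * \<phi> ((D ^^ Suc k) a # vs))) + - (\<Sum>k<N. q ^ k * \<phi> ((D ^^ Suc k) b # vs))
        = - (\<Sum>k<N. q ^ k * (psc c (\<phi> ((D ^^ Suc k) a # vs)) + \<phi> ((D ^^ Suc k) b # vs)))"
        by (simp add: distrib_left sum.distrib psc_sum)
      moreover have "\<phi> ((D ^^ Suc k) (csc c a + b) # vs)
          = psc c (\<phi> ((D ^^ Suc k) a # vs)) + \<phi> ((D ^^ Suc k) b # vs)" for k
        by (simp only: D_pow_lin mlinD1[OF \<phi>'(2)])
      ultimately show ?thesis
        using quot_eq[OF \<phi>'(2), of _ N vs] by (simp add: Nil N_def del: funpow.simps)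
    next
      case (Cons u us')
      show ?thesis
        using mlinD[OF \<phi>'(2), of "_ # us'"]
        by (simp add: Cons quot_def distrib_left sum.distrib psc_sum)
    qed
  qed
  show "vanishes_on J (quot D q \<phi>)"
    unfolding vanishes_on_def
  proof safe
    fix xs :: "'k cone list" assume xs: "xs \<noteq> []" "last xs \<in> J"
    then obtain a ys where ys: "xs = a # ys" by (cases xs) auto
    show "quot D q \<phi> xs = 0"
    proof (cases "ys = []")
      case True
      then have "\<phi> (b # ys) = 0" for b using \<phi>'(1) n by (simp add: on_length_def)
      then show ?thesis by (simp add: ys quot_def)
    next
      case False
      then have "\<phi> (b # ys) = 0" for b using \<phi>'(3) xs ys by (simp add: vanishes_on_def)
      then show ?thesis by (simp add: ys quot_def)
    qed
  qed
  show "of_degree (e - d) (quot D q \<phi>)"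
    unfolding of_degree_def
  proof safe
    fix xs :: "'k cone list" and ms assume *: "list_all2 (\<lambda>x m. x \<in> Cdeg m) xs ms"
    show "quot D q \<phi> xs \<in> Pdeg (sum_list ms + (e - d))"
    proof (cases xs)
      case (Cons a ys)
      then obtain m ms' where ms: "ms = m # ms'" "a \<in> Cdeg m" "list_all2 (\<lambda>x m. x \<in> Cdeg m) ys ms'"
        using * by (auto simp: list_all2_Cons1)
      have D: "(D ^^ k) a \<in> Cdeg (m - int k * d)" for k
      proof (induction k)
        case (Suc k)
        then show ?case using D_Cdeg[OF Suc] by (simp add: algebra_simps)
      qed (use ms in simp)
      have q: "q ^ k \<in> Pdeg (int k * d)" for k
      proof (induction k)
        case (Suc k)
        then show ?case using Pdeg_mult[OF q_Pdeg Suc] by (simp add: algebra_simps)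
      qed (simp add: one_Pdeg)
      have "q ^ k * \<phi> ((D ^^ Suc k) a # ys) \<in> Pdeg (sum_list ms + (e - d))" for k
      proof (rule Pdeg_times[OF q])
        show "\<phi> ((D ^^ Suc k) a # ys) \<in> Pdeg (sum_list ((m - int (Suc k) * d) # ms') + e)"
          using \<phi>'(4) D ms(3) unfolding of_degree_def by (metis list_all2_Cons)
      qed (simp add: ms algebra_simps)
      then show ?thesis by (auto simp: Cons quot_def simp del: funpow.simps intro!: Pdeg_uminus Pdeg_sum)
    qed (simp add: quot_def)
  qed
qed

lemma dual_cochain_lin_defect': "ideal_like J \<Longrightarrow> dual_cochain J n e \<phi> \<Longrightarrow> dual_cochain J n (e + d) (lin_defect p q \<phi>)"
  using dual_cochain_lin_defect p_Cdeg q_Pdeg by blast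

end

lemma lin_defect_quot_commute:
  assumes "division p q D d" and "mlin \<phi>" and comm: "\<And>a. D (p' * a) = p' * D a"
    and mlin': "mlin (lin_defect p' q' \<phi>)"
  shows "lin_defect p' q' (quot D q \<phi>) xs = quot D q (lin_defect p' q' \<phi>) xs"
proof (cases xs)
  case (Cons a ys)
  interpret division p q D d by fact
  define N where "N = nil_order D a + nil_order D (p' * a)"
  have D: "(D ^^ k) (p' * a) = p' * (D ^^ k) a" for k
    by (induction k) (simp_all add: comm)
  have "lin_defect p' q' (quot D q \<phi>) (a # ys)
      = - (\<Sum>k<N. q ^ k * (q' * \<phi> ((D ^^ Suc k) a # ys) - \<phi> (p' * (D ^^ Suc k) a # ys)))"
    using quot_eq[OF assms(2), of a N ys] quot_eq[OF assms(2), of "p' * a" N ys]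
    by (simp add: N_def D sum_distrib_left right_diff_distrib sum_subtractf mult.left_commute del: funpow.simps)
  also have "\<dots> = quot D q (lin_defect p' q' \<phi>) (a # ys)"
    using quot_eq[OF mlin', of a N ys] by (simp add: N_def del: funpow.simps)
  finally show ?thesis by (simp add: Cons)
qed (simp add: quot_def)

interpretation x: division CX PX CDx 2
  by standard (simp_all add: CD_lin CDx_CX CD_nilpotent CX_Cdeg PX_Pdeg CD_Cdeg)
interpretation y: division CY PY CDy 2
  by standard (simp_all add: CD_lin CDy_CY CD_nilpotent CY_Cdeg PY_Pdeg CD_Cdeg)

abbreviation "XX \<equiv> lin_defect CX PX"
abbreviation "YY \<equiv> lin_defect CY PY"
abbreviation "QX \<equiv> quot CDx PX"
abbreviation "QY \<equiv> quot CDy PY"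

lemma dual_cochain_mlin: "dual_cochain J n e \<phi> \<Longrightarrow> mlin \<phi>" by (simp add: dual_cochain_def)
lemma dual_cochain_len: "dual_cochain J n e \<phi> \<Longrightarrow> length xs \<noteq> n \<Longrightarrow> \<phi> xs = 0" by (simp add: dual_cochain_def on_length_def)

lemma XX_QX: "dual_cochain J n e \<phi> \<Longrightarrow> n > 0 \<Longrightarrow> XX (QX \<phi>) = \<phi>"
  using x.lin_defect_quot[of \<phi>] dual_cochain_mlin[of J n e \<phi>] dual_cochain_len[of J n e \<phi> "[]"] by (auto simp: fun_eq_iff neq_Nil_conv) (metis lin_defect_simps neq_Nil_conv)
lemma YY_QY: "dual_cochain J n e \<phi> \<Longrightarrow> n > 0 \<Longrightarrow> YY (QY \<phi>) = \<phi>"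
  using y.lin_defect_quot[of \<phi>] dual_cochain_mlin[of J n e \<phi>] dual_cochain_len[of J n e \<phi> "[]"] by (auto simp: fun_eq_iff neq_Nil_conv) (metis lin_defect_simps neq_Nil_conv)
lemma XX_QY: "ideal_like J \<Longrightarrow> dual_cochain J n e \<phi> \<Longrightarrow> XX (QY \<phi>) = QY (XX \<phi>)"
  by (rule ext, rule lin_defect_quot_commute[OF y.division_axioms _ CDy_CX]) (blast intro: dual_cochain_mlin x.dual_cochain_lin_defect')+
lemma insert_one_bdiff_dual_cochain: "dual_cochain J n e \<phi> \<Longrightarrow> n > 0 \<Longrightarrow> insert_one (bdiff \<phi>) = (\<lambda>xs. \<phi> xs - bdiff (insert_one \<phi>) xs)"
proof
  fix xs assume "dual_cochain J n e \<phi>" "n > 0"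
  then show "insert_one (bdiff \<phi>) xs = \<phi> xs - bdiff (insert_one \<phi>) xs"
    using insert_one_bdiff[of xs \<phi>] dual_cochain_len[of J n e \<phi> "[]"] by (cases "xs = []") (auto simp: insert_one_def)
qed

lemma bdiff_insert_one_singletons:
  assumes "dual_cochain J 1 e w"
  shows "bdiff (insert_one w) = (\<lambda>_. 0)"
proof
  fix xs
  have "bdiff (insert_one w) xs = bdiff (\<lambda>_. 0) xs"
    by (rule bdiff_cong, unfold insert_one_def, rule dual_cochain_len[OF assms]) auto
  then show "bdiff (insert_one w) xs = 0" by (simp add: bdiff_zero)
qed

lemmas bdiff_lin_defect_fun = ext[OF bdiff_lin_defect]
lemmas lin_defect_commute_fun = ext[OF lin_defect_commute]
lemmas bdiff_bdiff_fun = ext[OF bdiff_bdiff]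
lemmas bdiff_diff_fun = ext[OF bdiff_diff]
lemmas lin_defect_diff_fun = ext[OF lin_defect_diff]
lemmas bdiff_add_fun = ext[OF bdiff_add]
lemmas lin_defect_add_fun = ext[OF lin_defect_add]
lemma lin_defect_zero_fun: "lin_defect p q (\<lambda>_. 0) = (\<lambda>_. 0)" by (auto simp: fun_eq_iff lin_defect_def split: list.split)
lemma bdiff_zero_fun: "bdiff (\<lambda>_. 0) = (\<lambda>_. 0)" by (auto simp: bdiff_zero)
lemma quot_zero_fun: "quot D q (\<lambda>_. 0) = (\<lambda>_. 0)" by (auto simp: fun_eq_iff quot_def split: list.split)

subsection \<open>The comparison with the Koszul complex\<close>

text \<open>
  The zigzag through the double complex formed by the bar differential and the two linearity defects: take a
  primitive by the homotopy, apply a defect, take a primitive, apply the other defect; do this in both orders and subtract.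
\<close>
definition koszul_pre :: "'k::comm_ring_1 cochain \<Rightarrow> 'k cochain" where
  "koszul_pre \<phi> = (\<lambda>xs. YY (insert_one (XX (insert_one \<phi>))) xs - XX (insert_one (YY (insert_one \<phi>))) xs)"

text \<open>
  One more primitive completes the zigzag. It takes a cocycle with \<open>n + 3\<close> arguments that is \<open>P\<close>-linear in the
  first one to an element with \<open>n\<close> arguments, well defined modulo the images of the two defects.
\<close>
definition koszul :: "'k::comm_ring_1 cochain \<Rightarrow> 'k cochain" where
  "koszul \<phi> = insert_one (koszul_pre \<phi>)"

lemma dual_cochain_koszul_pre: "ideal_like J \<Longrightarrow> dual_cochain J (Suc (Suc n)) e \<phi> \<Longrightarrow> dual_cochain J n (e + 4) (koszul_pre \<phi>)"
proof -
  assume J: "ideal_like J" and \<phi>: "dual_cochain J (Suc (Suc n)) e \<phi>"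
  have "dual_cochain J n (e + 2 + 2) (koszul_pre \<phi>)"
    unfolding koszul_pre_def
    by (intro dual_cochain_diff y.dual_cochain_lin_defect' x.dual_cochain_lin_defect' dual_cochain_insert_one J \<phi>)
  then show ?thesis by (simp add: algebra_simps)
qed

lemma dual_cochain_koszul: "ideal_like J \<Longrightarrow> dual_cochain J (Suc (Suc (Suc n))) e \<phi> \<Longrightarrow> dual_cochain J n (e + 4) (koszul \<phi>)"
  unfolding koszul_def by (intro dual_cochain_insert_one dual_cochain_koszul_pre)

text \<open>
  The zigzag detects coboundaries. If it ends in the images of the two defects, the primitives chosen along the way
  can be corrected one after the other until the first of them is \<open>P\<close>-linear.
\<close>
lemma coboundary_of_koszul:
  assumes J: "ideal_like J" and n: "n \<ge> 1" and \<phi>: "dual_cochain J (Suc (Suc (Suc n))) e \<phi>"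
    and cyc: "bdiff \<phi> = (\<lambda>_. 0)" "XX \<phi> = (\<lambda>_. 0)" "YY \<phi> = (\<lambda>_. 0)"
    and \<alpha>: "dual_cochain J n (e + 2) \<alpha>" and \<beta>: "dual_cochain J n (e + 2) \<beta>"
    and koszul: "koszul \<phi> = (\<lambda>xs. YY \<alpha> xs - XX \<beta> xs)"
  shows "\<exists>\<psi>. dual_cochain J (Suc (Suc n)) e \<psi> \<and> XX \<psi> = (\<lambda>_. 0) \<and> YY \<psi> = (\<lambda>_. 0) \<and> bdiff \<psi> = \<phi>"
proof -
  have contract: "bdiff (insert_one \<chi>) = \<chi>" if "dual_cochain J m e' \<chi>" "m > 0" "bdiff \<chi> = (\<lambda>_. 0)" for \<chi> m e'
    using insert_one_bdiff_dual_cochain[OF that(1,2)] that(3) by (auto simp: fun_eq_iff insert_one_def)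
  \<comment> \<open>A primitive of \<open>\<phi>\<close>, whose linearity defects are \<open>bdiff a'\<close> and \<open>bdiff b'\<close>.\<close>
  define g0 where "g0 = insert_one \<phi>"
  have g0: "dual_cochain J (Suc (Suc n)) e g0" "bdiff g0 = \<phi>"
    using dual_cochain_insert_one[OF \<phi>] contract[OF \<phi>] cyc by (auto simp: g0_def)
  have Xg0: "dual_cochain J (Suc (Suc n)) (e + 2) (XX g0)" "bdiff (XX g0) = (\<lambda>_. 0)"
    using x.dual_cochain_lin_defect'[OF J g0(1)] by (auto simp: bdiff_lin_defect_fun g0 cyc)
  have Yg0: "dual_cochain J (Suc (Suc n)) (e + 2) (YY g0)" "bdiff (YY g0) = (\<lambda>_. 0)"
    using y.dual_cochain_lin_defect'[OF J g0(1)] by (auto simp: bdiff_lin_defect_fun g0 cyc)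
  define a' b' where "a' = insert_one (XX g0)" and "b' = insert_one (YY g0)"
  have a': "dual_cochain J (Suc n) (e + 2) a'" "bdiff a' = XX g0"
    using dual_cochain_insert_one[OF Xg0(1)] contract[OF Xg0(1)] Xg0(2) by (auto simp: a'_def)
  have b': "dual_cochain J (Suc n) (e + 2) b'" "bdiff b' = YY g0"
    using dual_cochain_insert_one[OF Yg0(1)] contract[OF Yg0(1)] Yg0(2) by (auto simp: b'_def)
  have c': "koszul_pre \<phi> = (\<lambda>xs. YY a' xs - XX b' xs)"
    by (simp add: koszul_pre_def a'_def b'_def g0_def)
  have "bdiff (koszul_pre \<phi>) = (\<lambda>_. 0)"
    unfolding c' by (simp add: bdiff_diff_fun bdiff_lin_defect_fun a' b' lin_defect_commute)
  then have c'_bdiff: "bdiff (koszul \<phi>) = koszul_pre \<phi>"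
    unfolding koszul_def using dual_cochain_koszul_pre[OF J \<phi>] by (intro contract) auto
  \<comment> \<open>The corrected primitives of the defects of \<open>g0\<close> are compatible, so they are the defects of one function \<open>\<gamma>\<close>.\<close>
  define \<alpha>1 \<beta>1 where "\<alpha>1 = (\<lambda>xs. a' xs - bdiff \<alpha> xs)" and "\<beta>1 = (\<lambda>xs. b' xs - bdiff \<beta> xs)"
  have \<alpha>1: "dual_cochain J (Suc n) (e + 2) \<alpha>1" unfolding \<alpha>1_def by (intro dual_cochain_diff a' dual_cochain_bdiff J \<alpha>)
  have \<beta>1: "dual_cochain J (Suc n) (e + 2) \<beta>1" unfolding \<beta>1_def by (intro dual_cochain_diff b' dual_cochain_bdiff J \<beta>)
  have "YY \<alpha>1 xs - XX \<beta>1 xs = koszul_pre \<phi> xs - bdiff (koszul \<phi>) xs" for xs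
    by (simp add: \<alpha>1_def \<beta>1_def lin_defect_diff c' koszul bdiff_diff bdiff_lin_defect)
  then have compat: "YY \<alpha>1 = XX \<beta>1" by (auto simp: c'_bdiff fun_eq_iff)
  \<comment> \<open>Solve for the \<open>x\<close>-defect, then repair the \<open>y\<close>-defect within the kernel of the \<open>x\<close>-defect.\<close>
  define \<gamma>0 where "\<gamma>0 = QX \<alpha>1"
  have \<gamma>0: "dual_cochain J (Suc n) e \<gamma>0" "XX \<gamma>0 = \<alpha>1"
    using x.dual_cochain_quot[OF \<alpha>1] XX_QX[OF \<alpha>1] n by (auto simp: \<gamma>0_def)
  define \<delta> where "\<delta> = (\<lambda>xs. \<beta>1 xs - YY \<gamma>0 xs)"
  have \<delta>: "dual_cochain J (Suc n) (e + 2) \<delta>" unfolding \<delta>_def by (intro dual_cochain_diff \<beta>1 y.dual_cochain_lin_defect' J \<gamma>0)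
  have X\<delta>: "XX \<delta> = (\<lambda>_. 0)"
    unfolding \<delta>_def lin_defect_diff_fun by (subst lin_defect_commute_fun) (simp add: \<gamma>0 compat)
  define \<gamma> where "\<gamma> = (\<lambda>xs. \<gamma>0 xs + QY \<delta> xs)"
  have E\<delta>: "dual_cochain J (Suc n) e (QY \<delta>)" "YY (QY \<delta>) = \<delta>" "XX (QY \<delta>) = (\<lambda>_. 0)"
    using y.dual_cochain_quot[OF \<delta>] YY_QY[OF \<delta>] XX_QY[OF J \<delta>] n by (auto simp: X\<delta> quot_zero_fun)
  have \<gamma>: "dual_cochain J (Suc n) e \<gamma>" unfolding \<gamma>_def by (intro dual_cochain_add \<gamma>0 E\<delta>)
  have X\<gamma>: "XX \<gamma> = \<alpha>1" by (simp add: \<gamma>_def lin_defect_add_fun \<gamma>0 E\<delta>)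
  have Y\<gamma>: "YY \<gamma> = \<beta>1" by (simp add: \<gamma>_def lin_defect_add_fun E\<delta>) (simp add: \<delta>_def)
  define \<psi> where "\<psi> = (\<lambda>xs. g0 xs - bdiff \<gamma> xs)"
  have "dual_cochain J (Suc (Suc n)) e \<psi>" unfolding \<psi>_def by (intro dual_cochain_diff g0 dual_cochain_bdiff J \<gamma>)
  moreover have "bdiff \<psi> = \<phi>" by (simp add: \<psi>_def bdiff_diff_fun bdiff_bdiff_fun g0)
  moreover have "XX \<psi> = (\<lambda>_. 0)"
    by (simp add: \<psi>_def lin_defect_diff_fun flip: bdiff_lin_defect_fun) (simp add: X\<gamma> \<alpha>1_def bdiff_diff_fun bdiff_bdiff_fun a')
  moreover have "YY \<psi> = (\<lambda>_. 0)"
    by (simp add: \<psi>_def lin_defect_diff_fun flip: bdiff_lin_defect_fun) (simp add: Y\<gamma> \<beta>1_def bdiff_diff_fun bdiff_bdiff_fun b')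
  ultimately show ?thesis by blast
qed

text \<open>
  With at least two arguments left at its end, the zigzag always ends in the image of a defect, as these are surjective.
\<close>
lemma coboundary_high:
  assumes J: "ideal_like J" and n: "n \<ge> 2" and \<phi>: "dual_cochain J (Suc (Suc (Suc n))) e \<phi>"
    and cyc: "bdiff \<phi> = (\<lambda>_. 0)" "XX \<phi> = (\<lambda>_. 0)" "YY \<phi> = (\<lambda>_. 0)"
  shows "\<exists>\<psi>. dual_cochain J (Suc (Suc n)) e \<psi> \<and> XX \<psi> = (\<lambda>_. 0) \<and> YY \<psi> = (\<lambda>_. 0) \<and> bdiff \<psi> = \<phi>"
proof (rule coboundary_of_koszul[OF J _ \<phi> cyc])
  have k: "dual_cochain J n (e + 4) (koszul \<phi>)" using J \<phi> by (rule dual_cochain_koszul)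
  show "dual_cochain J n (e + 2) (\<lambda>_. 0)" by (rule dual_cochain_zero)
  show "dual_cochain J n (e + 2) (\<lambda>xs. - QX (koszul \<phi>) xs)"
    using x.dual_cochain_quot[OF k n] by (intro dual_cochain_uminus) (simp add: algebra_simps)
  have "XX (\<lambda>xs. - QX (koszul \<phi>) xs) = (\<lambda>xs. - XX (QX (koszul \<phi>)) xs)"
    by (auto simp: lin_defect_def fun_eq_iff split: list.split)
  then show "koszul \<phi> = (\<lambda>xs. YY (\<lambda>_. 0) xs - XX (\<lambda>xs. - QX (koszul \<phi>) xs) xs)"
    using XX_QX[OF k] n by (simp add: lin_defect_zero_fun)
qed (use n in simp)

text \<open>
  The zigzag of a coboundary is a sum of defects up to the boundary of an element without arguments, which is zero.
\<close>
lemma koszul_coboundary: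
  assumes J: "ideal_like J" and \<psi>: "dual_cochain J (Suc (Suc (Suc 0))) e \<psi>"
    and "XX \<psi> = (\<lambda>_. 0)" "YY \<psi> = (\<lambda>_. 0)"
  shows "koszul (bdiff \<psi>) = (\<lambda>xs. YY (insert_one (XX (insert_one \<psi>))) xs - XX (insert_one (YY (insert_one \<psi>))) xs)"
proof -
  have 1: "dual_cochain J (Suc (Suc 0)) e (insert_one \<psi>)" using \<psi> by (rule dual_cochain_insert_one)
  have d: "insert_one (bdiff \<psi>) = (\<lambda>xs. \<psi> xs - bdiff (insert_one \<psi>) xs)" by (rule insert_one_bdiff_dual_cochain[OF \<psi>]) simp
  have X: "dual_cochain J (Suc (Suc 0)) (e + 2) (XX (insert_one \<psi>))" "XX (insert_one (bdiff \<psi>)) = (\<lambda>xs. - bdiff (XX (insert_one \<psi>)) xs)"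
    using x.dual_cochain_lin_defect'[OF J 1] by (auto simp: d lin_defect_diff_fun assms bdiff_lin_defect_fun)
  have Y: "dual_cochain J (Suc (Suc 0)) (e + 2) (YY (insert_one \<psi>))" "YY (insert_one (bdiff \<psi>)) = (\<lambda>xs. - bdiff (YY (insert_one \<psi>)) xs)"
    using y.dual_cochain_lin_defect'[OF J 1] by (auto simp: d lin_defect_diff_fun assms bdiff_lin_defect_fun)
  have minus: "insert_one (\<lambda>xs. - \<chi> xs) = (\<lambda>xs. - insert_one \<chi> xs)" for \<chi> :: "'a cochain"
    by (auto simp: insert_one_def)
  have X2: "insert_one (XX (insert_one (bdiff \<psi>))) = (\<lambda>xs. bdiff (insert_one (XX (insert_one \<psi>))) xs - XX (insert_one \<psi>) xs)"
    by (simp add: X(2) minus insert_one_bdiff_dual_cochain[OF X(1)])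
  have Y2: "insert_one (YY (insert_one (bdiff \<psi>))) = (\<lambda>xs. bdiff (insert_one (YY (insert_one \<psi>))) xs - YY (insert_one \<psi>) xs)"
    by (simp add: Y(2) minus insert_one_bdiff_dual_cochain[OF Y(1)])
  define w where "w = (\<lambda>xs. YY (insert_one (XX (insert_one \<psi>))) xs - XX (insert_one (YY (insert_one \<psi>))) xs)"
  have w: "dual_cochain J 1 (e + 2 + 2) w"
    unfolding w_def One_nat_def by (intro dual_cochain_diff y.dual_cochain_lin_defect' x.dual_cochain_lin_defect' dual_cochain_insert_one J X Y)
  have "koszul_pre (bdiff \<psi>) = bdiff w"
    by (simp add: koszul_pre_def X2 Y2 lin_defect_diff_fun w_def bdiff_diff_fun bdiff_lin_defect_fun)
      (simp add: lin_defect_commute[of CY PY CX PX])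
  then have "koszul (bdiff \<psi>) = (\<lambda>xs. w xs - bdiff (insert_one w) xs)"
    by (simp add: koszul_def insert_one_bdiff_dual_cochain[OF w])
  moreover have "bdiff (insert_one w) = (\<lambda>xs. 0)"
  by (rule bdiff_insert_one_singletons[OF w])
  ultimately show ?thesis by (simp add: w_def)
qed

text \<open>
  The zigzag run backwards: \<open>bdiff c\<close> is divided by the \<open>x\<close>-defect, the boundary of the result by the \<open>y\<close>-defect, and
  the boundary of that is a cocycle. The forward zigzag makes other choices of primitives, whence \<open>\<alpha>\<close> and \<open>\<beta>\<close>.
\<close>
lemma koszul_surj:
  assumes J: "ideal_like J" and c: "dual_cochain J 1 e c"
  shows "\<exists>\<phi> \<alpha> \<beta>. dual_cochain J (Suc (Suc (Suc 1))) (e - 4) \<phi> \<and> bdiff \<phi> = (\<lambda>_. 0) \<and> XX \<phi> = (\<lambda>_. 0) \<and> YY \<phi> = (\<lambda>_. 0)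
     \<and> dual_cochain J 1 (e - 2) \<alpha> \<and> dual_cochain J 1 (e - 2) \<beta> \<and> koszul \<phi> = (\<lambda>xs. c xs - (YY \<alpha> xs - XX \<beta> xs))"
proof -
  define b' where "b' = (\<lambda>xs. - QX (bdiff c) xs)"
  have c': "dual_cochain J 2 e (bdiff c)" using dual_cochain_bdiff[OF J c] by (simp add: numeral_2_eq_2)
  have b': "dual_cochain J 2 (e - 2) b'" unfolding b'_def using x.dual_cochain_quot[OF c'] by (intro dual_cochain_uminus) simp
  have "XX b' = (\<lambda>xs. - XX (QX (bdiff c)) xs)"
    by (auto simp: b'_def lin_defect_def fun_eq_iff split: list.split)
  then have Xb': "XX b' = (\<lambda>xs. - bdiff c xs)" using XX_QX[OF c'] by simp
  define b where "b = bdiff b'"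
  have b: "dual_cochain J 3 (e - 2) b" using dual_cochain_bdiff[OF J b'] by (simp add: b_def)
  have minus: "bdiff (\<lambda>xs. - \<chi> xs) = (\<lambda>xs. - bdiff \<chi> xs)" for \<chi> :: "'a cochain"
    using bdiff_diff[of "\<lambda>_. 0" \<chi>] by (auto simp: bdiff_zero)
  have Xb: "XX b = (\<lambda>_. 0)"
    by (simp add: b_def flip: bdiff_lin_defect_fun) (simp add: Xb' minus bdiff_bdiff_fun)
  define g0 where "g0 = QY b"
  have g0: "dual_cochain J 3 (e - 4) g0" using y.dual_cochain_quot[OF b] by (simp add: g0_def)
  have Yg0: "YY g0 = b" using YY_QY[OF b] by (simp add: g0_def)
  have Xg0: "XX g0 = (\<lambda>_. 0)" using XX_QY[OF J b] by (simp add: g0_def Xb quot_zero_fun)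
  define \<phi> where "\<phi> = bdiff g0"
  have \<phi>: "dual_cochain J (Suc (Suc (Suc 1))) (e - 4) \<phi>" using dual_cochain_bdiff[OF J g0] by (simp add: \<phi>_def eval_nat_numeral)
  have cyc: "bdiff \<phi> = (\<lambda>_. 0)" "XX \<phi> = (\<lambda>_. 0)" "YY \<phi> = (\<lambda>_. 0)"
    by (simp_all add: \<phi>_def bdiff_bdiff_fun flip: bdiff_lin_defect_fun) (simp_all add: Xg0 Yg0 bdiff_zero_fun b_def bdiff_bdiff_fun)
  define k where "k = insert_one g0"
  have k: "dual_cochain J 2 (e - 4) k" using dual_cochain_insert_one[of J 2] g0 by (simp add: k_def eval_nat_numeral)
  have h1: "insert_one \<phi> = (\<lambda>xs. g0 xs - bdiff k xs)" using insert_one_bdiff_dual_cochain[OF g0] by (simp add: \<phi>_def k_def)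
  have X1: "XX (insert_one \<phi>) = (\<lambda>xs. - bdiff (XX k) xs)" by (simp add: h1 lin_defect_diff_fun Xg0 bdiff_lin_defect_fun)
  have Y1: "YY (insert_one \<phi>) = bdiff (\<lambda>xs. b' xs - YY k xs)"
    by (simp add: h1 lin_defect_diff_fun Yg0 bdiff_lin_defect_fun bdiff_diff_fun b_def)
  have Xk: "dual_cochain J 2 (e - 4 + 2) (XX k)" by (rule x.dual_cochain_lin_defect'[OF J k])
  have Yk: "dual_cochain J 2 (e - 4 + 2) (YY k)" by (rule y.dual_cochain_lin_defect'[OF J k])
  define m where "m = (\<lambda>xs. b' xs - YY k xs)"
  have m: "dual_cochain J 2 (e - 4 + 2) m" unfolding m_def by (intro dual_cochain_diff Yk) (use b' in simp)
  have ins_minus: "insert_one (\<lambda>xs. - \<chi> xs) = (\<lambda>xs. - insert_one \<chi> xs)" for \<chi> :: "'a cochain"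
    by (auto simp: insert_one_def)
  have X2: "insert_one (XX (insert_one \<phi>)) = (\<lambda>xs. bdiff (insert_one (XX k)) xs - XX k xs)"
    by (simp add: X1 ins_minus insert_one_bdiff_dual_cochain[OF Xk])
  have Y2: "insert_one (YY (insert_one \<phi>)) = (\<lambda>xs. m xs - bdiff (insert_one m) xs)"
    unfolding Y1 m_def[symmetric] by (simp add: insert_one_bdiff_dual_cochain[OF m])
  define \<alpha> \<beta> where "\<alpha> = (\<lambda>xs. - insert_one (XX k) xs)" and "\<beta> = (\<lambda>xs. insert_one m xs)"
  have \<alpha>: "dual_cochain J 1 (e - 2) \<alpha>" unfolding \<alpha>_def
    by (intro dual_cochain_uminus dual_cochain_insert_one) (use Xk in \<open>simp add: eval_nat_numeral\<close>)
  have \<beta>: "dual_cochain J 1 (e - 2) \<beta>" unfolding \<beta>_def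
    using dual_cochain_insert_one[of J 1 "e - 2" m] m by (simp add: eval_nat_numeral)
  define w where "w = (\<lambda>xs. c xs - (YY \<alpha> xs - XX \<beta> xs))"
  have w: "dual_cochain J 1 e w"
    unfolding w_def using y.dual_cochain_lin_defect'[OF J \<alpha>] x.dual_cochain_lin_defect'[OF J \<beta>] by (intro dual_cochain_diff c) auto
  have "koszul_pre \<phi> xs = bdiff w xs" for xs
  proof -
    have "XX m xs = - bdiff c xs - XX (YY k) xs" by (simp add: m_def lin_defect_diff Xb')
    moreover have "YY \<alpha> = (\<lambda>xs. - YY (insert_one (XX k)) xs)"
      by (auto simp: \<alpha>_def lin_defect_def fun_eq_iff split: list.split)
    ultimately show ?thesis
      unfolding koszul_pre_def X2 Y2 lin_defect_diff w_def
      by (simp add: bdiff_diff_fun bdiff_lin_defect_fun minus \<beta>_def lin_defect_commute[of CX PX CY PY])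
  qed
  then have "koszul_pre \<phi> = bdiff w" by auto
  then have "koszul \<phi> = (\<lambda>xs. w xs - bdiff (insert_one w) xs)"
    by (simp add: koszul_def insert_one_bdiff_dual_cochain[OF w])
  moreover have "bdiff (insert_one w) = (\<lambda>_. 0)" by (rule bdiff_insert_one_singletons[OF w])
  ultimately have "koszul \<phi> = (\<lambda>xs. c xs - (YY \<alpha> xs - XX \<beta> xs))" by (simp add: w_def)
  then show ?thesis using \<phi> cyc \<alpha> \<beta> by blast
qed

section \<open>The cone as a graded algebra\<close>

definition cone_alg :: "('k::field, 'k cone) graded_alg" where
  "cone_alg = \<lparr>carrier = UNIV, mult = (*), one = 1, zero = 0, add = (+), smult = csc,
     part = (\<lambda>n. Cdeg (int n))\<rparr>"

lemma cone_alg_simps [simp]: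
  "carrier cone_alg = UNIV" "mult cone_alg = (*)" "one cone_alg = 1" "zero cone_alg = 0"
  "add cone_alg = (+)" "smult cone_alg = csc" "part cone_alg = (\<lambda>n. Cdeg (int n))"
  by (simp_all add: cone_alg_def)

lemma ring_cone_alg: "ring cone_alg"
proof (rule ringI)
  show "abelian_group cone_alg"
    by (rule abelian_groupI) (auto simp: add.assoc add.commute intro: exI[of _ "- _"] left_minus)
  show "monoid cone_alg"
    by (rule monoidI) (auto simp: mult.assoc)
qed (auto simp: algebra_simps)

interpretation cone: ring cone_alg by (rule ring_cone_alg)

lemma finsum_cone_alg: "finsum cone_alg f S = sum f S"
proof (induction S rule: infinite_finite_induct)
  case (insert x S)
  then show ?case by (subst cone.finsum_insert) auto
qed auto

lemma bar_args_cone: "bar_args cone_alg i = {xs. length xs = Suc i}"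
  by (auto simp: bar_args_def)

lemma int_part_cone: "int_part cone_alg e = Cdeg e"
  using Cdeg_neg by (auto simp: int_part_def)

lemma hcomp_Ctail: "n \<le> m \<Longrightarrow> hcomp (int m) a \<in> Ctail n"
  using Cdeg_Ctail[OF hcomp_Cdeg] Ctail_mono by blast

lemma tail_ideal_cone: "tail_ideal cone_alg n = Ctail n"
proof (rule Set.set_eqI, rule iffI)
  fix a :: "'a cone" assume "a \<in> tail_ideal cone_alg n"
  then obtain N s where "finite N" "N \<subseteq> {n..}" "\<forall>m\<in>N. s m \<in> Cdeg (int m)" "a = sum s N"
    by (auto simp: tail_ideal_def finsum_cone_alg)
  then show "a \<in> Ctail n"
    by (auto intro!: Ctail_sum dest: Cdeg_Ctail subsetD[OF Ctail_mono])
next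
  fix a :: "'a cone" assume "a \<in> Ctail n"
  then obtain N where N: "a = (\<Sum>m\<in>{n..<N}. hcomp (int m) a)" using Ctail_split by blast
  have "finite {n..<N} \<and> {n..<N} \<subseteq> {n..} \<and> (\<forall>m\<in>{n..<N}. hcomp (int m) a \<in> Cdeg (int m))"
    by (auto simp: hcomp_Cdeg)
  with N show "a \<in> tail_ideal cone_alg n"
    unfolding tail_ideal_def finsum_cone_alg cone_alg_simps mem_Collect_eq by metis
qed

lemma ideal_like_Ctail: "ideal_like (Ctail n)"
  using Ctail_mult[of _ 0 _ n] by (auto simp: ideal_like_def)

lemma graded_left_ideal_Ctail: "graded_left_ideal cone_alg (Ctail n)"
proof -
  have "additive_subgroup (Ctail n) (cone_alg :: ('a, 'a cone) graded_alg)"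
  proof (rule additive_subgroup.intro, rule cone.add.subgroupI)
    fix a :: "'a cone" assume a: "a \<in> Ctail n"
    have "\<ominus>\<^bsub>cone_alg\<^esub> a = - a" by (rule cone.minus_equality) auto
    then show "\<ominus>\<^bsub>cone_alg\<^esub> a \<in> Ctail n" using Ctail_csc[OF a, of "- 1"] by (simp add: csc_minus_left)
  next
    show "Ctail n \<noteq> {}" using Ctail_zero by blast
  qed (auto intro: Ctail_add)
  moreover have "\<exists>N s. finite N \<and> (\<forall>m\<in>N. s m \<in> Ctail n \<inter> Cdeg (int m)) \<and> b = sum s N"
    if "b \<in> Ctail n" for b :: "'a cone"
  proof -
    obtain N where N: "b = (\<Sum>m\<in>{n..<N}. hcomp (int m) b)" using Ctail_split[OF \<open>b \<in> Ctail n\<close>] by blast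
    have "finite {n..<N}" "\<forall>m\<in>{n..<N}. hcomp (int m) b \<in> Ctail n \<inter> Cdeg (int m)"
      using hcomp_Ctail by (auto simp: hcomp_Cdeg)
    with N show ?thesis by metis
  qed
  ultimately show ?thesis
    using ideal_like_Ctail[of n] unfolding graded_left_ideal_def finsum_cone_alg cone_alg_simps ideal_like_def by blast
qed

subsection \<open>Cochains of the cone\<close>

text \<open>
  Taking the coefficient of \<open>z\<close> is a Frobenius form of \<open>A\<close> over \<open>P\<close>: it identifies \<open>A\<close> with \<open>Hom\<^sub>P(A, P)\<close>. Hence an
  \<open>A\<close>-valued function \<open>f\<close> is encoded by the \<open>P\<close>-valued function \<open>(a, \<dots>) \<mapsto> tr(a f(\<dots>))\<close>, which is \<open>P\<close>-linear in \<open>a\<close>.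
\<close>
definition frob_trace :: "nat \<Rightarrow> ('k::field cone list \<Rightarrow> 'k cone) \<Rightarrow> 'k cochain" where
  "frob_trace i f xs = (if length xs = Suc (Suc i) then cim (hd xs * f (tl xs)) else 0)"

lemma frob_trace_Cons [simp]: "length ys = Suc i \<Longrightarrow> frob_trace i f (a # ys) = cim (a * f ys)"
  by (simp add: frob_trace_def)

text \<open>
  The two linearity conditions at a list position, merged into one and phrased by concatenation, and the degree
  condition extended to integer degrees, where negative ones force an argument to vanish.
\<close>
lemma bar_cochainsD:
  assumes "f \<in> bar_cochains cone_alg J i e"
  shows "f \<in> {xs. length xs = Suc i} \<rightarrow>\<^sub>E UNIV"
    and "length us + length vs = i \<Longrightarrow> f (us @ (csc c a + b) # vs) = csc c (f (us @ a # vs)) + f (us @ b # vs)"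
    and "length xs = Suc i \<Longrightarrow> last xs \<in> J \<Longrightarrow> f xs = 0"
    and "length xs = Suc i \<Longrightarrow> list_all2 (\<lambda>x m. x \<in> Cdeg m) xs ms \<Longrightarrow> f xs \<in> Cdeg (sum_list ms + e)"
proof -
  note A = assms[unfolded bar_cochains_def bar_args_cone cone_alg_simps mem_Collect_eq]
  have A1: "f \<in> {xs. length xs = Suc i} \<rightarrow>\<^sub>E UNIV" by (rule A[THEN conjunct1])
  have A2: "f (xs[p := a + b]) = f (xs[p := a]) + f (xs[p := b])" if "length xs = Suc i" "p \<le> i" for xs p a b
    by (rule A[THEN conjunct2, THEN conjunct1, rule_format]) (use that in auto)
  have A3: "f (xs[p := csc c a]) = csc c (f (xs[p := a]))" if "length xs = Suc i" "p \<le> i" for xs p a c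
    by (rule A[THEN conjunct2, THEN conjunct2, THEN conjunct1, rule_format]) (use that in auto)
  have A4: "f xs = 0" if "length xs = Suc i" "last xs \<in> J" for xs
    by (rule A[THEN conjunct2, THEN conjunct2, THEN conjunct2, THEN conjunct1, rule_format]) (use that in auto)
  have A5: "f xs \<in> int_part cone_alg (int (sum_list ns) + e)"
    if "length xs = Suc i" "list_all2 (\<lambda>x n. x \<in> Cdeg (int n)) xs ns" for xs ns
    by (rule A[THEN conjunct2, THEN conjunct2, THEN conjunct2, THEN conjunct2, rule_format]) (use that in auto)
  show "f \<in> {xs. length xs = Suc i} \<rightarrow>\<^sub>E UNIV" by (rule A1)
  have lin: "f (us @ (csc c a + b) # vs) = csc c (f (us @ a # vs)) + f (us @ b # vs)"
    if "length us + length vs = i" for us vs c a b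
  proof -
    have add: "f ((us @ 0 # vs)[length us := x + y]) = f ((us @ 0 # vs)[length us := x]) + f ((us @ 0 # vs)[length us := y])" for x y
      by (rule A2) (use that in auto)
    have sc: "f ((us @ 0 # vs)[length us := csc c x]) = csc c (f ((us @ 0 # vs)[length us := x]))" for x
      by (rule A3) (use that in auto)
    show ?thesis using add[of "csc c a" b] sc[of a] by simp
  qed
  then show "length us + length vs = i \<Longrightarrow> f (us @ (csc c a + b) # vs) = csc c (f (us @ a # vs)) + f (us @ b # vs)" .
  show "length xs = Suc i \<Longrightarrow> last xs \<in> J \<Longrightarrow> f xs = 0" by (rule A4)
  assume len: "length xs = Suc i" and ms: "list_all2 (\<lambda>x m. x \<in> Cdeg m) xs ms"
  show "f xs \<in> Cdeg (sum_list ms + e)"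
  proof (cases "\<forall>m\<in>set ms. m \<ge> 0")
    case True
    define ns where "ns = map nat ms"
    have ms_ns: "ms = map int ns" using True by (auto simp: ns_def o_def map_idI)
    have "list_all2 (\<lambda>x n. x \<in> Cdeg (int n)) xs ns"
      using ms unfolding ms_ns by (simp add: list_all2_map2)
    then have "f xs \<in> int_part cone_alg (int (sum_list ns) + e)"
      by (rule A5[OF len])
    moreover have "sum_list ms = int (sum_list ns)" unfolding ms_ns by (induction ns) auto
    ultimately show ?thesis by (simp add: int_part_cone)
  next
    case False
    then obtain p where p: "p < length ms" "ms ! p < 0" by (auto simp: in_set_conv_nth not_le)
    then have "xs ! p \<in> Cdeg (ms ! p)" "p < length xs" using ms by (auto simp: list_all2_conv_all_nth)
    then have "xs ! p = 0" using p Cdeg_neg by blast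
    then obtain us vs where "xs = us @ 0 # vs" using \<open>p < length xs\<close> by (metis id_take_nth_drop)
    then have "f xs = 0" using lin[of us vs 1 0 0] len by simp
    then show ?thesis by simp
  qed
qed

lemma Cdeg_cim: "a \<in> Cdeg n \<Longrightarrow> cim a \<in> Pdeg (n - 2)" by (simp add: Cdeg_def)

lemma dual_cochain_frob_trace:
  assumes f: "f \<in> bar_cochains cone_alg J i e"
  shows "dual_cochain J (Suc (Suc i)) (e - 2) (frob_trace i f)" "XX (frob_trace i f) = (\<lambda>_. 0)" "YY (frob_trace i f) = (\<lambda>_. 0)"
proof -
  note D = bar_cochainsD[OF f]
  show "XX (frob_trace i f) = (\<lambda>_. 0)" "YY (frob_trace i f) = (\<lambda>_. 0)"
    by (auto simp: fun_eq_iff lin_defect_def frob_trace_def algebra_simps split: list.split)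
  have "mlin (frob_trace i f)"
    unfolding mlin_def
  proof safe
    fix us vs c a and b :: "'a cone"
    show "frob_trace i f (us @ (csc c a + b) # vs) = psc c (frob_trace i f (us @ a # vs)) + frob_trace i f (us @ b # vs)"
    proof (cases us)
      case Nil
      then show ?thesis by (auto simp: frob_trace_def distrib_right smult_add_right algebra_simps)
    next
      case (Cons u us')
      show ?thesis
      proof (cases "length us' + length vs = i")
        case True
        then show ?thesis
          using D(2)[of us' vs c a b] by (simp add: Cons smult_add_right algebra_simps)
      qed (simp add: frob_trace_def Cons)
    qed
  qed
  moreover have "vanishes_on J (frob_trace i f)"
    unfolding vanishes_on_def frob_trace_def
    using D(3) by (auto simp: length_Suc_conv split: if_splits)
  moreover have "of_degree (e - 2) (frob_trace i f)"
    unfolding of_degree_def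
  proof safe
    fix xs :: "'a cone list" and ms assume *: "list_all2 (\<lambda>x m. x \<in> Cdeg m) xs ms"
    show "frob_trace i f xs \<in> Pdeg (sum_list ms + (e - 2))"
    proof (cases "length xs = Suc (Suc i)")
      case True
      then obtain a ys where xs: "xs = a # ys" "length ys = Suc i" by (cases xs) auto
      then obtain m ms' where ms: "ms = m # ms'" "a \<in> Cdeg m" "list_all2 (\<lambda>x m. x \<in> Cdeg m) ys ms'"
        using * by (auto simp: list_all2_Cons1)
      have "a * f ys \<in> Cdeg (m + (sum_list ms' + e))"
        using D(4) xs ms by (intro Cdeg_mult) auto
      from Cdeg_cim[OF this] show ?thesis by (simp add: xs ms algebra_simps)
    qed (simp add: frob_trace_def)
  qed
  ultimately show "dual_cochain J (Suc (Suc i)) (e - 2) (frob_trace i f)"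
    unfolding dual_cochain_def by (intro conjI) (auto simp: on_length_def frob_trace_def)
qed

lemma cone_split: "a = CP (cre a) + CP (cim a) * CZ"
  by (rule cone_eqI) simp_all

lemma frob_trace_inject:
  assumes "f \<in> {xs. length xs = Suc i} \<rightarrow>\<^sub>E UNIV" "g \<in> {xs. length xs = Suc i} \<rightarrow>\<^sub>E UNIV" "frob_trace i f = frob_trace i g"
  shows "f = g"
proof (rule PiE_ext[OF assms(1,2)])
  fix xs :: "'a cone list" assume "xs \<in> {xs. length xs = Suc i}"
  then have *: "cim (a * f xs) = cim (a * g xs)" for a
    using fun_cong[OF assms(3), of "a # xs"] by simp
  show "f xs = g xs" using *[of 1] *[of CZ] by (intro cone_eqI) simp_all
qed

text \<open>
  Compatibility with \<open>x\<close> and \<open>y\<close> implies linearity over all of \<open>k[x, y]\<close>.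
\<close>
lemma CP_linear:
  assumes \<phi>: "mlin \<phi>" and X: "\<And>a. \<phi> (CX * a # ys) = PX * \<phi> (a # ys)" and Y: "\<And>a. \<phi> (CY * a # ys) = PY * \<phi> (a # ys)"
  shows "\<phi> (CP p * a # ys) = p * \<phi> (a # ys)"
proof -
  have inner: "\<phi> (CP [:c:] * a # ys) = [:c:] * \<phi> (a # ys)" for c a
  proof (induction c)
    case 0
    then show ?case using mlin_zero1[OF \<phi>] by (simp add: CP_def flip: zero_cone_def)
  next
    case (pCons d c)
    have "CP [:pCons d c:] * a = csc d a + CY * (CP [:c:] * a)"
      by (rule cone_eqI; simp add: PY_def algebra_simps smult_add_left[symmetric])
    moreover have "[:pCons d c:] * \<phi> (a # ys) = psc d (\<phi> (a # ys)) + PY * ([:c:] * \<phi> (a # ys))"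
      by (simp add: PY_def smult_add_left[symmetric])
    ultimately show ?case using mlinD1[OF \<phi>, of d a "CY * (CP [:c:] * a)"] Y pCons by simp
  qed
  show ?thesis
  proof (induction p)
    case 0
    then show ?case using mlin_zero1[OF \<phi>] by (simp add: CP_def flip: zero_cone_def)
  next
    case (pCons c p)
    have "CP (pCons c p) * a = CP [:c:] * a + CX * (CP p * a)"
      by (rule cone_eqI; simp add: PX_def)
    moreover have "pCons c p * \<phi> (a # ys) = [:c:] * \<phi> (a # ys) + PX * (p * \<phi> (a # ys))"
      by (simp add: PX_def)
    ultimately show ?case using mlin_add1[OF \<phi>] X pCons inner by simp
  qed
qed

text \<open>
  The value of the cochain is recovered from its traces against the basis \<open>z, 1\<close>, which is dual to \<open>1, z\<close>.
\<close>
lemma frob_trace_surj: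
  assumes \<phi>: "dual_cochain J (Suc (Suc i)) (e - 2) \<phi>" and X: "XX \<phi> = (\<lambda>_. 0)" and Y: "YY \<phi> = (\<lambda>_. 0)"
  shows "\<exists>f\<in>bar_cochains cone_alg J i e. frob_trace i f = \<phi>"
proof
  define f where "f = (\<lambda>xs\<in>bar_args cone_alg i. CP (\<phi> (CZ # xs)) + CP (\<phi> (1 # xs)) * CZ)"
  have f: "f xs = CP (\<phi> (CZ # xs)) + CP (\<phi> (1 # xs)) * CZ" if "length xs = Suc i" for xs
    using that by (simp add: f_def bar_args_cone)
  have ml: "mlin \<phi>" using \<phi> by (rule dual_cochain_mlin)
  have X': "\<phi> (CX * a # ys) = PX * \<phi> (a # ys)" and Y': "\<phi> (CY * a # ys) = PY * \<phi> (a # ys)" for a ys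
    using fun_cong[OF X, of "a # ys"] fun_cong[OF Y, of "a # ys"] by auto
  show "frob_trace i f = \<phi>"
  proof
    fix xs
    show "frob_trace i f xs = \<phi> xs"
    proof (cases "length xs = Suc (Suc i)")
      case True
      then obtain a ys where xs: "xs = a # ys" "length ys = Suc i" by (cases xs) auto
      have "\<phi> (a # ys) = \<phi> ((CP (cre a) * 1 + CP (cim a) * CZ) # ys)"
        using cone_split[of a] by simp
      also have "\<dots> = cre a * \<phi> (1 # ys) + cim a * \<phi> (CZ # ys)"
        by (simp only: mlin_add1[OF ml] CP_linear[OF ml X' Y'])
      finally show ?thesis by (simp add: xs f)
    qed (use dual_cochain_len[OF \<phi>] in \<open>simp add: frob_trace_def\<close>)
  qed
  have add: "f (us @ (a + b) # vs) = f (us @ a # vs) + f (us @ b # vs)" if "length us + length vs = i" for us vs a b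
  proof -
    have "\<phi> (w # us @ (a + b) # vs) = \<phi> (w # us @ a # vs) + \<phi> (w # us @ b # vs)" for w
      using mlinD[OF ml, of "w # us" 1 a b vs] by (simp add: pCons_one)
    then show ?thesis using that by (simp add: f) (rule cone_eqI; simp)
  qed
  have sc: "f (us @ csc c a # vs) = csc c (f (us @ a # vs))" if "length us + length vs = i" for us vs a c
  proof -
    have "\<phi> (w # us @ csc c a # vs) = psc c (\<phi> (w # us @ a # vs))" for w
      using mlinD[OF ml, of "w # us" c a 0 vs] mlin_zero[OF ml, of "w # us"] by simp
    then show ?thesis using that by (simp add: f) (rule cone_eqI; simp)
  qed
  have upd: "f (xs[p := a + b]) = f (xs[p := a]) + f (xs[p := b])" "f (xs[p := csc c a]) = csc c (f (xs[p := a]))"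
    if "length xs = Suc i" "p \<le> i" for xs p a b c
  proof -
    have *: "xs[p := y] = take p xs @ y # drop (Suc p) xs" for y
      using that by (simp add: upd_conv_take_nth_drop)
    have "length (take p xs) + length (drop (Suc p) xs) = i" using that by auto
    then show "f (xs[p := a + b]) = f (xs[p := a]) + f (xs[p := b])" "f (xs[p := csc c a]) = csc c (f (xs[p := a]))"
      by (simp_all only: * add sc)
  qed
  have van: "f xs = 0" if "length xs = Suc i" "last xs \<in> J" for xs
  proof -
    have "\<phi> (w # xs) = 0" for w
      using \<phi> that unfolding dual_cochain_def vanishes_on_def by (metis last.simps length_0_conv list.distinct(1) nat.distinct(1))
    then show ?thesis using that by (simp add: f) (rule cone_eqI; simp)
  qed
  have deg: "f xs \<in> Cdeg (int (sum_list ns) + e)"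
    if "length xs = Suc i" "list_all2 (\<lambda>x n. x \<in> Cdeg (int n)) xs ns" for xs ns
  proof -
    have ns: "list_all2 (\<lambda>x m. x \<in> Cdeg m) xs (map int ns)" using that by (simp add: list_all2_map2)
    have s: "sum_list (map int ns) = int (sum_list ns)" by (induction ns) auto
    have "\<phi> (CZ # xs) \<in> Pdeg (sum_list (2 # map int ns) + (e - 2))"
      "\<phi> (1 # xs) \<in> Pdeg (sum_list (0 # map int ns) + (e - 2))"
      using \<phi> ns CZ_Cdeg one_Cdeg unfolding dual_cochain_def of_degree_def by (metis list_all2_Cons)+
    then show ?thesis using that by (simp add: f Cdeg_def s algebra_simps)
  qed
  have dom: "f \<in> bar_args cone_alg i \<rightarrow>\<^sub>E UNIV"
    unfolding f_def by (rule restrict_PiE_iff[THEN iffD2]) simp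
  show "f \<in> bar_cochains cone_alg J i e"
    unfolding bar_cochains_def
    using upd van deg dom by (simp add: bar_args_cone int_part_cone)
qed

lemma bdiff_merge: "bdiff \<phi> xs = (\<Sum>j<length xs - 1. (- 1) ^ j * \<phi> (merge_at cone_alg j xs))"
  for \<phi> :: "'k::field cochain"
proof (induction \<phi> xs rule: bdiff.induct)
  case (1 \<phi> a b xs)
  then show ?case
    by (simp add: sum.lessThan_Suc_shift merge_at_def sum_negf del: sum.lessThan_Suc)
qed auto

lemma csc_sign: "csc ((- 1) ^ j) a = (- 1) ^ j * a"
  by (induction j) (simp_all add: csc_minus_left)

lemma cim_sign: "cim (a * ((- 1) ^ j * b)) = (- 1) ^ j * cim (a * b)"
proof (induction j arbitrary: b)
  case (Suc j)
  then show ?case using Suc[of "- b"] by (simp add: algebra_simps)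
qed simp

text \<open>
  The leading term \<open>b f(\<dots>)\<close> of the bar differential turns into the merge of the first two arguments, since
  \<open>tr(a (b f)) = tr((a b) f)\<close>.
\<close>
lemma frob_trace_bar_diff: "frob_trace (Suc i) (bar_diff cone_alg i f) = bdiff (frob_trace i f)"
proof
  fix xs :: "'a cone list"
  show "frob_trace (Suc i) (bar_diff cone_alg i f) xs = bdiff (frob_trace i f) xs"
  proof (cases "length xs = Suc (Suc (Suc i))")
    case True
    then obtain a b ys where xs: "xs = a # b # ys" "length ys = Suc i"
      by (cases xs; cases "tl xs") auto
    have "frob_trace (Suc i) (bar_diff cone_alg i f) xs
        = cim (a * (b * f ys)) + cim (a * (\<Sum>j\<le>i. csc ((- 1) ^ Suc j) (f (merge_at cone_alg j (b # ys)))))"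
      by (simp add: xs bar_diff_def bar_args_cone finsum_cone_alg distrib_left del: power_Suc)
    also have "cim (a * (\<Sum>j\<le>i. csc ((- 1) ^ Suc j) (f (merge_at cone_alg j (b # ys)))))
        = (\<Sum>j\<le>i. (- 1) ^ Suc j * cim (a * f (merge_at cone_alg j (b # ys))))"
      by (simp only: sum_distrib_left cone_sum csc_sign cim_sign)
    also have "\<dots> = (\<Sum>j\<le>i. (- 1) ^ Suc j * frob_trace i f (a # merge_at cone_alg j (b # ys)))"
      by (rule sum.cong) (auto simp: merge_at_def xs)
    also have "\<dots> = - bdiff (\<lambda>zs. frob_trace i f (a # zs)) (b # ys)"
      by (simp add: bdiff_merge xs lessThan_Suc_atMost sum_negf)
    finally show ?thesis by (simp add: xs mult.assoc del: cone_sel)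
  next
    case False
    have "on_length (Suc (Suc i)) (frob_trace i f)" by (simp add: on_length_def frob_trace_def)
    then have "bdiff (frob_trace i f) xs = 0" using False on_length_bdiff unfolding on_length_def by blast
    then show ?thesis using False by (simp add: frob_trace_def)
  qed
qed

lemma frob_trace_bar_zero: "frob_trace i (bar_zero cone_alg i) = (\<lambda>_. 0)"
  by (auto simp: fun_eq_iff frob_trace_def bar_zero_def bar_args_cone)

lemma bar_cocycles_iff:
  "f \<in> bar_cocycles cone_alg J i e \<longleftrightarrow> f \<in> bar_cochains cone_alg J i e \<and> bdiff (frob_trace i f) = (\<lambda>_. 0)"
proof -
  have "bar_diff cone_alg i f = bar_zero cone_alg (Suc i) \<longleftrightarrow> bdiff (frob_trace i f) = (\<lambda>_. 0)"
  proof
    assume "bdiff (frob_trace i f) = (\<lambda>_. 0)"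
    then have "frob_trace (Suc i) (bar_diff cone_alg i f) = frob_trace (Suc i) (bar_zero cone_alg (Suc i))"
      by (simp add: frob_trace_bar_diff frob_trace_bar_zero)
    then show "bar_diff cone_alg i f = bar_zero cone_alg (Suc i)"
      by (rule frob_trace_inject[rotated 2]) (auto simp: bar_diff_def bar_zero_def bar_args_cone)
  next
    assume "bar_diff cone_alg i f = bar_zero cone_alg (Suc i)"
    then show "bdiff (frob_trace i f) = (\<lambda>_. 0)" by (metis frob_trace_bar_diff frob_trace_bar_zero)
  qed
  then show ?thesis by (auto simp: bar_cocycles_def)
qed

lemma bar_coboundaryI:
  assumes f: "f \<in> bar_cochains cone_alg J (Suc i) e"
    and \<psi>: "dual_cochain J (Suc (Suc i)) (e - 2) \<psi>" "XX \<psi> = (\<lambda>_. 0)" "YY \<psi> = (\<lambda>_. 0)" "bdiff \<psi> = frob_trace (Suc i) f"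
  shows "f \<in> bar_coboundaries cone_alg J (Suc i) e"
proof -
  obtain g where g: "g \<in> bar_cochains cone_alg J i e" "frob_trace i g = \<psi>" using frob_trace_surj[OF \<psi>(1-3)] by blast
  have "frob_trace (Suc i) f = frob_trace (Suc i) (bar_diff cone_alg i g)" by (simp add: frob_trace_bar_diff g \<psi>)
  then have "f = bar_diff cone_alg i g"
    by (rule frob_trace_inject[rotated 2]) (use bar_cochainsD(1)[OF f] in \<open>auto simp: bar_diff_def bar_args_cone\<close>)
  then show ?thesis using g by (auto simp: bar_coboundaries_def)
qed

lemma ext_vanishing:
  assumes J: "ideal_like J" and i: "i > 2" and f: "f \<in> bar_cocycles cone_alg J i e"
  shows "f \<in> bar_coboundaries cone_alg J i e"
proof -
  have f': "f \<in> bar_cochains cone_alg J i e" "bdiff (frob_trace i f) = (\<lambda>_. 0)" using f by (auto simp: bar_cocycles_iff)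
  define n where "n = i - 1"
  have n: "i = Suc n" "n \<ge> 2" using i by (auto simp: n_def)
  have "dual_cochain J (Suc (Suc (Suc n))) (e - 2) (frob_trace i f)" using dual_cochain_frob_trace(1)[OF f'(1)] by (simp add: n)
  from coboundary_high[OF J n(2) this f'(2) dual_cochain_frob_trace(2,3)[OF f'(1)]]
  show ?thesis using bar_coboundaryI f'(1) unfolding n(1) by blast
qed

section \<open>Transport along isomorphisms of graded algebras\<close>

definition graded_algebra :: "('k, 'a, 'm) graded_alg_scheme \<Rightarrow> bool" where
  "graded_algebra A \<longleftrightarrow> ring A \<and> (\<forall>c. \<forall>a\<in>carrier A. c \<odot>\<^bsub>A\<^esub> a \<in> carrier A) \<and> (\<forall>n. part A n \<subseteq> carrier A)"

definition graded_iso ::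
    "('k, 'a, 'm) graded_alg_scheme \<Rightarrow> ('k, 'b, 'n) graded_alg_scheme \<Rightarrow> ('a \<Rightarrow> 'b) \<Rightarrow> bool" where
  "graded_iso A B \<theta> \<longleftrightarrow> bij_betw \<theta> (carrier A) (carrier B) \<and> \<theta> \<in> ring_hom A B
     \<and> (\<forall>c. \<forall>a\<in>carrier A. \<theta> (c \<odot>\<^bsub>A\<^esub> a) = c \<odot>\<^bsub>B\<^esub> \<theta> a) \<and> (\<forall>n. \<theta> ` part A n = part B n)"

text \<open>
  Conjugation of cochains by an isomorphism \<open>\<theta>\<close>; for an automorphism it induces the action on cohomology.
\<close>
definition bar_transport ::
    "('k, 'a, 'm) graded_alg_scheme \<Rightarrow> ('k, 'b, 'n) graded_alg_scheme \<Rightarrow> ('a \<Rightarrow> 'b) \<Rightarrow> nat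
      \<Rightarrow> ('a list \<Rightarrow> 'a) \<Rightarrow> 'b list \<Rightarrow> 'b" where
  "bar_transport A B \<theta> i f = (\<lambda>xs \<in> bar_args B i. \<theta> (f (map (inv_into (carrier A) \<theta>) xs)))"

lemma bar_push_transport: "bar_push A i g f = bar_transport A A g i f"
  by (simp add: bar_push_def bar_transport_def)

locale graded_isomorphism =
  fixes A :: "('k::field, 'a, 'm) graded_alg_scheme" and B :: "('k, 'b, 'n) graded_alg_scheme"
    and \<theta> :: "'a \<Rightarrow> 'b"
  assumes A: "graded_algebra A" and B: "graded_algebra B" and iso: "graded_iso A B \<theta>"
begin

sublocale hom: ring_hom_ring A B \<theta>
  using A B iso by (intro ring_hom_ring.intro ring_hom_ring_axioms.intro)
    (auto simp: graded_algebra_def graded_iso_def)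

abbreviation \<theta>' :: "'b \<Rightarrow> 'a" where "\<theta>' \<equiv> inv_into (carrier A) \<theta>"

lemma smult_closed: "a \<in> carrier A \<Longrightarrow> c \<odot>\<^bsub>A\<^esub> a \<in> carrier A" "b \<in> carrier B \<Longrightarrow> c \<odot>\<^bsub>B\<^esub> b \<in> carrier B"
  using A B by (auto simp: graded_algebra_def)
lemma part_carrier: "a \<in> part A n \<Longrightarrow> a \<in> carrier A" "b \<in> part B n \<Longrightarrow> b \<in> carrier B"
  using A B by (auto simp: graded_algebra_def)
lemma \<theta>_smult: "a \<in> carrier A \<Longrightarrow> \<theta> (c \<odot>\<^bsub>A\<^esub> a) = c \<odot>\<^bsub>B\<^esub> \<theta> a"
  using iso by (auto simp: graded_iso_def)
lemma bij: "bij_betw \<theta> (carrier A) (carrier B)" using iso by (auto simp: graded_iso_def)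
lemma \<theta>'_closed: "b \<in> carrier B \<Longrightarrow> \<theta>' b \<in> carrier A"
  using bij by (metis bij_betw_def inv_into_into)
lemma \<theta>_\<theta>' [simp]: "b \<in> carrier B \<Longrightarrow> \<theta> (\<theta>' b) = b"
  using bij by (metis bij_betw_inv_into_right)
lemma \<theta>'_\<theta> [simp]: "a \<in> carrier A \<Longrightarrow> \<theta>' (\<theta> a) = a"
  using bij by (metis bij_betw_inv_into_left)
lemma \<theta>'_eqI: "a \<in> carrier A \<Longrightarrow> \<theta> a = b \<Longrightarrow> \<theta>' b = a" by auto

lemma \<theta>'_add: "b \<in> carrier B \<Longrightarrow> c \<in> carrier B \<Longrightarrow> \<theta>' (b \<oplus>\<^bsub>B\<^esub> c) = \<theta>' b \<oplus>\<^bsub>A\<^esub> \<theta>' c"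
  by (rule \<theta>'_eqI) (simp_all add: \<theta>'_closed)
lemma \<theta>'_mult: "b \<in> carrier B \<Longrightarrow> c \<in> carrier B \<Longrightarrow> \<theta>' (b \<otimes>\<^bsub>B\<^esub> c) = \<theta>' b \<otimes>\<^bsub>A\<^esub> \<theta>' c"
  by (rule \<theta>'_eqI) (simp_all add: \<theta>'_closed)
lemma \<theta>'_smult: "b \<in> carrier B \<Longrightarrow> \<theta>' (c \<odot>\<^bsub>B\<^esub> b) = c \<odot>\<^bsub>A\<^esub> \<theta>' b"
  by (rule \<theta>'_eqI) (simp_all add: \<theta>'_closed smult_closed \<theta>_smult)

lemma part_image: "\<theta> ` part A n = part B n" using iso by (auto simp: graded_iso_def)
lemma \<theta>_part: "a \<in> part A n \<Longrightarrow> \<theta> a \<in> part B n" using part_image by blast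
lemma \<theta>'_part: "b \<in> part B n \<Longrightarrow> \<theta>' b \<in> part A n"
  using part_image part_carrier(1) by (metis (no_types, lifting) \<theta>'_\<theta> imageE)
lemma \<theta>_int_part: "a \<in> int_part A e \<Longrightarrow> \<theta> a \<in> int_part B e"
  using \<theta>_part by (auto simp: int_part_def split: if_splits)

lemma inverse_iso: "graded_isomorphism B A \<theta>'"
proof
  have "\<theta>' \<in> ring_hom B A"
  proof (rule ring_hom_memI)
    show "\<theta>' \<one>\<^bsub>B\<^esub> = \<one>\<^bsub>A\<^esub>" by (rule \<theta>'_eqI) simp_all
  qed (auto intro: \<theta>'_closed \<theta>'_add \<theta>'_mult)
  moreover have "\<theta>' ` part B n = part A n" for n
    using \<theta>'_part \<theta>_part part_carrier by (force intro!: image_eqI[of _ _ "\<theta> _"])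
  ultimately show "graded_iso B A \<theta>'"
    by (auto simp: graded_iso_def bij_betw_inv_into bij \<theta>'_smult)
qed (fact A B)+

lemma \<theta>'': "a \<in> carrier A \<Longrightarrow> inv_into (carrier B) \<theta>' a = \<theta> a"
  using graded_isomorphism.\<theta>'_eqI[OF inverse_iso] by simp

lemma hom_finsum':
  "f \<in> S \<rightarrow> carrier A \<Longrightarrow> \<theta> (finsum A f S) = finsum B (\<lambda>x. \<theta> (f x)) S"
proof (induction S rule: infinite_finite_induct)
  case (insert x F)
  then have "f x \<in> carrier A" "f \<in> F \<rightarrow> carrier A" by auto
  then have "(\<lambda>x. \<theta> (f x)) \<in> F \<rightarrow> carrier B" by (auto simp: Pi_iff)
  then show ?case using insert \<open>f x \<in> carrier A\<close> \<open>f \<in> F \<rightarrow> carrier A\<close>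
    by (simp add: hom.R.finsum_insert hom.S.finsum_insert hom.R.finsum_closed)
qed auto

abbreviation bt :: "nat \<Rightarrow> ('a list \<Rightarrow> 'a) \<Rightarrow> 'b list \<Rightarrow> 'b" where
  "bt \<equiv> bar_transport A B \<theta>"

lemma bar_args_map: "xs \<in> bar_args B i \<Longrightarrow> map \<theta>' xs \<in> bar_args A i"
  using \<theta>'_closed by (auto simp: bar_args_def)

lemma bt_apply: "xs \<in> bar_args B i \<Longrightarrow> bt i f xs = \<theta> (f (map \<theta>' xs))"
  by (simp add: bar_transport_def)

lemma bt_closed: "f \<in> bar_args A i \<rightarrow> carrier A \<Longrightarrow> bt i f \<in> bar_args B i \<rightarrow>\<^sub>E carrier B"
  using bar_args_map by (auto simp: bar_transport_def Pi_iff)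

lemma bt_inverse:
  assumes "f \<in> bar_args A i \<rightarrow>\<^sub>E carrier A"
  shows "bar_transport B A \<theta>' i (bt i f) = f"
proof (rule PiE_ext[of _ "bar_args A i" "\<lambda>_. carrier A"])
  interpret inv: graded_isomorphism B A \<theta>' by (rule inverse_iso)
  have "f \<in> bar_args A i \<rightarrow> carrier A" using assms by (auto simp: PiE_def)
  show "bar_transport B A \<theta>' i (bt i f) \<in> bar_args A i \<rightarrow>\<^sub>E carrier A"
    using bt_closed[OF \<open>f \<in> bar_args A i \<rightarrow> carrier A\<close>] by (intro inv.bt_closed) auto
  fix xs assume xs: "xs \<in> bar_args A i"
  have ys: "map (inv_into (carrier B) \<theta>') xs \<in> bar_args B i" using inv.bar_args_map[OF xs] .
  have "map \<theta>' (map (inv_into (carrier B) \<theta>') xs) = xs"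
    using xs \<theta>'' by (auto simp: bar_args_def intro!: map_idI)
  moreover have "f xs \<in> carrier A" using assms xs by auto
  ultimately show "bar_transport B A \<theta>' i (bt i f) xs = f xs"
    using xs ys by (simp add: inv.bt_apply bt_apply)
qed (fact assms)

lemma bt_cochains:
  assumes f: "f \<in> bar_cochains A J i e" and J: "J \<subseteq> carrier A"
  shows "bt i f \<in> bar_cochains B (\<theta> ` J) i e"
proof -
  note F = f[unfolded bar_cochains_def mem_Collect_eq]
  have F1: "f \<in> bar_args A i \<rightarrow>\<^sub>E carrier A" by (rule F[THEN conjunct1])
  have F2: "f (xs[p := a \<oplus>\<^bsub>A\<^esub> b]) = f (xs[p := a]) \<oplus>\<^bsub>A\<^esub> f (xs[p := b])"
    if "xs \<in> bar_args A i" "p \<le> i" "a \<in> carrier A" "b \<in> carrier A" for xs p a b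
    by (rule F[THEN conjunct2, THEN conjunct1, rule_format]) (use that in auto)
  have F3: "f (xs[p := c \<odot>\<^bsub>A\<^esub> a]) = c \<odot>\<^bsub>A\<^esub> f (xs[p := a])"
    if "xs \<in> bar_args A i" "p \<le> i" "a \<in> carrier A" for xs p a c
    by (rule F[THEN conjunct2, THEN conjunct2, THEN conjunct1, rule_format]) (use that in auto)
  have F4: "f xs = \<zero>\<^bsub>A\<^esub>" if "xs \<in> bar_args A i" "last xs \<in> J" for xs
    by (rule F[THEN conjunct2, THEN conjunct2, THEN conjunct2, THEN conjunct1, rule_format]) (use that in auto)
  have F5: "f xs \<in> int_part A (int (sum_list ns) + e)"
    if "xs \<in> bar_args A i" "list_all2 (\<lambda>x n. x \<in> part A n) xs ns" for xs ns
    by (rule F[THEN conjunct2, THEN conjunct2, THEN conjunct2, THEN conjunct2, rule_format]) (use that in auto)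
  have upd: "xs[p := b] \<in> bar_args C i"
    if "xs \<in> bar_args C i" "b \<in> carrier C" for xs p b and C :: "('k, 'c, 'q) graded_alg_scheme"
    using that set_update_subset_insert[of xs p b] by (auto simp: bar_args_def)
  have fcl: "f xs \<in> carrier A" if "xs \<in> bar_args A i" for xs using F1 that by auto
  show ?thesis
    unfolding bar_cochains_def mem_Collect_eq
  proof (intro conjI ballI allI impI)
    show "bt i f \<in> bar_args B i \<rightarrow>\<^sub>E carrier B" by (rule bt_closed) (use F1 in auto)
    fix xs assume xs: "xs \<in> bar_args B i"
    note ys = bar_args_map[OF xs]
    {
      fix p a b assume p: "p \<le> i" and a: "a \<in> carrier B" and b: "b \<in> carrier B"
      show "bt i f (xs[p := a \<oplus>\<^bsub>B\<^esub> b]) = bt i f (xs[p := a]) \<oplus>\<^bsub>B\<^esub> bt i f (xs[p := b])"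
        using F2[OF ys p \<theta>'_closed[OF a] \<theta>'_closed[OF b]] upd[OF ys] upd[OF xs] fcl
        by (simp add: bt_apply map_update \<theta>'_add \<theta>'_closed a b)
    next
      fix p a c assume p: "p \<le> i" and a: "a \<in> carrier B"
      show "bt i f (xs[p := c \<odot>\<^bsub>B\<^esub> a]) = c \<odot>\<^bsub>B\<^esub> bt i f (xs[p := a])"
        using F3[OF ys p \<theta>'_closed[OF a]] upd[OF ys] upd[OF xs] fcl
        by (simp add: bt_apply map_update \<theta>'_smult \<theta>'_closed a smult_closed \<theta>_smult)
    next
      assume l: "last xs \<in> \<theta> ` J"
      have "last (map \<theta>' xs) \<in> J"
        using l J xs by (subst last_map) (auto simp: bar_args_def)
      then show "bt i f xs = \<zero>\<^bsub>B\<^esub>" using F4[OF ys] xs by (simp add: bt_apply)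
    next
      fix ns assume "list_all2 (\<lambda>x n. x \<in> part B n) xs ns"
      then have "list_all2 (\<lambda>x n. x \<in> part A n) (map \<theta>' xs) ns"
        by (auto simp: list_all2_map1 \<theta>'_part elim: list_all2_mono)
      then show "bt i f xs \<in> int_part B (int (sum_list ns) + e)"
        using F5[OF ys] xs \<theta>_int_part by (simp add: bt_apply)
    }
  qed
qed

lemma merge_at_args:
  "xs \<in> bar_args B (Suc i) \<Longrightarrow> j \<le> i \<Longrightarrow> merge_at B j xs \<in> bar_args B i \<and> map \<theta>' (merge_at B j xs) = merge_at A j (map \<theta>' xs)"
proof -
  assume xs: "xs \<in> bar_args B (Suc i)" and j: "j \<le> i"
  have n: "xs ! j \<in> carrier B" "xs ! Suc j \<in> carrier B" using xs j by (auto simp: bar_args_def)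
  then show ?thesis
    using xs j by (auto simp: bar_args_def merge_at_def take_map drop_map \<theta>'_mult dest: in_set_takeD in_set_dropD)
qed

lemma merge_at_args_A: "xs \<in> bar_args A (Suc i) \<Longrightarrow> j \<le> i \<Longrightarrow> merge_at A j xs \<in> bar_args A i"
proof -
  assume xs: "xs \<in> bar_args A (Suc i)" and j: "j \<le> i"
  have n: "xs ! j \<in> carrier A" "xs ! Suc j \<in> carrier A" using xs j by (auto simp: bar_args_def)
  then show ?thesis
    using xs j by (auto simp: bar_args_def merge_at_def dest: in_set_takeD in_set_dropD)
qed

lemma bt_bar_diff:
  assumes f: "f \<in> bar_args A i \<rightarrow> carrier A"
  shows "bar_diff B i (bt i f) = bt (Suc i) (bar_diff A i f)"
proof
  fix xs
  show "bar_diff B i (bt i f) xs = bt (Suc i) (bar_diff A i f) xs"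
  proof (cases "xs \<in> bar_args B (Suc i)")
    case True
    define ys where "ys = map \<theta>' xs"
    have ys: "ys \<in> bar_args A (Suc i)" unfolding ys_def using True by (rule bar_args_map)
    have tl: "tl xs \<in> bar_args B i" "tl ys \<in> bar_args A i" "hd xs \<in> carrier B" "hd ys \<in> carrier A"
      using True ys by (auto simp: bar_args_def length_Suc_conv)
    have hd: "hd xs = \<theta> (hd ys)" "map \<theta>' (tl xs) = tl ys"
      using True by (auto simp: ys_def bar_args_def length_Suc_conv)
    have fm: "f (merge_at A j ys) \<in> carrier A" if "j \<le> i" for j
      using f merge_at_args_A[OF ys that] by auto
    have "(\<Oplus>\<^bsub>B\<^esub>j\<in>{..i}. (- 1) ^ Suc j \<odot>\<^bsub>B\<^esub> bt i f (merge_at B j xs))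
        = (\<Oplus>\<^bsub>B\<^esub>j\<in>{..i}. \<theta> ((- 1) ^ Suc j \<odot>\<^bsub>A\<^esub> f (merge_at A j ys)))"
      using merge_at_args[OF True] fm
      by (intro hom.S.finsum_cong') (auto simp: bt_apply \<theta>_smult ys_def smult_closed)
    also have "\<dots> = \<theta> (\<Oplus>\<^bsub>A\<^esub>j\<in>{..i}. (- 1) ^ Suc j \<odot>\<^bsub>A\<^esub> f (merge_at A j ys))"
      using fm by (intro hom_finsum'[symmetric]) (auto simp: smult_closed)
    finally have s: "(\<Oplus>\<^bsub>B\<^esub>j\<in>{..i}. (- 1) ^ Suc j \<odot>\<^bsub>B\<^esub> bt i f (merge_at B j xs))
        = \<theta> (\<Oplus>\<^bsub>A\<^esub>j\<in>{..i}. (- 1) ^ Suc j \<odot>\<^bsub>A\<^esub> f (merge_at A j ys))" .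
    have "(\<Oplus>\<^bsub>A\<^esub>j\<in>{..i}. (- 1) ^ Suc j \<odot>\<^bsub>A\<^esub> f (merge_at A j ys)) \<in> carrier A"
      using fm by (intro hom.R.finsum_closed) (auto simp: smult_closed)
    moreover have "f (tl ys) \<in> carrier A" using f tl by auto
    ultimately show ?thesis
      using True ys tl by (simp add: bar_diff_def bt_apply s hd ys_def[symmetric] del: power_Suc)
  qed (simp add: bar_diff_def bar_transport_def)
qed

lemma bt_bar_zero: "bt i (bar_zero A i) = bar_zero B i"
  using bar_args_map by (auto simp: bar_transport_def bar_zero_def fun_eq_iff restrict_def)

lemma cochain_fun: "f \<in> bar_cochains A J i e \<Longrightarrow> f \<in> bar_args A i \<rightarrow>\<^sub>E carrier A"
  by (simp add: bar_cochains_def)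

lemma cochain_fun': "f \<in> bar_cochains A J i e \<Longrightarrow> f \<in> bar_args A i \<rightarrow> carrier A"
  using cochain_fun[of f J i e] by (simp add: PiE_def)

lemma bt_cocycles:
  "f \<in> bar_cocycles A J i e \<Longrightarrow> J \<subseteq> carrier A \<Longrightarrow> bt i f \<in> bar_cocycles B (\<theta> ` J) i e"
  using bt_cochains[of f J i e] bt_bar_diff[OF cochain_fun', of f J i e] bt_bar_zero[of "Suc i"]
  by (auto simp: bar_cocycles_def)

lemma bt_coboundaries:
  "f \<in> bar_coboundaries A J i e \<Longrightarrow> J \<subseteq> carrier A \<Longrightarrow> bt i f \<in> bar_coboundaries B (\<theta> ` J) i e"
proof (cases i)
  case (Suc j)
  assume J: "J \<subseteq> carrier A" and "f \<in> bar_coboundaries A J i e"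
  then obtain g where "g \<in> bar_cochains A J j e" "f = bar_diff A j g"
    by (auto simp: bar_coboundaries_def Suc)
  then show ?thesis
    using bt_cochains[OF _ J, of g j e] bt_bar_diff[OF cochain_fun', of g J j e]
    by (simp add: bar_coboundaries_def Suc) (metis image_eqI)
qed (auto simp: bar_coboundaries_def bt_bar_zero)

lemma tail_ideal_carrier: "tail_ideal A n \<subseteq> carrier A"
  using part_carrier by (force simp: tail_ideal_def intro: hom.R.finsum_closed)

lemma tail_ideal_image_subset: "\<theta> ` tail_ideal A n \<subseteq> tail_ideal B n"
proof safe
  fix a assume "a \<in> tail_ideal A n"
  then obtain N s where s: "finite N" "N \<subseteq> {n..}" "\<forall>m\<in>N. s m \<in> part A m" "a = finsum A s N"
    by (auto simp: tail_ideal_def)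
  then have "\<theta> a = finsum B (\<lambda>m. \<theta> (s m)) N"
    using part_carrier by (auto intro!: hom_finsum')
  then show "\<theta> a \<in> tail_ideal B n"
    unfolding tail_ideal_def using s \<theta>_part by (auto intro!: exI[of _ N] exI[of _ "\<lambda>m. \<theta> (s m)"])
qed

lemma tail_ideal_image: "\<theta> ` tail_ideal A n = tail_ideal B n"
proof
  interpret inv: graded_isomorphism B A \<theta>' by (rule inverse_iso)
  show "tail_ideal B n \<subseteq> \<theta> ` tail_ideal A n"
    using inv.tail_ideal_image_subset[of n] inv.tail_ideal_carrier[of n] by (force intro!: image_eqI[of _ _ "\<theta>' _"])
qed (rule tail_ideal_image_subset)

lemma bt_lc_cocycles: "f \<in> lc_cocycles A i e \<Longrightarrow> bt i f \<in> lc_cocycles B i e"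
  unfolding lc_cocycles_def using bt_cocycles[OF _ tail_ideal_carrier] tail_ideal_image by fastforce
lemma bt_lc_coboundaries: "f \<in> lc_coboundaries A i e \<Longrightarrow> bt i f \<in> lc_coboundaries B i e"
  unfolding lc_coboundaries_def using bt_coboundaries[OF _ tail_ideal_carrier] tail_ideal_image by fastforce

lemma lc_cocycle_fun: "f \<in> lc_cocycles A i e \<Longrightarrow> f \<in> bar_args A i \<rightarrow>\<^sub>E carrier A"
  unfolding lc_cocycles_def bar_cocycles_def using cochain_fun by blast
lemma lc_cocycle_closed: "f \<in> lc_cocycles A i e \<Longrightarrow> xs \<in> bar_args A i \<Longrightarrow> f xs \<in> carrier A"
  using lc_cocycle_fun by (auto dest: PiE_mem)

lemma bt_lc_cocycles_iff: "bt i ` lc_cocycles A i e = lc_cocycles B i e"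
proof
  interpret inv: graded_isomorphism B A \<theta>' by (rule inverse_iso)
  show "lc_cocycles B i e \<subseteq> bt i ` lc_cocycles A i e"
  proof
    fix f assume f: "f \<in> lc_cocycles B i e"
    have "bt i (bar_transport B A \<theta>' i f) = f"
    proof -
      have "bar_transport A B (inv_into (carrier B) \<theta>') i (bar_transport B A \<theta>' i f) = f"
        by (rule inv.bt_inverse[OF inv.lc_cocycle_fun[OF f]])
      moreover have "bar_transport A B (inv_into (carrier B) \<theta>') i (bar_transport B A \<theta>' i f)
          = bt i (bar_transport B A \<theta>' i f)"
      proof
        fix xs
        have "inv_into (carrier A) (inv_into (carrier B) \<theta>') x = \<theta>' x" if "x \<in> carrier B" for x
          using inv.\<theta>'' that by blast
        then have m: "map (inv_into (carrier A) (inv_into (carrier B) \<theta>')) xs = map \<theta>' xs" if "xs \<in> bar_args B i"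
          using that by (auto simp: bar_args_def)
        show "bar_transport A B (inv_into (carrier B) \<theta>') i (bar_transport B A \<theta>' i f) xs = bt i (bar_transport B A \<theta>' i f) xs"
        proof (cases "xs \<in> bar_args B i")
          case True
          have "bar_transport B A \<theta>' i f (map \<theta>' xs) \<in> carrier A"
            using inv.bt_lc_cocycles[OF f] lc_cocycle_closed bar_args_map[OF True] by blast
          then show ?thesis
            unfolding bar_transport_def[of A B] restrict_apply'[OF True] m[OF True] by (rule \<theta>'')
        qed (simp add: bar_transport_def[of A B])
      qed
      ultimately show ?thesis by simp
    qed
    then show "f \<in> bt i ` lc_cocycles A i e" using inv.bt_lc_cocycles[OF f] by (metis image_eqI)
  qed
qed (use bt_lc_cocycles in blast)

lemma bt_lc_coboundaries_iff:
  assumes f: "f \<in> lc_cocycles A i e"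
  shows "bt i f \<in> lc_coboundaries B i e \<longleftrightarrow> f \<in> lc_coboundaries A i e"
proof
  interpret inv: graded_isomorphism B A \<theta>' by (rule inverse_iso)
  assume "bt i f \<in> lc_coboundaries B i e"
  from inv.bt_lc_coboundaries[OF this] show "f \<in> lc_coboundaries A i e"
    by (simp add: bt_inverse[OF lc_cocycle_fun[OF f]])
qed (rule bt_lc_coboundaries)

lemma graded_left_ideal_image:
  assumes J: "graded_left_ideal A J"
  shows "graded_left_ideal B (\<theta> ` J)"
proof -
  have J1: "additive_subgroup J A" and J2: "\<forall>a\<in>carrier A. \<forall>b\<in>J. a \<otimes>\<^bsub>A\<^esub> b \<in> J"
    and J3: "\<forall>b\<in>J. \<exists>N s. finite N \<and> (\<forall>n\<in>N. s n \<in> J \<inter> part A n) \<and> b = (\<Oplus>\<^bsub>A\<^esub>n\<in>N. s n)"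
    using J by (auto simp: graded_left_ideal_def)
  interpret J: additive_subgroup J A by (rule J1)
  have Jc: "b \<in> carrier A" if "b \<in> J" for b using that J.a_subset by blast
  have "additive_subgroup (\<theta> ` J) B"
  proof (rule additive_subgroup.intro, rule hom.S.add.subgroupI)
    show "\<theta> ` J \<subseteq> carrier B" using Jc by auto
    show "\<theta> ` J \<noteq> {}" using J.zero_closed by blast
    fix a b assume "a \<in> \<theta> ` J" "b \<in> \<theta> ` J"
    then obtain a' b' where ab: "a' \<in> J" "b' \<in> J" "a = \<theta> a'" "b = \<theta> b'" by auto
    then show "a \<oplus>\<^bsub>B\<^esub> b \<in> \<theta> ` J" using Jc by (auto intro!: image_eqI[of _ _ "a' \<oplus>\<^bsub>A\<^esub> b'"])
    have "a = \<theta> a'" "a' \<in> J" using ab by auto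
    then show "\<ominus>\<^bsub>B\<^esub> a \<in> \<theta> ` J" using Jc J.a_inv_closed by (auto intro!: image_eqI[of _ _ "\<ominus>\<^bsub>A\<^esub> a'"])
  qed
  moreover have "a \<otimes>\<^bsub>B\<^esub> \<theta> b \<in> \<theta> ` J" if "a \<in> carrier B" "b \<in> J" for a b
    using J2 that Jc \<theta>'_closed by (auto intro!: image_eqI[of _ _ "\<theta>' a \<otimes>\<^bsub>A\<^esub> b"])
  moreover have "\<exists>N s. finite N \<and> (\<forall>n\<in>N. s n \<in> \<theta> ` J \<inter> part B n) \<and> \<theta> b = (\<Oplus>\<^bsub>B\<^esub>n\<in>N. s n)"
    if "b \<in> J" for b
  proof -
    obtain N s where s: "finite N" "\<forall>n\<in>N. s n \<in> J \<inter> part A n" "b = (\<Oplus>\<^bsub>A\<^esub>n\<in>N. s n)"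
      using J3[rule_format, OF \<open>b \<in> J\<close>] by metis
    have "s \<in> N \<rightarrow> carrier A" using s(2) Jc by auto
    then have "\<theta> b = (\<Oplus>\<^bsub>B\<^esub>n\<in>N. \<theta> (s n))" unfolding s(3) by (rule hom_finsum')
    moreover have "\<forall>n\<in>N. \<theta> (s n) \<in> \<theta> ` J \<inter> part B n" using s(2) \<theta>_part by blast
    ultimately show ?thesis using s(1) by (intro exI[of _ N] exI[of _ "\<lambda>n. \<theta> (s n)"] conjI)
  qed
  ultimately show ?thesis unfolding graded_left_ideal_def by blast
qed

lemma vanishing_transfer:
  assumes "\<forall>J. graded_left_ideal A J \<longrightarrow> (\<forall>i>d. \<forall>e. bar_cocycles A J i e \<subseteq> bar_coboundaries A J i e)"
  shows "\<forall>J. graded_left_ideal B J \<longrightarrow> (\<forall>i>d. \<forall>e. bar_cocycles B J i e \<subseteq> bar_coboundaries B J i e)"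
proof (intro allI impI subsetI)
  interpret inv: graded_isomorphism B A \<theta>' by (rule inverse_iso)
  fix J i e f
  assume J: "graded_left_ideal B J" and i: "d < i" and f: "f \<in> bar_cocycles B J i e"
  have Jc: "J \<subseteq> carrier B"
    using J additive_subgroup.a_subset by (auto simp: graded_left_ideal_def)
  have fe: "f \<in> bar_args B i \<rightarrow>\<^sub>E carrier B" using f inv.cochain_fun[of f J i e] by (simp add: bar_cocycles_def)
  have "bar_transport B A \<theta>' i f \<in> bar_cocycles A (\<theta>' ` J) i e" by (rule inv.bt_cocycles[OF f Jc])
  then have g: "bar_transport B A \<theta>' i f \<in> bar_coboundaries A (\<theta>' ` J) i e"
    using assms inv.graded_left_ideal_image[OF J] i by blast
  have "\<theta>' ` J \<subseteq> carrier A" using Jc \<theta>'_closed by auto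
  then have "bt i (bar_transport B A \<theta>' i f) \<in> bar_coboundaries B (\<theta> ` \<theta>' ` J) i e"
    using bt_coboundaries g by blast
  moreover have "\<theta> ` \<theta>' ` J = J" using Jc by (force simp: image_image)
  moreover have "bt i (bar_transport B A \<theta>' i f) = f"
  proof (rule PiE_ext[OF _ fe])
    have "bar_transport B A \<theta>' i f \<in> bar_args A i \<rightarrow> carrier A"
      using inv.bt_closed[of f i] fe by (auto dest: PiE_mem)
    then show "bt i (bar_transport B A \<theta>' i f) \<in> bar_args B i \<rightarrow>\<^sub>E carrier B" by (rule bt_closed)
    fix xs assume xs: "xs \<in> bar_args B i"
    then have "map (inv_into (carrier B) \<theta>' \<circ> \<theta>') xs = xs"
      using \<theta>'' \<theta>'_closed by (auto simp: bar_args_def intro!: map_idI)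
    then show "bt i (bar_transport B A \<theta>' i f) xs = f xs"
      using fe xs by (simp add: bt_apply inv.bt_apply bar_args_map) (metis PiE_mem \<theta>_\<theta>')
  qed
  ultimately show "f \<in> bar_coboundaries B J i e" by simp
qed

text \<open>
  The vanishing statements for \<open>A\<close> and \<open>B\<close> are equivalent for each bound separately, so their least bounds agree
  whether or not such bounds exist.
\<close>
lemma inj_dim_eq: "inj_dim A = inj_dim B"
proof -
  interpret inv: graded_isomorphism B A \<theta>' by (rule inverse_iso)
  show ?thesis
    unfolding inj_dim_def
    by (rule arg_cong[where f = Least], rule ext, rule iffI) (erule vanishing_transfer inv.vanishing_transfer)+
qed

lemma bt_bar_add:
  assumes "f \<in> bar_args A i \<rightarrow> carrier A" "h \<in> bar_args A i \<rightarrow> carrier A"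
  shows "bt i (bar_add A i f h) = bar_add B i (bt i f) (bt i h)"
proof
  fix xs show "bt i (bar_add A i f h) xs = bar_add B i (bt i f) (bt i h) xs"
    using assms bar_args_map[of xs i] by (auto simp: bar_transport_def bar_add_def Pi_iff)
qed

lemma bt_bar_smult:
  assumes "f \<in> bar_args A i \<rightarrow> carrier A"
  shows "bt i (bar_smult A i c f) = bar_smult B i c (bt i f)"
proof
  fix xs show "bt i (bar_smult A i c f) xs = bar_smult B i c (bt i f) xs"
    using assms bar_args_map[of xs i] by (auto simp: bar_transport_def bar_smult_def Pi_iff \<theta>_smult)
qed

lemma bt_bar_act:
  assumes b: "b \<in> carrier A"
  shows "bt i (bar_act A i b f) = bar_act B i (\<theta> b) (bt i f)"
proof
  fix xs
  show "bt i (bar_act A i b f) xs = bar_act B i (\<theta> b) (bt i f) xs"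
  proof (cases "xs \<in> bar_args B i")
    case True
    then have ne: "xs \<noteq> []" by (auto simp: bar_args_def)
    then have l: "last xs \<in> carrier B" using True last_in_set by (auto simp: bar_args_def)
    have "butlast xs @ [last xs \<otimes>\<^bsub>B\<^esub> \<theta> b] \<in> bar_args B i"
      using True l b by (auto simp: bar_args_def dest: in_set_butlastD)
    moreover have "map \<theta>' (butlast xs @ [last xs \<otimes>\<^bsub>B\<^esub> \<theta> b]) = butlast (map \<theta>' xs) @ [last (map \<theta>' xs) \<otimes>\<^bsub>A\<^esub> b]"
      using ne l b by (simp add: map_butlast last_map \<theta>'_mult)
    ultimately show ?thesis using True bar_args_map[OF True] by (simp add: bt_apply bar_act_def)
  qed (simp add: bar_transport_def bar_act_def)
qed

lemma dual_part_transfer: "\<psi> \<in> dual_part B j \<Longrightarrow> (\<lambda>a\<in>carrier A. \<psi> (\<theta> a)) \<in> dual_part A j"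
  unfolding dual_part_def using part_carrier \<theta>_part by (auto simp: smult_closed \<theta>_smult)

definition pull_dual :: "(int \<Rightarrow> ('b list \<Rightarrow> 'b) \<Rightarrow> 'b \<Rightarrow> 'k) \<Rightarrow> nat \<Rightarrow> int \<Rightarrow> ('a list \<Rightarrow> 'a) \<Rightarrow> 'a \<Rightarrow> 'k" where
  "pull_dual \<Phi> d e f = (\<lambda>a\<in>carrier A. \<Phi> e (bt d f) (\<theta> a))"

lemma lc_dual_iso_pull:
  assumes \<Phi>: "lc_dual_iso B d l \<Phi>"
  shows "lc_dual_iso A d l (pull_dual \<Phi> d)"
proof -
  interpret inv: graded_isomorphism B A \<theta>' by (rule inverse_iso)
  note P = \<Phi>[unfolded lc_dual_iso_def]
  have P1: "\<Phi> e ` lc_cocycles B d e = dual_part B (e + l)" for e by (rule P[THEN conjunct1, rule_format])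
  have P2: "\<Phi> e (bar_add B d f h) a = \<Phi> e f a + \<Phi> e h a"
    if "f \<in> lc_cocycles B d e" "h \<in> lc_cocycles B d e" "a \<in> carrier B" for e f h a
    by (rule P[THEN conjunct2, THEN conjunct1, rule_format]) (use that in auto)
  have P3: "\<Phi> e (bar_smult B d c f) a = c * \<Phi> e f a" if "f \<in> lc_cocycles B d e" "a \<in> carrier B" for e c f a
    by (rule P[THEN conjunct2, THEN conjunct2, THEN conjunct1, rule_format]) (use that in auto)
  have P4: "(\<forall>a\<in>carrier B. \<Phi> e f a = 0) \<longleftrightarrow> f \<in> lc_coboundaries B d e" if "f \<in> lc_cocycles B d e" for e f
    by (rule P[THEN conjunct2, THEN conjunct2, THEN conjunct2, THEN conjunct1, rule_format]) (use that in auto)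
  have P5: "\<Phi> (e + int n) (bar_act B d b f) a = \<Phi> e f (a \<otimes>\<^bsub>B\<^esub> b)"
    if "f \<in> lc_cocycles B d e" "b \<in> part B n" "a \<in> carrier B" for e n f b a
    by (rule P[THEN conjunct2, THEN conjunct2, THEN conjunct2, THEN conjunct2, rule_format]) (use that in auto)
  have fn: "f \<in> bar_args A d \<rightarrow> carrier A" if "f \<in> lc_cocycles A d e" for f e
    using lc_cocycle_closed[OF that] by auto
  show ?thesis
    unfolding lc_dual_iso_def
  proof (intro conjI allI ballI)
    fix e
    show "pull_dual \<Phi> d e ` lc_cocycles A d e = dual_part A (e + l)"
    proof safe
      fix f assume "f \<in> lc_cocycles A d e"
      then have "\<Phi> e (bt d f) \<in> dual_part B (e + l)" using P1 bt_lc_cocycles by blast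
      then show "pull_dual \<Phi> d e f \<in> dual_part A (e + l)" unfolding pull_dual_def by (rule dual_part_transfer)
    next
      fix \<psi> assume \<psi>: "\<psi> \<in> dual_part A (e + l)"
      then have "(\<lambda>b\<in>carrier B. \<psi> (\<theta>' b)) \<in> dual_part B (e + l)" by (rule inv.dual_part_transfer)
      then obtain g where g: "g \<in> lc_cocycles B d e" "\<Phi> e g = (\<lambda>b\<in>carrier B. \<psi> (\<theta>' b))" using P1 by (metis imageE)
      then obtain f where f: "f \<in> lc_cocycles A d e" "g = bt d f" using bt_lc_cocycles_iff by blast
      have "pull_dual \<Phi> d e f = \<psi>"
      proof
        fix a show "pull_dual \<Phi> d e f a = \<psi> a"
          using \<psi> g f by (cases "a \<in> carrier A") (auto simp: pull_dual_def dual_part_def extensional_def)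
      qed
      then show "\<psi> \<in> pull_dual \<Phi> d e ` lc_cocycles A d e" using f by blast
    qed
  next
    fix e f h a assume "f \<in> lc_cocycles A d e" "h \<in> lc_cocycles A d e" "a \<in> carrier A"
    then show "pull_dual \<Phi> d e (bar_add A d f h) a = pull_dual \<Phi> d e f a + pull_dual \<Phi> d e h a"
      using P2 bt_lc_cocycles fn by (simp add: pull_dual_def bt_bar_add)
  next
    fix e c f a assume "f \<in> lc_cocycles A d e" "a \<in> carrier A"
    then show "pull_dual \<Phi> d e (bar_smult A d c f) a = c * pull_dual \<Phi> d e f a"
      using P3 bt_lc_cocycles fn by (simp add: pull_dual_def bt_bar_smult)
  next
    fix e f assume f: "f \<in> lc_cocycles A d e"
    have "(\<forall>a\<in>carrier A. pull_dual \<Phi> d e f a = 0) \<longleftrightarrow> (\<forall>b\<in>carrier B. \<Phi> e (bt d f) b = 0)"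
      unfolding bij_betw_imp_surj_on[OF bij, symmetric] by (simp add: pull_dual_def)
    then show "(\<forall>a\<in>carrier A. pull_dual \<Phi> d e f a = 0) \<longleftrightarrow> f \<in> lc_coboundaries A d e"
      using P4 bt_lc_cocycles[OF f] bt_lc_coboundaries_iff[OF f] by blast
  next
    fix e n f b a assume "f \<in> lc_cocycles A d e" "b \<in> part A n" "a \<in> carrier A"
    then show "pull_dual \<Phi> d (e + int n) (bar_act A d b f) a = pull_dual \<Phi> d e f (a \<otimes>\<^bsub>A\<^esub> b)"
      using P5[OF bt_lc_cocycles \<theta>_part] part_carrier by (simp add: pull_dual_def bt_bar_act)
  qed
qed

lemma bt_push:
  assumes g: "bij_betw g (carrier A) (carrier A)" and g2: "bij_betw g2 (carrier B) (carrier B)"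
    and rel: "\<And>a. a \<in> carrier A \<Longrightarrow> \<theta> (g a) = g2 (\<theta> a)"
    and f: "f \<in> bar_args A i \<rightarrow> carrier A"
  shows "bt i (bar_push A i g f) = bar_push B i g2 (bt i f)"
    and "a \<in> carrier A \<Longrightarrow> inv_into (carrier B) g2 (\<theta> a) = \<theta> (inv_into (carrier A) g a)"
proof -
  have ginv: "inv_into (carrier A) g a \<in> carrier A" "g (inv_into (carrier A) g a) = a" if "a \<in> carrier A" for a
    using g that by (auto simp: bij_betw_inv_into_right) (metis bij_betw_def inv_into_into)
  have inv: "inv_into (carrier B) g2 (\<theta> a) = \<theta> (inv_into (carrier A) g a)" if a: "a \<in> carrier A" for a
  proof -
    have "\<theta> a = g2 (\<theta> (inv_into (carrier A) g a))" using rel[OF ginv(1)[OF a]] ginv(2)[OF a] by simp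
    then show ?thesis using g2 ginv(1)[OF a] by (simp add: bij_betw_inv_into_left)
  qed
  then show "a \<in> carrier A \<Longrightarrow> inv_into (carrier B) g2 (\<theta> a) = \<theta> (inv_into (carrier A) g a)" .
  show "bt i (bar_push A i g f) = bar_push B i g2 (bt i f)"
  proof
    fix xs
    show "bt i (bar_push A i g f) xs = bar_push B i g2 (bt i f) xs"
    proof (cases "xs \<in> bar_args B i")
      case True
      have c: "set (map \<theta>' xs) \<subseteq> carrier A" using bar_args_map[OF True] by (auto simp: bar_args_def)
      have g2i: "map (inv_into (carrier B) g2) xs = map \<theta> (map (inv_into (carrier A) g) (map \<theta>' xs))"
      proof -
        have "inv_into (carrier B) g2 x = \<theta> (inv_into (carrier A) g (\<theta>' x))" if "x \<in> set xs" for x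
          using inv[of "\<theta>' x"] that True by (auto simp: bar_args_def \<theta>'_closed subset_iff)
        then show ?thesis by simp
      qed
      have gi: "map (inv_into (carrier A) g) (map \<theta>' xs) \<in> bar_args A i"
        using c ginv(1) True by (auto simp: bar_args_def)
      then have m: "map \<theta>' (map (inv_into (carrier B) g2) xs) = map (inv_into (carrier A) g) (map \<theta>' xs)"
        unfolding g2i by (auto simp: bar_args_def intro!: map_idI)
      have "map (inv_into (carrier B) g2) xs \<in> bar_args B i"
        unfolding g2i using gi by (auto simp: bar_args_def)
      moreover have "f (map (inv_into (carrier A) g) (map \<theta>' xs)) \<in> carrier A" using f gi by auto
      ultimately show ?thesis
        using True bar_args_map[OF True] m rel by (simp add: bar_push_def bt_apply del: map_map)
    qed (simp add: bar_transport_def bar_push_def)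
  qed
qed

lemma hdet_witness_pull:
  assumes g: "bij_betw g (carrier A) (carrier A)" and g2: "bij_betw g2 (carrier B) (carrier B)"
    and rel: "\<And>a. a \<in> carrier A \<Longrightarrow> \<theta> (g a) = g2 (\<theta> a)"
    and \<Phi>: "lc_dual_iso B d l \<Phi>"
    and push: "\<forall>e. \<forall>f\<in>lc_cocycles B d e. \<forall>a\<in>carrier B. \<Phi> e (bar_push B d g2 f) a = c * \<Phi> e f (inv_into (carrier B) g2 a)"
  shows "\<exists>\<Psi>. lc_dual_iso A d l \<Psi> \<and> (\<forall>e. \<forall>f\<in>lc_cocycles A d e. \<forall>a\<in>carrier A.
     \<Psi> e (bar_push A d g f) a = c * \<Psi> e f (inv_into (carrier A) g a))"
proof (intro exI conjI allI ballI)
  show "lc_dual_iso A d l (pull_dual \<Phi> d)" by (rule lc_dual_iso_pull[OF \<Phi>])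
  fix e f a assume f: "f \<in> lc_cocycles A d e" and a: "a \<in> carrier A"
  have fn: "f \<in> bar_args A d \<rightarrow> carrier A" using lc_cocycle_closed[OF f] by auto
  have "inv_into (carrier A) g a \<in> carrier A" using g a by (metis bij_betw_def inv_into_into)
  then show "pull_dual \<Phi> d e (bar_push A d g f) a = c * pull_dual \<Phi> d e f (inv_into (carrier A) g a)"
    using bt_push[OF g g2 rel fn] push bt_lc_cocycles[OF f] a by (simp add: pull_dual_def)
qed

text \<open>
  The homological determinant is defined by the existence of a duality isomorphism, and such an isomorphism can be
  pulled back along \<open>\<theta>\<close> in both directions.
\<close>
lemma hdet_transfer:
  assumes g: "bij_betw g (carrier A) (carrier A)" and g2: "bij_betw g2 (carrier B) (carrier B)"
    and rel: "\<And>a. a \<in> carrier A \<Longrightarrow> \<theta> (g a) = g2 (\<theta> a)"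
  shows "hdet A g = hdet B g2"
proof -
  interpret inv: graded_isomorphism B A \<theta>' by (rule inverse_iso)
  have rel': "\<theta>' (g2 b) = g (\<theta>' b)" if "b \<in> carrier B" for b
    using rel[OF \<theta>'_closed[OF that]] that g \<theta>'_closed[OF that] by (metis \<theta>'_\<theta> \<theta>_\<theta>' bij_betwE)
  have "(\<exists>c l \<Phi>. c \<noteq> 0 \<and> lc_dual_iso A (inj_dim A) l \<Phi> \<and>
     (\<forall>e. \<forall>f\<in>lc_cocycles A (inj_dim A) e. \<forall>a\<in>carrier A.
        \<Phi> e (bar_push A (inj_dim A) g f) a = c * \<Phi> e f (inv_into (carrier A) g a)) \<and> h = inverse c)
    \<longleftrightarrow> (\<exists>c l \<Phi>. c \<noteq> 0 \<and> lc_dual_iso B (inj_dim B) l \<Phi> \<and>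
     (\<forall>e. \<forall>f\<in>lc_cocycles B (inj_dim B) e. \<forall>a\<in>carrier B.
        \<Phi> e (bar_push B (inj_dim B) g2 f) a = c * \<Phi> e f (inv_into (carrier B) g2 a)) \<and> h = inverse c)"
    (is "?P h \<longleftrightarrow> ?Q h") for h
  proof
    assume "?P h"
    then obtain c l \<Phi> where "c \<noteq> 0" "h = inverse c" and 1: "lc_dual_iso A (inj_dim A) l \<Phi>"
      and 2: "\<forall>e. \<forall>f\<in>lc_cocycles A (inj_dim A) e. \<forall>a\<in>carrier A.
        \<Phi> e (bar_push A (inj_dim A) g f) a = c * \<Phi> e f (inv_into (carrier A) g a)" by (elim exE conjE)
    with inv.hdet_witness_pull[OF g2 g rel' 1 2] show "?Q h" unfolding inj_dim_eq by blast
  next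
    assume "?Q h"
    then obtain c l \<Phi> where "c \<noteq> 0" "h = inverse c" and 1: "lc_dual_iso B (inj_dim B) l \<Phi>"
      and 2: "\<forall>e. \<forall>f\<in>lc_cocycles B (inj_dim B) e. \<forall>a\<in>carrier B.
        \<Phi> e (bar_push B (inj_dim B) g2 f) a = c * \<Phi> e f (inv_into (carrier B) g2 a)" by (elim exE conjE)
    with hdet_witness_pull[OF g g2 rel 1 2] show "?P h" unfolding inj_dim_eq by blast
  qed
  then show ?thesis unfolding hdet_def by (simp only:)
qed

end

section \<open>Local duality for the cone\<close>

text \<open>
  For \<open>c : A/J \<rightarrow> P\<close> the sum of the coefficients of \<open>x\<^sup>i y\<^sup>j\<close> in \<open>c(x\<^sup>i y\<^sup>j m)\<close>. It kills both linearity defects by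
  telescoping as soon as \<open>J\<close> contains \<open>A\<^sub>\<ge>\<^sub>N\<close>, and on a constant-valued \<open>c\<close> it returns \<open>c(m)\<close>.
\<close>
definition partial_residue :: "nat \<Rightarrow> 'k::comm_ring_1 cochain \<Rightarrow> 'k cone \<Rightarrow> 'k" where
  "partial_residue N c m = (\<Sum>i<N. \<Sum>j<N. cf (c [CX ^ i * CY ^ j * m]) i j)"

text \<open>
  Any bound beyond which \<open>c\<close> vanishes gives the same sum, see \<open>residue_eq\<close>.
\<close>
definition residue :: "'k::comm_ring_1 cochain \<Rightarrow> 'k cone \<Rightarrow> 'k" where
  "residue c = partial_residue (SOME n. vanishes_on (Ctail n) c) c"

lemma vanishes_powers:
  "vanishes_on (Ctail n) c \<Longrightarrow> n \<le> 2 * (i + j) \<Longrightarrow> c [CX ^ i * CY ^ j * m] = 0"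
  using Ctail_powers[of m 0 i j] Ctail_mono[of n "2 * (i + j)"] by (auto simp: vanishes_on_def)

lemma partial_residue_stable:
  assumes c: "vanishes_on (Ctail n) c" and N: "n \<le> N"
  shows "partial_residue N c m = partial_residue n c m"
proof -
  have eq: "partial_residue N c m = (\<Sum>(i, j)\<in>{..<N} \<times> {..<N}. cf (c [CX ^ i * CY ^ j * m]) i j)" for N
    by (simp add: partial_residue_def sum.cartesian_product)
  have z: "cf (c [CX ^ i * CY ^ j * m]) i j = 0" if "\<not> (i < n \<and> j < n)" for i j
    using vanishes_powers[OF c, of i j m] that by auto
  show ?thesis
    unfolding eq by (rule sum.mono_neutral_right) (use N z in fastforce)+
qed

lemma residue_eq: "vanishes_on (Ctail n) c \<Longrightarrow> n \<le> N \<Longrightarrow> residue c m = partial_residue N c m"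
proof -
  assume c: "vanishes_on (Ctail n) c" and N: "n \<le> N"
  have s: "vanishes_on (Ctail (SOME n. vanishes_on (Ctail n) c)) c" using c by (rule someI)
  show ?thesis
    unfolding residue_def
    using partial_residue_stable[OF c, of "max n (SOME n. vanishes_on (Ctail n) c)"]
      partial_residue_stable[OF s, of "max n (SOME n. vanishes_on (Ctail n) c)"] partial_residue_stable[OF c N] by simp
qed

lemma partial_residue_YY:
  assumes \<alpha>: "vanishes_on (Ctail n) \<alpha>" and N: "n \<le> N"
  shows "partial_residue N (YY \<alpha>) m = 0"
proof -
  have "(\<Sum>j<N. cf (YY \<alpha> [CX ^ i * CY ^ j * m]) i j) = 0" for i
  proof -
    define h where "h j = (case j of 0 \<Rightarrow> 0 | Suc j' \<Rightarrow> cf (\<alpha> [CX ^ i * CY ^ j * m]) i j')" for j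
    have "cf (YY \<alpha> [CX ^ i * CY ^ j * m]) i j = h j - h (Suc j)" for j
      by (simp add: cf_PY h_def mult_ac split: nat.split)
    then have "(\<Sum>j<N. cf (YY \<alpha> [CX ^ i * CY ^ j * m]) i j) = h 0 - h N"
      by (simp add: sum_lessThan_telescope')
    also have "\<dots> = 0" using vanishes_powers[OF \<alpha>, of i N m] N by (cases N) (simp_all add: h_def)
    finally show ?thesis .
  qed
  then show ?thesis by (simp add: partial_residue_def)
qed

lemma partial_residue_XX:
  assumes \<alpha>: "vanishes_on (Ctail n) \<alpha>" and N: "n \<le> N"
  shows "partial_residue N (XX \<alpha>) m = 0"
proof -
  have "(\<Sum>i<N. cf (XX \<alpha> [CX ^ i * CY ^ j * m]) i j) = 0" for j
  proof -
    define h where "h i = (case i of 0 \<Rightarrow> 0 | Suc i' \<Rightarrow> cf (\<alpha> [CX ^ i * CY ^ j * m]) i' j)" for i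
    have "cf (XX \<alpha> [CX ^ i * CY ^ j * m]) i j = h i - h (Suc i)" for i
      by (simp add: cf_PX h_def mult_ac split: nat.split)
    then have "(\<Sum>i<N. cf (XX \<alpha> [CX ^ i * CY ^ j * m]) i j) = h 0 - h N"
      by (simp add: sum_lessThan_telescope')
    also have "\<dots> = 0" using vanishes_powers[OF \<alpha>, of N j m] N by (cases N) (simp_all add: h_def)
    finally show ?thesis .
  qed
  then show ?thesis unfolding partial_residue_def by (subst sum.swap) simp
qed

lemma partial_residue_add: "partial_residue N (\<lambda>xs. c xs + c' xs) m = partial_residue N c m + partial_residue N c' m"
  by (simp add: partial_residue_def sum.distrib)
lemma partial_residue_diff: "partial_residue N (\<lambda>xs. c xs - c' xs) m = partial_residue N c m - partial_residue N c' m"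
  by (simp add: partial_residue_def sum_subtractf)

lemma vanishes_on_mono: "vanishes_on J c \<Longrightarrow> J' \<subseteq> J \<Longrightarrow> vanishes_on J' c"
  by (auto simp: vanishes_on_def)
lemma dual_cochain_mono: "dual_cochain J n e \<phi> \<Longrightarrow> J' \<subseteq> J \<Longrightarrow> dual_cochain J' n e \<phi>"
  unfolding dual_cochain_def using vanishes_on_mono by blast
lemma dual_cochain_vanishes: "dual_cochain J n e \<phi> \<Longrightarrow> vanishes_on J \<phi>" by (simp add: dual_cochain_def)

lemma dual_cochain_post:
  assumes \<phi>: "dual_cochain J n e \<phi>" and L: "\<And>c p q. L (psc c p + q) = psc c (L p) + L q"
    and Ld: "\<And>m p. p \<in> Pdeg m \<Longrightarrow> L p \<in> Pdeg (m + d)"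
  shows "dual_cochain J n (e + d) (\<lambda>xs. L (\<phi> xs))"
proof -
  have L0: "L 0 = 0" using L[of 1 0 0] by (simp add: pCons_one)
  have "mlin (\<lambda>xs. L (\<phi> xs))" using \<phi> by (simp add: dual_cochain_def mlin_def L)
  moreover have "of_degree (e + d) (\<lambda>xs. L (\<phi> xs))"
    using \<phi> Ld by (fastforce simp: dual_cochain_def of_degree_def add.assoc[symmetric])
  ultimately show ?thesis using \<phi> by (simp add: dual_cochain_def on_length_def vanishes_on_def L0)
qed

text \<open>
  Division by \<open>y\<close> of the part of \<open>p\<close> without \<open>x\<close>, which completes the decomposition \<open>euclid\<close>.
\<close>
definition Ldiv :: "'k::comm_ring_1 poly poly \<Rightarrow> 'k poly poly" where
  "Ldiv p = PDy (p - PX * PDx p)"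

lemma euclid: "p = [:[:cf p 0 0:]:] + PX * PDx p + PY * Ldiv p"
  by (rule cf_eqI)
    (simp add: Ldiv_def cf_PX cf_PY cf_PDx cf_PDy coeff_pCons split: nat.split)

lemma Pdeg_constant_term: "p \<in> Pdeg m \<Longrightarrow> [:[:cf p 0 0:]:] \<in> Pdeg m"
proof -
  assume p: "p \<in> Pdeg m"
  have "cf p 0 0 \<noteq> 0 \<longrightarrow> 2 * int (0 + 0) = m" using p unfolding Pdeg_def by blast
  then show ?thesis by (auto simp: Pdeg_def cf_const)
qed

text \<open>
  Modulo linearity defects, \<open>x c\<^sub>1(m)\<close> may be replaced by \<open>c\<^sub>1(x m)\<close>. Writing \<open>c = c\<^sub>0 + x c\<^sub>1 + y c\<^sub>2\<close> with constant \<open>c\<^sub>0\<close>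
  therefore reduces \<open>c\<close> to a map that vanishes already on \<open>A\<^sub>\<ge>\<^sub>n\<close> instead of \<open>A\<^sub>\<ge>\<^sub>n\<^sub>+\<^sub>1\<close>, and induction applies.
\<close>
lemma constant_term_normal_form:
  "dual_cochain (Ctail n) 1 e c \<Longrightarrow> \<exists>c0 \<alpha> \<beta>. dual_cochain (Ctail n) 1 e c0 \<and> dual_cochain (Ctail n) 1 (e - 2) \<alpha> \<and> dual_cochain (Ctail n) 1 (e - 2) \<beta>
     \<and> (\<forall>xs. c0 xs = [:[:cf (c0 xs) 0 0:]:]) \<and> c = (\<lambda>xs. c0 xs + YY \<alpha> xs - XX \<beta> xs)"
proof (induction n arbitrary: c)
  case 0
  then have "c xs = 0" for xs using dual_cochain_len[OF 0] dual_cochain_vanishes[OF 0] by (cases "xs = []") (auto simp: vanishes_on_def)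
  then have "c = (\<lambda>xs. 0)" by auto
  then show ?case
    by (intro exI[of _ "\<lambda>_. 0"] conjI dual_cochain_zero) (simp_all add: lin_defect_zero_fun)
next
  case (Suc n)
  define c0 c1 c2 where "c0 = (\<lambda>xs. [:[:cf (c xs) 0 0:]:])" and "c1 = (\<lambda>xs. PDx (c xs))"
    and "c2 = (\<lambda>xs. Ldiv (c xs))"
  have c0: "dual_cochain (Ctail (Suc n)) 1 (e + 0) c0" unfolding c0_def
    by (rule dual_cochain_post[OF Suc.prems]) (auto simp: Pdeg_constant_term)
  have Ldiv_lin: "Ldiv (psc c p + q) = psc c (Ldiv p) + Ldiv q" for c :: 'a and p q
    by (rule cf_eqI, rename_tac i j, case_tac i) (simp_all add: Ldiv_def cf_PDy cf_PX cf_PDx algebra_simps)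
  have c1: "dual_cochain (Ctail (Suc n)) 1 (e + - 2) c1" unfolding c1_def
    by (rule dual_cochain_post[OF Suc.prems]) (use PDx_Pdeg in \<open>auto simp: PDx_lin\<close>)
  have "Ldiv p \<in> Pdeg (m + - 2)" if "p \<in> Pdeg m" for m and p :: "'a poly poly"
    unfolding Ldiv_def using PDy_Pdeg[OF Pdeg_diff[OF that Pdeg_times[OF PX_Pdeg PDx_Pdeg[OF that], of m]]] by simp
  then have c2: "dual_cochain (Ctail (Suc n)) 1 (e + - 2) c2" unfolding c2_def
    by (intro dual_cochain_post[OF Suc.prems]) (simp_all add: Ldiv_lin)
  have J: "ideal_like (Ctail (Suc n) :: 'a cone set)" using Ctail_mult[of _ 0 _ "Suc n"] by (auto simp: ideal_like_def)
  define d where "d = (\<lambda>xs. PX * c1 xs - XX c1 xs + (PY * c2 xs - YY c2 xs))"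
  have PXc: "dual_cochain (Ctail (Suc n)) 1 (e + - 2 + 2) (\<lambda>xs. PX * c1 xs)"
    by (rule dual_cochain_post[OF c1]) (use Pdeg_times[OF PX_Pdeg] in \<open>auto simp: algebra_simps\<close>)
  have PYc: "dual_cochain (Ctail (Suc n)) 1 (e + - 2 + 2) (\<lambda>xs. PY * c2 xs)"
    by (rule dual_cochain_post[OF c2]) (use Pdeg_times[OF PY_Pdeg] in \<open>auto simp: algebra_simps\<close>)
  have "dual_cochain (Ctail (Suc n)) 1 (e + - 2 + 2) d"
    unfolding d_def by (intro dual_cochain_add dual_cochain_diff PXc PYc dual_cochain_lin_defect J c1 c2 CX_Cdeg CY_Cdeg PX_Pdeg PY_Pdeg)
  then have d: "dual_cochain (Ctail (Suc n)) 1 e d" by simp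
  have "vanishes_on (Ctail n) d"
    unfolding vanishes_on_def
  proof safe
    fix xs :: "'a cone list" assume ne: "xs \<noteq> []" and l: "last xs \<in> Ctail n"
    show "d xs = 0"
    proof (cases "length xs = 1")
      case True
      then obtain m where xs: "xs = [m]" by (cases xs) auto
      have "CX * m \<in> Ctail (Suc n)" "CY * m \<in> Ctail (Suc n)"
        using Ctail_mult[OF Cdeg_Ctail[of CX 2], of m n] Ctail_mult[OF Cdeg_Ctail[of CY 2], of m n] l
          subsetD[OF Ctail_mono[of "Suc n" "2 + n"]]
        by (simp_all add: xs CX_Cdeg CY_Cdeg)
      then show ?thesis
        using dual_cochain_vanishes[OF c1] dual_cochain_vanishes[OF c2] by (simp add: xs d_def vanishes_on_def)
    qed (use dual_cochain_len[OF d] in simp)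
  qed
  then have "dual_cochain (Ctail n) 1 e d" using d by (simp add: dual_cochain_def)
  from Suc.IH[OF this] obtain c0' \<alpha> \<beta> where IH: "dual_cochain (Ctail n) 1 e c0'" "dual_cochain (Ctail n) 1 (e - 2) \<alpha>" "dual_cochain (Ctail n) 1 (e - 2) \<beta>"
    "\<forall>xs. c0' xs = [:[:cf (c0' xs) 0 0:]:]" "d = (\<lambda>xs. c0' xs + YY \<alpha> xs - XX \<beta> xs)" by blast
  have sub: "Ctail (Suc n) \<subseteq> (Ctail n :: 'a cone set)" by (rule Ctail_mono) simp
  show ?case
  proof (intro exI conjI allI)
    show "dual_cochain (Ctail (Suc n)) 1 e (\<lambda>xs. c0 xs + c0' xs)" using dual_cochain_add[OF _ dual_cochain_mono[OF IH(1) sub]] c0 by simp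
    show "dual_cochain (Ctail (Suc n)) 1 (e - 2) (\<lambda>xs. \<alpha> xs + c2 xs)" using dual_cochain_add[OF dual_cochain_mono[OF IH(2) sub]] c2 by simp
    show "dual_cochain (Ctail (Suc n)) 1 (e - 2) (\<lambda>xs. \<beta> xs - c1 xs)" using dual_cochain_diff[OF dual_cochain_mono[OF IH(3) sub]] c1 by simp
    fix xs
    show "c0 xs + c0' xs = [:[:cf (c0 xs + c0' xs) 0 0:]:]"
      by (subst (1) IH(4)[rule_format, of xs]) (simp add: c0_def)
  next
    have "c xs = c0 xs + c0' xs + YY (\<lambda>xs. \<alpha> xs + c2 xs) xs - XX (\<lambda>xs. \<beta> xs - c1 xs) xs" for xs
    proof -
      have "c xs = c0 xs + PX * c1 xs + PY * c2 xs" using euclid[of "c xs"] by (simp add: c0_def c1_def c2_def)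
      also have "\<dots> = c0 xs + d xs + XX c1 xs + YY c2 xs" by (simp add: d_def)
      finally show ?thesis by (simp add: IH(5) lin_defect_add lin_defect_diff)
    qed
    then show "c = (\<lambda>xs. c0 xs + c0' xs + YY (\<lambda>xs. \<alpha> xs + c2 xs) xs - XX (\<lambda>xs. \<beta> xs - c1 xs) xs)" by blast
  qed
qed

text \<open>
  On the constant-valued normal form the residue is the map itself, so a vanishing residue leaves only defects.
\<close>
lemma residue_zero_boundary:
  assumes c: "dual_cochain (Ctail n) 1 e c" and r: "\<And>m. residue c m = 0"
  shows "\<exists>\<alpha> \<beta>. dual_cochain (Ctail n) 1 (e - 2) \<alpha> \<and> dual_cochain (Ctail n) 1 (e - 2) \<beta> \<and> c = (\<lambda>xs. YY \<alpha> xs - XX \<beta> xs)"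
proof -
  obtain c0 \<alpha> \<beta> where *: "dual_cochain (Ctail n) 1 e c0" "dual_cochain (Ctail n) 1 (e - 2) \<alpha>" "dual_cochain (Ctail n) 1 (e - 2) \<beta>"
     "\<forall>xs. c0 xs = [:[:cf (c0 xs) 0 0:]:]" "c = (\<lambda>xs. c0 xs + YY \<alpha> xs - XX \<beta> xs)"
    using constant_term_normal_form[OF c] by blast
  have "c0 xs = 0" for xs
  proof (cases "length xs = 1")
    case True
    then obtain m where xs: "xs = [m]" by (cases xs) auto
    have "0 = partial_residue (Suc n) c m" using residue_eq[OF dual_cochain_vanishes[OF c], of "Suc n" m] r by simp
    also have "\<dots> = partial_residue (Suc n) c0 m"
      unfolding *(5) partial_residue_diff partial_residue_add
      using partial_residue_YY[OF dual_cochain_vanishes[OF *(2)], of "Suc n" m] partial_residue_XX[OF dual_cochain_vanishes[OF *(3)], of "Suc n" m] by simp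
    also have "\<dots> = (\<Sum>i<Suc n. \<Sum>j<Suc n. if i = 0 \<and> j = 0 then cf (c0 [m]) 0 0 else 0)"
      unfolding partial_residue_def
    proof (intro sum.cong refl)
      fix i j
      have "cf (c0 [CX ^ i * CY ^ j * m]) i j = cf [:[:cf (c0 [CX ^ i * CY ^ j * m]) 0 0:]:] i j"
        using *(4) by metis
      then show "cf (c0 [CX ^ i * CY ^ j * m]) i j = (if i = 0 \<and> j = 0 then cf (c0 [m]) 0 0 else 0)"
        by (auto simp: cf_const)
    qed
    also have "\<dots> = cf (c0 [m]) 0 0" by (simp add: sum.lessThan_Suc_shift del: sum.lessThan_Suc)
    finally show ?thesis using *(4) xs by (metis pCons_0_0)
  qed (use dual_cochain_len[OF *(1)] in simp)
  then show ?thesis using * by auto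
qed

subsection \<open>The duality isomorphism\<close>

text \<open>
  Bar cocycle, zigzag to the cokernel of the Koszul complex, residue functional.
\<close>
definition cone_dual :: "int \<Rightarrow> ('k::field cone list \<Rightarrow> 'k cone) \<Rightarrow> 'k cone \<Rightarrow> 'k" where
  "cone_dual e f = residue (koszul (frob_trace 2 f))"

lemma lc_cone: "lc_cocycles cone_alg 2 e = (\<Union>n. bar_cocycles cone_alg (Ctail n) 2 e)"
  "lc_coboundaries cone_alg 2 e = (\<Union>n. bar_coboundaries cone_alg (Ctail n) 2 e)"
  by (simp_all add: lc_cocycles_def lc_coboundaries_def tail_ideal_cone)

lemma cocycle_dual_cochain:
  assumes "f \<in> bar_cocycles cone_alg J 2 e"
  shows "dual_cochain J (Suc (Suc (Suc 1))) (e - 2) (frob_trace 2 f)" "bdiff (frob_trace 2 f) = (\<lambda>_. 0)"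
    "XX (frob_trace 2 f) = (\<lambda>_. 0)" "YY (frob_trace 2 f) = (\<lambda>_. 0)"
  using assms dual_cochain_frob_trace[of f J 2 e] by (auto simp: bar_cocycles_iff eval_nat_numeral)

lemma cocycleI:
  assumes "f \<in> bar_args cone_alg 2 \<rightarrow>\<^sub>E UNIV" "dual_cochain J (Suc (Suc (Suc 1))) (e - 2) (frob_trace 2 f)" "bdiff (frob_trace 2 f) = (\<lambda>_. 0)"
    "XX (frob_trace 2 f) = (\<lambda>_. 0)" "YY (frob_trace 2 f) = (\<lambda>_. 0)"
  shows "f \<in> bar_cocycles cone_alg J 2 e"
proof -
  obtain g where g: "g \<in> bar_cochains cone_alg J 2 e" "frob_trace 2 g = frob_trace 2 f"
    using frob_trace_surj[of J 2 e "frob_trace 2 f"] assms by (auto simp: eval_nat_numeral)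
  then have "g = f"
    using assms(1) bar_cochainsD(1)[OF g(1)] by (intro frob_trace_inject) (auto simp: bar_args_cone)
  then show ?thesis using g assms by (simp add: bar_cocycles_iff)
qed

lemma koszul_dual_cochain: "f \<in> bar_cocycles cone_alg (Ctail n) 2 e \<Longrightarrow> dual_cochain (Ctail n) 1 (e + 2) (koszul (frob_trace 2 f))"
  using dual_cochain_koszul[OF ideal_like_Ctail cocycle_dual_cochain(1)[of f "Ctail n" e]] by (simp add: add.commute)

lemma cone_dual_eq:
  "f \<in> bar_cocycles cone_alg (Ctail n) 2 e \<Longrightarrow> n \<le> N \<Longrightarrow> cone_dual e f m = partial_residue N (koszul (frob_trace 2 f)) m"
  unfolding cone_dual_def using residue_eq dual_cochain_vanishes[OF koszul_dual_cochain] by blast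

lemma frob_trace_bar_add: "frob_trace i (bar_add cone_alg i f h) = (\<lambda>xs. frob_trace i f xs + frob_trace i h xs)"
  by (auto simp: fun_eq_iff frob_trace_def bar_add_def bar_args_cone algebra_simps)
lemma frob_trace_bar_smult: "frob_trace i (bar_smult cone_alg i c f) = (\<lambda>xs. psc c (frob_trace i f xs))"
  by (auto simp: fun_eq_iff frob_trace_def bar_smult_def bar_args_cone algebra_simps smult_add_right)

lemma lin_defect_psc: "lin_defect p q (\<lambda>ys. psc c (\<phi> ys)) xs = psc c (lin_defect p q \<phi> xs)"
  by (cases xs) (auto simp: smult_diff_right)
lemma koszul_add: "koszul (\<lambda>xs. \<phi> xs + \<psi> xs) = (\<lambda>xs. koszul \<phi> xs + koszul \<psi> xs)"
  unfolding koszul_def koszul_pre_def insert_one_def lin_defect_add[abs_def] by auto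
lemma koszul_psc: "koszul (\<lambda>xs. psc c (\<phi> xs)) = (\<lambda>xs. psc c (koszul \<phi> xs))"
  unfolding koszul_def koszul_pre_def insert_one_def lin_defect_psc[abs_def] by (auto simp: smult_diff_right)

lemma bar_cocycles_mono: "f \<in> bar_cocycles cone_alg (Ctail n) 2 e \<Longrightarrow> n \<le> N \<Longrightarrow> f \<in> bar_cocycles cone_alg (Ctail N) 2 e"
proof -
  assume f: "f \<in> bar_cocycles cone_alg (Ctail n) 2 e" and N: "n \<le> N"
  have "f \<in> bar_args cone_alg 2 \<rightarrow>\<^sub>E UNIV" using f by (auto simp: bar_cocycles_def bar_cochains_def)
  then show ?thesis by (rule cocycleI) (use cocycle_dual_cochain[OF f] dual_cochain_mono Ctail_mono[OF N] in blast)+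
qed

lemma mlin_psc: "mlin \<phi> \<Longrightarrow> mlin (\<lambda>xs. psc c (\<phi> xs))"
  by (simp add: mlin_def smult_add_right mult.commute)

lemma dual_cochain_psc: "dual_cochain J n e \<phi> \<Longrightarrow> dual_cochain J n e (\<lambda>xs. psc c (\<phi> xs))"
  using mlin_psc[of \<phi> c] by (simp add: dual_cochain_def on_length_def vanishes_on_def of_degree_def Pdeg_psc)

lemma lc_add_closed:
  assumes "f \<in> lc_cocycles cone_alg 2 e" "h \<in> lc_cocycles cone_alg 2 e"
  shows "\<exists>n. f \<in> bar_cocycles cone_alg (Ctail n) 2 e \<and> h \<in> bar_cocycles cone_alg (Ctail n) 2 e
    \<and> bar_add cone_alg 2 f h \<in> bar_cocycles cone_alg (Ctail n) 2 e"
proof -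
  obtain n1 n2 where "f \<in> bar_cocycles cone_alg (Ctail n1) 2 e" "h \<in> bar_cocycles cone_alg (Ctail n2) 2 e"
    using assms by (auto simp: lc_cone)
  then have f: "f \<in> bar_cocycles cone_alg (Ctail (max n1 n2)) 2 e" and h: "h \<in> bar_cocycles cone_alg (Ctail (max n1 n2)) 2 e"
    using bar_cocycles_mono by (metis max.cobounded1 max.cobounded2)+
  have "bar_add cone_alg 2 f h \<in> bar_cocycles cone_alg (Ctail (max n1 n2)) 2 e"
  proof (rule cocycleI)
    show "bar_add cone_alg 2 f h \<in> bar_args cone_alg 2 \<rightarrow>\<^sub>E UNIV" by (auto simp: bar_add_def)
  qed (simp_all add: frob_trace_bar_add bdiff_add_fun lin_defect_add_fun cocycle_dual_cochain[OF f] cocycle_dual_cochain[OF h] dual_cochain_add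
      cocycle_dual_cochain(1)[OF f, simplified] cocycle_dual_cochain(1)[OF h, simplified])
  then show ?thesis using f h by blast
qed

lemma lc_smult_closed:
  assumes f: "f \<in> bar_cocycles cone_alg (Ctail n) 2 e"
  shows "bar_smult cone_alg 2 c f \<in> bar_cocycles cone_alg (Ctail n) 2 e"
proof (rule cocycleI)
  show "bar_smult cone_alg 2 c f \<in> bar_args cone_alg 2 \<rightarrow>\<^sub>E UNIV" by (auto simp: bar_smult_def)
  show "dual_cochain (Ctail n) (Suc (Suc (Suc 1))) (e - 2) (frob_trace 2 (bar_smult cone_alg 2 c f))"
    unfolding frob_trace_bar_smult by (rule dual_cochain_psc[OF cocycle_dual_cochain(1)[OF f]])
qed (simp_all add: frob_trace_bar_smult bdiff_psc lin_defect_psc cocycle_dual_cochain[OF f] fun_eq_iff)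

text \<open>
  The module structure of \<open>Ext\<close>: right multiplication on the module \<open>A/J\<close>.
\<close>
definition last_mult :: "'k::comm_ring_1 cone \<Rightarrow> 'k cochain \<Rightarrow> 'k cochain" where
  "last_mult b \<phi> xs = (if xs = [] then 0 else \<phi> (butlast xs @ [last xs * b]))"

lemma frob_trace_bar_act: "frob_trace i (bar_act cone_alg i b f) = last_mult b (frob_trace i f)"
proof
  fix xs show "frob_trace i (bar_act cone_alg i b f) xs = last_mult b (frob_trace i f) xs"
    by (cases xs) (auto simp: frob_trace_def last_mult_def bar_act_def bar_args_cone)
qed

lemma bdiff_last_mult: "bdiff (last_mult b \<phi>) = last_mult b (bdiff \<phi>)"
proof
  fix xs
  have "bdiff \<psi> xs = bdiff \<phi> (butlast xs @ [last xs * b])" if "xs \<noteq> []"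
    "\<And>ys. ys \<noteq> [] \<Longrightarrow> \<psi> ys = \<phi> (butlast ys @ [last ys * b])" for \<psi> :: "'a cochain" and \<phi> xs
    using that
  proof (induction \<psi> xs arbitrary: \<phi> rule: bdiff.induct)
    case (1 \<psi> u v xs)
    have IH: "bdiff (\<lambda>ys. \<psi> (u # ys)) (v # xs) = bdiff (\<lambda>ys. \<phi> (u # ys)) (butlast (v # xs) @ [last (v # xs) * b])"
      by (rule "1.IH") (simp_all add: 1)
    show ?case
    proof (cases "xs = []")
      case True
      then show ?thesis using 1(3) by (simp add: mult.assoc)
    next
      case False
      then show ?thesis using IH 1(3)[of "u * v # xs"] by (cases xs) simp_all
    qed
  qed auto
  from this[of xs "last_mult b \<phi>" \<phi>] show "bdiff (last_mult b \<phi>) xs = last_mult b (bdiff \<phi>) xs"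
    by (cases "xs = []") (auto simp: last_mult_def)
qed

lemma lin_defect_last_mult: "lin_defect p q (last_mult b \<phi>) = last_mult b (lin_defect p q \<phi>)"
proof
  fix xs show "lin_defect p q (last_mult b \<phi>) xs = last_mult b (lin_defect p q \<phi>) xs"
  proof (cases xs)
    case (Cons a ys)
    then show ?thesis by (cases "ys = []") (simp_all add: last_mult_def mult.assoc)
  qed (simp add: last_mult_def)
qed

lemma dual_cochain_last_mult:
  assumes J: "ideal_like J" and \<phi>: "dual_cochain J n e \<phi>" and b: "b \<in> Cdeg d"
  shows "dual_cochain J n (e + d) (last_mult b \<phi>)"
  unfolding dual_cochain_def
proof (intro conjI)
  have \<phi>': "on_length n \<phi>" "mlin \<phi>" "vanishes_on J \<phi>" "of_degree e \<phi>" using \<phi> by (auto simp: dual_cochain_def)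
  show "on_length n (last_mult b \<phi>)"
    using \<phi>'(1) by (auto simp: on_length_def last_mult_def)
  show "mlin (last_mult b \<phi>)"
    unfolding mlin_def
  proof safe
    fix us vs c x and y :: "'a cone"
    show "last_mult b \<phi> (us @ (csc c x + y) # vs) = psc c (last_mult b \<phi> (us @ x # vs)) + last_mult b \<phi> (us @ y # vs)"
    proof (cases "vs = []")
      case True
      then show ?thesis using mlinD[OF \<phi>'(2), of us c "x * b" "y * b" "[]"] by (simp add: last_mult_def distrib_right)
    next
      case False
      then show ?thesis using mlinD[OF \<phi>'(2), of us c x y "butlast vs @ [last vs * b]"]
        by (simp add: last_mult_def butlast_append)
    qed
  qed
  show "vanishes_on J (last_mult b \<phi>)"
    using \<phi>'(3) J by (auto simp: vanishes_on_def last_mult_def ideal_like_def mult.commute)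
  show "of_degree (e + d) (last_mult b \<phi>)"
    unfolding of_degree_def
  proof safe
    fix xs :: "'a cone list" and ms assume *: "list_all2 (\<lambda>x m. x \<in> Cdeg m) xs ms"
    show "last_mult b \<phi> xs \<in> Pdeg (sum_list ms + (e + d))"
    proof (cases xs rule: rev_cases)
      case (snoc ys x)
      then obtain ns k where ms: "ms = ns @ [k]" "list_all2 (\<lambda>x m. x \<in> Cdeg m) ys ns" "x \<in> Cdeg k"
        using * by (auto simp: list_all2_append1 list_all2_Cons1)
      then have "list_all2 (\<lambda>x m. x \<in> Cdeg m) (ys @ [x * b]) (ns @ [k + d])"
        using b by (auto intro!: list_all2_appendI Cdeg_mult)
      then have "\<phi> (ys @ [x * b]) \<in> Pdeg (sum_list (ns @ [k + d]) + e)" using \<phi>'(4) unfolding of_degree_def by blast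
      then show ?thesis by (simp add: snoc last_mult_def ms algebra_simps)
    qed (simp add: last_mult_def)
  qed
qed

lemma last_mult_zero: "last_mult b (\<lambda>_. 0) = (\<lambda>_. 0)" by (auto simp: last_mult_def)

lemma bar_act_closed:
  assumes f: "f \<in> bar_cocycles cone_alg (Ctail n) 2 e" and b: "b \<in> Cdeg (int d)"
  shows "bar_act cone_alg 2 b f \<in> bar_cocycles cone_alg (Ctail n) 2 (e + int d)"
proof (rule cocycleI)
  show "bar_act cone_alg 2 b f \<in> bar_args cone_alg 2 \<rightarrow>\<^sub>E UNIV" by (auto simp: bar_act_def)
  show "dual_cochain (Ctail n) (Suc (Suc (Suc 1))) (e + int d - 2) (frob_trace 2 (bar_act cone_alg 2 b f))"
    unfolding frob_trace_bar_act using dual_cochain_last_mult[OF ideal_like_Ctail cocycle_dual_cochain(1)[OF f] b] by (simp add: algebra_simps)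
qed (simp_all add: frob_trace_bar_act bdiff_last_mult lin_defect_last_mult cocycle_dual_cochain[OF f] last_mult_zero)

lemma koszul_last_mult: "koszul (last_mult b \<phi>) [m] = koszul \<phi> [m * b]"
  by (simp add: koszul_def koszul_pre_def insert_one_def last_mult_def mult.assoc)

lemma partial_residue_linear:
  assumes "mlin c"
  shows "partial_residue N c (a + b) = partial_residue N c a + partial_residue N c b" "partial_residue N c (csc s a) = s * partial_residue N c a"
  by (simp_all add: partial_residue_def distrib_left mlin_add1[OF assms] mlin_csc1[OF assms] sum.distrib sum_distrib_left)

text \<open>
  Degrees add up: the trace contributes \<open>-2\<close>, the zigzag \<open>2 + 2\<close>, and the residue compares the degree of
  \<open>c(x\<^sup>i y\<^sup>j m)\<close> with that of \<open>x\<^sup>i y\<^sup>j\<close>.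
\<close>
lemma cone_dual_in_dual_part:
  assumes "f \<in> lc_cocycles cone_alg 2 e"
  shows "cone_dual e f \<in> dual_part cone_alg (e + 2)"
proof -
  obtain n where f: "f \<in> bar_cocycles cone_alg (Ctail n) 2 e" using assms by (auto simp: lc_cone)
  have eq: "cone_dual e f m = partial_residue n (koszul (frob_trace 2 f)) m" for m by (rule cone_dual_eq[OF f]) simp
  have dual_cochain: "dual_cochain (Ctail n) 1 (e + 2) (koszul (frob_trace 2 f))" by (rule koszul_dual_cochain[OF f])
  have deg: "cone_dual e f a = 0" if a: "a \<in> Cdeg (int k)" and k: "int k \<noteq> - (e + 2)" for k a
  proof -
    have "cf (koszul (frob_trace 2 f) [CX ^ i * CY ^ j * a]) i j = 0" for i j
    proof -
      have X: "CX ^ i \<in> Cdeg (2 * int i)" for i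
      proof (induction i)
        case (Suc i)
        then show ?case using Cdeg_mult[OF CX_Cdeg Suc] by simp
      qed (simp add: one_Cdeg)
      have Y: "CY ^ i \<in> Cdeg (2 * int i)" for i
      proof (induction i)
        case (Suc i)
        then show ?case using Cdeg_mult[OF CY_Cdeg Suc] by simp
      qed (simp add: one_Cdeg)
      have "CX ^ i * CY ^ j * a \<in> Cdeg (2 * int i + 2 * int j + int k)" by (intro Cdeg_mult X Y a)
      then have "koszul (frob_trace 2 f) [CX ^ i * CY ^ j * a] \<in> Pdeg (sum_list [2 * int i + 2 * int j + int k] + (e + 2))"
        using dual_cochain unfolding dual_cochain_def of_degree_def by blast
      then have "cf (koszul (frob_trace 2 f) [CX ^ i * CY ^ j * a]) i j \<noteq> 0 \<longrightarrow>
          2 * int (i + j) = sum_list [2 * int i + 2 * int j + int k] + (e + 2)"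
        unfolding Pdeg_def by blast
      then show ?thesis using k by auto
    qed
    then show ?thesis by (simp add: eq partial_residue_def)
  qed
  show ?thesis
    unfolding dual_part_def
    using deg partial_residue_linear[OF dual_cochain_mlin[OF dual_cochain]] by (auto simp: eq extensional_def)
qed

lemma dual_part_coneD:
  assumes "\<psi> \<in> dual_part cone_alg j"
  shows "\<psi> (a + b) = \<psi> a + \<psi> b" "\<psi> (csc c a) = c * \<psi> a" "int n \<noteq> - j \<Longrightarrow> a \<in> Cdeg (int n) \<Longrightarrow> \<psi> a = 0"
  using assms by (auto simp: dual_part_def)

lemma additive_sum:
  fixes F :: "'k::comm_ring_1 cone \<Rightarrow> 'b::ab_group_add"
  assumes F: "\<And>a b. F (a + b) = F a + F b"
  shows "F (sum s S) = (\<Sum>i\<in>S. F (s i))"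
proof (induction S rule: infinite_finite_induct)
  case empty
  have "F (0 + 0) = F 0 + F 0" by (rule F)
  then show ?case by simp
next
  case (infinite S)
  have "F (0 + 0) = F 0 + F 0" by (rule F)
  then show ?case using infinite by simp
qed (simp add: F)

lemma additive_eqI:
  fixes F G :: "'k::comm_ring_1 cone \<Rightarrow> 'b::ab_group_add"
  assumes F: "\<And>a b. F (a + b) = F a + F b" and G: "\<And>a b. G (a + b) = G a + G b"
    and eq: "\<And>n a. a \<in> Cdeg (int n) \<Longrightarrow> F a = G a"
  shows "F a = G a"
proof -
  obtain N where N: "a = (\<Sum>n<N. hcomp (int n) a)" using cone_decomposition by blast
  have "F (\<Sum>n<N. hcomp (int n) a) = G (\<Sum>n<N. hcomp (int n) a)"
    by (simp add: additive_sum[of F, OF F] additive_sum[of G, OF G] eq[OF hcomp_Cdeg])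
  then show ?thesis using N by metis
qed

lemma dual_part_vanishes:
  assumes "\<psi> \<in> dual_part cone_alg j" and a: "a \<in> Ctail (Suc (nat (- j)))"
  shows "\<psi> a = 0"
proof -
  note \<psi> = dual_part_coneD[OF assms(1)]
  obtain N where N: "a = (\<Sum>m\<in>{Suc (nat (- j))..<N}. hcomp (int m) a)" using Ctail_split[OF a] by blast
  have "\<psi> (\<Sum>m\<in>{Suc (nat (- j))..<N}. hcomp (int m) a) = 0"
    unfolding additive_sum[of \<psi>, OF \<psi>(1)] by (intro sum.neutral ballI \<psi>(3)[OF _ hcomp_Cdeg]) auto
  then show ?thesis using N by metis
qed

text \<open>
  A functional \<open>\<psi>\<close> is the residue of itself, regarded as a map with constant values.
\<close>
lemma cone_dual_surj:
  assumes \<psi>: "\<psi> \<in> dual_part cone_alg (e + 2)"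
  shows "\<exists>f\<in>lc_cocycles cone_alg 2 e. cone_dual e f = \<psi>"
proof -
  \<comment> \<open>\<open>\<psi>\<close> lives on the single degree \<open>- (e + 2)\<close>, hence vanishes from the next degree on.\<close>
  define n where "n = Suc (nat (- (e + 2)))"
  define c where "c = (\<lambda>xs. if length xs = 1 then [:[:\<psi> (hd xs):]:] else 0)"
  note \<psi>D = dual_part_coneD[OF \<psi>]
  have "mlin c"
    unfolding mlin_def
  proof safe
    fix us vs s a and b :: "'a cone"
    show "c (us @ (csc s a + b) # vs) = psc s (c (us @ a # vs)) + c (us @ b # vs)"
      by (cases us) (auto simp: c_def \<psi>D)
  qed
  moreover have "vanishes_on (Ctail n) c"
    unfolding vanishes_on_def
  proof safe
    fix xs :: "'a cone list" assume "last xs \<in> Ctail n"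
    then show "c xs = 0"
      using dual_part_vanishes[OF \<psi>] by (cases xs) (auto simp: c_def n_def)
  qed
  moreover have "of_degree (e + 2) c"
    unfolding of_degree_def
  proof safe
    fix xs :: "'a cone list" and ms assume *: "list_all2 (\<lambda>x m. x \<in> Cdeg m) xs ms"
    show "c xs \<in> Pdeg (sum_list ms + (e + 2))"
    proof (cases "length xs = 1")
      case True
      then obtain a where xs: "xs = [a]" by (cases xs) auto
      then obtain m where ms: "ms = [m]" "a \<in> Cdeg m" using * by (auto simp: list_all2_Cons1)
      show ?thesis
      proof (cases "m = - (e + 2)")
        case True
        then show ?thesis by (auto simp: c_def xs ms Pdeg_def coeff_pCons split: nat.splits)
      next
        case False
        have "\<psi> a = 0"
        proof (cases "m < 0")
          case True
          then have "a = 0" using ms Cdeg_neg by blast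
          then show ?thesis using \<psi>D(2)[of 0 0] by simp
        next
          case m: False
          then show ?thesis using \<psi>D(3)[of "nat m" a] ms False by simp
        qed
        then show ?thesis by (simp add: c_def xs)
      qed
    qed (simp add: c_def)
  qed
  ultimately have c: "dual_cochain (Ctail n) 1 (e + 2) c" by (simp add: dual_cochain_def on_length_def c_def)
  obtain \<phi> \<alpha> \<beta> where \<phi>: "dual_cochain (Ctail n) (Suc (Suc (Suc 1))) (e - 2) \<phi>" "bdiff \<phi> = (\<lambda>_. 0)" "XX \<phi> = (\<lambda>_. 0)" "YY \<phi> = (\<lambda>_. 0)"
    and \<alpha>: "dual_cochain (Ctail n) 1 e \<alpha>" and \<beta>: "dual_cochain (Ctail n) 1 e \<beta>"
    and koszul: "koszul \<phi> = (\<lambda>xs. c xs - (YY \<alpha> xs - XX \<beta> xs))"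
    using koszul_surj[OF ideal_like_Ctail c] by auto
  obtain f where f: "f \<in> bar_cochains cone_alg (Ctail n) 2 e" "frob_trace 2 f = \<phi>"
    using frob_trace_surj[of "Ctail n" 2 e \<phi>] \<phi> by (auto simp: eval_nat_numeral)
  then have f': "f \<in> bar_cocycles cone_alg (Ctail n) 2 e" using \<phi> by (simp add: bar_cocycles_iff)
  have "cone_dual e f m = \<psi> m" for m
  proof -
    have "cone_dual e f m = partial_residue (Suc n) c m"
      using cone_dual_eq[OF f', of "Suc n" m] partial_residue_YY[OF dual_cochain_vanishes[OF \<alpha>], of "Suc n" m]
        partial_residue_XX[OF dual_cochain_vanishes[OF \<beta>], of "Suc n" m] by (simp add: f koszul partial_residue_diff)
    also have "\<dots> = (\<Sum>i<Suc n. \<Sum>j<Suc n. if i = 0 \<and> j = 0 then \<psi> m else 0)"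
      unfolding partial_residue_def by (intro sum.cong refl) (auto simp: c_def cf_const)
    also have "\<dots> = \<psi> m" by (simp add: sum.lessThan_Suc_shift del: sum.lessThan_Suc)
    finally show ?thesis .
  qed
  then show ?thesis using f' by (auto simp: lc_cone)
qed

text \<open>
  If the residue vanishes, the zigzag ends in linearity defects and the cocycle is a coboundary. Conversely, the
  zigzag of a coboundary ends in linearity defects, which have no residue.
\<close>
lemma cone_dual_coboundary:
  assumes "f \<in> lc_cocycles cone_alg 2 e"
  shows "(\<forall>a. cone_dual e f a = 0) \<longleftrightarrow> f \<in> lc_coboundaries cone_alg 2 e"
proof
  assume z: "\<forall>a. cone_dual e f a = 0"
  obtain n where f: "f \<in> bar_cocycles cone_alg (Ctail n) 2 e" using assms by (auto simp: lc_cone)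
  then have fc: "f \<in> bar_cochains cone_alg (Ctail n) (Suc 1) e" by (simp add: bar_cocycles_def eval_nat_numeral)
  obtain \<alpha> \<beta> where "dual_cochain (Ctail n) 1 e \<alpha>" "dual_cochain (Ctail n) 1 e \<beta>" "koszul (frob_trace 2 f) = (\<lambda>xs. YY \<alpha> xs - XX \<beta> xs)"
    using residue_zero_boundary[OF koszul_dual_cochain[OF f]] z by (auto simp: cone_dual_def)
  then obtain \<psi> where "dual_cochain (Ctail n) (Suc (Suc 1)) (e - 2) \<psi>" "XX \<psi> = (\<lambda>_. 0)" "YY \<psi> = (\<lambda>_. 0)" "bdiff \<psi> = frob_trace 2 f"
    using coboundary_of_koszul[OF ideal_like_Ctail _ cocycle_dual_cochain[OF f], of \<alpha> \<beta>] by auto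
  then have "f \<in> bar_coboundaries cone_alg (Ctail n) (Suc 1) e"
    by (intro bar_coboundaryI[OF fc]) (auto simp: eval_nat_numeral)
  then have "f \<in> bar_coboundaries cone_alg (Ctail n) 2 e" by (simp add: numeral_2_eq_2)
  then show "f \<in> lc_coboundaries cone_alg 2 e" by (auto simp: lc_cone)
next
  assume "f \<in> lc_coboundaries cone_alg 2 e"
  moreover have "bar_coboundaries cone_alg J 2 e = bar_diff cone_alg 1 ` bar_cochains cone_alg J 1 e" for J :: "'a cone set"
    by (simp add: bar_coboundaries_def numeral_2_eq_2)
  ultimately obtain n g where g: "g \<in> bar_cochains cone_alg (Ctail n) 1 e" and f: "f = bar_diff cone_alg 1 g"
    by (auto simp: lc_cone)
  define \<psi> where "\<psi> = frob_trace 1 g"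
  have \<psi>: "dual_cochain (Ctail n) (Suc (Suc (Suc 0))) (e - 2) \<psi>" "XX \<psi> = (\<lambda>_. 0)" "YY \<psi> = (\<lambda>_. 0)"
    using dual_cochain_frob_trace[OF g] by (auto simp: \<psi>_def)
  have "frob_trace 2 f = bdiff \<psi>" using frob_trace_bar_diff[of 1 g] by (simp add: \<psi>_def f eval_nat_numeral)
  then have koszul: "koszul (frob_trace 2 f) = (\<lambda>xs. YY (insert_one (XX (insert_one \<psi>))) xs - XX (insert_one (YY (insert_one \<psi>))) xs)"
    using koszul_coboundary[OF ideal_like_Ctail \<psi>] by simp
  have v: "vanishes_on (Ctail n) (insert_one (XX (insert_one \<psi>)))" "vanishes_on (Ctail n) (insert_one (YY (insert_one \<psi>)))"
    using dual_cochain_insert_one[OF dual_cochain_lin_defect[OF ideal_like_Ctail dual_cochain_insert_one[OF \<psi>(1)] CX_Cdeg PX_Pdeg]]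
      dual_cochain_insert_one[OF dual_cochain_lin_defect[OF ideal_like_Ctail dual_cochain_insert_one[OF \<psi>(1)] CY_Cdeg PY_Pdeg]] dual_cochain_vanishes by blast+
  have J: "ideal_like (Ctail n :: 'a cone set)" by (rule ideal_like_Ctail)
  have "dual_cochain (Ctail n) 1 (e - 2 + 2 + 2) (koszul (frob_trace 2 f))"
    unfolding koszul One_nat_def by (intro dual_cochain_diff dual_cochain_lin_defect dual_cochain_insert_one J \<psi> CX_Cdeg CY_Cdeg PX_Pdeg PY_Pdeg)
  from residue_eq[OF dual_cochain_vanishes[OF this] order_refl] show "\<forall>a. cone_dual e f a = 0"
    unfolding cone_dual_def koszul partial_residue_diff partial_residue_YY[OF v(1) order_refl] partial_residue_XX[OF v(2) order_refl] by simp
qed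

lemma cone_dual_add:
  assumes "f \<in> lc_cocycles cone_alg 2 e" "h \<in> lc_cocycles cone_alg 2 e"
  shows "cone_dual e (bar_add cone_alg 2 f h) a = cone_dual e f a + cone_dual e h a"
proof -
  obtain n where f: "f \<in> bar_cocycles cone_alg (Ctail n) 2 e" and h: "h \<in> bar_cocycles cone_alg (Ctail n) 2 e"
    and fh: "bar_add cone_alg 2 f h \<in> bar_cocycles cone_alg (Ctail n) 2 e"
    using lc_add_closed[OF assms] by blast
  show ?thesis
    by (simp add: cone_dual_eq[OF f order_refl] cone_dual_eq[OF h order_refl] cone_dual_eq[OF fh order_refl]
        frob_trace_bar_add koszul_add partial_residue_add)
qed

lemma cone_dual_smult:
  assumes "f \<in> lc_cocycles cone_alg 2 e"
  shows "cone_dual e (bar_smult cone_alg 2 c f) a = c * cone_dual e f a"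
proof -
  obtain n where f: "f \<in> bar_cocycles cone_alg (Ctail n) 2 e" using assms by (auto simp: lc_cone)
  show ?thesis
    by (simp add: cone_dual_eq[OF f order_refl] cone_dual_eq[OF lc_smult_closed[OF f] order_refl]
        frob_trace_bar_smult koszul_psc partial_residue_def sum_distrib_left)
qed

lemma cone_dual_act:
  assumes "f \<in> lc_cocycles cone_alg 2 e" and b: "b \<in> Cdeg (int n)"
  shows "cone_dual (e + int n) (bar_act cone_alg 2 b f) a = cone_dual e f (a * b)"
proof -
  obtain k where f: "f \<in> bar_cocycles cone_alg (Ctail k) 2 e" using assms by (auto simp: lc_cone)
  show ?thesis
    by (simp add: cone_dual_eq[OF f order_refl] cone_dual_eq[OF bar_act_closed[OF f b] order_refl]
        frob_trace_bar_act partial_residue_def koszul_last_mult mult.assoc)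
qed

theorem cone_duality: "lc_dual_iso cone_alg 2 2 cone_dual"
  unfolding lc_dual_iso_def
proof (intro conjI allI ballI)
  fix e
  show "cone_dual e ` lc_cocycles cone_alg 2 e = (dual_part cone_alg (e + 2) :: ('a cone \<Rightarrow> 'a) set)"
    using cone_dual_in_dual_part cone_dual_surj by fast
qed (simp_all add: cone_dual_add cone_dual_smult cone_dual_coboundary cone_dual_act)

text \<open>
  The augmentation, which spans the dual \<open>A'\<close> in degree \<open>0\<close>.
\<close>
definition eps :: "'k::comm_ring_1 cone \<Rightarrow> 'k" where
  "eps a = cf (cre a) 0 0"

lemma eps_add: "eps (a + b) = eps a + eps b" and eps_csc: "eps (csc c a) = c * eps a" and eps_1: "eps 1 = 1"
  by (simp_all add: eps_def)
lemma eps_Cdeg: "a \<in> Cdeg m \<Longrightarrow> m \<noteq> 0 \<Longrightarrow> eps a = 0"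
  by (force simp: eps_def Cdeg_def Pdeg_def)
lemma eps_dual: "eps \<in> dual_part cone_alg 0"
  using eps_Cdeg[of _ "int _"] by (auto simp: dual_part_def eps_add eps_csc)

text \<open>
  Two is attained: the augmentation corresponds to a class in \<open>H\<^sup>2\<^sub>m(A)\<close> that is nonzero, so some
  \<open>Ext\<^sup>2(A/A\<^sub>\<ge>\<^sub>n, A)\<close> does not vanish.
\<close>
theorem inj_dim_cone: "inj_dim (cone_alg :: ('k::field, 'k cone) graded_alg) = 2"
  unfolding inj_dim_def
proof (rule Least_equality)
  let ?A = "cone_alg :: ('k, 'k cone) graded_alg"
  show "\<forall>J. graded_left_ideal ?A J \<longrightarrow> (\<forall>i>2. \<forall>e. bar_cocycles ?A J i e \<subseteq> bar_coboundaries ?A J i e)"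
  proof (intro allI impI subsetI)
    fix J i e f assume "graded_left_ideal ?A J" "2 < i" "f \<in> bar_cocycles ?A J i e"
    then show "f \<in> bar_coboundaries ?A J i e"
      by (intro ext_vanishing) (auto simp: graded_left_ideal_def ideal_like_def)
  qed
  fix d
  assume d: "\<forall>J. graded_left_ideal ?A J \<longrightarrow> (\<forall>i>d. \<forall>e. bar_cocycles ?A J i e \<subseteq> bar_coboundaries ?A J i e)"
  show "2 \<le> d"
  proof (rule ccontr)
    assume "\<not> 2 \<le> d"
    then have "bar_cocycles ?A (Ctail n) 2 e \<subseteq> bar_coboundaries ?A (Ctail n) 2 e" for n e
      by (intro d[rule_format, OF graded_left_ideal_Ctail]) simp
    then have sub: "lc_cocycles ?A 2 e \<subseteq> lc_coboundaries ?A 2 e" for e by (auto simp: lc_cone)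
    obtain f where f: "f \<in> lc_cocycles ?A 2 (- 2)" "cone_dual (- 2) f = eps"
      using cone_dual_surj[of eps "- 2"] eps_dual by auto
    then have "\<forall>a. eps a = (0 :: 'k)" using cone_dual_coboundary[OF f(1)] sub by auto
    then show False using eps_1 by (metis zero_neq_one)
  qed
qed

section \<open>The homological determinant of the cone\<close>

lemma graded_algebra_cone: "graded_algebra cone_alg"
  by (simp add: graded_algebra_def ring_cone_alg)

definition cone_aut :: "('k::field cone \<Rightarrow> 'k cone) \<Rightarrow> bool" where
  "cone_aut g \<longleftrightarrow> graded_iso cone_alg cone_alg g"

lemma cone_aut_isomorphism: "cone_aut g \<Longrightarrow> graded_isomorphism cone_alg cone_alg g"
  by (simp add: cone_aut_def graded_isomorphism_def graded_algebra_cone)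

text \<open>
  The inverse of the homological determinant, as seen through one particular duality isomorphism.
\<close>
definition push_scalar :: "('k::field cone \<Rightarrow> 'k cone) \<Rightarrow> 'k \<Rightarrow> bool" where
  "push_scalar g c \<longleftrightarrow> (\<forall>e. \<forall>f\<in>lc_cocycles cone_alg 2 e. \<forall>a.
     cone_dual e (bar_push cone_alg 2 g f) a = c * cone_dual e f (inv_into UNIV g a))"

lemma eps_aut:
  fixes g :: "'k::field cone \<Rightarrow> 'k cone"
  assumes "cone_aut g"
  shows "eps (g a) = eps a"
proof -
  interpret graded_isomorphism cone_alg cone_alg g using assms by (rule cone_aut_isomorphism)
  show ?thesis
  proof (rule additive_eqI[of "\<lambda>a. eps (g a)" eps])
    show "eps (g (a + b)) = eps (g a) + eps (g b)" for a b :: "'k cone" using hom.hom_add[of a b] by (simp add: eps_add)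
    fix n and a :: "'k cone" assume a: "a \<in> Cdeg (int n)"
    show "eps (g a) = eps a"
    proof (cases "n = 0")
      case True
      then have "a = csc (eps a) 1" using Cdeg_zero_const[of a] a by (simp add: eps_def)
      moreover have "g (csc (eps a) 1) = csc (eps a) 1" using \<theta>_smult[of 1 "eps a"] hom.hom_one by simp
      ultimately show ?thesis by metis
    next
      case False
      then show ?thesis using eps_Cdeg[OF a] eps_Cdeg[of "g a" "int n"] \<theta>_part[of a n] a by simp
    qed
  qed (rule eps_add)
qed

lemma lc_closed:
  "f \<in> lc_cocycles cone_alg 2 e \<Longrightarrow> h \<in> lc_cocycles cone_alg 2 e \<Longrightarrow> bar_add cone_alg 2 f h \<in> lc_cocycles cone_alg 2 e"
  "f \<in> lc_cocycles cone_alg 2 e \<Longrightarrow> bar_smult cone_alg 2 c f \<in> lc_cocycles cone_alg 2 e"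
  "f \<in> lc_cocycles cone_alg 2 e \<Longrightarrow> b \<in> Cdeg (int n) \<Longrightarrow> bar_act cone_alg 2 b f \<in> lc_cocycles cone_alg 2 (e + int n)"
  using lc_add_closed lc_smult_closed bar_act_closed by (fastforce simp: lc_cone)+

text \<open>
  The classes of degree \<open>-2\<close> correspond to multiples of the augmentation, so \<open>g\<close> acts on them by a scalar. Any other
  class is moved to degree \<open>-2\<close> by the module action, since a functional on \<open>A\<close> is evaluated at \<open>a\<close> by acting with \<open>a\<close> and
  evaluating at \<open>1\<close>.
\<close>
lemma push_scalar_exists:
  fixes g :: "'k::field cone \<Rightarrow> 'k cone"
  assumes "cone_aut g"
  shows "\<exists>c. c \<noteq> 0 \<and> push_scalar g c"
proof -
  interpret graded_isomorphism cone_alg cone_alg g using assms by (rule cone_aut_isomorphism)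
  obtain f1 where f1: "f1 \<in> lc_cocycles cone_alg 2 (- 2)" "cone_dual (- 2) f1 = (eps :: 'k cone \<Rightarrow> 'k)"
    using cone_dual_surj[of eps "- 2"] eps_dual by auto
  \<comment> \<open>The image under \<open>g\<close> of the class that corresponds to the augmentation.\<close>
  define c where "c = cone_dual (- 2) (bt 2 f1) 1"
  have fn: "f \<in> bar_args cone_alg 2 \<rightarrow> carrier cone_alg" for f :: "'k cone list \<Rightarrow> 'k cone" by simp
  have push1: "cone_dual (- 2) (bt 2 f) 1 = cone_dual (- 2) f 1 * c" if f: "f \<in> lc_cocycles cone_alg 2 (- 2)" for f
  proof -
    define s where "s = cone_dual (- 2) f 1"
    have "cone_dual (- 2) f a = s * eps a" for a
    proof (rule additive_eqI[of "cone_dual (- 2) f" "\<lambda>a. s * eps a"])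
      note D = dual_part_coneD[OF cone_dual_in_dual_part[OF f]]
      show "cone_dual (- 2) f (a + b) = cone_dual (- 2) f a + cone_dual (- 2) f b" for a b by (rule D)
      show "s * eps (a + b) = s * eps a + s * eps b" for a b by (simp add: eps_add algebra_simps)
      fix n and a :: "'k cone" assume a: "a \<in> Cdeg (int n)"
      show "cone_dual (- 2) f a = s * eps a"
      proof (cases "n = 0")
        case True
        then have "a = csc (eps a) 1" using Cdeg_zero_const[of a] a by (simp add: eps_def)
        then show ?thesis using D(2)[of "eps a" 1] by (simp add: s_def)
      qed (use D(3)[of n a] a eps_Cdeg[OF a] in simp)
    qed
    then have "cone_dual (- 2) (bar_add cone_alg 2 f (bar_smult cone_alg 2 (- s) f1)) a = 0" for a
      by (simp add: cone_dual_add cone_dual_smult lc_closed f f1)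
    then have "bar_add cone_alg 2 f (bar_smult cone_alg 2 (- s) f1) \<in> lc_coboundaries cone_alg 2 (- 2)"
      using cone_dual_coboundary[OF lc_closed(1)[OF f lc_closed(2)[OF f1(1)]]] by blast
    then have b: "bar_add cone_alg 2 (bt 2 f) (bar_smult cone_alg 2 (- s) (bt 2 f1)) \<in> lc_coboundaries cone_alg 2 (- 2)"
      using bt_lc_coboundaries by (simp only: bt_bar_add[OF fn fn, symmetric] bt_bar_smult[OF fn, symmetric])
    have "cone_dual (- 2) (bar_add cone_alg 2 (bt 2 f) (bar_smult cone_alg 2 (- s) (bt 2 f1))) 1 = 0"
      using b cone_dual_coboundary[OF lc_closed(1)[OF bt_lc_cocycles[OF f] lc_closed(2)[OF bt_lc_cocycles[OF f1(1)]]]] by blast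
    then have "cone_dual (- 2) (bt 2 f) 1 + - s * cone_dual (- 2) (bt 2 f1) 1 = 0"
      by (simp only: cone_dual_add[OF bt_lc_cocycles[OF f] lc_closed(2)[OF bt_lc_cocycles[OF f1(1)]]]
          cone_dual_smult[OF bt_lc_cocycles[OF f1(1)]])
    then show ?thesis by (simp add: c_def s_def)
  qed
  have "push_scalar g c"
    unfolding push_scalar_def
  proof (intro allI ballI)
    fix e and f :: "'k cone list \<Rightarrow> 'k cone" and a assume f: "f \<in> lc_cocycles cone_alg 2 e"
    note D = dual_part_coneD[OF cone_dual_in_dual_part[OF f]]
    note D' = dual_part_coneD[OF cone_dual_in_dual_part[OF bt_lc_cocycles[OF f]]]
    have "cone_dual e (bt 2 f) a = c * cone_dual e f (\<theta>' a)"
    proof (rule additive_eqI[of "cone_dual e (bt 2 f)" "\<lambda>a. c * cone_dual e f (\<theta>' a)"])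
      show "cone_dual e (bt 2 f) (a + b) = cone_dual e (bt 2 f) a + cone_dual e (bt 2 f) b" for a b by (rule D')
      show "c * cone_dual e f (\<theta>' (a + b)) = c * cone_dual e f (\<theta>' a) + c * cone_dual e f (\<theta>' b)" for a b
        using \<theta>'_add[of a b] by (simp add: D algebra_simps)
      fix n and a :: "'k cone" assume a: "a \<in> Cdeg (int n)"
      then have b: "\<theta>' a \<in> Cdeg (int n)" using \<theta>'_part[of a n] by simp
      show "cone_dual e (bt 2 f) a = c * cone_dual e f (\<theta>' a)"
      proof (cases "int n = - (e + 2)")
        case True
        then have en: "e + int n = - 2" by simp
        have "cone_dual e (bt 2 f) a = cone_dual (- 2) (bar_act cone_alg 2 a (bt 2 f)) 1"
          using cone_dual_act[OF bt_lc_cocycles[OF f] a, of 1] by (simp add: en)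
        also have "bar_act cone_alg 2 a (bt 2 f) = bt 2 (bar_act cone_alg 2 (\<theta>' a) f)"
          using bt_bar_act[of "\<theta>' a" 2 f] \<theta>_\<theta>'[of a] by simp
        also have "cone_dual (- 2) \<dots> 1 = cone_dual (- 2) (bar_act cone_alg 2 (\<theta>' a) f) 1 * c"
          by (rule push1) (use lc_closed(3)[OF f b] en in simp)
        also have "cone_dual (- 2) (bar_act cone_alg 2 (\<theta>' a) f) 1 = cone_dual e f (\<theta>' a)"
          using cone_dual_act[OF f b, of 1] by (simp add: en)
        finally show ?thesis by simp
      qed (use a b D(3) D'(3) in simp)
    qed
    then show "cone_dual e (bar_push cone_alg 2 g f) a = c * cone_dual e f (inv_into UNIV g a)"
      by (simp add: bar_push_transport)
  qed
  moreover have "c \<noteq> 0"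
  proof
    assume "c = 0"
    then have "\<forall>a. cone_dual (- 2) (bt 2 f1) a = 0"
      using calculation f1(1) by (auto simp: push_scalar_def bar_push_transport)
    then have "f1 \<in> lc_coboundaries cone_alg 2 (- 2)"
      using cone_dual_coboundary[OF bt_lc_cocycles[OF f1(1)]] bt_lc_coboundaries_iff[OF f1(1)] by blast
    then have "eps 1 = (0 :: 'k)" using cone_dual_coboundary[OF f1(1)] f1(2) by metis
    then show False by (simp add: eps_1)
  qed
  ultimately show ?thesis by blast
qed

text \<open>
  The class that \<open>\<Phi>\<close> sends to the augmentation is killed by all elements of positive degree. This property does not
  depend on \<open>\<Phi>\<close>, so \<open>cone_dual\<close> sends the class to a multiple of the augmentation as well, and the scalars can be
  compared there.
\<close>
lemma push_scalar_unique:
  fixes g :: "'k::field cone \<Rightarrow> 'k cone"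
  assumes g: "cone_aut g" and c: "push_scalar g c"
    and \<Phi>: "lc_dual_iso cone_alg 2 l \<Phi>"
    and c': "\<forall>e. \<forall>f\<in>lc_cocycles cone_alg 2 e. \<forall>a\<in>carrier cone_alg.
        \<Phi> e (bar_push cone_alg 2 g f) a = c' * \<Phi> e f (inv_into (carrier cone_alg) g a)"
  shows "c' = c"
proof -
  interpret graded_isomorphism cone_alg cone_alg g using g by (rule cone_aut_isomorphism)
  interpret inv: graded_isomorphism cone_alg cone_alg \<theta>' by (rule inverse_iso)
  have inv_aut: "cone_aut \<theta>'" using inv.iso by (simp add: cone_aut_def)
  note P = \<Phi>[unfolded lc_dual_iso_def cone_alg_simps]
  have P1: "\<Phi> e ` lc_cocycles cone_alg 2 e = dual_part cone_alg (e + l)" for e by (rule P[THEN conjunct1, rule_format])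
  have P2: "\<Phi> e (bar_add cone_alg 2 f h) a = \<Phi> e f a + \<Phi> e h a"
    if "f \<in> lc_cocycles cone_alg 2 e" "h \<in> lc_cocycles cone_alg 2 e" for e f h a
    by (rule P[THEN conjunct2, THEN conjunct1, rule_format]) (use that in auto)
  have P3: "\<Phi> e (bar_smult cone_alg 2 c f) a = c * \<Phi> e f a" if "f \<in> lc_cocycles cone_alg 2 e" for e c f a
    by (rule P[THEN conjunct2, THEN conjunct2, THEN conjunct1, rule_format]) (use that in auto)
  have P4: "(\<forall>a\<in>UNIV. \<Phi> e f a = 0) \<longleftrightarrow> f \<in> lc_coboundaries cone_alg 2 e" if "f \<in> lc_cocycles cone_alg 2 e" for e f
    by (rule P[THEN conjunct2, THEN conjunct2, THEN conjunct2, THEN conjunct1, rule_format]) (use that in auto)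
  have P5: "\<Phi> (e + int n) (bar_act cone_alg 2 b f) a = \<Phi> e f (a * b)"
    if "f \<in> lc_cocycles cone_alg 2 e" "b \<in> Cdeg (int n)" for e n f b a
    by (rule P[THEN conjunct2, THEN conjunct2, THEN conjunct2, THEN conjunct2, rule_format]) (use that in auto)
  have "eps \<in> \<Phi> (- l) ` lc_cocycles cone_alg 2 (- l)" unfolding P1 using eps_dual by simp
  then obtain f where f: "f \<in> lc_cocycles cone_alg 2 (- l)" and \<Phi>f: "\<Phi> (- l) f = eps" by (metis imageE)
  define s where "s = cone_dual (- l) f 1"
  note D = dual_part_coneD[OF cone_dual_in_dual_part[OF f]]
  have Df: "cone_dual (- l) f a = s * eps a" for a
  proof (rule additive_eqI[of "cone_dual (- l) f" "\<lambda>a. s * eps a"])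
    show "cone_dual (- l) f (a + b) = cone_dual (- l) f a + cone_dual (- l) f b" for a b by (rule D)
    show "s * eps (a + b) = s * eps a + s * eps b" for a b by (simp add: eps_add algebra_simps)
    fix n and a :: "'k cone" assume a: "a \<in> Cdeg (int n)"
    show "cone_dual (- l) f a = s * eps a"
    proof (cases "n = 0")
      case True
      then have "a = csc (eps a) 1" using Cdeg_zero_const[of a] a by (simp add: eps_def)
      then show ?thesis using D(2)[of "eps a" 1] by (simp add: s_def)
    next
      case False
      have ba: "bar_act cone_alg 2 a f \<in> lc_cocycles cone_alg 2 (- l + int n)" by (rule lc_closed(3)[OF f a])
      have "\<Phi> (- l + int n) (bar_act cone_alg 2 a f) u = 0" for u
      proof -
        have "eps (u * a) = 0"
        proof (rule additive_eqI[of "\<lambda>u. eps (u * a)" "\<lambda>_. 0"])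
          fix m and u :: "'k cone" assume "u \<in> Cdeg (int m)"
          then have "u * a \<in> Cdeg (int m + int n)" using a by (rule Cdeg_mult)
          then show "eps (u * a) = 0" using eps_Cdeg[of "u * a" "int m + int n"] False by simp
        qed (simp_all add: eps_add algebra_simps)
        then show ?thesis using P5[OF f a] \<Phi>f by simp
      qed
      then have "bar_act cone_alg 2 a f \<in> lc_coboundaries cone_alg 2 (- l + int n)" using P4[OF ba] by blast
      then have "cone_dual (- l + int n) (bar_act cone_alg 2 a f) 1 = 0" using cone_dual_coboundary[OF ba] by blast
      then have "cone_dual (- l) f a = 0" using cone_dual_act[OF f a, of 1] by simp
      then show ?thesis using eps_Cdeg[OF a] False by simp
    qed
  qed
  have pf: "bar_push cone_alg 2 g f \<in> lc_cocycles cone_alg 2 (- l)"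
    using bt_lc_cocycles[OF f] by (simp add: bar_push_transport)
  have "cone_dual (- l) (bar_push cone_alg 2 g f) a = c * cone_dual (- l) f a" for a
    using c f Df eps_aut[OF inv_aut, of a] by (simp add: push_scalar_def)
  then have "cone_dual (- l) (bar_add cone_alg 2 (bar_push cone_alg 2 g f) (bar_smult cone_alg 2 (- c) f)) a = 0" for a
    by (simp add: cone_dual_add cone_dual_smult lc_closed f pf)
  then have "bar_add cone_alg 2 (bar_push cone_alg 2 g f) (bar_smult cone_alg 2 (- c) f) \<in> lc_coboundaries cone_alg 2 (- l)"
    using cone_dual_coboundary[OF lc_closed(1)[OF pf lc_closed(2)[OF f]]] by blast
  then have "\<Phi> (- l) (bar_add cone_alg 2 (bar_push cone_alg 2 g f) (bar_smult cone_alg 2 (- c) f)) 1 = 0"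
    using P4[OF lc_closed(1)[OF pf lc_closed(2)[OF f]]] by blast
  then have "\<Phi> (- l) (bar_push cone_alg 2 g f) 1 + - c * \<Phi> (- l) f 1 = 0"
    by (simp only: P2[OF pf lc_closed(2)[OF f]] P3[OF f])
  moreover have "\<Phi> (- l) (bar_push cone_alg 2 g f) 1 = c' * \<Phi> (- l) f (\<theta>' 1)" using c' f by simp
  ultimately show ?thesis using eps_aut[OF inv_aut, of 1] by (simp add: \<Phi>f eps_1)
qed

lemma hdet_cone:
  assumes g: "cone_aut g" and c: "push_scalar g c" "c \<noteq> 0"
  shows "hdet cone_alg g = inverse c"
  unfolding hdet_def inj_dim_cone
proof (rule the_equality)
  show "\<exists>c' l \<Phi>. c' \<noteq> 0 \<and> lc_dual_iso cone_alg 2 l \<Phi> \<and>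
     (\<forall>e. \<forall>f\<in>lc_cocycles cone_alg 2 e. \<forall>a\<in>carrier cone_alg.
        \<Phi> e (bar_push cone_alg 2 g f) a = c' * \<Phi> e f (inv_into (carrier cone_alg) g a)) \<and> inverse c = inverse c'"
    using c cone_duality by (intro exI[of _ c] exI[of _ 2] exI[of _ cone_dual]) (simp add: push_scalar_def)
next
  fix h assume "\<exists>c' l \<Phi>. c' \<noteq> 0 \<and> lc_dual_iso cone_alg 2 l \<Phi> \<and>
     (\<forall>e. \<forall>f\<in>lc_cocycles cone_alg 2 e. \<forall>a\<in>carrier cone_alg.
        \<Phi> e (bar_push cone_alg 2 g f) a = c' * \<Phi> e f (inv_into (carrier cone_alg) g a)) \<and> h = inverse c'"
  then obtain c' l \<Phi> where 1: "lc_dual_iso cone_alg 2 l \<Phi>" and h: "h = inverse c'"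
    and 2: "\<forall>e. \<forall>f\<in>lc_cocycles cone_alg 2 e. \<forall>a\<in>carrier cone_alg.
        \<Phi> e (bar_push cone_alg 2 g f) a = c' * \<Phi> e f (inv_into (carrier cone_alg) g a)" by (elim exE conjE)
  show "h = inverse c" unfolding h push_scalar_unique[OF g c(1) 1 2] ..
qed

lemma cone_aut_comp:
  assumes g: "cone_aut g" and h: "cone_aut h"
  shows "cone_aut (g \<circ> h)"
proof -
  interpret g: graded_isomorphism cone_alg cone_alg g using g by (rule cone_aut_isomorphism)
  interpret h: graded_isomorphism cone_alg cone_alg h using h by (rule cone_aut_isomorphism)
  show ?thesis
    unfolding cone_aut_def graded_iso_def
    using bij_betw_trans[OF h.bij g.bij] ring_hom_trans[OF h.hom.homh g.hom.homh] h.\<theta>_smult g.\<theta>_smult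
      h.part_image g.part_image by (auto simp flip: image_image simp: image_comp[symmetric])
qed

text \<open>
  Scalars multiply because pushing cochains forward is functorial.
\<close>
theorem hdet_cone_mult:
  assumes g: "cone_aut g" and h: "cone_aut h"
  shows "hdet cone_alg (g \<circ> h) = hdet cone_alg g * hdet cone_alg h" "hdet cone_alg g \<noteq> 0"
proof -
  interpret g: graded_isomorphism cone_alg cone_alg g using g by (rule cone_aut_isomorphism)
  interpret h: graded_isomorphism cone_alg cone_alg h using h by (rule cone_aut_isomorphism)
  obtain c where c: "c \<noteq> 0" "push_scalar g c" using push_scalar_exists[OF g] by blast
  obtain d where d: "d \<noteq> 0" "push_scalar h d" using push_scalar_exists[OF h] by blast
  have bg: "bij g" and bh: "bij h" using g.bij h.bij by auto
  have inv: "inv_into UNIV (g \<circ> h) = inv_into UNIV h \<circ> inv_into UNIV g" by (rule o_inv_distrib[OF bg bh])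
  have push: "bar_push cone_alg 2 (g \<circ> h) f = bar_push cone_alg 2 g (bar_push cone_alg 2 h f)" for f
    by (auto simp: bar_push_def bar_args_cone inv fun_eq_iff)
  have "push_scalar (g \<circ> h) (c * d)"
    unfolding push_scalar_def push inv
    using c(2) d(2) h.bt_lc_cocycles by (auto simp: push_scalar_def bar_push_transport)
  then show "hdet cone_alg (g \<circ> h) = hdet cone_alg g * hdet cone_alg h"
    using hdet_cone[OF g c(2,1)] hdet_cone[OF h d(2,1)] hdet_cone[OF cone_aut_comp[OF g h], of "c * d"] c d
    by simp
  show "hdet cone_alg g \<noteq> 0" using hdet_cone[OF g c(2,1)] c by simp
qed

section \<open>Recognizing the associated graded algebra\<close>

text \<open>
  The convolution formula matches the multiplication of the associated graded algebra.
\<close>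
lemma hcomp_mult: "hcomp (int n) (a * b) = (\<Sum>i\<le>n. hcomp (int i) a * hcomp (int (n - i)) b)"
proof -
  obtain N1 where N1: "\<And>m. m \<ge> N1 \<Longrightarrow> hcomp (int m) a = 0" using hcomp_bounded by blast
  obtain N2 where N2: "\<And>m. m \<ge> N2 \<Longrightarrow> hcomp (int m) b = 0" using hcomp_bounded by blast
  define N where "N = Suc (n + N1 + N2)"
  have a: "a = (\<Sum>i<N. hcomp (int i) a)" and b: "b = (\<Sum>i<N. hcomp (int i) b)"
    by (rule hcomp_sum_eq[symmetric]; simp add: N1 N2 N_def)+
  have "hcomp (int n) (a * b) = hcomp (int n) ((\<Sum>i<N. hcomp (int i) a) * (\<Sum>i<N. hcomp (int i) b))"
    using arg_cong2[OF a b, of "\<lambda>a b. hcomp (int n) (a * b)"] .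
  also have "\<dots>
      = (\<Sum>i<N. \<Sum>j<N. if int n = int i + int j then hcomp (int i) a * hcomp (int j) b else 0)"
    by (simp add: sum_product hcomp_sum hcomp_of_Cdeg[OF Cdeg_mult[OF hcomp_Cdeg hcomp_Cdeg]])
  also have "\<dots> = (\<Sum>i<N. if i \<le> n then hcomp (int i) a * hcomp (int (n - i)) b else 0)"
  proof (rule sum.cong[OF refl])
    fix i
    show "(\<Sum>j<N. if int n = int i + int j then hcomp (int i) a * hcomp (int j) b else 0)
      = (if i \<le> n then hcomp (int i) a * hcomp (int (n - i)) b else 0)"
    proof (cases "i \<le> n")
      case True
      then have "(int n = int i + int j) = (j = n - i)" for j by linarith
      moreover have "n - i < N" by (simp add: N_def)
      ultimately show ?thesis using True by (simp add: sum.delta del: of_nat_diff)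
    next
      case False
      then have "int n \<noteq> int i + int j" for j by linarith
      then show ?thesis using False by simp
    qed
  qed
  also have "\<dots> = (\<Sum>i\<le>n. hcomp (int i) a * hcomp (int (n - i)) b)"
    by (rule sum.mono_neutral_cong_right) (auto simp: N_def)
  finally show ?thesis .
qed

text \<open>
  A filtered algebra with principal symbols in \<open>A\<close>: the map \<open>\<sigma> n\<close> identifies \<open>F n / F (n - 1)\<close> with the part of degree \<open>n\<close>,
  and products of elements have the product of the symbols as their symbol.
\<close>
locale symbols =
  fixes R :: "('k::field, 'r, 'm) module_scheme" and F :: "nat \<Rightarrow> 'r set" and \<sigma> :: "nat \<Rightarrow> 'r \<Rightarrow> 'k cone"
  assumes ring: "ring R"
    and F_carrier: "r \<in> F n \<Longrightarrow> r \<in> carrier R"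
    and F_Suc: "r \<in> F n \<Longrightarrow> r \<in> F (Suc n)"
    and F_exhausts: "r \<in> carrier R \<Longrightarrow> \<exists>n. r \<in> F n"
    and F_zero: "\<zero>\<^bsub>R\<^esub> \<in> F n"
    and F_add: "r \<in> F n \<Longrightarrow> s \<in> F n \<Longrightarrow> r \<oplus>\<^bsub>R\<^esub> s \<in> F n"
    and F_uminus: "r \<in> F n \<Longrightarrow> \<ominus>\<^bsub>R\<^esub> r \<in> F n"
    and F_smult: "r \<in> F n \<Longrightarrow> c \<odot>\<^bsub>R\<^esub> r \<in> F n"
    and F_one: "\<one>\<^bsub>R\<^esub> \<in> F 0"
    and F_mult: "r \<in> F n \<Longrightarrow> s \<in> F m \<Longrightarrow> r \<otimes>\<^bsub>R\<^esub> s \<in> F (n + m)"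
    and \<sigma>_Cdeg: "r \<in> F n \<Longrightarrow> \<sigma> n r \<in> Cdeg (int n)"
    and \<sigma>_add: "r \<in> F n \<Longrightarrow> s \<in> F n \<Longrightarrow> \<sigma> n (r \<oplus>\<^bsub>R\<^esub> s) = \<sigma> n r + \<sigma> n s"
    and \<sigma>_smult: "r \<in> F n \<Longrightarrow> \<sigma> n (c \<odot>\<^bsub>R\<^esub> r) = csc c (\<sigma> n r)"
    and \<sigma>_mult: "r \<in> F n \<Longrightarrow> s \<in> F m \<Longrightarrow> \<sigma> (n + m) (r \<otimes>\<^bsub>R\<^esub> s) = \<sigma> n r * \<sigma> m s"
    and \<sigma>_one: "\<sigma> 0 \<one>\<^bsub>R\<^esub> = 1"
    and \<sigma>_kernel: "r \<in> F n \<Longrightarrow> \<sigma> n r = 0 \<longleftrightarrow> r \<in> F_prev R F n"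
    and \<sigma>_surj: "a \<in> Cdeg (int n) \<Longrightarrow> \<exists>r\<in>F n. \<sigma> n r = a"
begin

sublocale R: ring R by (rule ring)

lemma F_prev_F: "r \<in> F_prev R F n \<Longrightarrow> r \<in> F n"
  by (auto simp: F_prev_def F_zero F_Suc split: nat.splits)

lemma F_prev_zero: "\<zero>\<^bsub>R\<^esub> \<in> F_prev R F n"
  by (auto simp: F_prev_def F_zero split: nat.splits)

lemma \<sigma>_zero: "\<sigma> n \<zero>\<^bsub>R\<^esub> = 0"
  using \<sigma>_kernel[OF F_zero] F_prev_zero by blast

lemma \<sigma>_uminus: "r \<in> F n \<Longrightarrow> \<sigma> n (\<ominus>\<^bsub>R\<^esub> r) = - \<sigma> n r"
proof -
  assume r: "r \<in> F n"
  have "\<sigma> n (r \<oplus>\<^bsub>R\<^esub> (\<ominus>\<^bsub>R\<^esub> r)) = 0" using F_carrier[OF r] by (simp add: R.r_neg \<sigma>_zero)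
  then show ?thesis by (simp add: \<sigma>_add r F_uminus eq_neg_iff_add_eq_0 add.commute)
qed

lemma same_symbol_iff:
  assumes r: "r \<in> F n" and s: "s \<in> F n"
  shows "\<sigma> n r = \<sigma> n s \<longleftrightarrow> r \<oplus>\<^bsub>R\<^esub> (\<ominus>\<^bsub>R\<^esub> s) \<in> F_prev R F n"
  using \<sigma>_kernel[OF F_add[OF r F_uminus[OF s]]] by (simp add: \<sigma>_add r s F_uminus \<sigma>_uminus)

lemma gr_class_eq:
  assumes s: "s n \<in> F n"
  shows "gr_class R F s n = {r \<in> F n. \<sigma> n r = \<sigma> n (s n)}"
proof (rule Set.set_eqI)
  fix r
  have "r \<in> gr_class R F s n \<longleftrightarrow> (\<exists>h\<in>F_prev R F n. r = h \<oplus>\<^bsub>R\<^esub> s n)"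
    by (auto simp: gr_class_def a_r_coset_def')
  also have "\<dots> \<longleftrightarrow> r \<in> F n \<and> \<sigma> n r = \<sigma> n (s n)"
  proof
    assume "\<exists>h\<in>F_prev R F n. r = h \<oplus>\<^bsub>R\<^esub> s n"
    then obtain h where h: "h \<in> F_prev R F n" "r = h \<oplus>\<^bsub>R\<^esub> s n" by blast
    then show "r \<in> F n \<and> \<sigma> n r = \<sigma> n (s n)"
      using F_prev_F[OF h(1)] \<sigma>_kernel[of h n] s by (simp add: F_add \<sigma>_add)
  next
    assume r: "r \<in> F n \<and> \<sigma> n r = \<sigma> n (s n)"
    then have "r \<oplus>\<^bsub>R\<^esub> (\<ominus>\<^bsub>R\<^esub> s n) \<in> F_prev R F n" using same_symbol_iff s by blast
    moreover have "r = (r \<oplus>\<^bsub>R\<^esub> (\<ominus>\<^bsub>R\<^esub> s n)) \<oplus>\<^bsub>R\<^esub> s n"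
      using F_carrier[of r n] F_carrier[OF s] r by (simp add: R.a_assoc R.l_neg)
    ultimately show "\<exists>h\<in>F_prev R F n. r = h \<oplus>\<^bsub>R\<^esub> s n" by blast
  qed
  finally show "r \<in> gr_class R F s n \<longleftrightarrow> r \<in> {r \<in> F n. \<sigma> n r = \<sigma> n (s n)}" by simp
qed

lemma gr_class_cong:
  assumes "\<And>n. s n \<in> F n" "\<And>n. s' n \<in> F n"
  shows "gr_class R F s = gr_class R F s' \<longleftrightarrow> (\<forall>n. \<sigma> n (s n) = \<sigma> n (s' n))"
  using assms by (auto simp: fun_eq_iff gr_class_eq)

lemma gr_rep_class:
  assumes s: "\<And>n. s n \<in> F n"
  shows "gr_rep (gr_class R F s) n \<in> F n" "\<sigma> n (gr_rep (gr_class R F s) n) = \<sigma> n (s n)"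
proof -
  have "s n \<in> gr_class R F s n" using s by (simp add: gr_class_eq)
  then have "gr_rep (gr_class R F s) n \<in> gr_class R F s n" unfolding gr_rep_def by (rule someI)
  then show "gr_rep (gr_class R F s) n \<in> F n" "\<sigma> n (gr_rep (gr_class R F s) n) = \<sigma> n (s n)"
    using s by (auto simp: gr_class_eq)
qed

lemma F_finsum:
  "(\<And>i. i \<in> S \<Longrightarrow> f i \<in> F n) \<Longrightarrow> finsum R f S \<in> F n \<and> \<sigma> n (finsum R f S) = (\<Sum>i\<in>S. \<sigma> n (f i))"
proof (induction S rule: infinite_finite_induct)
  case (insert x S)
  have fx: "f x \<in> F n" and fS: "finsum R f S \<in> F n" "\<sigma> n (finsum R f S) = (\<Sum>i\<in>S. \<sigma> n (f i))"
    using insert by auto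
  have c: "f \<in> S \<rightarrow> carrier R" "f x \<in> carrier R" using insert.prems F_carrier by auto
  show ?case
    using R.finsum_insert[OF insert(1,2) c] insert(1,2) by (simp add: F_add \<sigma>_add fx fS)
qed (auto simp: F_zero \<sigma>_zero)

abbreviation "gr \<equiv> gr_alg R F"

lemma gr_sel [simp]:
  "carrier gr = gr_carrier R F" "one gr = gr_class R F (\<lambda>n. if n = 0 then \<one>\<^bsub>R\<^esub> else \<zero>\<^bsub>R\<^esub>)"
  "zero gr = gr_class R F (\<lambda>n. \<zero>\<^bsub>R\<^esub>)"
  "part gr n = {u \<in> gr_carrier R F. \<forall>m. m \<noteq> n \<longrightarrow> u m = F_prev R F m}"
  by (simp_all add: gr_alg_def)

lemma gr_add:
  assumes "\<And>n. s n \<in> F n" "\<And>n. s' n \<in> F n"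
  shows "gr_class R F s \<oplus>\<^bsub>gr\<^esub> gr_class R F s' = gr_class R F (\<lambda>n. s n \<oplus>\<^bsub>R\<^esub> s' n)"
  unfolding gr_alg_def ring.simps
  by (subst gr_class_cong) (simp_all add: assms F_add \<sigma>_add gr_rep_class)

lemma gr_smult:
  assumes "\<And>n. s n \<in> F n"
  shows "c \<odot>\<^bsub>gr\<^esub> gr_class R F s = gr_class R F (\<lambda>n. c \<odot>\<^bsub>R\<^esub> s n)"
  unfolding gr_alg_def module.simps
  by (subst gr_class_cong) (simp_all add: assms F_smult \<sigma>_smult gr_rep_class)

lemma F_conv:
  assumes "\<And>n. s n \<in> F n" "\<And>n. s' n \<in> F n"
  shows "(\<Oplus>\<^bsub>R\<^esub>i\<in>{..n}. s i \<otimes>\<^bsub>R\<^esub> s' (n - i)) \<in> F n"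
    and "\<sigma> n (\<Oplus>\<^bsub>R\<^esub>i\<in>{..n}. s i \<otimes>\<^bsub>R\<^esub> s' (n - i)) = (\<Sum>i\<le>n. \<sigma> i (s i) * \<sigma> (n - i) (s' (n - i)))"
proof -
  have m: "s i \<otimes>\<^bsub>R\<^esub> s' (n - i) \<in> F n \<and> \<sigma> n (s i \<otimes>\<^bsub>R\<^esub> s' (n - i)) = \<sigma> i (s i) * \<sigma> (n - i) (s' (n - i))" if "i \<le> n" for i
    using F_mult[OF assms(1)[of i] assms(2)[of "n - i"]] \<sigma>_mult[OF assms(1)[of i] assms(2)[of "n - i"]] that by simp
  have *: "(\<Oplus>\<^bsub>R\<^esub>i\<in>{..n}. s i \<otimes>\<^bsub>R\<^esub> s' (n - i)) \<in> F n \<and> \<sigma> n (\<Oplus>\<^bsub>R\<^esub>i\<in>{..n}. s i \<otimes>\<^bsub>R\<^esub> s' (n - i))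
      = (\<Sum>i\<in>{..n}. \<sigma> n (s i \<otimes>\<^bsub>R\<^esub> s' (n - i)))"
    by (rule F_finsum) (use m in auto)
  then show "(\<Oplus>\<^bsub>R\<^esub>i\<in>{..n}. s i \<otimes>\<^bsub>R\<^esub> s' (n - i)) \<in> F n" by blast
  show "\<sigma> n (\<Oplus>\<^bsub>R\<^esub>i\<in>{..n}. s i \<otimes>\<^bsub>R\<^esub> s' (n - i)) = (\<Sum>i\<le>n. \<sigma> i (s i) * \<sigma> (n - i) (s' (n - i)))"
    unfolding *[THEN conjunct2] by (rule sum.cong) (use m in auto)
qed

lemma gr_mult:
  assumes "\<And>n. s n \<in> F n" "\<And>n. s' n \<in> F n"
  shows "gr_class R F s \<otimes>\<^bsub>gr\<^esub> gr_class R F s' = gr_class R F (\<lambda>n. \<Oplus>\<^bsub>R\<^esub>i\<in>{..n}. s i \<otimes>\<^bsub>R\<^esub> s' (n - i))"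
  unfolding gr_alg_def monoid.simps
proof (subst gr_class_cong)
  show "\<forall>n. \<sigma> n (\<Oplus>\<^bsub>R\<^esub>i\<in>{..n}. gr_rep (gr_class R F s) i \<otimes>\<^bsub>R\<^esub> gr_rep (gr_class R F s') (n - i))
      = \<sigma> n (\<Oplus>\<^bsub>R\<^esub>i\<in>{..n}. s i \<otimes>\<^bsub>R\<^esub> s' (n - i))"
    using F_conv(2)[of "gr_rep (gr_class R F s)" "gr_rep (gr_class R F s')"] F_conv(2)[of s s'] assms
    by (simp add: gr_rep_class)
qed (intro F_conv(1) gr_rep_class assms)+

text \<open>
  A representative of a symbol. The zero symbol is lifted to zero, since elements of the associated graded algebra
  are families with finite support.
\<close>
definition lift :: "nat \<Rightarrow> 'k cone \<Rightarrow> 'r" where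
  "lift n a = (if a = 0 then \<zero>\<^bsub>R\<^esub> else SOME r. r \<in> F n \<and> \<sigma> n r = a)"

lemma lift: "a \<in> Cdeg (int n) \<Longrightarrow> lift n a \<in> F n" "a \<in> Cdeg (int n) \<Longrightarrow> \<sigma> n (lift n a) = a"
proof -
  assume "a \<in> Cdeg (int n)"
  then have "\<exists>r. r \<in> F n \<and> \<sigma> n r = a" using \<sigma>_surj by blast
  from someI_ex[OF this] show "lift n a \<in> F n" "\<sigma> n (lift n a) = a"
    by (auto simp: lift_def F_zero \<sigma>_zero)
qed

text \<open>
  The isomorphism from \<open>A\<close> to the associated graded algebra.
\<close>
definition \<kappa> :: "'k cone \<Rightarrow> nat \<Rightarrow> 'r set" where
  "\<kappa> a = gr_class R F (\<lambda>n. lift n (hcomp (int n) a))"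

lemma lift_hcomp: "lift n (hcomp (int n) a) \<in> F n" "\<sigma> n (lift n (hcomp (int n) a)) = hcomp (int n) a"
  by (rule lift[OF hcomp_Cdeg])+

lemma \<kappa>_eq_class: "(\<And>n. s n \<in> F n) \<Longrightarrow> \<kappa> a = gr_class R F s \<longleftrightarrow> (\<forall>n. hcomp (int n) a = \<sigma> n (s n))"
  unfolding \<kappa>_def by (subst gr_class_cong) (simp_all add: lift_hcomp)

lemma \<kappa>_carrier: "\<kappa> a \<in> gr_carrier R F"
proof -
  obtain N where N: "\<And>n. n \<ge> N \<Longrightarrow> hcomp (int n) a = 0" using hcomp_bounded by blast
  have "{n. lift n (hcomp (int n) a) \<noteq> \<zero>\<^bsub>R\<^esub>} \<subseteq> {..<N}"
    using N by (auto simp: lift_def not_less[symmetric])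
  then have "finite {n. lift n (hcomp (int n) a) \<noteq> \<zero>\<^bsub>R\<^esub>}" using finite_subset by blast
  then show ?thesis using lift_hcomp unfolding gr_carrier_def \<kappa>_def by blast
qed

lemma \<kappa>_surj: "u \<in> gr_carrier R F \<Longrightarrow> \<exists>a. u = \<kappa> a"
proof -
  assume "u \<in> gr_carrier R F"
  then obtain s where s: "u = gr_class R F s" "\<And>n. s n \<in> F n" "finite {n. s n \<noteq> \<zero>\<^bsub>R\<^esub>}"
    by (auto simp: gr_carrier_def)
  define S where "S = {n. s n \<noteq> \<zero>\<^bsub>R\<^esub>}"
  have "hcomp (int n) (\<Sum>m\<in>S. \<sigma> m (s m)) = \<sigma> n (s n)" for n
  proof -
    have "hcomp (int n) (\<Sum>m\<in>S. \<sigma> m (s m)) = (\<Sum>m\<in>S. if m = n then \<sigma> m (s m) else 0)"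
      unfolding hcomp_sum by (rule sum.cong) (auto simp: hcomp_of_Cdeg[OF \<sigma>_Cdeg[OF s(2)]])
    then show ?thesis using s(3) by (simp add: S_def \<sigma>_zero)
  qed
  then have "\<kappa> (\<Sum>m\<in>S. \<sigma> m (s m)) = u" using \<kappa>_eq_class[of s] s by simp
  then show ?thesis by blast
qed

lemma \<kappa>_inj: "\<kappa> a = \<kappa> b \<Longrightarrow> a = b"
proof -
  assume "\<kappa> a = \<kappa> b"
  then have "hcomp (int n) a = hcomp (int n) b" for n
    using \<kappa>_eq_class[of "\<lambda>n. lift n (hcomp (int n) b)" a] by (simp add: \<kappa>_def[of b] lift_hcomp)
  then show ?thesis by (rule hcomp_eqI)
qed

lemma \<kappa>_bij: "bij_betw \<kappa> UNIV (gr_carrier R F)"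
  unfolding bij_betw_def inj_on_def using \<kappa>_inj \<kappa>_carrier \<kappa>_surj by blast

lemma \<kappa>_add: "\<kappa> (a + b) = \<kappa> a \<oplus>\<^bsub>gr\<^esub> \<kappa> b"
  unfolding \<kappa>_def[of a] \<kappa>_def[of b]
  by (simp add: gr_add lift_hcomp \<kappa>_eq_class F_add \<sigma>_add hcomp_add)
lemma \<kappa>_smult: "\<kappa> (csc c a) = c \<odot>\<^bsub>gr\<^esub> \<kappa> a"
  unfolding \<kappa>_def[of a]
  by (simp add: gr_smult lift_hcomp \<kappa>_eq_class F_smult \<sigma>_smult hcomp_csc)
lemma \<kappa>_mult: "\<kappa> (a * b) = \<kappa> a \<otimes>\<^bsub>gr\<^esub> \<kappa> b"
  unfolding \<kappa>_def[of a] \<kappa>_def[of b]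
  using F_conv[of "\<lambda>n. lift n (hcomp (int n) a)" "\<lambda>n. lift n (hcomp (int n) b)"]
  by (simp add: gr_mult lift_hcomp \<kappa>_eq_class hcomp_mult del: of_nat_diff)
lemma \<kappa>_one: "\<kappa> 1 = one gr"
  by (simp add: \<kappa>_eq_class F_one F_zero \<sigma>_one \<sigma>_zero hcomp_of_Cdeg[OF one_Cdeg])
lemma \<kappa>_zero: "\<kappa> 0 = zero gr"
  by (simp add: \<kappa>_eq_class F_zero \<sigma>_zero)

lemma \<kappa>_part: "\<kappa> ` Cdeg (int n) = part gr n"
proof -
  have "\<kappa> a m = F_prev R F m \<longleftrightarrow> hcomp (int m) a = 0" for a m
  proof -
    have prev: "r \<in> F_prev R F m \<longleftrightarrow> r \<in> F m \<and> \<sigma> m r = 0" for r using \<sigma>_kernel F_prev_F by blast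
    have \<kappa>m: "r \<in> \<kappa> a m \<longleftrightarrow> r \<in> F m \<and> \<sigma> m r = hcomp (int m) a" for r
      unfolding \<kappa>_def using lift_hcomp by (subst gr_class_eq) auto
    obtain r where r: "r \<in> F m" "\<sigma> m r = hcomp (int m) a" using \<sigma>_surj hcomp_Cdeg by blast
    show ?thesis
    proof
      assume "\<kappa> a m = F_prev R F m"
      then show "hcomp (int m) a = 0" using r prev \<kappa>m by metis
    next
      assume "hcomp (int m) a = 0"
      then show "\<kappa> a m = F_prev R F m" by (intro Set.set_eqI) (simp add: prev \<kappa>m)
    qed
  qed
  moreover have "a \<in> Cdeg (int n) \<longleftrightarrow> (\<forall>m. m \<noteq> n \<longrightarrow> hcomp (int m) a = 0)" for a :: "'k cone"
  proof
    assume *: "\<forall>m. m \<noteq> n \<longrightarrow> hcomp (int m) a = 0"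
    have "hcomp (int n) a = a"
      by (rule hcomp_eqI) (use * in \<open>auto simp: hcomp_of_Cdeg[OF hcomp_Cdeg]\<close>)
    then show "a \<in> Cdeg (int n)" by (metis hcomp_Cdeg)
  qed (auto simp: hcomp_of_Cdeg)
  ultimately have "u \<in> part gr n \<longleftrightarrow> u \<in> \<kappa> ` Cdeg (int n)" for u
    using \<kappa>_carrier \<kappa>_surj by (auto simp: image_iff) metis
  then show ?thesis by blast
qed

lemma \<kappa>_ring_iso: "\<kappa> \<in> ring_iso cone_alg gr"
  by (rule ring_iso_memI) (use \<kappa>_bij in \<open>auto simp: \<kappa>_carrier \<kappa>_mult \<kappa>_add \<kappa>_one simp del: gr_sel(2)\<close>)

lemma ring_gr: "ring gr"
proof -
  have "ring (gr\<lparr>zero := \<kappa> \<zero>\<^bsub>cone_alg\<^esub>\<rparr>)" using \<kappa>_ring_iso by (rule cone.ring_iso_imp_img_ring)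
  moreover have "gr\<lparr>zero := \<kappa> \<zero>\<^bsub>cone_alg\<^esub>\<rparr> = gr" unfolding cone_alg_simps \<kappa>_zero by simp
  ultimately show ?thesis by metis
qed

lemma graded_algebra_gr: "graded_algebra gr"
proof -
  have "c \<odot>\<^bsub>gr\<^esub> u \<in> carrier gr" if "u \<in> carrier gr" for c u
  proof -
    have "u \<in> gr_carrier R F" using that by simp
    then obtain a where "u = \<kappa> a" using \<kappa>_surj by blast
    then show ?thesis using \<kappa>_carrier[of "csc c a"] by (simp add: \<kappa>_smult)
  qed
  then show ?thesis using ring_gr by (auto simp: graded_algebra_def)
qed

lemma \<kappa>_graded_iso: "graded_iso cone_alg gr \<kappa>"
  using \<kappa>_ring_iso \<kappa>_bij \<kappa>_part by (auto simp: graded_iso_def ring_iso_def \<kappa>_smult simp del: gr_sel(2-))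

sublocale \<kappa>: graded_isomorphism cone_alg gr \<kappa>
  by (intro graded_isomorphism.intro graded_algebra_cone graded_algebra_gr \<kappa>_graded_iso)

subsection \<open>The graded map of a filtered automorphism\<close>

lemma F_le: "r \<in> F n \<Longrightarrow> n \<le> m \<Longrightarrow> r \<in> F m"
  by (induction m) (auto simp: le_Suc_eq F_Suc)

text \<open>
  It lets preservation of degrees be expressed by preservation of the filtered pieces.
\<close>
lemma F_iff_fdeg: "r \<in> carrier R \<Longrightarrow> r \<in> F n \<longleftrightarrow> fdeg F r \<le> n"
proof
  assume r: "r \<in> carrier R"
  show "r \<in> F n \<Longrightarrow> fdeg F r \<le> n" unfolding fdeg_def by (rule Least_le)
  have "r \<in> F (fdeg F r)" unfolding fdeg_def using F_exhausts[OF r] by (rule LeastI_ex)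
  then show "fdeg F r \<le> n \<Longrightarrow> r \<in> F n" by (rule F_le)
qed

lemma filtered_autsD:
  assumes "g \<in> filtered_auts R F"
  shows "bij_betw g (carrier R) (carrier R)" "g \<in> ring_hom R R"
    "r \<in> carrier R \<Longrightarrow> g (c \<odot>\<^bsub>R\<^esub> r) = c \<odot>\<^bsub>R\<^esub> g r" "g ` F n = F n" "g \<in> extensional (carrier R)"
proof -
  show b: "bij_betw g (carrier R) (carrier R)" and "g \<in> ring_hom R R" "g \<in> extensional (carrier R)"
    and "r \<in> carrier R \<Longrightarrow> g (c \<odot>\<^bsub>R\<^esub> r) = c \<odot>\<^bsub>R\<^esub> g r"
    using assms by (auto simp: filtered_auts_def alg_auts_def alg_endos_def Bij_def)
  have deg: "fdeg F (g r) = fdeg F r" if "r \<in> carrier R" for r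
    using assms that by (auto simp: filtered_auts_def)
  have iff: "g r \<in> F n \<longleftrightarrow> r \<in> F n" if "r \<in> carrier R" for r
    using F_iff_fdeg[of r n] F_iff_fdeg[of "g r" n] deg[OF that] that b by (auto dest: bij_betwE)
  show "g ` F n = F n"
  proof safe
    fix r assume "r \<in> F n"
    then show "g r \<in> F n" using iff F_carrier by blast
  next
    fix r assume r: "r \<in> F n"
    then obtain s where "s \<in> carrier R" "g s = r" using b F_carrier by (metis bij_betw_imp_surj_on imageE)
    then show "r \<in> g ` F n" using iff r by blast
  qed
qed

context
  fixes g assumes g: "g \<in> filtered_auts R F"
begin

lemma g_F: "r \<in> F n \<Longrightarrow> g r \<in> F n" using filtered_autsD(4)[OF g] by blast

lemma g_hom: "ring_hom_ring R R g"
  using filtered_autsD(2)[OF g] ring by (intro ring_hom_ring.intro ring_hom_ring_axioms.intro)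

interpretation g: ring_hom_ring R R g by (rule g_hom)

lemma g_F_prev: "g ` F_prev R F n = F_prev R F n"
  using filtered_autsD(4)[OF g] by (auto simp: F_prev_def split: nat.split)

lemma g_symbol:
  assumes r: "r \<in> F n" and s: "s \<in> F n" and eq: "\<sigma> n r = \<sigma> n s"
  shows "\<sigma> n (g r) = \<sigma> n (g s)"
proof -
  have "r \<oplus>\<^bsub>R\<^esub> (\<ominus>\<^bsub>R\<^esub> s) \<in> F_prev R F n" using same_symbol_iff r s eq by blast
  then have "g (r \<oplus>\<^bsub>R\<^esub> (\<ominus>\<^bsub>R\<^esub> s)) \<in> F_prev R F n" using g_F_prev by blast
  then have "g r \<oplus>\<^bsub>R\<^esub> (\<ominus>\<^bsub>R\<^esub> g s) \<in> F_prev R F n" using F_carrier r s by simp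
  then show ?thesis using same_symbol_iff g_F r s by blast
qed

lemma gr_map_class:
  assumes s: "\<And>n. s n \<in> F n" and fin: "gr_class R F s \<in> gr_carrier R F"
  shows "gr_map R F g (gr_class R F s) = gr_class R F (\<lambda>n. g (s n))"
proof
  fix n
  have "gr_map R F g (gr_class R F s) n = g ` (F_prev R F n +>\<^bsub>R\<^esub> s n)"
    using fin by (simp add: gr_map_def) (simp add: gr_class_def)
  also have "\<dots> = (\<lambda>h. g (h \<oplus>\<^bsub>R\<^esub> s n)) ` F_prev R F n"
    by (auto simp: a_r_coset_def')
  also have "\<dots> = (\<lambda>h. h \<oplus>\<^bsub>R\<^esub> g (s n)) ` g ` F_prev R F n"
    unfolding image_image
  proof (rule image_cong[OF refl])
    fix h assume "h \<in> F_prev R F n"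
    then show "g (h \<oplus>\<^bsub>R\<^esub> s n) = g h \<oplus>\<^bsub>R\<^esub> g (s n)"
      using F_carrier[OF F_prev_F] F_carrier[OF s] by simp
  qed
  also have "\<dots> = F_prev R F n +>\<^bsub>R\<^esub> g (s n)"
    unfolding g_F_prev by (auto simp: a_r_coset_def')
  finally show "gr_map R F g (gr_class R F s) n = gr_class R F (\<lambda>n. g (s n)) n" by (simp add: gr_class_def)
qed

lemma gr_map_carrier: "u \<in> gr_carrier R F \<Longrightarrow> gr_map R F g u \<in> gr_carrier R F"
proof -
  assume u: "u \<in> gr_carrier R F"
  then obtain s where s: "u = gr_class R F s" "\<forall>n. s n \<in> F n" "finite {n. s n \<noteq> \<zero>\<^bsub>R\<^esub>}"
    unfolding gr_carrier_def by blast
  have "{n. g (s n) \<noteq> \<zero>\<^bsub>R\<^esub>} \<subseteq> {n. s n \<noteq> \<zero>\<^bsub>R\<^esub>}" by auto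
  then have "finite {n. g (s n) \<noteq> \<zero>\<^bsub>R\<^esub>}" using s(3) finite_subset by blast
  moreover have "gr_map R F g u = gr_class R F (\<lambda>n. g (s n))" unfolding s(1) by (rule gr_map_class) (use s u in auto)
  ultimately show ?thesis using g_F[OF s(2)[rule_format]] unfolding gr_carrier_def by blast
qed

text \<open>
  The associated graded automorphism, carried over to \<open>A\<close>.
\<close>
definition induced :: "'k cone \<Rightarrow> 'k cone" where
  "induced a = inv_into UNIV \<kappa> (gr_map R F g (\<kappa> a))"

lemma \<kappa>_induced: "\<kappa> (induced a) = gr_map R F g (\<kappa> a)"
  unfolding induced_def using gr_map_carrier[OF \<kappa>_carrier] \<kappa>.\<theta>_\<theta>' by simp

lemma \<kappa>_induced_class: "\<kappa> (induced a) = gr_class R F (\<lambda>n. g (lift n (hcomp (int n) a)))"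
  unfolding \<kappa>_induced unfolding \<kappa>_def using \<kappa>_carrier by (intro gr_map_class lift_hcomp) (simp add: \<kappa>_def)

lemma hcomp_induced: "hcomp (int n) (induced a) = \<sigma> n (g (lift n (hcomp (int n) a)))"
  using \<kappa>_eq_class[of "\<lambda>n. g (lift n (hcomp (int n) a))" "induced a"] \<kappa>_induced_class[of a]
    g_F[OF lift_hcomp(1)] by simp

text \<open>
  The symbol of the image depends on the symbol only, so any representative may be used to compute the induced map.
\<close>
lemma hcomp_induced':
  assumes r: "r \<in> F n" "\<sigma> n r = hcomp (int n) a"
  shows "hcomp (int n) (induced a) = \<sigma> n (g r)"
  unfolding hcomp_induced by (rule g_symbol) (simp_all add: lift_hcomp r)

lemma induced_add: "induced (a + b) = induced a + induced b"
proof (rule hcomp_eqI)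
  fix n
  have "hcomp (int n) (induced (a + b)) = \<sigma> n (g (lift n (hcomp (int n) a) \<oplus>\<^bsub>R\<^esub> lift n (hcomp (int n) b)))"
    by (rule hcomp_induced') (simp_all add: F_add lift_hcomp \<sigma>_add hcomp_add)
  then show "hcomp (int n) (induced (a + b)) = hcomp (int n) (induced a + induced b)"
    using F_carrier[OF lift_hcomp(1)] by (simp add: hcomp_add hcomp_induced \<sigma>_add g_F lift_hcomp)
qed

lemma induced_csc: "induced (csc c a) = csc c (induced a)"
proof (rule hcomp_eqI)
  fix n
  have "hcomp (int n) (induced (csc c a)) = \<sigma> n (g (c \<odot>\<^bsub>R\<^esub> lift n (hcomp (int n) a)))"
    by (rule hcomp_induced') (simp_all add: F_smult lift_hcomp \<sigma>_smult hcomp_csc)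
  then show "hcomp (int n) (induced (csc c a)) = hcomp (int n) (csc c (induced a))"
    using F_carrier[OF lift_hcomp(1)] filtered_autsD(3)[OF g] by (simp add: hcomp_csc hcomp_induced \<sigma>_smult g_F lift_hcomp)
qed

lemma induced_mult: "induced (a * b) = induced a * induced b"
proof (rule hcomp_eqI)
  fix n
  let ?s = "\<lambda>n. lift n (hcomp (int n) a)" and ?s' = "\<lambda>n. lift n (hcomp (int n) b)"
  have hom: "g (\<Oplus>\<^bsub>R\<^esub>i\<in>{..n}. ?s i \<otimes>\<^bsub>R\<^esub> ?s' (n - i)) = (\<Oplus>\<^bsub>R\<^esub>i\<in>{..n}. g (?s i) \<otimes>\<^bsub>R\<^esub> g (?s' (n - i)))"
  proof -
    have c: "?s i \<in> carrier R" "?s' i \<in> carrier R" for i using F_carrier lift_hcomp by blast+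
    have "g (finsum R (\<lambda>i. ?s i \<otimes>\<^bsub>R\<^esub> ?s' (n - i)) S) = finsum R (\<lambda>i. g (?s i) \<otimes>\<^bsub>R\<^esub> g (?s' (n - i))) S" if "finite S" for S
      using that
    proof (induction S)
      case (insert x S)
      then show ?case using c by (simp add: R.finsum_insert Pi_iff)
    qed simp
    then show ?thesis by simp
  qed
  have "hcomp (int n) (induced (a * b)) = \<sigma> n (g (\<Oplus>\<^bsub>R\<^esub>i\<in>{..n}. ?s i \<otimes>\<^bsub>R\<^esub> ?s' (n - i)))"
    using F_conv[of ?s ?s'] by (intro hcomp_induced') (simp_all add: lift_hcomp hcomp_mult del: of_nat_diff)
  also have "\<dots> = (\<Sum>i\<le>n. \<sigma> i (g (?s i)) * \<sigma> (n - i) (g (?s' (n - i))))"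
    unfolding hom by (rule F_conv(2)) (simp_all add: g_F lift_hcomp)
  also have "\<dots> = hcomp (int n) (induced a * induced b)"
    by (simp add: hcomp_mult hcomp_induced del: of_nat_diff)
  finally show "hcomp (int n) (induced (a * b)) = hcomp (int n) (induced a * induced b)" .
qed

lemma induced_one: "induced 1 = 1"
proof (rule hcomp_eqI)
  fix n
  have "hcomp (int n) (induced 1) = \<sigma> n (g (if n = 0 then \<one>\<^bsub>R\<^esub> else \<zero>\<^bsub>R\<^esub>))"
    by (rule hcomp_induced') (simp_all add: F_one F_zero \<sigma>_one \<sigma>_zero hcomp_of_Cdeg[OF one_Cdeg])
  then show "hcomp (int n) (induced 1) = hcomp (int n) 1"
    by (simp add: \<sigma>_one \<sigma>_zero hcomp_of_Cdeg[OF one_Cdeg])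
qed

lemma g_reflects: "r \<in> F n \<Longrightarrow> \<sigma> n (g r) = 0 \<Longrightarrow> \<sigma> n r = 0"
proof -
  assume r: "r \<in> F n" and "\<sigma> n (g r) = 0"
  then have "g r \<in> g ` F_prev R F n" using \<sigma>_kernel g_F g_F_prev by blast
  then obtain h where h: "h \<in> F_prev R F n" "g r = g h" by blast
  then have "r = h" using filtered_autsD(1)[OF g] F_carrier r F_prev_F
    by (metis bij_betw_def inj_onD)
  then show ?thesis using h \<sigma>_kernel r by blast
qed

lemma induced_Cdeg_iff: "induced ` Cdeg (int n) = Cdeg (int n)"
proof
  show "induced ` Cdeg (int n) \<subseteq> Cdeg (int n)"
  proof safe
    fix a :: "'k cone" assume a: "a \<in> Cdeg (int n)"
    have "hcomp (int n) (induced a) = induced a"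
    proof (rule hcomp_eqI)
      fix m
      show "hcomp (int m) (hcomp (int n) (induced a)) = hcomp (int m) (induced a)"
        using a by (cases "m = n") (simp_all add: hcomp_of_Cdeg[OF hcomp_Cdeg],
            simp add: hcomp_induced hcomp_of_Cdeg lift_def \<sigma>_zero)
    qed
    then show "induced a \<in> Cdeg (int n)" by (metis hcomp_Cdeg)
  qed
  show "Cdeg (int n) \<subseteq> induced ` Cdeg (int n)"
  proof
    fix a :: "'k cone" assume a: "a \<in> Cdeg (int n)"
    obtain r where r: "r \<in> F n" "\<sigma> n (g r) = a"
      using \<sigma>_surj[OF a] filtered_autsD(4)[OF g, of n] by (metis imageE)
    have "induced (\<sigma> n r) = a"
    proof (rule hcomp_eqI)
      fix m
      show "hcomp (int m) (induced (\<sigma> n r)) = hcomp (int m) a"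
      proof (cases "m = n")
        case True
        then show ?thesis using hcomp_induced'[of r n "\<sigma> n r"] r a \<sigma>_Cdeg[OF r(1)] by (simp add: hcomp_of_Cdeg)
      next
        case False
        then show ?thesis using a \<sigma>_Cdeg[OF r(1)] by (simp add: hcomp_induced hcomp_of_Cdeg lift_def \<sigma>_zero)
      qed
    qed
    then show "a \<in> induced ` Cdeg (int n)" using \<sigma>_Cdeg[OF r(1)] by blast
  qed
qed

lemma induced_inj: "induced a = induced b \<Longrightarrow> a = b"
proof -
  assume "induced a = induced b"
  then have *: "\<sigma> n (g (lift n (hcomp (int n) a))) = \<sigma> n (g (lift n (hcomp (int n) b)))" for n
    by (metis hcomp_induced)
  have "hcomp (int n) a = hcomp (int n) b" for n
  proof -
    let ?r = "lift n (hcomp (int n) a)" and ?s = "lift n (hcomp (int n) b)"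
    have c: "?r \<in> F n" "?s \<in> F n" by (rule lift_hcomp)+
    then have "\<sigma> n (g (?r \<oplus>\<^bsub>R\<^esub> (\<ominus>\<^bsub>R\<^esub> ?s))) = 0"
      using * F_carrier by (simp add: \<sigma>_add \<sigma>_uminus g_F F_uminus)
    then have "\<sigma> n (?r \<oplus>\<^bsub>R\<^esub> (\<ominus>\<^bsub>R\<^esub> ?s)) = 0" using g_reflects c F_add F_uminus by blast
    then show ?thesis using c by (simp add: \<sigma>_add \<sigma>_uminus F_uminus lift_hcomp)
  qed
  then show ?thesis by (rule hcomp_eqI)
qed

lemma induced_surj: "\<exists>a. induced a = b"
proof -
  obtain N where N: "b = (\<Sum>n<N. hcomp (int n) b)" using cone_decomposition by blast
  have "\<exists>a. induced a = hcomp (int n) b" for n using induced_Cdeg_iff hcomp_Cdeg by (metis imageE)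
  then obtain a where a: "\<And>n. induced (a n) = hcomp (int n) b" by metis
  have "induced (\<Sum>n<N. a n) = (\<Sum>n<N. hcomp (int n) b)"
    by (simp add: additive_sum[of induced, OF induced_add] a)
  then show ?thesis using N by metis
qed

lemma cone_aut_induced: "cone_aut induced"
proof -
  have "bij induced" unfolding bij_def inj_def surj_def using induced_inj induced_surj by metis
  moreover have "induced \<in> ring_hom cone_alg cone_alg"
    by (rule ring_hom_memI) (simp_all add: induced_mult induced_add induced_one)
  ultimately show ?thesis
    by (simp add: cone_aut_def graded_iso_def induced_csc induced_Cdeg_iff)
qed

lemma gr_map_bij: "bij_betw (gr_map R F g) (gr_carrier R F) (gr_carrier R F)"
proof -
  have "bij induced" using cone_aut_induced by (simp add: cone_aut_def graded_iso_def)
  then have "bij_betw (\<kappa> \<circ> induced \<circ> inv_into UNIV \<kappa>) (gr_carrier R F) (gr_carrier R F)"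
    by (intro bij_betw_trans[OF bij_betw_inv_into[OF \<kappa>_bij]] bij_betw_trans[OF _ \<kappa>_bij]) 
  moreover have "(\<kappa> \<circ> induced \<circ> inv_into UNIV \<kappa>) u = gr_map R F g u" if "u \<in> gr_carrier R F" for u
    using \<kappa>.\<theta>_\<theta>' that by (simp add: \<kappa>_induced)
  ultimately show ?thesis by (subst bij_betw_cong[symmetric]) auto
qed

lemma filtered_hdet_induced: "filtered_hdet R F g = hdet cone_alg induced"
proof -
  have "bij induced" using cone_aut_induced by (simp add: cone_aut_def graded_iso_def)
  then show ?thesis
    unfolding filtered_hdet_def
    by (intro \<kappa>.hdet_transfer[symmetric]) (simp_all add: gr_map_bij \<kappa>_induced)
qed

end

text \<open>
  Passing to induced maps turns composition into composition, which reduces the claim to \<open>A\<close>.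
\<close>
theorem filtered_hdet_mult:
  assumes g: "g \<in> filtered_auts R F" and h: "h \<in> filtered_auts R F" and gh: "compose (carrier R) g h \<in> filtered_auts R F"
  shows "filtered_hdet R F (compose (carrier R) g h) = filtered_hdet R F g * filtered_hdet R F h"
    and "filtered_hdet R F g \<noteq> 0"
proof -
  have "induced (compose (carrier R) g h) = induced g \<circ> induced h"
  proof
    fix a
    show "induced (compose (carrier R) g h) a = (induced g \<circ> induced h) a"
    proof (rule hcomp_eqI)
      fix n
      let ?r = "lift n (hcomp (int n) a)"
      have r: "?r \<in> F n" by (rule lift_hcomp)
      have "hcomp (int n) (induced g (induced h a)) = \<sigma> n (g (h ?r))"
        by (rule hcomp_induced'[OF g]) (simp_all add: g_F[OF h] r hcomp_induced[OF h])
      then show "hcomp (int n) (induced (compose (carrier R) g h) a) = hcomp (int n) ((induced g \<circ> induced h) a)"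
        using F_carrier[OF r] by (simp add: hcomp_induced[OF gh] compose_eq)
    qed
  qed
  then show "filtered_hdet R F (compose (carrier R) g h) = filtered_hdet R F g * filtered_hdet R F h"
    using hdet_cone_mult(1)[OF cone_aut_induced[OF g] cone_aut_induced[OF h]]
    by (simp add: filtered_hdet_induced g h gh)
  show "filtered_hdet R F g \<noteq> 0"
    using hdet_cone_mult(2)[OF cone_aut_induced[OF g] cone_aut_induced[OF h]] by (simp add: filtered_hdet_induced g)
qed

end

section \<open>The free algebra and linear extension\<close>

lemma free_ring_simps [simp]:
  "carrier free_ring = UNIV" "mult free_ring = (*)" "one free_ring = 1" "zero free_ring = 0" "add free_ring = (+)"
  by (simp_all add: free_ring_def)

lemma ring_free_ring: "ring free_ring"
proof (rule ringI)
  show "abelian_group free_ring"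
    by (rule abelian_groupI) (auto simp: add.assoc add.commute intro: exI[of _ "- _"] left_minus)
  show "monoid free_ring"
    by (rule monoidI) (auto simp: mult.assoc)
qed (auto simp: algebra_simps)

interpretation free: ring free_ring by (rule ring_free_ring)

lemma free_minus [simp]: "\<ominus>\<^bsub>free_ring\<^esub> p = - p"
  by (rule free.minus_equality) auto

lemma fp_sum_singles: "p = (\<Sum>w\<in>Poly_Mapping.keys p. Poly_Mapping.single w (Poly_Mapping.lookup p w))"
  by (rule poly_mapping_eqI)
    (simp add: lookup_sum lookup_single when_def sum.delta in_keys_iff)

lemma fp_additive_sum:
  fixes f :: "'k::ring_1 free_poly \<Rightarrow> 'b::ab_group_add"
  assumes "\<And>p q. f (p + q) = f p + f q"
  shows "f (sum s S) = (\<Sum>i\<in>S. f (s i))"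
proof -
  have "f (0 + 0) = f 0 + f 0" by (rule assms)
  then have "f 0 = 0" by simp
  then show ?thesis by (induction S rule: infinite_finite_induct) (auto simp: assms)
qed

text \<open>
  Identities that are additive in a noncommutative polynomial need checking on single terms only.
\<close>
lemma fp_additive_eqI:
  fixes f g :: "'k::ring_1 free_poly \<Rightarrow> 'b::ab_group_add"
  assumes f: "\<And>p q. f (p + q) = f p + f q" and g: "\<And>p q. g (p + q) = g p + g q"
    and eq: "\<And>w c. f (Poly_Mapping.single w c) = g (Poly_Mapping.single w c)"
  shows "f p = g p"
proof -
  have "f (\<Sum>w\<in>Poly_Mapping.keys p. Poly_Mapping.single w (Poly_Mapping.lookup p w))
      = g (\<Sum>w\<in>Poly_Mapping.keys p. Poly_Mapping.single w (Poly_Mapping.lookup p w))"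
    by (simp add: fp_additive_sum[of f, OF f] fp_additive_sum[of g, OF g] eq)
  then show ?thesis by (simp flip: fp_sum_singles)
qed

text \<open>
  The linear extension of a function on words; \<open>s\<close> is the scalar multiplication of the target.
\<close>
definition lext :: "('k::ring_1 \<Rightarrow> 'b \<Rightarrow> 'b) \<Rightarrow> (word \<Rightarrow> 'b::ab_group_add) \<Rightarrow> 'k free_poly \<Rightarrow> 'b" where
  "lext s h p = (\<Sum>w\<in>Poly_Mapping.keys p. s (Poly_Mapping.lookup p w) (h w))"

lemma lext_superset:
  assumes s: "\<And>b. s 0 b = 0" and S: "finite S" "Poly_Mapping.keys p \<subseteq> S"
  shows "lext s h p = (\<Sum>w\<in>S. s (Poly_Mapping.lookup p w) (h w))"
  unfolding lext_def by (rule sum.mono_neutral_left) (use s S in \<open>auto simp: in_keys_iff\<close>)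

lemma lext_add:
  assumes s: "\<And>c d b. s (c + d) b = s c b + s d b"
  shows "lext s h (p + q) = lext s h p + lext s h q"
proof -
  have s0: "s 0 b = 0" for b using s[of 0 0 b] by simp
  let ?S = "Poly_Mapping.keys p \<union> Poly_Mapping.keys q"
  have fin: "finite ?S" by simp
  have "lext s h (p + q) = (\<Sum>w\<in>?S. s (Poly_Mapping.lookup (p + q) w) (h w))"
    by (rule lext_superset[of s ?S "p + q" h, OF s0 fin]) (rule keys_add)
  moreover have "lext s h p = (\<Sum>w\<in>?S. s (Poly_Mapping.lookup p w) (h w))"
    by (rule lext_superset[of s ?S p h, OF s0 fin]) auto
  moreover have "lext s h q = (\<Sum>w\<in>?S. s (Poly_Mapping.lookup q w) (h w))"
    by (rule lext_superset[of s ?S q h, OF s0 fin]) auto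
  ultimately show ?thesis by (simp add: lookup_add s sum.distrib)
qed

lemma lext_single:
  assumes s: "\<And>b. s 0 b = 0"
  shows "lext s h (Poly_Mapping.single w c) = s c (h w)"
  by (simp add: lext_def s)

subsection \<open>Constants and one-variable polynomials\<close>

lemma const_fp_simps [simp]:
  "const_fp 0 = 0" "const_fp 1 = 1" "const_fp (c + d) = const_fp c + const_fp d"
  "const_fp (c - d) = const_fp c - const_fp d" "const_fp (- c) = - const_fp c"
  by (simp_all add: const_fp_def single_add single_diff single_uminus)

lemma const_fp_mult: "const_fp (c * d) = const_fp c * const_fp d"
  by (simp add: const_fp_def mult_single)

lemma const_fp_single: "const_fp c * Poly_Mapping.single w d = Poly_Mapping.single w (c * d)"
  "Poly_Mapping.single w d * const_fp c = Poly_Mapping.single w (d * c)"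
  by (simp_all add: const_fp_def mult_single)

lemma const_fp_commute: "p * const_fp c = const_fp c * (p :: 'k::comm_ring_1 free_poly)"
  by (rule fp_additive_eqI[of "\<lambda>p. p * const_fp c" "\<lambda>p. const_fp c * p"])
    (simp_all add: distrib_left distrib_right const_fp_single mult.commute)

text \<open>
  Evaluation of a polynomial at an element of the free algebra.
\<close>
definition eval_at :: "'k::comm_ring_1 free_poly \<Rightarrow> 'k poly \<Rightarrow> 'k free_poly" where
  "eval_at u d = (\<Sum>i\<le>degree d. const_fp (coeff d i) * u ^ i)"

lemma eval_at_bound: "degree d \<le> N \<Longrightarrow> eval_at u d = (\<Sum>i\<le>N. const_fp (coeff d i) * u ^ i)"
  unfolding eval_at_def by (rule sum.mono_neutral_left) (auto simp: coeff_eq_0)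

lemma eval_at_0 [simp]: "eval_at u 0 = 0" by (simp add: eval_at_def)

lemma eval_at_pCons [simp]: "eval_at u (pCons c d) = const_fp c + u * eval_at u d"
proof -
  have "eval_at u (pCons c d) = (\<Sum>i\<le>Suc (degree d). const_fp (coeff (pCons c d) i) * u ^ i)"
    by (rule eval_at_bound) (rule degree_pCons_le)
  also have "\<dots> = const_fp c + (\<Sum>i\<le>degree d. const_fp (coeff d i) * (u * u ^ i))"
    by (subst sum.atMost_Suc_shift) simp
  also have "(\<Sum>i\<le>degree d. const_fp (coeff d i) * (u * u ^ i)) = u * eval_at u d"
    by (simp add: eval_at_def sum_distrib_left mult.assoc[symmetric] const_fp_commute)
  finally show ?thesis .
qed

lemma poly_in_Z_eval_at: "poly_in_Z d = eval_at (var GZ) d"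
  by (simp add: poly_in_Z_def eval_at_def)

lemma eval_at_add: "eval_at u (d + e) = eval_at u d + eval_at u e"
  by (induction d e rule: poly_induct2) (simp_all add: algebra_simps)

lemma const_fp_left_commute: "q * (const_fp c * p) = const_fp c * (q * (p :: 'k::comm_ring_1 free_poly))"
  by (metis const_fp_commute mult.assoc)

lemma eval_at_smult: "eval_at u (Polynomial.smult c d) = const_fp c * eval_at u d"
  by (induction d) (simp_all add: distrib_left const_fp_mult const_fp_left_commute)

section \<open>The ideal of relations and the quotient\<close>

abbreviation rels :: "'k::field \<Rightarrow> 'k free_poly set" where
  "rels t \<equiv> gwa_relations shift_aut (a_poly t)"

definition rel_ideal :: "'k::field \<Rightarrow> 'k free_poly set" where
  "rel_ideal t = gwa_ideal shift_aut (a_poly t)"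

definition cls :: "'k::field \<Rightarrow> 'k free_poly \<Rightarrow> 'k free_poly set" where
  "cls t = gwa_class shift_aut (a_poly t)"

lemma ideal_rel_ideal: "ideal (rel_ideal t) free_ring"
  unfolding rel_ideal_def gwa_ideal_def by (rule free.genideal_ideal) simp

lemma rels_rel_ideal: "r \<in> rels t \<Longrightarrow> r \<in> rel_ideal t"
  unfolding rel_ideal_def gwa_ideal_def using free.genideal_self[of "rels t"] by auto

lemma rel_ideal_minimal: "ideal J free_ring \<Longrightarrow> rels t \<subseteq> J \<Longrightarrow> rel_ideal t \<subseteq> J"
  unfolding rel_ideal_def gwa_ideal_def by (rule free.genideal_minimal)

lemma rel_ideal_zero: "0 \<in> rel_ideal t"
  and rel_ideal_add: "p \<in> rel_ideal t \<Longrightarrow> q \<in> rel_ideal t \<Longrightarrow> p + q \<in> rel_ideal t"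
  and rel_ideal_uminus: "p \<in> rel_ideal t \<Longrightarrow> - p \<in> rel_ideal t"
  and rel_ideal_mult_left: "p \<in> rel_ideal t \<Longrightarrow> q * p \<in> rel_ideal t"
  and rel_ideal_mult_right: "p \<in> rel_ideal t \<Longrightarrow> p * q \<in> rel_ideal t"
proof -
  interpret I: ideal "rel_ideal t" free_ring by (rule ideal_rel_ideal)
  show "0 \<in> rel_ideal t" using I.zero_closed by simp
  show "p \<in> rel_ideal t \<Longrightarrow> q \<in> rel_ideal t \<Longrightarrow> p + q \<in> rel_ideal t" using I.a_closed by simp
  show "p \<in> rel_ideal t \<Longrightarrow> - p \<in> rel_ideal t" using I.a_inv_closed by simp
  show "p \<in> rel_ideal t \<Longrightarrow> q * p \<in> rel_ideal t" using I.I_l_closed[of p q] by simp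
  show "p \<in> rel_ideal t \<Longrightarrow> p * q \<in> rel_ideal t" using I.I_r_closed[of p q] by simp
qed

lemma rel_ideal_diff: "p \<in> rel_ideal t \<Longrightarrow> q \<in> rel_ideal t \<Longrightarrow> p - q \<in> rel_ideal t"
  using rel_ideal_add[OF _ rel_ideal_uminus, of p t q] by simp

lemma cls_set: "cls t p = {h + p | h. h \<in> rel_ideal t}"
  by (auto simp: cls_def gwa_class_def rel_ideal_def[symmetric] a_r_coset_def')

lemma cls_eq_iff: "cls t p = cls t q \<longleftrightarrow> p - q \<in> rel_ideal t"
proof
  assume "cls t p = cls t q"
  moreover have "p \<in> cls t p" unfolding cls_set using rel_ideal_zero[of t] by (auto intro: exI[of _ 0])
  ultimately obtain h where "h \<in> rel_ideal t" "p = h + q" by (auto simp: cls_set)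
  then show "p - q \<in> rel_ideal t" by simp
next
  assume *: "p - q \<in> rel_ideal t"
  have "cls t p \<subseteq> cls t q" if "p - q \<in> rel_ideal t" for p q
  proof
    fix r assume "r \<in> cls t p"
    then obtain h where h: "h \<in> rel_ideal t" "r = h + p" by (auto simp: cls_set)
    then have "r = (h + (p - q)) + q" by simp
    then show "r \<in> cls t q" using rel_ideal_add[OF h(1) that] unfolding cls_set by blast
  qed
  moreover have "q - p \<in> rel_ideal t" using rel_ideal_uminus[OF *] by simp
  ultimately show "cls t p = cls t q" using * by blast
qed

lemma R_alg_simps:
  "carrier (R_alg t) = range (cls t)"
  "one (R_alg t) = cls t 1" "zero (R_alg t) = cls t 0"
  "cls t p \<otimes>\<^bsub>R_alg t\<^esub> cls t q = cls t (p * q)"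
  "cls t p \<oplus>\<^bsub>R_alg t\<^esub> cls t q = cls t (p + q)"
  "c \<odot>\<^bsub>R_alg t\<^esub> cls t p = cls t (const_fp c * p)"
proof -
  interpret I: ideal "rel_ideal t" free_ring by (rule ideal_rel_ideal)
  note defs = R_alg_def gwa_def Let_def cls_def gwa_class_def rel_ideal_def[symmetric]
  have m: "rcoset_mult free_ring (rel_ideal t) (rel_ideal t +>\<^bsub>free_ring\<^esub> p) (rel_ideal t +>\<^bsub>free_ring\<^esub> q) = rel_ideal t +>\<^bsub>free_ring\<^esub> (p * q)" for p q
    using I.rcoset_mult_add[of p q] by simp
  show "carrier (R_alg t) = range (cls t)"
    by (auto simp: defs FactRing_def A_RCOSETS_def')
  show "one (R_alg t) = cls t 1" by (simp add: defs FactRing_def)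
  have "rel_ideal t = rel_ideal t +>\<^bsub>free_ring\<^esub> 0" using cls_set[of t 0] by (simp add: defs)
  then show "zero (R_alg t) = cls t 0" by (simp add: defs FactRing_def)
  show "cls t p \<otimes>\<^bsub>R_alg t\<^esub> cls t q = cls t (p * q)" by (simp add: defs FactRing_def m)
  show "cls t p \<oplus>\<^bsub>R_alg t\<^esub> cls t q = cls t (p + q)"
    using I.a_rcos_sum[of p q] by (simp add: defs FactRing_def)
  show "c \<odot>\<^bsub>R_alg t\<^esub> cls t p = cls t (const_fp c * p)" by (simp add: defs FactRing_def m)
qed

lemma ring_R_alg: "ring (R_alg t)"
proof (rule ringI)
  show "abelian_group (R_alg t)"
  proof (rule abelian_groupI)
    fix r assume "r \<in> carrier (R_alg t)"
    then obtain p where "r = cls t p" by (auto simp: R_alg_simps)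
    then show "\<exists>s\<in>carrier (R_alg t). s \<oplus>\<^bsub>R_alg t\<^esub> r = \<zero>\<^bsub>R_alg t\<^esub>"
      by (intro bexI[of _ "cls t (- p)"]) (simp_all add: R_alg_simps)
  qed (auto simp: R_alg_simps add_ac)
  show "monoid (R_alg t)"
    by (rule monoidI) (auto simp: R_alg_simps mult.assoc)
qed (auto simp: R_alg_simps algebra_simps)

lemma R_alg_uminus: "\<ominus>\<^bsub>R_alg t\<^esub> cls t p = cls t (- p)"
proof -
  interpret ring "R_alg t" by (rule ring_R_alg)
  show ?thesis by (rule minus_equality) (simp_all add: R_alg_simps)
qed

lemma R_alg_minus: "cls t p \<ominus>\<^bsub>R_alg t\<^esub> cls t q = cls t (p - q)"
  by (simp add: a_minus_def R_alg_uminus R_alg_simps)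

subsection \<open>The defining relations\<close>

abbreviation "vx \<equiv> var GX"
abbreviation "vy \<equiv> var GY"
abbreviation "vz \<equiv> var GZ"

lemma shift_a: "shift_aut (a_poly t) = [:1 + t, - 2 - t, 1:]"
  by (simp add: shift_aut_def a_poly_def pcompose_pCons)

text \<open>
  The inverse of \<open>\<sigma>\<close>, in closed form.
\<close>
definition unshift :: "'k::field poly \<Rightarrow> 'k poly" where
  "unshift d = pcompose d [:1, 1:]"

lemma shift_unshift: "shift_aut (unshift d) = d" "unshift (shift_aut d) = d"
  by (simp_all add: shift_aut_def unshift_def flip: pcompose_assoc)
    (simp_all add: pcompose_pCons)

lemma inv_shift: "inv_into UNIV shift_aut = unshift"
proof -
  have "inj shift_aut" by (metis injI shift_unshift(2))
  then show ?thesis by (intro ext inv_f_eq) (simp_all add: shift_unshift)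
qed

lemma shift_pCons: "shift_aut (pCons c d) = [:c:] + [:- 1, 1:] * shift_aut d"
  and unshift_pCons: "unshift (pCons c d) = [:c:] + [:1, 1:] * unshift d"
  by (simp_all add: shift_aut_def unshift_def pcompose_pCons)

lemma shift_zero: "shift_aut 0 = 0" "unshift 0 = 0" by (simp_all add: shift_aut_def unshift_def)

lemma relations:
  "vx * vy - (const_fp (1 + t) + vz * (vz - const_fp (2 + t))) \<in> rel_ideal t"
  "vy * vx - vz * (vz - const_fp t) \<in> rel_ideal t"
  "vx * vz - (vz - 1) * vx \<in> rel_ideal t"
  "vy * vz - (vz + 1) * vy \<in> rel_ideal t"
proof -
  have "vx * vy - poly_in_Z (shift_aut (a_poly t)) \<in> rel_ideal t" "vy * vx - poly_in_Z (a_poly t) \<in> rel_ideal t"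
    "vx * poly_in_Z [:0, 1:] - poly_in_Z (shift_aut [:0, 1:]) * vx \<in> rel_ideal t"
    "vy * poly_in_Z [:0, 1:] - poly_in_Z (unshift [:0, 1:]) * vy \<in> rel_ideal t"
    by (rule rels_rel_ideal, force simp: gwa_relations_def inv_shift)+
  then show "vx * vy - (const_fp (1 + t) + vz * (vz - const_fp (2 + t))) \<in> rel_ideal t"
    "vy * vx - vz * (vz - const_fp t) \<in> rel_ideal t" "vx * vz - (vz - 1) * vx \<in> rel_ideal t" "vy * vz - (vz + 1) * vy \<in> rel_ideal t"
    unfolding shift_a poly_in_Z_eval_at
    by (simp_all add: a_poly_def shift_pCons unshift_pCons shift_zero algebra_simps)
qed

section \<open>A faithful representation\<close>

text \<open>
  \<open>R\<close> acts on Laurent polynomials in \<open>x\<close> over \<open>k[z]\<close>, with \<open>y\<close> acting as \<open>a x\<^sup>-\<^sup>1\<close>. An element is given by its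
  family of coefficients. The action shows that the words
  \<open>x\<^sup>i y\<^sup>j z\<^sup>\<epsilon>\<close> with \<open>\<epsilon> \<le> 1\<close> are independent modulo shorter words.
\<close>
type_synonym 'k vec = "int \<Rightarrow> 'k poly"

definition vscale :: "'k::field \<Rightarrow> 'k vec \<Rightarrow> 'k vec" where
  "vscale c v = (\<lambda>n. Polynomial.smult c (v n))"

fun gen_op :: "'k::field \<Rightarrow> gen \<Rightarrow> 'k vec \<Rightarrow> 'k vec" where
  "gen_op t GX v = (\<lambda>n. shift_aut (v (n - 1)))"
| "gen_op t GY v = (\<lambda>n. unshift (v (n + 1)) * a_poly t)"
| "gen_op t GZ v = (\<lambda>n. [:0, 1:] * v n)"

definition actw :: "'k::field \<Rightarrow> word \<Rightarrow> 'k vec \<Rightarrow> 'k vec" where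
  "actw t w v = foldr (gen_op t) (letters w) v"

definition act :: "'k::field \<Rightarrow> 'k free_poly \<Rightarrow> 'k vec \<Rightarrow> 'k vec" where
  "act t p v = lext vscale (\<lambda>w. actw t w v) p"

lemma vscale_simps [simp]: "vscale 0 v = 0" "vscale (c + d) v = vscale c v + vscale d v" "vscale c (u + v) = vscale c u + vscale c v"
  "vscale c (vscale d v) = vscale (c * d) v" "vscale 1 v = v"
  by (auto simp: vscale_def fun_eq_iff smult_add_left smult_add_right)

lemma shift_linear: "shift_aut (d + e) = shift_aut d + shift_aut e" "shift_aut (Polynomial.smult c d) = Polynomial.smult c (shift_aut d)"
  "shift_aut (d * e) = shift_aut d * shift_aut e"
  "unshift (d + e) = unshift d + unshift e" "unshift (Polynomial.smult c d) = Polynomial.smult c (unshift d)"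
  "unshift (d * e) = unshift d * unshift e"
  by (simp_all add: shift_aut_def unshift_def pcompose_add pcompose_smult pcompose_mult)

lemma gen_op_linear: "gen_op t g (u + v) = gen_op t g u + gen_op t g v" "gen_op t g (vscale c v) = vscale c (gen_op t g v)"
  by (cases g; auto simp: fun_eq_iff vscale_def shift_linear algebra_simps)+

lemma letters_plus: "letters (v + w) = letters v @ letters w" "letters 0 = []"
  by (simp_all add: plus_word_def zero_word_def)

lemma actw_linear: "actw t w (u + v) = actw t w u + actw t w v" "actw t w (vscale c v) = vscale c (actw t w v)"
proof -
  have "foldr (gen_op t) ls (u + v) = foldr (gen_op t) ls u + foldr (gen_op t) ls v"
    "foldr (gen_op t) ls (vscale c v) = vscale c (foldr (gen_op t) ls v)" for ls
    by (induction ls) (simp_all add: gen_op_linear)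
  then show "actw t w (u + v) = actw t w u + actw t w v" "actw t w (vscale c v) = vscale c (actw t w v)"
    by (simp_all add: actw_def)
qed

lemma actw_plus: "actw t (w + w') v = actw t w (actw t w' v)"
  by (simp add: actw_def letters_plus)

lemma act_add: "act t (p + q) v = act t p v + act t q v"
  unfolding act_def by (rule lext_add) simp
lemma act_single: "act t (Poly_Mapping.single w c) v = vscale c (actw t w v)"
  unfolding act_def by (rule lext_single) simp

lemma act_add_vec: "act t p (u + v) = act t p u + act t p v"
  by (rule fp_additive_eqI[of "\<lambda>p. act t p (u + v)" "\<lambda>p. act t p u + act t p v"])
    (simp_all add: act_add act_single actw_linear algebra_simps)

lemma act_mult: "act t (p * q) v = act t p (act t q v)"
proof (rule fp_additive_eqI[of "\<lambda>p. act t (p * q) v" "\<lambda>p. act t p (act t q v)"])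
  fix w c
  show "act t (Poly_Mapping.single w c * q) v = act t (Poly_Mapping.single w c) (act t q v)"
    by (rule fp_additive_eqI[of "\<lambda>q. act t (Poly_Mapping.single w c * q) v" "\<lambda>q. act t (Poly_Mapping.single w c) (act t q v)"])
      (simp_all add: distrib_left act_add act_add_vec mult_single act_single actw_plus actw_linear)
qed (simp_all add: distrib_right act_add)

lemma act_diff: "act t (p - q) v = act t p v - act t q v"
  using act_add[of t "p - q" q v] by simp
lemma act_zero: "act t 0 v = 0" using act_add[of t 0 0 v] by simp

lemma act_var: "act t (var g) v = gen_op t g v"
  by (simp add: var_def act_single actw_def)
lemma act_const: "act t (const_fp c) v = vscale c v"
  by (simp add: const_fp_def act_single actw_def letters_plus)

lemma act_poly_in_Z: "act t (poly_in_Z d) v = (\<lambda>n. d * v n)"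
  unfolding poly_in_Z_eval_at
  by (induction d) (auto simp: act_zero act_add act_mult act_const act_var vscale_def fun_eq_iff)

text \<open>
  The annihilator is an ideal that contains the relations.
\<close>
lemma act_rel_ideal:
  assumes "p \<in> rel_ideal t"
  shows "act t p v = 0"
proof -
  define J where "J = {p. \<forall>v. act t p v = 0}"
  have "ideal J free_ring"
  proof (rule idealI[OF ring_free_ring])
    show "subgroup J (add_monoid free_ring)"
    proof (rule free.add.subgroupI)
      fix p assume "p \<in> J"
      then show "\<ominus>\<^bsub>free_ring\<^esub> p \<in> J" using act_diff[of t 0 p] by (simp add: J_def act_zero)
    qed (auto simp: J_def act_add act_zero intro: exI[of _ 0])
  qed (auto simp: J_def act_mult act_zero, use act_add_vec[of t _ 0 0] in simp)
  moreover have "rels t \<subseteq> J"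
    unfolding gwa_relations_def J_def inv_shift
    by (auto simp: act_diff act_mult act_var act_poly_in_Z fun_eq_iff shift_linear shift_unshift mult.commute)
  ultimately have "p \<in> J" using rel_ideal_minimal assms by blast
  then show ?thesis by (simp add: J_def)
qed

abbreviation len :: "word \<Rightarrow> nat" where "len w \<equiv> length (letters w)"

text \<open>
  Assigning \<open>0, 1, 2\<close> to \<open>x, z, y\<close> makes \<open>x y = z\<^sup>2\<close> homogeneous. Together with the length the weight determines the
  monomial that a word represents in \<open>A\<close>.
\<close>
fun q_weight :: "gen \<Rightarrow> nat" where "q_weight GX = 0" | "q_weight GY = 2" | "q_weight GZ = 1"
definition q_word :: "word \<Rightarrow> nat" where "q_word w = sum_list (map q_weight (letters w))"

lemma q_word_le: "q_word w \<le> 2 * len w"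
proof -
  have "sum_list (map q_weight ls) \<le> 2 * length ls" for ls
  proof (induction ls)
    case (Cons g ls)
    then show ?case by (cases g) auto
  qed simp
  then show ?thesis by (simp add: q_word_def)
qed

definition vacuum :: "'k::field vec" where "vacuum = (\<lambda>n. if n = 0 then 1 else 0)"

lemma shift_degree: "degree (shift_aut d) = degree d" "degree (unshift d) = degree d"
  by (simp_all add: shift_aut_def unshift_def degree_pcompose)

lemma shift_lead: "lead_coeff (shift_aut d) = lead_coeff d" "lead_coeff (unshift d) = lead_coeff d"
  by (simp_all add: shift_aut_def unshift_def lead_coeff_comp)

lemma a_poly_degree: "degree (a_poly t) = 2" "lead_coeff (a_poly t) = 1"
  by (simp_all add: a_poly_def)

text \<open>
  A word shifts the vacuum by the number of \<open>x\<close> minus the number of \<open>y\<close>, which is its length minus its weight, and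
  multiplies it by a monic polynomial with one factor for each \<open>z\<close> and two for each \<open>y\<close>.
\<close>
lemma actw_vacuum:
  "n \<noteq> int (len w) - int (q_word w) \<Longrightarrow> actw t w vacuum n = 0"
  "degree (actw t w vacuum (int (len w) - int (q_word w))) = q_word w"
  "lead_coeff (actw t w vacuum (int (len w) - int (q_word w))) = 1"
proof -
  have "(\<forall>n. n \<noteq> int (length ls) - int (sum_list (map q_weight ls)) \<longrightarrow> foldr (gen_op t) ls vacuum n = 0)
    \<and> degree (foldr (gen_op t) ls vacuum (int (length ls) - int (sum_list (map q_weight ls)))) = sum_list (map q_weight ls)
    \<and> lead_coeff (foldr (gen_op t) ls vacuum (int (length ls) - int (sum_list (map q_weight ls)))) = 1" for ls
  proof (induction ls)
    case Nil
    then show ?case by (simp add: vacuum_def)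
  next
    case (Cons g ls)
    define u k where "u = foldr (gen_op t) ls vacuum" and "k = int (length ls) - int (sum_list (map q_weight ls))"
    have IH: "\<And>n. n \<noteq> k \<Longrightarrow> u n = 0" "degree (u k) = sum_list (map q_weight ls)" "lead_coeff (u k) = 1"
      using Cons.IH by (auto simp: u_def k_def)
    have nz: "u k \<noteq> 0" using IH(3) by auto
    show ?case
    proof (cases g)
      case GX
      have k': "int (length (g # ls)) - int (sum_list (map q_weight (g # ls))) = k + 1" by (simp add: k_def GX)
      show ?thesis unfolding k' using IH shift_lead(1)[of "u k"]
        by (simp add: GX u_def[symmetric] shift_degree shift_zero)
    next
      case GY
      have k': "int (length (g # ls)) - int (sum_list (map q_weight (g # ls))) = k - 1" by (simp add: k_def GY)
      have "unshift (u k) \<noteq> 0" using nz shift_unshift(1)[of "u k"] by (auto simp: shift_zero)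
      moreover have "a_poly t \<noteq> 0" using a_poly_degree(1)[of t] by auto
      ultimately have "degree (unshift (u k) * a_poly t) = degree (u k) + 2"
        by (simp add: degree_mult_eq shift_degree a_poly_degree)
      moreover have "lead_coeff (unshift (u k) * a_poly t) = 1"
        by (simp only: lead_coeff_mult shift_lead a_poly_degree(2) IH(3) mult_1)
      ultimately show ?thesis unfolding k' using IH by (simp add: GY u_def[symmetric] shift_zero)
    next
      case GZ
      have k': "int (length (g # ls)) - int (sum_list (map q_weight (g # ls))) = k" by (simp add: k_def GZ)
      show ?thesis unfolding k' using IH nz by (simp add: GZ u_def[symmetric])
    qed
  qed
  then show "n \<noteq> int (len w) - int (q_word w) \<Longrightarrow> actw t w vacuum n = 0"
    "degree (actw t w vacuum (int (len w) - int (q_word w))) = q_word w"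
    "lead_coeff (actw t w vacuum (int (len w) - int (q_word w))) = 1"
    unfolding actw_def q_word_def by blast+
qed

text \<open>
  The filtered pieces of the free algebra; the index is shifted by one so that \<open>shorter 0\<close> is the zero space.
\<close>
definition shorter :: "nat \<Rightarrow> 'k::field free_poly set" where
  "shorter n = {p. \<forall>w\<in>Poly_Mapping.keys p. len w < n}"

text \<open>
  The coefficient in the symbol of degree \<open>l\<close> of the monomial with weight \<open>q\<close>.
\<close>
definition top_coeff :: "nat \<Rightarrow> nat \<Rightarrow> 'k::field free_poly \<Rightarrow> 'k" where
  "top_coeff l q p = lext (*) (\<lambda>w. if len w = l \<and> q_word w = q then 1 else 0) p"

text \<open>
  Acting on the vacuum, only words of length \<open>l\<close> and weight \<open>q\<close> contribute to the coefficient of \<open>z\<^sup>q\<close> in position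
  \<open>l - q\<close>: shorter words in the same position have smaller weight, hence smaller degree.
\<close>
lemma top_coeff_rel_ideal:
  assumes p: "p \<in> rel_ideal t" and l: "p \<in> shorter (Suc l)"
  shows "top_coeff l q p = 0"
proof -
  have "coeff (actw t w vacuum (int l - int q)) q = (if len w = l \<and> q_word w = q then 1 else 0)" if "len w \<le> l" for w
  proof (cases "int l - int q = int (len w) - int (q_word w)")
    case True
    have d: "degree (actw t w vacuum (int l - int q)) = q_word w" and lc: "lead_coeff (actw t w vacuum (int l - int q)) = 1"
      unfolding True by (rule actw_vacuum)+
    show ?thesis
    proof (cases "len w = l")
      case True': True
      then show ?thesis using True d lc by auto
    next
      case False
      then have "degree (actw t w vacuum (int l - int q)) < q" using True that d by linarith
      then show ?thesis using False by (simp add: coeff_eq_0)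
    qed
  next
    case False
    then show ?thesis by (auto simp: actw_vacuum(1))
  qed
  then have "top_coeff l q p = (\<Sum>w\<in>Poly_Mapping.keys p. Poly_Mapping.lookup p w * coeff (actw t w vacuum (int l - int q)) q)"
    unfolding top_coeff_def lext_def using l by (intro sum.cong) (auto simp: shorter_def)
  also have "\<dots> = coeff (act t p vacuum (int l - int q)) q"
  proof -
    have "act t p vacuum n = (\<Sum>w\<in>Poly_Mapping.keys p. Polynomial.smult (Poly_Mapping.lookup p w) (actw t w vacuum n))" for n
    proof -
      have "(sum f S) n = (\<Sum>w\<in>S. f w n)" for f :: "word \<Rightarrow> int \<Rightarrow> 'a poly" and S
        by (induction S rule: infinite_finite_induct) auto
      then show ?thesis by (simp add: act_def lext_def vscale_def)
    qed
    then show ?thesis by (simp add: coeff_sum)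
  qed
  also have "\<dots> = 0" by (simp add: act_rel_ideal[OF p])
  finally show ?thesis .
qed

section \<open>Symbols\<close>

fun gmono :: "gen \<Rightarrow> 'k::field cone" where "gmono GX = CX" | "gmono GY = CY" | "gmono GZ = CZ"
definition wmono :: "word \<Rightarrow> 'k::field cone" where "wmono w = prod_list (map gmono (letters w))"

lemma wmono_plus: "wmono (v + w) = wmono v * wmono w" by (simp add: wmono_def letters_plus)

text \<open>
  The monomial \<open>x\<^sup>i y\<^sup>j z\<^sup>\<epsilon>\<close> with \<open>\<epsilon> \<le> 1\<close> of length \<open>l\<close> and weight \<open>q\<close>.
\<close>
definition nmono :: "nat \<Rightarrow> nat \<Rightarrow> 'k::field cone" where
  "nmono l q = CX ^ (l - (q + 1) div 2) * CY ^ (q div 2) * CZ ^ (q mod 2)"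

lemma wmono_normal: "wmono w = nmono (len w) (q_word w)"
proof -
  have "prod_list (map gmono ls) = (nmono (length ls) (sum_list (map q_weight ls)) :: 'a::field cone)" for ls
  proof (induction ls)
    case (Cons g ls)
    define l q where "l = length ls" and "q = sum_list (map q_weight ls)"
    have q: "q \<le> 2 * l" using q_word_le[of "Word ls"] by (simp add: l_def q_def q_word_def)
    have IH: "prod_list (map gmono ls) = (nmono l q :: 'a cone)" using Cons by (simp add: l_def q_def)
    have "gmono g * nmono l q = (nmono (Suc l) (q_weight g + q) :: 'a cone)"
    proof (cases g)
      case GX
      have "Suc l - (q + 1) div 2 = Suc (l - (q + 1) div 2)" using q by auto
      then show ?thesis by (simp add: GX nmono_def mult_ac)
    next
      case GY
      have "Suc l - (2 + q + 1) div 2 = l - (q + 1) div 2" "(2 + q) div 2 = Suc (q div 2)" "(2 + q) mod 2 = q mod 2"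
        using q by auto
      then show ?thesis unfolding GY nmono_def q_weight.simps gmono.simps by (simp only: power_Suc mult_ac)
    next
      case GZ
      show ?thesis
      proof (cases "even q")
        case True
        then obtain r where r: "q = 2 * r" by auto
        have "Suc l - (Suc (2 * r) + 1) div 2 = l - (2 * r + 1) div 2" "Suc (r * 2) mod 2 = 1" by presburger+
        then show ?thesis by (simp add: GZ nmono_def mult_ac r)
      next
        case False
        then obtain r where r: "q = 2 * r + 1" by (auto elim: oddE)
        have d: "l - (q + 1) div 2 = l - Suc r" "Suc l - (Suc q + 1) div 2 = Suc (l - Suc r)"
          "q div 2 = r" "Suc q div 2 = Suc r" "q mod 2 = 1" "Suc q mod 2 = 0"
          using q r by auto
        have "CZ * (CX ^ (l - Suc r) * CY ^ r * CZ) = CX ^ (l - Suc r) * CY ^ r * (CZ * (CZ :: 'a cone))"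
          by (simp add: mult_ac)
        also have "\<dots> = CX ^ Suc (l - Suc r) * CY ^ Suc r" unfolding CZ_square by (simp add: mult_ac)
        finally have "CZ * (CX ^ (l - Suc r) * CY ^ r * (CZ :: 'a cone)) = CX ^ Suc (l - Suc r) * CY ^ Suc r" .
        then show ?thesis unfolding GZ nmono_def q_weight.simps gmono.simps plus_1_eq_Suc d by simp
      qed
    qed
    then show ?case using IH by (simp add: l_def q_def)
  qed (simp_all add: nmono_def)
  then show ?thesis by (simp add: wmono_def q_word_def)
qed

text \<open>
  The coordinate of an element of \<open>A\<close> with respect to \<open>nmono l q\<close>.
\<close>
definition kcoeff :: "nat \<Rightarrow> nat \<Rightarrow> 'k::field cone \<Rightarrow> 'k" where
  "kcoeff l q a = (if even q then cf (cre a) (l - q div 2) (q div 2) else cf (cim a) (l - Suc (q div 2)) (q div 2))"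

lemma CP_powers: "CX ^ i = CP (PX ^ i)" "CY ^ i = CP (PY ^ i)"
  by (induction i) (auto intro!: cone_eqI)

lemma nmono_sel:
  "cre (nmono l q) = (if even q then PX ^ (l - q div 2) * PY ^ (q div 2) else 0)"
  "cim (nmono l q) = (if even q then 0 else PX ^ (l - Suc (q div 2)) * PY ^ (q div 2))"
proof -
  have P: "cre (CX ^ i * CY ^ j) = PX ^ i * PY ^ j" "cim (CX ^ i * CY ^ j) = 0" for i j
    by (simp_all add: CP_powers)
  show "cre (nmono l q) = (if even q then PX ^ (l - q div 2) * PY ^ (q div 2) else 0)"
    "cim (nmono l q) = (if even q then 0 else PX ^ (l - Suc (q div 2)) * PY ^ (q div 2))"
    by (cases "even q"; auto simp: nmono_def P elim!: evenE oddE simp del: cone_sel(11,12) simp: cone_sel(11,12)[of "_ * _" CZ])+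
qed

lemma cf_monomial: "cf (PX ^ i * PY ^ j) i' j' = (if i = i' \<and> j = j' then 1 else 0)"
  by (auto simp: cf_PX_pow cf_PY_pow[where p = 1, simplified] cf_one)

lemma kcoeff_nmono:
  assumes "q \<le> 2 * l" "q' \<le> 2 * l"
  shows "kcoeff l q (nmono l q') = (if q = q' then 1 else 0)"
proof (cases "even q = even q'")
  case True
  then have "q div 2 = q' div 2 \<longleftrightarrow> q = q'" by (metis dvd_mult_div_cancel odd_two_times_div_two_succ)
  then show ?thesis using True by (auto simp: kcoeff_def nmono_sel cf_monomial)
next
  case False
  then show ?thesis by (auto simp: kcoeff_def nmono_sel)
qed

definition symb :: "nat \<Rightarrow> 'k::field free_poly \<Rightarrow> 'k cone" where
  "symb l p = lext csc (\<lambda>w. if len w = l then wmono w else 0) p"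

lemma symb_add: "symb l (p + q) = symb l p + symb l q"
  unfolding symb_def by (rule lext_add) (rule csc_add_left)
lemma symb_single: "symb l (Poly_Mapping.single w c) = csc c (if len w = l then wmono w else 0)"
  unfolding symb_def by (rule lext_single) simp
lemma symb_diff: "symb l (p - q) = symb l p - symb l q"
  using symb_add[of l "p - q" q] by simp

lemma symb_top_coeff: "symb l p = (\<Sum>q\<le>2 * l. csc (top_coeff l q p) (nmono l q))"
proof (rule fp_additive_eqI[of "symb l" "\<lambda>p. \<Sum>q\<le>2 * l. csc (top_coeff l q p) (nmono l q)"])
  have top_coeff_add: "top_coeff l q (p + p') = top_coeff l q p + top_coeff l q p'" for q p p'
    unfolding top_coeff_def by (rule lext_add) (rule distrib_right)
  show "(\<Sum>q\<le>2 * l. csc (top_coeff l q (p + p')) (nmono l q)) = (\<Sum>q\<le>2 * l. csc (top_coeff l q p) (nmono l q)) + (\<Sum>q\<le>2 * l. csc (top_coeff l q p') (nmono l q))" for p p'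
    by (simp add: top_coeff_add csc_add_left sum.distrib)
  fix w c
  have "top_coeff l q (Poly_Mapping.single w c) = (if len w = l \<and> q_word w = q then c else 0)" for q
    unfolding top_coeff_def by (subst lext_single) auto
  then have "(\<Sum>q\<le>2 * l. csc (top_coeff l q (Poly_Mapping.single w c)) (nmono l q))
      = (\<Sum>q\<le>2 * l. if q = q_word w then (if len w = l then csc c (nmono l q) else 0) else 0)"
    by (intro sum.cong) auto
  also have "\<dots> = csc c (if len w = l then wmono w else 0)"
    using q_word_le[of w] by (auto simp: wmono_normal)
  finally show "symb l (Poly_Mapping.single w c) = (\<Sum>q\<le>2 * l. csc (top_coeff l q (Poly_Mapping.single w c)) (nmono l q))"
    by (simp add: symb_single)
qed (rule symb_add)

lemma kcoeff_linear: "kcoeff l q (a + b) = kcoeff l q a + kcoeff l q b" "kcoeff l q (csc c a) = c * kcoeff l q a"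
  by (simp_all add: kcoeff_def)

lemma top_coeff_symb: "q \<le> 2 * l \<Longrightarrow> top_coeff l q p = kcoeff l q (symb l p)"
proof -
  assume q: "q \<le> 2 * l"
  have "kcoeff l q (symb l p) = (\<Sum>r\<le>2 * l. top_coeff l r p * kcoeff l q (nmono l r))"
    unfolding symb_top_coeff additive_sum[of "kcoeff l q", OF kcoeff_linear(1)] kcoeff_linear ..
  also have "\<dots> = (\<Sum>r\<le>2 * l. if r = q then top_coeff l r p else 0)"
    by (rule sum.cong) (use q in \<open>auto simp: kcoeff_nmono\<close>)
  finally show ?thesis using q by simp
qed

lemma symb_rel_ideal: "p \<in> rel_ideal t \<Longrightarrow> p \<in> shorter (Suc l) \<Longrightarrow> symb l p = 0"
  unfolding symb_top_coeff by (intro sum.neutral) (simp add: top_coeff_rel_ideal)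

lemma symb_shorter: "p \<in> shorter l \<Longrightarrow> symb l p = 0"
  unfolding symb_def lext_def by (intro sum.neutral) (auto simp: shorter_def)

subsection \<open>Words modulo shorter words\<close>

lemma shorter_0: "p \<in> shorter 0 \<longleftrightarrow> p = 0" by (auto simp: shorter_def)
lemma shorter_zero [simp]: "0 \<in> shorter n" by (simp add: shorter_def)
lemma shorter_mono: "p \<in> shorter n \<Longrightarrow> n \<le> m \<Longrightarrow> p \<in> shorter m" by (auto simp: shorter_def)
lemma shorter_add: "p \<in> shorter n \<Longrightarrow> q \<in> shorter n \<Longrightarrow> p + q \<in> shorter n"
  using keys_add[of p q] by (auto simp: shorter_def)
lemma shorter_uminus: "p \<in> shorter n \<Longrightarrow> - p \<in> shorter n"
  by (simp add: shorter_def)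
lemma shorter_diff: "p \<in> shorter n \<Longrightarrow> q \<in> shorter n \<Longrightarrow> p - q \<in> shorter n"
  using shorter_add[OF _ shorter_uminus, of p n q] by simp
lemma shorter_single: "len w < n \<Longrightarrow> Poly_Mapping.single w c \<in> shorter n"
  by (simp add: shorter_def)
lemma shorter_sum: "(\<And>i. i \<in> S \<Longrightarrow> f i \<in> shorter n) \<Longrightarrow> sum f S \<in> shorter n"
  by (induction S rule: infinite_finite_induct) (auto intro: shorter_add)

lemma shorter_mult:
  assumes p: "p \<in> shorter n" and q: "q \<in> shorter (Suc m)"
  shows "p * q \<in> shorter (n + m)" "q * p \<in> shorter (n + m)"
proof -
  have "len w < n + m" if w: "w \<in> Poly_Mapping.keys (p * q) \<union> Poly_Mapping.keys (q * p)" for w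
  proof -
    obtain a b where ab: "w = a + b" "a \<in> Poly_Mapping.keys p \<and> b \<in> Poly_Mapping.keys q \<or> a \<in> Poly_Mapping.keys q \<and> b \<in> Poly_Mapping.keys p"
      using keys_mult[of p q] keys_mult[of q p] w by blast
    then show ?thesis using p q by (fastforce simp: shorter_def letters_plus)
  qed
  then show "p * q \<in> shorter (n + m)" "q * p \<in> shorter (n + m)" by (auto simp: shorter_def)
qed

lemma shorter_var: "var g \<in> shorter 2" by (simp add: shorter_def var_def)
lemma shorter_const: "const_fp c \<in> shorter 1" by (simp add: shorter_def const_fp_def letters_plus)

text \<open>
  The preimage in the free algebra of a filtered piece of \<open>R\<close>.
\<close>
definition shorter_mod :: "'k::field \<Rightarrow> nat \<Rightarrow> 'k free_poly set" where
  "shorter_mod t n = {p. \<exists>r\<in>shorter n. p - r \<in> rel_ideal t}"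

lemma shorter_mod_shorter: "p \<in> shorter n \<Longrightarrow> p \<in> shorter_mod t n"
  unfolding shorter_mod_def using rel_ideal_zero[of t] by (auto intro!: bexI[of _ p])
lemma shorter_mod_add: "p \<in> shorter_mod t n \<Longrightarrow> q \<in> shorter_mod t n \<Longrightarrow> p + q \<in> shorter_mod t n"
proof -
  assume "p \<in> shorter_mod t n" "q \<in> shorter_mod t n"
  then obtain r s where "r \<in> shorter n" "p - r \<in> rel_ideal t" "s \<in> shorter n" "q - s \<in> rel_ideal t" by (auto simp: shorter_mod_def)
  moreover have "p + q - (r + s) = (p - r) + (q - s)" by simp
  ultimately show ?thesis unfolding shorter_mod_def using shorter_add rel_ideal_add by (metis (mono_tags, lifting) mem_Collect_eq)
qed
lemma shorter_mod_uminus: "p \<in> shorter_mod t n \<Longrightarrow> - p \<in> shorter_mod t n"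
proof -
  assume "p \<in> shorter_mod t n"
  then obtain r where r: "r \<in> shorter n" "p - r \<in> rel_ideal t" by (auto simp: shorter_mod_def)
  have "- p - (- r) \<in> rel_ideal t" using rel_ideal_uminus[OF r(2)] by simp
  then show ?thesis unfolding shorter_mod_def using shorter_uminus[OF r(1)] by blast
qed
lemma shorter_mod_sum: "(\<And>i. i \<in> S \<Longrightarrow> f i \<in> shorter_mod t n) \<Longrightarrow> sum f S \<in> shorter_mod t n"
  by (induction S rule: infinite_finite_induct) (auto intro: shorter_mod_add shorter_mod_shorter)
lemma shorter_mod_mult:
  assumes p: "p \<in> shorter_mod t n" and q: "q \<in> shorter (Suc m)"
  shows "p * q \<in> shorter_mod t (n + m)" "q * p \<in> shorter_mod t (n + m)"
proof -
  obtain r where r: "r \<in> shorter n" "p - r \<in> rel_ideal t" using p by (auto simp: shorter_mod_def)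
  have "p * q - r * q \<in> rel_ideal t" "q * p - q * r \<in> rel_ideal t"
    using rel_ideal_mult_right[OF r(2), of q] rel_ideal_mult_left[OF r(2), of q] by (simp_all add: algebra_simps)
  then show "p * q \<in> shorter_mod t (n + m)" "q * p \<in> shorter_mod t (n + m)"
    unfolding shorter_mod_def using shorter_mult[OF r(1) q] by blast+
qed

text \<open>
  Equality of two words of the same length in the associated graded algebra.
\<close>
definition wrel :: "'k::field \<Rightarrow> gen list \<Rightarrow> gen list \<Rightarrow> bool" where
  "wrel t u v \<longleftrightarrow> length u = length v \<and>
     Poly_Mapping.single (Word u) 1 - Poly_Mapping.single (Word v) (1 :: 'k) \<in> shorter_mod t (length u)"

lemma wrel_refl: "wrel t u u" using shorter_mod_shorter[OF shorter_zero] by (simp add: wrel_def)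
lemma wrel_sym: "wrel t u v \<Longrightarrow> wrel t v u"
  using shorter_mod_uminus by (fastforce simp: wrel_def)
lemma wrel_trans [trans]: "wrel t u v \<Longrightarrow> wrel t v w \<Longrightarrow> wrel t u w"
  unfolding wrel_def using shorter_mod_add by fastforce

lemma wrel_context:
  assumes "wrel t u v"
  shows "wrel t (a @ u @ b) (a @ v @ b)"
proof -
  let ?s = "\<lambda>u. Poly_Mapping.single (Word u) (1 :: 'a)"
  have len: "length u = length v" and uv: "?s u - ?s v \<in> shorter_mod t (length u)" using assms by (auto simp: wrel_def)
  have "?s a * (?s u - ?s v) \<in> shorter_mod t (length u + length a)" by (rule shorter_mod_mult(2)[OF uv]) (simp add: shorter_single)
  then have "?s a * (?s u - ?s v) * ?s b \<in> shorter_mod t (length u + length a + length b)"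
    by (rule shorter_mod_mult(1)) (simp add: shorter_single)
  moreover have "?s a * (?s u - ?s v) * ?s b = ?s (a @ u @ b) - ?s (a @ v @ b)"
    by (simp add: algebra_simps mult_single plus_word_def)
  ultimately show ?thesis using len by (simp add: wrel_def add_ac)
qed

text \<open>
  The leading parts of the defining relations; the remaining terms have length at most one.
\<close>
lemma wrel_relations:
  "wrel t [GX, GY] [GZ, GZ]" "wrel t [GY, GX] [GZ, GZ]" "wrel t [GX, GZ] [GZ, GX]" "wrel t [GY, GZ] [GZ, GY]"
proof -
  have pair: "Poly_Mapping.single (Word [g, h]) 1 = var g * (var h :: 'a free_poly)" for g h
    by (simp add: var_def mult_single plus_word_def)
  have I: "wrel t [g, h] [g', h']" if "var g * var h - var g' * var h' - r \<in> rel_ideal t" "r \<in> shorter 2" for g h g' h' r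
    using that unfolding wrel_def pair shorter_mod_def by (auto simp: eval_nat_numeral)
  have s: "const_fp c * var g \<in> shorter 2" "const_fp c \<in> shorter 2" "var g \<in> shorter 2" for c :: 'a and g
    using shorter_mult(2)[OF shorter_var[of g], of "const_fp c" 0] shorter_const[of c] shorter_mono[of "const_fp c" 1 2] shorter_var
    by simp_all
  show "wrel t [GX, GY] [GZ, GZ]"
    by (rule I[of _ _ _ _ "const_fp (1 + t) - const_fp (2 + t) * vz"])
      (use relations(1)[of t] in \<open>simp add: algebra_simps const_fp_commute[of vz]\<close>, intro shorter_diff s)
  show "wrel t [GY, GX] [GZ, GZ]"
    by (rule I[of _ _ _ _ "- (const_fp t * vz)"])
      (use relations(2)[of t] in \<open>simp add: algebra_simps const_fp_commute[of vz]\<close>, intro shorter_uminus s)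
  show "wrel t [GX, GZ] [GZ, GX]"
    by (rule I[of _ _ _ _ "- vx"]) (use relations(3)[of t] in \<open>simp add: algebra_simps\<close>, intro shorter_uminus s)
  show "wrel t [GY, GZ] [GZ, GY]"
    by (rule I[of _ _ _ _ "vy"]) (use relations(4)[of t] in \<open>simp add: algebra_simps\<close>, intro s)
qed

lemma wrel_swap: "wrel t [g, h] [h, g]"
proof -
  have xy: "wrel t [GX, GY] [GY, GX]" using wrel_trans[OF wrel_relations(1) wrel_sym[OF wrel_relations(2)]] .
  show ?thesis
    using xy wrel_sym[OF xy] wrel_relations(3,4) wrel_relations(3,4)[THEN wrel_sym] wrel_refl
    by (cases g; cases h) auto
qed

lemma wrel_past: "wrel t ([g] @ u) (u @ [g])"
proof (induction u)
  case Nil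
  then show ?case by (simp add: wrel_refl)
next
  case (Cons h u)
  have "wrel t ([g, h] @ u) ([h, g] @ u)" using wrel_context[OF wrel_swap, where a = "[]" and b = u, of t g h] by simp
  also have "wrel t ([h, g] @ u) ([h] @ u @ [g])" using wrel_context[OF Cons, where a = "[h]" and b = "[]"] by simp
  finally show ?case by simp
qed

definition canon :: "nat \<Rightarrow> nat \<Rightarrow> gen list" where
  "canon l q = replicate (l - (q + 1) div 2) GX @ replicate (q div 2) GY @ replicate (q mod 2) GZ"

lemma canon_length: "q \<le> 2 * l \<Longrightarrow> length (canon l q) = l"
proof -
  assume "q \<le> 2 * l"
  then have "(q + 1) div 2 \<le> l" by linarith
  moreover have "(q + 1) div 2 = q div 2 + q mod 2" by presburger
  ultimately show ?thesis by (simp add: canon_def)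
qed

text \<open>
  Letters commute in the associated graded algebra and \<open>z z\<close> may be replaced by \<open>x y\<close>, so every word equals the one
  of the form \<open>x\<^sup>i y\<^sup>j z\<^sup>\<epsilon>\<close> with the same length and weight.
\<close>
lemma wrel_canon: "wrel t ls (canon (length ls) (sum_list (map q_weight ls)))"
proof (induction ls)
  case Nil
  then show ?case by (simp add: canon_def wrel_refl)
next
  case (Cons g ls)
  define l q where "l = length ls" and "q = sum_list (map q_weight ls)"
  have q: "q \<le> 2 * l" using q_word_le[of "Word ls"] by (simp add: l_def q_def q_word_def)
  have IH: "wrel t ls (canon l q)" using Cons by (simp add: l_def q_def)
  have "wrel t (g # ls) (g # canon l q)" using wrel_context[OF IH, where a = "[g]" and b = "[]"] by simp
  also have "wrel t (g # canon l q) (canon (Suc l) (q_weight g + q))"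
  proof (cases g)
    case GX
    have "Suc l - (q + 1) div 2 = Suc (l - (q + 1) div 2)" using q by auto
    then show ?thesis by (simp add: GX canon_def wrel_refl)
  next
    case GY
    let ?a = "replicate (l - (q + 1) div 2) GX" and ?b = "replicate (q div 2) GY @ replicate (q mod 2) GZ"
    have "wrel t ([] @ ([GY] @ ?a) @ ?b) ([] @ (?a @ [GY]) @ ?b)" by (rule wrel_context[OF wrel_past])
    moreover have "Suc l - (2 + q + 1) div 2 = l - (q + 1) div 2" "(2 + q) div 2 = Suc (q div 2)" "(2 + q) mod 2 = q mod 2"
      using q by auto
    then have "canon (Suc l) (2 + q) = ?a @ GY # ?b" unfolding canon_def by (simp only: replicate_Suc append_Cons)
    ultimately show ?thesis by (simp add: GY canon_def)
  next
    case GZ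
    have past: "wrel t (GZ # canon l q) (canon l q @ [GZ])" using wrel_past[of t GZ "canon l q"] by simp
    show ?thesis
    proof (cases "even q")
      case True
      then obtain r where r: "q = 2 * r" by auto
      have "Suc l - (Suc (2 * r) + 1) div 2 = l - (2 * r + 1) div 2" "Suc (2 * r) mod 2 = Suc 0" "Suc (2 * r) div 2 = r"
        by presburger+
      then have "canon (Suc l) (Suc q) = canon l q @ [GZ]" by (simp add: canon_def r)
      then show ?thesis using past by (simp add: GZ)
    next
      case False
      then obtain r where r: "q = 2 * r + 1" by (auto elim: oddE)
      let ?a = "replicate (l - Suc r) GX" and ?b = "replicate r GY"
      have c: "canon l q = ?a @ ?b @ [GZ]" by (simp add: canon_def r)
      note past
      also have "wrel t (canon l q @ [GZ]) (?a @ ?b @ [GX, GY])"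
        unfolding c using wrel_context[OF wrel_sym[OF wrel_relations(1)], where a = "?a @ ?b" and b = "[]"] by simp
      also have "wrel t (?a @ ?b @ [GX, GY]) (?a @ [GX] @ ?b @ [GY])"
        using wrel_context[OF wrel_past[of t GX ?b, THEN wrel_sym], where a = ?a and b = "[GY]"] by simp
      also have "?a @ [GX] @ ?b @ [GY] = canon (Suc l) (Suc q)"
      proof -
        have "Suc l - (Suc q + 1) div 2 = Suc (l - Suc r)" "Suc q div 2 = Suc r" "Suc q mod 2 = 0" using q r by auto
        then show ?thesis unfolding canon_def by (simp add: replicate_append_same flip: replicate_Suc)
      qed
      finally show ?thesis by (simp add: GZ)
    qed
  qed
  finally show ?case by (simp add: l_def q_def)
qed

text \<open>
  Replacing all words of length \<open>l\<close> by normal forms leaves the coefficients of the symbol, which vanish.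
\<close>
lemma shorter_mod_of_symb_zero:
  assumes p: "p \<in> shorter (Suc l)" and s: "symb l p = 0"
  shows "p \<in> shorter_mod t l"
proof -
  let ?c = "Poly_Mapping.lookup p" and ?S = "{w \<in> Poly_Mapping.keys p. len w = l}"
  have top_coeff: "top_coeff l q p = 0" if "q \<le> 2 * l" for q using top_coeff_symb[OF that, of p] s by (simp add: kcoeff_def)
  have split: "p = (\<Sum>w\<in>?S. Poly_Mapping.single w (?c w)) + (\<Sum>w\<in>Poly_Mapping.keys p - ?S. Poly_Mapping.single w (?c w))"
    using fp_sum_singles[of p] by (simp add: sum.subset_diff[of ?S "Poly_Mapping.keys p"] add.commute)
  have low: "(\<Sum>w\<in>Poly_Mapping.keys p - ?S. Poly_Mapping.single w (?c w)) \<in> shorter_mod t l"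
    by (rule shorter_mod_shorter, rule shorter_sum, rule shorter_single) (use p in \<open>auto simp: shorter_def less_Suc_eq\<close>)
  have "(\<Sum>w\<in>?S. Poly_Mapping.single w (?c w) - Poly_Mapping.single (Word (canon l (q_word w))) (?c w)) \<in> shorter_mod t l"
  proof (rule shorter_mod_sum)
    fix w assume w: "w \<in> ?S"
    then have "wrel t (letters w) (canon l (q_word w))" using wrel_canon[of t "letters w"] by (simp add: q_word_def)
    then have "Poly_Mapping.single w 1 - Poly_Mapping.single (Word (canon l (q_word w))) 1 \<in> shorter_mod t l"
      using w by (auto simp: wrel_def)
    from shorter_mod_mult(2)[OF this, of "const_fp (?c w)" 0] shorter_const[of "?c w"]
    show "Poly_Mapping.single w (?c w) - Poly_Mapping.single (Word (canon l (q_word w))) (?c w) \<in> shorter_mod t l"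
      by (simp add: right_diff_distrib const_fp_single)
  qed
  moreover have "(\<Sum>w\<in>?S. Poly_Mapping.single (Word (canon l (q_word w))) (?c w)) = 0"
  proof -
    have "(\<Sum>w\<in>?S. Poly_Mapping.single (Word (canon l (q_word w))) (?c w))
        = (\<Sum>q\<le>2 * l. \<Sum>w\<in>{w \<in> ?S. q_word w = q}. Poly_Mapping.single (Word (canon l (q_word w))) (?c w))"
      by (rule sum.group[symmetric]) (use q_word_le in auto)
    also have "\<dots> = (\<Sum>q\<le>2 * l. Poly_Mapping.single (Word (canon l q)) (top_coeff l q p))"
    proof (rule sum.cong[OF refl])
      fix q
      have "top_coeff l q p = (\<Sum>w\<in>{w \<in> ?S. q_word w = q}. ?c w)"
        unfolding top_coeff_def lext_def by (rule sum.mono_neutral_cong_right) auto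
      moreover have "Poly_Mapping.single v (sum f S) = (\<Sum>w\<in>S. Poly_Mapping.single v (f w))" for v :: word and S and f :: "word \<Rightarrow> 'a"
        by (induction S rule: infinite_finite_induct) (auto simp: single_add)
      ultimately show "(\<Sum>w\<in>{w \<in> ?S. q_word w = q}. Poly_Mapping.single (Word (canon l (q_word w))) (?c w))
          = Poly_Mapping.single (Word (canon l q)) (top_coeff l q p)" by simp
    qed
    also have "\<dots> = 0" using top_coeff by (intro sum.neutral) auto
    finally show ?thesis .
  qed
  ultimately have "(\<Sum>w\<in>?S. Poly_Mapping.single w (?c w)) \<in> shorter_mod t l" by (simp add: sum_subtractf)
  from shorter_mod_add[OF this low] show ?thesis by (simp only: split[symmetric])
qed

text \<open>
  Symbols are faithful: one direction is the reduction to normal forms, the other the independence of normal forms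
  modulo shorter words.
\<close>
lemma symb_zero_iff:
  assumes p: "p \<in> shorter (Suc l)"
  shows "symb l p = 0 \<longleftrightarrow> p \<in> shorter_mod t l"
proof
  assume "p \<in> shorter_mod t l"
  then obtain r where r: "r \<in> shorter l" "p - r \<in> rel_ideal t" by (auto simp: shorter_mod_def)
  then have "p - r \<in> shorter (Suc l)" using p shorter_mono[of r l "Suc l"] shorter_diff by auto
  then have "symb l (p - r) = 0" using symb_rel_ideal r(2) by blast
  then show "symb l p = 0" using symb_shorter[OF r(1)] by (simp add: symb_diff)
qed (rule shorter_mod_of_symb_zero[OF p])

lemma symb_mult:
  assumes p: "p \<in> shorter (Suc l)" and q: "q \<in> shorter (Suc k)"
  shows "symb (l + k) (p * q) = symb l p * symb k q"
proof -
  let ?P = "Poly_Mapping.keys p" and ?Q = "Poly_Mapping.keys q"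
  have "p * q = (\<Sum>v\<in>?P. \<Sum>w\<in>?Q. Poly_Mapping.single (v + w) (Poly_Mapping.lookup p v * Poly_Mapping.lookup q w))"
    using arg_cong2[OF fp_sum_singles[of p] fp_sum_singles[of q], of "(*)"]
    by (simp add: sum_product mult_single)
  then have "symb (l + k) (p * q) = (\<Sum>v\<in>?P. \<Sum>w\<in>?Q. symb (l + k) (Poly_Mapping.single (v + w) (Poly_Mapping.lookup p v * Poly_Mapping.lookup q w)))"
    by (simp only: fp_additive_sum[of "symb (l + k)", OF symb_add])
  also have "\<dots> = (\<Sum>v\<in>?P. \<Sum>w\<in>?Q. csc (Poly_Mapping.lookup p v) (if len v = l then wmono v else 0) * csc (Poly_Mapping.lookup q w) (if len w = k then wmono w else 0))"
  proof (intro sum.cong refl)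
    fix v w assume "v \<in> ?P" "w \<in> ?Q"
    then have "len v \<le> l" "len w \<le> k" using p q by (auto simp: shorter_def less_Suc_eq_le)
    then show "symb (l + k) (Poly_Mapping.single (v + w) (Poly_Mapping.lookup p v * Poly_Mapping.lookup q w))
      = csc (Poly_Mapping.lookup p v) (if len v = l then wmono v else 0) * csc (Poly_Mapping.lookup q w) (if len w = k then wmono w else 0)"
      by (auto simp: symb_single letters_plus wmono_plus mult.commute)
  qed
  also have "\<dots> = symb l p * symb k q" by (simp add: symb_def lext_def sum_product)
  finally show ?thesis .
qed

lemma Cdeg_power: "a \<in> Cdeg 2 \<Longrightarrow> a ^ n \<in> Cdeg (2 * int n)"
proof (induction n)
  case (Suc n)
  then show ?case using Cdeg_mult[OF Suc.prems Suc.IH] by (simp add: algebra_simps)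
qed (simp add: one_Cdeg)

lemma nmono_Cdeg: "q \<le> 2 * l \<Longrightarrow> nmono l q \<in> Cdeg (2 * int l)"
proof -
  assume q: "q \<le> 2 * l"
  have "nmono l q \<in> Cdeg (2 * int (l - (q + 1) div 2) + 2 * int (q div 2) + 2 * int (q mod 2))"
    unfolding nmono_def by (intro Cdeg_mult Cdeg_power CX_Cdeg CY_Cdeg CZ_Cdeg)
  moreover have "(l - (q + 1) div 2) + q div 2 + q mod 2 = l" using q by presburger
  then have "2 * int (l - (q + 1) div 2) + 2 * int (q div 2) + 2 * int (q mod 2) = 2 * int l" by linarith
  ultimately show ?thesis by metis
qed

lemma symb_Cdeg: "symb l p \<in> Cdeg (2 * int l)"
  unfolding symb_top_coeff by (intro Cdeg_sum Cdeg_csc nmono_Cdeg) simp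

lemma symb_surj:
  assumes a: "a \<in> Cdeg (2 * int l)"
  shows "\<exists>p\<in>shorter (Suc l). symb l p = a"
proof -
  define p where "p = (\<Sum>q\<le>2 * l. Poly_Mapping.single (Word (canon l q)) (kcoeff l q a))"
  have can: "wmono (Word (canon l q)) = (nmono l q :: 'a cone)" for q
    by (simp add: wmono_def canon_def nmono_def)
  have "p \<in> shorter (Suc l)" unfolding p_def by (rule shorter_sum, rule shorter_single) (simp add: canon_length)
  moreover have "symb l p = (\<Sum>q\<le>2 * l. csc (kcoeff l q a) (nmono l q))"
    unfolding p_def fp_additive_sum[of "symb l", OF symb_add]
    by (rule sum.cong) (simp_all add: symb_single canon_length can)
  moreover have "(\<Sum>q\<le>2 * l. csc (kcoeff l q a) (nmono l q)) = a"
  proof (rule cone_eqI; rule cf_eqI)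
    fix i j
    have deg: "cf (cre a) i j \<noteq> 0 \<longrightarrow> 2 * int (i + j) = 2 * int l" "cf (cim a) i j \<noteq> 0 \<longrightarrow> 2 * int (i + j) = 2 * int l - 2"
      using a unfolding Cdeg_def Pdeg_def by blast+
    have "cf (cre (\<Sum>q\<le>2 * l. csc (kcoeff l q a) (nmono l q))) i j
        = (\<Sum>q\<le>2 * l. if q = 2 * j then (if i + j = l then cf (cre a) i j else 0) else 0)"
      unfolding cone_sum coeff_sum
    proof (rule sum.cong[OF refl])
      fix q assume "q \<in> {..2 * l}"
      then show "cf (cre (csc (kcoeff l q a) (nmono l q))) i j
          = (if q = 2 * j then (if i + j = l then cf (cre a) i j else 0) else 0)"
        by (auto simp: nmono_sel cf_monomial kcoeff_def elim!: evenE)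
    qed
    also have "\<dots> = cf (cre a) i j" using deg(1) by auto
    finally show "cf (cre (\<Sum>q\<le>2 * l. csc (kcoeff l q a) (nmono l q))) i j = cf (cre a) i j" .
    have "cf (cim (\<Sum>q\<le>2 * l. csc (kcoeff l q a) (nmono l q))) i j
        = (\<Sum>q\<le>2 * l. if q = 2 * j + 1 then (if i + j + 1 = l then cf (cim a) i j else 0) else 0)"
      unfolding cone_sum coeff_sum
    proof (rule sum.cong[OF refl])
      fix q assume "q \<in> {..2 * l}"
      then show "cf (cim (csc (kcoeff l q a) (nmono l q))) i j
          = (if q = 2 * j + 1 then (if i + j + 1 = l then cf (cim a) i j else 0) else 0)"
        by (auto simp: nmono_sel cf_monomial kcoeff_def elim!: oddE)
    qed
    also have "\<dots> = cf (cim a) i j" using deg(2) by auto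
    finally show "cf (cim (\<Sum>q\<le>2 * l. csc (kcoeff l q a) (nmono l q))) i j = cf (cim a) i j" .
  qed
  ultimately show ?thesis by metis
qed

section \<open>The standard filtration\<close>

definition Fr :: "nat \<Rightarrow> 'k::field free_poly set" where
  "Fr n = {p. \<forall>w\<in>Poly_Mapping.keys p. 2 * len w \<le> n}"

lemma Fr_shorter: "Fr n = shorter (Suc (n div 2))"
  by (auto simp: Fr_def shorter_def)

lemma word_weight_len: "word_weight (a_poly t) w = 2 * len w"
proof -
  have "gen_weight (a_poly t) g = 2" for g by (cases g) (simp_all add: a_poly_degree)
  then have "sum_list (map (gen_weight (a_poly t)) ls) = 2 * length ls" for ls by (induction ls) auto
  then show ?thesis unfolding word_weight_def .
qed

lemma R_filt_eq: "R_filt t n = cls t ` shorter (Suc (n div 2))"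
  unfolding R_filt_def std_filtration_def word_weight_len cls_def[symmetric] Fr_shorter[symmetric] Fr_def ..

lemma F_prev_eq: "F_prev (R_alg t) (R_filt t) n = (if even n then cls t ` shorter (n div 2) else R_filt t n)"
proof (cases n)
  case 0
  then show ?thesis by (auto simp: F_prev_def R_alg_simps shorter_0 image_iff)
next
  case (Suc m)
  then show ?thesis by (auto simp: F_prev_def R_filt_eq elim!: evenE oddE)
qed

text \<open>
  All letters have weight \<open>2\<close>, so nothing new appears in odd degrees.
\<close>
definition rsymb :: "'k::field \<Rightarrow> nat \<Rightarrow> 'k free_poly set \<Rightarrow> 'k cone" where
  "rsymb t n r = (if even n then symb (n div 2) (SOME p. p \<in> shorter (Suc (n div 2)) \<and> cls t p = r) else 0)"

lemma rsymb_cls: "p \<in> shorter (Suc (n div 2)) \<Longrightarrow> rsymb t n (cls t p) = (if even n then symb (n div 2) p else 0)"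
proof -
  assume p: "p \<in> shorter (Suc (n div 2))"
  define q where "q = (SOME q. q \<in> shorter (Suc (n div 2)) \<and> cls t q = cls t p)"
  have q: "q \<in> shorter (Suc (n div 2)) \<and> cls t q = cls t p" unfolding q_def by (rule someI[of _ p]) (simp add: p)
  then have "symb (n div 2) (q - p) = 0"
    using symb_rel_ideal[of "q - p" t "n div 2"] shorter_diff[of q _ p] p by (simp add: cls_eq_iff)
  then show ?thesis by (simp add: rsymb_def q_def[symmetric] symb_diff)
qed

lemma symbols_R: "symbols (R_alg t) (R_filt t) (rsymb t)"
proof (rule symbols.intro)
  let ?R = "R_alg t" and ?F = "R_filt t"
  show "ring ?R" by (rule ring_R_alg)
  then interpret ring ?R .
  have Fcl: "r \<in> ?F n \<longleftrightarrow> (\<exists>p\<in>shorter (Suc (n div 2)). r = cls t p)" for r n by (auto simp: R_filt_eq)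
  have clF: "p \<in> shorter (Suc (n div 2)) \<Longrightarrow> cls t p \<in> ?F n" for p n by (auto simp: Fcl)
  show "r \<in> carrier ?R" if "r \<in> ?F n" for r n using that by (auto simp: Fcl R_alg_simps)
  show "r \<in> ?F (Suc n)" if "r \<in> ?F n" for r n
    using that shorter_mono[of _ "Suc (n div 2)" "Suc (Suc n div 2)"] by (fastforce simp: Fcl)
  show "\<exists>n. r \<in> ?F n" if r: "r \<in> carrier ?R" for r
  proof -
    obtain p where p: "r = cls t p" using r by (auto simp: R_alg_simps)
    define N where "N = (\<Sum>w\<in>Poly_Mapping.keys p. len w)"
    have "len w \<le> N" if "w \<in> Poly_Mapping.keys p" for w
      unfolding N_def by (rule member_le_sum) (use that in auto)
    then have "p \<in> shorter (Suc (2 * N div 2))" by (auto simp: shorter_def less_Suc_eq_le)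
    then show ?thesis using clF p by blast
  qed
  show "zero ?R \<in> ?F n" for n using clF[OF shorter_zero] by (simp add: R_alg_simps)
  show "r \<oplus>\<^bsub>?R\<^esub> s \<in> ?F n" if "r \<in> ?F n" "s \<in> ?F n" for r s n
    using that shorter_add by (fastforce simp: Fcl R_alg_simps)
  show "\<ominus>\<^bsub>?R\<^esub> r \<in> ?F n" if "r \<in> ?F n" for r n
    using that shorter_uminus by (fastforce simp: Fcl R_alg_uminus)
  have fscale: "const_fp c * p \<in> shorter n" if "p \<in> shorter n" for c :: 'a and p n
    using shorter_mult(2)[OF that, of "const_fp c" 0] shorter_const[of c] by simp
  show "c \<odot>\<^bsub>?R\<^esub> r \<in> ?F n" if "r \<in> ?F n" for c r n
    using that fscale by (fastforce simp: Fcl R_alg_simps)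
  show "one ?R \<in> ?F 0" using clF[of 1 0] shorter_const[of 1] by (simp add: R_alg_simps)
  have prod: "p * q \<in> shorter (Suc (n div 2 + m div 2))" if "p \<in> shorter (Suc (n div 2))" "q \<in> shorter (Suc (m div 2))" for p q n m
    using shorter_mult(1)[OF that] by simp
  have prod': "p * q \<in> shorter (Suc ((n + m) div 2))" if "p \<in> shorter (Suc (n div 2))" "q \<in> shorter (Suc (m div 2))" for p q n m
    using shorter_mono[OF prod[OF that], of "Suc ((n + m) div 2)"] by linarith
  show "r \<otimes>\<^bsub>?R\<^esub> s \<in> ?F (n + m)" if rs: "r \<in> ?F n" "s \<in> ?F m" for r s n m
  proof -
    obtain p q where "p \<in> shorter (Suc (n div 2))" "r = cls t p" "q \<in> shorter (Suc (m div 2))" "s = cls t q"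
      using rs by (auto simp: Fcl)
    then show ?thesis using clF[OF prod'] by (simp add: R_alg_simps)
  qed
  show "rsymb t n r \<in> Cdeg (int n)" if r: "r \<in> ?F n" for r n
  proof -
    obtain p where p: "p \<in> shorter (Suc (n div 2))" "r = cls t p" using r by (auto simp: Fcl)
    have "even n \<Longrightarrow> 2 * int (n div 2) = int n" by auto
    then show ?thesis using symb_Cdeg[of "n div 2" p] by (auto simp: p rsymb_cls)
  qed
  show "rsymb t n (r \<oplus>\<^bsub>?R\<^esub> s) = rsymb t n r + rsymb t n s" if rs: "r \<in> ?F n" "s \<in> ?F n" for r s n
  proof -
    obtain p q where "p \<in> shorter (Suc (n div 2))" "r = cls t p" "q \<in> shorter (Suc (n div 2))" "s = cls t q"
      using rs by (auto simp: Fcl)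
    then show ?thesis by (simp add: R_alg_simps rsymb_cls symb_add shorter_add)
  qed
  have symb_fscale: "symb l (const_fp c * p) = csc c (symb l p)" for l c p
    by (rule fp_additive_eqI[of "\<lambda>p. symb l (const_fp c * p)" "\<lambda>p. csc c (symb l p)"])
      (simp_all add: distrib_left symb_add const_fp_single symb_single)
  show "rsymb t n (c \<odot>\<^bsub>?R\<^esub> r) = csc c (rsymb t n r)" if "r \<in> ?F n" for c r n
    using that by (auto simp: Fcl R_alg_simps rsymb_cls symb_fscale fscale)
  show "rsymb t (n + m) (r \<otimes>\<^bsub>?R\<^esub> s) = rsymb t n r * rsymb t m s" if rs: "r \<in> ?F n" "s \<in> ?F m" for r s n m
  proof -
    obtain p q where pq: "p \<in> shorter (Suc (n div 2))" "r = cls t p" "q \<in> shorter (Suc (m div 2))" "s = cls t q"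
      using rs by (auto simp: Fcl)
    have e: "rsymb t (n + m) (r \<otimes>\<^bsub>?R\<^esub> s) = (if even (n + m) then symb ((n + m) div 2) (p * q) else 0)"
      using rsymb_cls[OF prod'[OF pq(1,3)]] by (simp add: pq R_alg_simps)
    show ?thesis
    proof (cases "even n \<and> even m")
      case True
      then have "(n + m) div 2 = n div 2 + m div 2" by auto
      then show ?thesis using True symb_mult[OF pq(1,3)]
        unfolding e unfolding pq(2,4) rsymb_cls[OF pq(1)] rsymb_cls[OF pq(3)] by simp
    next
      case False
      have "symb ((n + m) div 2) (p * q) = 0" if "even (n + m)"
      proof (rule symb_shorter, rule shorter_mono[OF prod[OF pq(1,3)]])
        show "Suc (n div 2 + m div 2) \<le> (n + m) div 2" using False that by presburger
      qed
      then show ?thesis using False unfolding e unfolding pq(2,4) rsymb_cls[OF pq(1)] rsymb_cls[OF pq(3)] by auto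
    qed
  qed
  show "rsymb t 0 (one ?R) = 1"
    using rsymb_cls[of "1 :: 'a free_poly" 0 t] shorter_const[of "1 :: 'a"] symb_single[of 0 0 "1 :: 'a"]
    by (simp add: R_alg_simps wmono_def letters_plus)
  show "rsymb t n r = 0 \<longleftrightarrow> r \<in> F_prev ?R ?F n" if "r \<in> ?F n" for r n
  proof -
    obtain p where p: "p \<in> shorter (Suc (n div 2))" "r = cls t p" using \<open>r \<in> ?F n\<close> by (auto simp: Fcl)
    show ?thesis
    proof (cases "even n")
      case True
      have "p \<in> shorter_mod t (n div 2) \<longleftrightarrow> cls t p \<in> cls t ` shorter (n div 2)"
        by (auto simp: shorter_mod_def image_iff cls_eq_iff)
      then show ?thesis using True symb_zero_iff[OF p(1), of t] by (simp add: p rsymb_cls F_prev_eq)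
    next
      case False
      then show ?thesis using that by (simp add: p rsymb_cls F_prev_eq)
    qed
  qed
  show "\<exists>r\<in>?F n. rsymb t n r = a" if a: "a \<in> Cdeg (int n)" for n a
  proof (cases "even n")
    case True
    then have "2 * int (n div 2) = int n" by auto
    then have "a \<in> Cdeg (2 * int (n div 2))" using a by metis
    then obtain p where "p \<in> shorter (Suc (n div 2))" "symb (n div 2) p = a" using symb_surj by blast
    then show ?thesis using True clF by (intro bexI[of _ "cls t p"]) (simp_all add: rsymb_cls)
  next
    case False
    have "cf (cre a) i j = 0" "cf (cim a) i j = 0" for i j
    proof -
      have "cf (cre a) i j \<noteq> 0 \<longrightarrow> 2 * int (i + j) = int n" "cf (cim a) i j \<noteq> 0 \<longrightarrow> 2 * int (i + j) = int n - 2"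
        using a unfolding Cdeg_def Pdeg_def by blast+
      moreover have "2 * int (i + j) \<noteq> int n" "2 * int (i + j) \<noteq> int n - 2" using False by presburger+
      ultimately show "cf (cre a) i j = 0" "cf (cim a) i j = 0" by blast+
    qed
    then have "a = 0" by (intro cone_eqI cf_eqI) auto
    then show ?thesis using False clF[OF shorter_zero] by (intro bexI[of _ "cls t 0"]) (simp_all add: rsymb_cls)
  qed
qed

section \<open>Endomorphisms of the generalized Weyl algebra\<close>

definition fscale :: "'k::field \<Rightarrow> 'k free_poly \<Rightarrow> 'k free_poly" where "fscale c p = const_fp c * p"

lemma fscale_simps [simp]:
  "fscale 0 p = 0" "fscale 1 p = p" "fscale c 0 = 0" "fscale c (p + q) = fscale c p + fscale c q" "fscale c (p - q) = fscale c p - fscale c q"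
  "fscale c (- p) = - fscale c p" "fscale c (fscale d p) = fscale (c * d) p" "fscale c p * q = fscale c (p * q)" "q * fscale c p = fscale c (q * p)"
proof -
  show "q * fscale c p = fscale c (q * p)"
    unfolding fscale_def by (simp only: mult.assoc[symmetric] const_fp_commute[of q c])
  show "fscale c (fscale d p) = fscale (c * d) p"
    unfolding fscale_def by (simp only: mult.assoc[symmetric] const_fp_mult)
qed (simp_all add: fscale_def algebra_simps)

lemma fscale_left: "fscale (c + d) p = fscale c p + fscale d p" "fscale (c - d) p = fscale c p - fscale d p" "fscale (- c) p = - fscale c p"
  by (simp_all add: fscale_def algebra_simps)

lemma fscale_single: "fscale c (Poly_Mapping.single w d) = Poly_Mapping.single w (c * d)"
  by (simp add: fscale_def const_fp_single)

lemma rel_ideal_fscale: "p \<in> rel_ideal t \<Longrightarrow> fscale c p \<in> rel_ideal t"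
  unfolding fscale_def by (rule rel_ideal_mult_left)

definition subst :: "(gen \<Rightarrow> 'k::field free_poly) \<Rightarrow> 'k free_poly \<Rightarrow> 'k free_poly" where
  "subst im p = lext fscale (\<lambda>w. prod_list (map im (letters w))) p"

lemma subst_add: "subst im (p + q) = subst im p + subst im q"
  unfolding subst_def by (rule lext_add) (rule fscale_left)
lemma subst_single: "subst im (Poly_Mapping.single w c) = fscale c (prod_list (map im (letters w)))"
  unfolding subst_def by (rule lext_single) simp
lemma subst_zero: "subst im 0 = 0" using subst_add[of im 0 0] by simp
lemma subst_diff: "subst im (p - q) = subst im p - subst im q"
  using subst_add[of im "p - q" q] by simp
lemma subst_fscale: "subst im (fscale c p) = fscale c (subst im p)"
  by (rule fp_additive_eqI[of "\<lambda>p. subst im (fscale c p)" "\<lambda>p. fscale c (subst im p)"])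
    (simp_all add: subst_add fscale_single subst_single)
lemma subst_mult: "subst im (p * q) = subst im p * subst im q"
proof (rule fp_additive_eqI[of "\<lambda>p. subst im (p * q)" "\<lambda>p. subst im p * subst im q"])
  fix w c
  show "subst im (Poly_Mapping.single w c * q) = subst im (Poly_Mapping.single w c) * subst im q"
    by (rule fp_additive_eqI[of "\<lambda>q. subst im (Poly_Mapping.single w c * q)" "\<lambda>q. subst im (Poly_Mapping.single w c) * subst im q"])
      (simp_all add: distrib_left subst_add mult_single subst_single letters_plus mult.commute)
qed (simp_all add: distrib_right subst_add)
lemma subst_var: "subst im (var g) = im g"
  by (simp add: var_def subst_single)
lemma subst_const: "subst im (const_fp c) = const_fp c"
  by (simp add: const_fp_def subst_single letters_plus, simp add: fscale_def const_fp_def)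
lemma subst_one: "subst im 1 = 1" using subst_const[of im 1] by simp
lemma subst_eval_at: "subst im (eval_at u d) = eval_at (subst im u) d"
  by (induction d) (simp_all add: subst_zero subst_add subst_mult subst_const)

text \<open>
  The relations of \<open>R\<close> for the images of \<open>x, y, z\<close>, with \<open>a = z (z - t)\<close> and \<open>\<sigma>(a) = (1 + t) + z (z - 2 - t)\<close>
  written out, and commutation with \<open>d \<in> k[z]\<close> required for \<open>d = z\<close> only.
\<close>
definition preserves :: "'k::field \<Rightarrow> (gen \<Rightarrow> 'k free_poly) \<Rightarrow> bool" where
  "preserves t im \<longleftrightarrow>
     im GX * im GY - (const_fp (1 + t) + im GZ * (im GZ - const_fp (2 + t))) \<in> rel_ideal t \<and>
     im GY * im GX - im GZ * (im GZ - const_fp t) \<in> rel_ideal t \<and>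
     im GX * im GZ - (im GZ - 1) * im GX \<in> rel_ideal t \<and>
     im GY * im GZ - (im GZ + 1) * im GY \<in> rel_ideal t"

lemma eval_at_linear_mult: "eval_at w ([:b, 1:] * e) = (w + const_fp b) * eval_at w e"
  by (simp add: eval_at_add eval_at_smult algebra_simps)

text \<open>
  \<open>S\<close> is \<open>\<sigma>\<close> or its inverse, as a substitution \<open>z \<mapsto> z + b\<close>. The relation for \<open>d = z\<close> propagates to all \<open>d\<close> by Horner's
  scheme.
\<close>
lemma eval_at_commutation:
  assumes "u * w - (w + const_fp b) * u \<in> rel_ideal t"
    and S: "\<And>c d. S (pCons c d) = [:c:] + [:b, 1:] * S d" "S 0 = 0"
  shows "u * eval_at w d - eval_at w (S d) * u \<in> rel_ideal t"
proof (induction d)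
  case (pCons c d)
  have "u * eval_at w (pCons c d) - eval_at w (S (pCons c d)) * u
      = (u * w - (w + const_fp b) * u) * eval_at w d + (w + const_fp b) * (u * eval_at w d - eval_at w (S d) * u)"
    unfolding S eval_at_add eval_at_linear_mult by (simp add: algebra_simps const_fp_commute[of u c])
  then show ?case using rel_ideal_add[OF rel_ideal_mult_right[OF assms(1)] rel_ideal_mult_left[OF pCons.IH]] by metis
qed (simp add: S rel_ideal_zero)

lemma subst_rel_ideal:
  assumes im: "preserves t im" and p: "p \<in> rel_ideal t"
  shows "subst im p \<in> rel_ideal t"
proof -
  define J where "J = {p. subst im p \<in> rel_ideal t}"
  have "ideal J free_ring"
  proof (rule idealI[OF ring_free_ring])
    show "subgroup J (add_monoid free_ring)"
    proof (rule free.add.subgroupI)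
      fix p assume "p \<in> J"
      then show "\<ominus>\<^bsub>free_ring\<^esub> p \<in> J" using subst_diff[of im 0 p] rel_ideal_uminus by (simp add: J_def subst_zero)
    qed (auto simp: J_def subst_add rel_ideal_add subst_zero rel_ideal_zero intro: exI[of _ 0])
  qed (auto simp: J_def subst_mult rel_ideal_mult_left rel_ideal_mult_right)
  moreover have "rels t \<subseteq> J"
  proof
    fix r assume "r \<in> rels t"
    then consider "r = vx * vy - poly_in_Z (shift_aut (a_poly t))" | "r = vy * vx - poly_in_Z (a_poly t)"
      | d where "r = vx * poly_in_Z d - poly_in_Z (shift_aut d) * vx"
      | d where "r = vy * poly_in_Z d - poly_in_Z (unshift d) * vy"
      unfolding gwa_relations_def inv_shift by blast
    then show "r \<in> J"
    proof cases
      case 1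
      show ?thesis using im unfolding 1 preserves_def J_def mem_Collect_eq poly_in_Z_eval_at shift_a subst_diff subst_mult subst_var subst_eval_at
        by (simp add: algebra_simps)
    next
      case 2
      show ?thesis using im unfolding 2 preserves_def J_def mem_Collect_eq poly_in_Z_eval_at a_poly_def subst_diff subst_mult subst_var subst_eval_at
        by (simp add: algebra_simps)
    next
      case 3
      have "im GX * eval_at (im GZ) d - eval_at (im GZ) (shift_aut d) * im GX \<in> rel_ideal t"
        by (rule eval_at_commutation[of _ _ "- 1"]) (use im in \<open>simp_all add: preserves_def shift_pCons shift_zero\<close>)
      then show ?thesis using 3 by (simp add: J_def poly_in_Z_eval_at subst_diff subst_mult subst_var subst_eval_at)
    next
      case 4
      have "im GY * eval_at (im GZ) d - eval_at (im GZ) (unshift d) * im GY \<in> rel_ideal t"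
        by (rule eval_at_commutation[of _ _ 1]) (use im in \<open>simp_all add: preserves_def unshift_pCons shift_zero\<close>)
      then show ?thesis using 4 by (simp add: J_def poly_in_Z_eval_at subst_diff subst_mult subst_var subst_eval_at)
    qed
  qed
  ultimately have "p \<in> J" using rel_ideal_minimal p by blast
  then show ?thesis by (simp add: J_def)
qed

lemma alg_endosD:
  assumes "\<phi> \<in> alg_endos (R_alg t)"
  shows "\<phi> (cls t (p + q)) = \<phi> (cls t p) \<oplus>\<^bsub>R_alg t\<^esub> \<phi> (cls t q)"
    "\<phi> (cls t (p * q)) = \<phi> (cls t p) \<otimes>\<^bsub>R_alg t\<^esub> \<phi> (cls t q)"
    "\<phi> (cls t (fscale c p)) = c \<odot>\<^bsub>R_alg t\<^esub> \<phi> (cls t p)" "\<phi> (cls t 1) = cls t 1"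
    "\<phi> (cls t p) \<in> carrier (R_alg t)"
proof -
  have h: "\<phi> \<in> ring_hom (R_alg t) (R_alg t)" and s: "\<And>c r. r \<in> carrier (R_alg t) \<Longrightarrow> \<phi> (c \<odot>\<^bsub>R_alg t\<^esub> r) = c \<odot>\<^bsub>R_alg t\<^esub> \<phi> r"
    using assms by (auto simp: alg_endos_def)
  have c: "cls t p \<in> carrier (R_alg t)" for p by (simp add: R_alg_simps)
  show "\<phi> (cls t (p + q)) = \<phi> (cls t p) \<oplus>\<^bsub>R_alg t\<^esub> \<phi> (cls t q)"
    using ring_hom_add[OF h c c] by (simp add: R_alg_simps)
  show "\<phi> (cls t (p * q)) = \<phi> (cls t p) \<otimes>\<^bsub>R_alg t\<^esub> \<phi> (cls t q)"
    using ring_hom_mult[OF h c c] by (simp add: R_alg_simps)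
  show "\<phi> (cls t (fscale c p)) = c \<odot>\<^bsub>R_alg t\<^esub> \<phi> (cls t p)" using s[OF c] by (simp add: R_alg_simps fscale_def)
  show "\<phi> (cls t 1) = cls t 1" using ring_hom_one[OF h] by (simp add: R_alg_simps)
  show "\<phi> (cls t p) \<in> carrier (R_alg t)" using ring_hom_closed[OF h c] .
qed

lemma R_alg_fscale: "c \<odot>\<^bsub>R_alg t\<^esub> cls t p = cls t (fscale c p)" by (simp add: R_alg_simps fscale_def)

lemma endo_subst:
  assumes \<phi>: "\<phi> \<in> alg_endos (R_alg t)" and im: "\<And>g. \<phi> (cls t (var g)) = cls t (im g)"
  shows "\<phi> (cls t p) = cls t (subst im p)"
proof -
  note D = alg_endosD[OF \<phi>]
  have word: "\<phi> (cls t (Poly_Mapping.single (Word ls) 1)) = cls t (prod_list (map im ls))" for ls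
  proof (induction ls)
    case Nil
    have "Poly_Mapping.single (Word []) 1 = (1 :: 'a free_poly)" by (simp flip: zero_word_def)
    then show ?case using D(4) by simp
  next
    case (Cons g ls)
    have "Poly_Mapping.single (Word (g # ls)) 1 = var g * Poly_Mapping.single (Word ls) (1 :: 'a)"
      by (simp add: var_def mult_single plus_word_def)
    then show ?case by (simp add: D Cons im R_alg_simps)
  qed
  have single: "\<phi> (cls t (Poly_Mapping.single w c)) = cls t (subst im (Poly_Mapping.single w c))" for w c
    using D(3)[of c "Poly_Mapping.single w 1"] word[of "letters w"]
    by (simp add: fscale_single subst_single R_alg_fscale)
  have zero: "\<phi> (cls t 0) = cls t 0" using D(3)[of 0 1] D(4) by (simp add: R_alg_fscale)
  have "\<phi> (cls t (\<Sum>w\<in>S. Poly_Mapping.single w (Poly_Mapping.lookup p w)))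
      = cls t (subst im (\<Sum>w\<in>S. Poly_Mapping.single w (Poly_Mapping.lookup p w)))" for S
    by (induction S rule: infinite_finite_induct) (simp_all add: zero subst_zero D(1) single subst_add R_alg_simps)
  from this[of "Poly_Mapping.keys p"] show ?thesis by (simp flip: fp_sum_singles)
qed

lemma endo_ext:
  assumes \<phi>: "\<phi> \<in> alg_endos (R_alg t)" and \<psi>: "\<psi> \<in> alg_endos (R_alg t)"
    and eq: "\<And>g. \<phi> (cls t (var g)) = \<psi> (cls t (var g))"
  shows "\<phi> = \<psi>"
proof -
  have "\<exists>q. \<phi> (cls t (var g)) = cls t q" for g using alg_endosD(5)[OF \<phi>] by (auto simp: R_alg_simps)
  then obtain im where im: "\<And>g. \<phi> (cls t (var g)) = cls t (im g)" by metis
  show ?thesis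
  proof (rule extensionalityI)
    show "\<phi> \<in> extensional (carrier (R_alg t))" "\<psi> \<in> extensional (carrier (R_alg t))"
      using \<phi> \<psi> by (auto simp: alg_endos_def)
    fix r assume "r \<in> carrier (R_alg t)"
    then obtain p where "r = cls t p" by (auto simp: R_alg_simps)
    then show "\<phi> r = \<psi> r" using endo_subst[OF \<phi> im] endo_subst[OF \<psi>, of im] eq im by simp
  qed
qed

text \<open>
  It is independent of the chosen representatives when substitution preserves the ideal, see \<open>endo_cls\<close>.
\<close>
definition endo :: "'k::field \<Rightarrow> (gen \<Rightarrow> 'k free_poly) \<Rightarrow> 'k free_poly set \<Rightarrow> 'k free_poly set" where
  "endo t im = (\<lambda>r\<in>carrier (R_alg t). cls t (subst im (SOME p. cls t p = r)))"

lemma endo_cls: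
  assumes "preserves t im"
  shows "endo t im (cls t p) = cls t (subst im p)"
proof -
  define q where "q = (SOME q. cls t q = cls t p)"
  have "cls t q = cls t p" unfolding q_def by (rule someI) simp
  then have "cls t (subst im q) = cls t (subst im p)"
    using subst_rel_ideal[OF assms, of "q - p"] by (simp add: cls_eq_iff subst_diff)
  then show ?thesis by (simp add: endo_def R_alg_simps q_def)
qed

lemma endo_alg_endo:
  assumes "preserves t im"
  shows "endo t im \<in> alg_endos (R_alg t)"
proof -
  have "endo t im \<in> ring_hom (R_alg t) (R_alg t)"
    by (rule ring_hom_memI) (auto simp: R_alg_simps endo_cls[OF assms] subst_mult subst_add subst_one)
  moreover have "endo t im \<in> extensional (carrier (R_alg t))" by (simp add: endo_def)
  moreover have "endo t im (c \<odot>\<^bsub>R_alg t\<^esub> r) = c \<odot>\<^bsub>R_alg t\<^esub> endo t im r" if "r \<in> carrier (R_alg t)" for c r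
    using that by (auto simp: R_alg_simps(1) R_alg_fscale endo_cls[OF assms] subst_fscale)
  ultimately show ?thesis by (simp add: alg_endos_def)
qed

text \<open>
  This evaluates the definite description by which the generators of the group are given.
\<close>
lemma R_map_endo:
  assumes im: "preserves t im" "u = cls t (im GX)" "v = cls t (im GY)" "w = cls t (im GZ)"
  shows "R_map t u v w = endo t im"
  unfolding R_map_def
proof (rule the_equality)
  have g: "R_gen t g = cls t (var g)" for g by (simp add: R_gen_def cls_def)
  show "endo t im \<in> alg_endos (R_alg t) \<and> endo t im (R_gen t GX) = u \<and> endo t im (R_gen t GY) = v \<and> endo t im (R_gen t GZ) = w"
    by (simp add: g endo_alg_endo[OF im(1)] endo_cls[OF im(1)] subst_var im)
  fix \<phi> assume \<phi>: "\<phi> \<in> alg_endos (R_alg t) \<and> \<phi> (R_gen t GX) = u \<and> \<phi> (R_gen t GY) = v \<and> \<phi> (R_gen t GZ) = w"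
  show "\<phi> = endo t im"
  proof (rule endo_ext)
    fix gg show "\<phi> (cls t (var gg)) = endo t im (cls t (var gg))"
      using \<phi> by (cases gg) (simp_all add: g endo_cls[OF im(1)] subst_var im)
  qed (use \<phi> endo_alg_endo[OF im(1)] in auto)
qed

section \<open>The linear action\<close>

text \<open>
  With \<open>x\<close> and \<open>y\<close> it spans a copy of \<open>sl\<^sub>2\<close>, see \<open>sl2_relations\<close>.
\<close>
definition h_elem :: "'k::field \<Rightarrow> 'k free_poly" where "h_elem t = vz + vz - fscale (1 + t) 1"

type_synonym 'k triple = "'k \<times> 'k \<times> 'k"

fun lin :: "'k::field \<Rightarrow> 'k triple \<Rightarrow> 'k free_poly" where
  "lin t (a, b, c) = fscale a vx + fscale b (h_elem t) + fscale c vy"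

definition lin_class :: "'k::field \<Rightarrow> 'k triple \<Rightarrow> 'k free_poly set" where "lin_class t v = cls t (lin t v)"

text \<open>
  \<open>\<phi>\<close> restricts to the linear map \<open>f\<close> on the span of \<open>x, h, y\<close>, in coordinates with respect to this basis.
\<close>
definition acts :: "'k::field \<Rightarrow> ('k free_poly set \<Rightarrow> 'k free_poly set) \<Rightarrow> ('k triple \<Rightarrow> 'k triple) \<Rightarrow> bool" where
  "acts t \<phi> f \<longleftrightarrow> \<phi> \<in> alg_endos (R_alg t) \<and> (\<forall>v. \<phi> (lin_class t v) = lin_class t (f v))"

text \<open>
  The linear map that sends the basis vectors to three given vectors.
\<close>
fun comb :: "'k::field triple \<Rightarrow> 'k triple \<Rightarrow> 'k triple \<Rightarrow> 'k triple \<Rightarrow> 'k triple" where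
  "comb (a1, b1, c1) (a2, b2, c2) (a3, b3, c3) (a, b, c)
    = (a * a1 + b * a2 + c * a3, a * b1 + b * b2 + c * b3, a * c1 + b * c2 + c * c3)"

lemma actsI:
  assumes \<phi>: "\<phi> \<in> alg_endos (R_alg t)"
    and "\<phi> (cls t vx) = lin_class t v1" "\<phi> (cls t (h_elem t)) = lin_class t v2" "\<phi> (cls t vy) = lin_class t v3"
  shows "acts t \<phi> (comb v1 v2 v3)"
  unfolding acts_def
proof (intro conjI allI \<phi>)
  fix v :: "'a triple"
  note D = alg_endosD[OF \<phi>]
  obtain a b c a1 b1 c1 a2 b2 c2 a3 b3 c3 where v: "v = (a, b, c)" "v1 = (a1, b1, c1)" "v2 = (a2, b2, c2)" "v3 = (a3, b3, c3)"
    by (metis prod_cases3)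
  have "\<phi> (lin_class t v) = cls t (fscale a (lin t v1) + fscale b (lin t v2) + fscale c (lin t v3))"
    using assms(2-4) unfolding v(1) lin_class_def lin.simps by (simp add: D R_alg_simps) (simp add: fscale_def)
  also have "fscale a (lin t v1) + fscale b (lin t v2) + fscale c (lin t v3) = lin t (comb v1 v2 v3 v)"
    by (simp add: v fscale_left algebra_simps)
  finally show "\<phi> (lin_class t v) = lin_class t (comb v1 v2 v3 v)" by (simp add: lin_class_def)
qed

lemma half: "fscale (1 / 2) (h_elem t + fscale (1 + t) 1) = vz" for t :: "'k::field_char_0"
  by (simp add: h_elem_def fscale_left[symmetric])

text \<open>
  Since \<open>2\<close> is invertible, \<open>z\<close> is recovered from \<open>h\<close>.
\<close>
lemma acts_unique:
  fixes t :: "'k::field_char_0"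
  assumes \<phi>: "acts t \<phi> f" and \<psi>: "acts t \<psi> f"
  shows "\<phi> = \<psi>"
proof (rule endo_ext)
  show 1: "\<phi> \<in> alg_endos (R_alg t)" and 2: "\<psi> \<in> alg_endos (R_alg t)" using \<phi> \<psi> by (auto simp: acts_def)
  have e: "\<phi> (lin_class t v) = \<psi> (lin_class t v)" for v using \<phi> \<psi> unfolding acts_def by metis
  have x: "lin_class t (1, 0, 0) = cls t vx" and y: "lin_class t (0, 0, 1) = cls t vy" and h: "lin_class t (0, 1, 0) = cls t (h_elem t)"
    by (simp_all add: lin_class_def)
  fix g show "\<phi> (cls t (var g)) = \<psi> (cls t (var g))"
  proof (cases g)
    case GX
    then show ?thesis using e[of "(1, 0, 0)"] x by simp
  next
    case GY
    then show ?thesis using e[of "(0, 0, 1)"] y by simp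
  next
    case GZ
    have "\<phi> (cls t (fscale (1 / 2) (h_elem t + fscale (1 + t) 1))) = \<psi> (cls t (fscale (1 / 2) (h_elem t + fscale (1 + t) 1)))"
      using e[of "(0, 1, 0)"] h alg_endosD[OF 1] alg_endosD[OF 2] by metis
    then show ?thesis unfolding half GZ .
  qed
qed

lemma alg_endos_compose:
  assumes \<phi>: "\<phi> \<in> alg_endos (R_alg t)" and \<psi>: "\<psi> \<in> alg_endos (R_alg t)"
  shows "compose (carrier (R_alg t)) \<phi> \<psi> \<in> alg_endos (R_alg t)"
proof -
  interpret ring "R_alg t" by (rule ring_R_alg)
  have h: "\<phi> \<in> ring_hom (R_alg t) (R_alg t)" "\<psi> \<in> ring_hom (R_alg t) (R_alg t)" using \<phi> \<psi> by (auto simp: alg_endos_def)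
  have s: "c \<odot>\<^bsub>R_alg t\<^esub> r \<in> carrier (R_alg t)" if "r \<in> carrier (R_alg t)" for c r
    using that by (auto simp: R_alg_simps)
  have "compose (carrier (R_alg t)) \<phi> \<psi> \<in> ring_hom (R_alg t) (R_alg t)"
    by (rule ring_hom_memI) (simp_all add: compose_eq ring_hom_closed[OF h(1)] ring_hom_closed[OF h(2)]
      ring_hom_mult[OF h(1)] ring_hom_mult[OF h(2)] ring_hom_add[OF h(1)] ring_hom_add[OF h(2)]
      ring_hom_one[OF h(1)] ring_hom_one[OF h(2)])
  then show ?thesis
    using \<phi> \<psi> s ring_hom_closed[OF h(2)] by (auto simp: alg_endos_def compose_eq)
qed

lemma lin_class_carrier: "lin_class t v \<in> carrier (R_alg t)"
  by (simp add: lin_class_def R_alg_simps)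

lemma acts_compose: "acts t \<phi> f \<Longrightarrow> acts t \<psi> g \<Longrightarrow> acts t (compose (carrier (R_alg t)) \<phi> \<psi>) (f \<circ> g)"
  using alg_endos_compose[of \<phi> t \<psi>] by (simp add: acts_def compose_eq lin_class_carrier del: split_paired_All)

lemma id_alg_endo: "(\<lambda>r\<in>carrier (R_alg t). r) \<in> alg_endos (R_alg t)"
  unfolding alg_endos_def by (auto simp: R_alg_simps intro!: ring_hom_memI)

lemma acts_id: "acts t (\<lambda>r\<in>carrier (R_alg t). r) id"
  using id_alg_endo by (auto simp: acts_def lin_class_def R_alg_simps)

subsection \<open>The generators\<close>

fun f_Psi :: "'k::field \<Rightarrow> 'k triple \<Rightarrow> 'k triple" where
  "f_Psi l (a, b, c) = (a - 2 * l * b + l * l * c, b - l * c, c)"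
fun f_Phi :: "'k::field \<Rightarrow> 'k triple \<Rightarrow> 'k triple" where
  "f_Phi l (a, b, c) = (a, l * a + b, l * l * a + 2 * l * b + c)"
fun f_Theta :: "'k::field \<Rightarrow> 'k triple \<Rightarrow> 'k triple" where
  "f_Theta m (a, b, c) = (m * a, b, inverse m * c)"
fun f_Omega :: "'k::field triple \<Rightarrow> 'k triple" where
  "f_Omega (a, b, c) = (c, - b, a)"

lemma relations_fscale:
  "vx * vy - (fscale (1 + t) 1 + vz * (vz - fscale (1 + t) 1 - 1)) \<in> rel_ideal t"
  "vy * vx - vz * (vz - fscale (1 + t) 1 + 1) \<in> rel_ideal t"
  "vx * vz - (vz - 1) * vx \<in> rel_ideal t" "vy * vz - (vz + 1) * vy \<in> rel_ideal t"
proof -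
  have two: "const_fp (2 :: 'a) = 1 + 1" using const_fp_simps(3)[of "1::'a" 1] by simp
  show "vx * vy - (fscale (1 + t) 1 + vz * (vz - fscale (1 + t) 1 - 1)) \<in> rel_ideal t"
    "vy * vx - vz * (vz - fscale (1 + t) 1 + 1) \<in> rel_ideal t"
    using relations(1,2)[of t] by (simp_all add: fscale_def two mult_2_right algebra_simps)
qed (rule relations)+

lemma preservesI:
  assumes "X * Y - (fscale (1 + t) 1 + Z * (Z - fscale (1 + t) 1 - 1)) \<in> rel_ideal t"
    "Y * X - Z * (Z - fscale (1 + t) 1 + 1) \<in> rel_ideal t"
    "X * Z - (Z - 1) * X \<in> rel_ideal t" "Y * Z - (Z + 1) * Y \<in> rel_ideal t"
  shows "preserves t (case_gen X Y Z)"
proof -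
  have two: "const_fp (2 :: 'a) = 1 + 1" using const_fp_simps(3)[of "1::'a" 1] by simp
  show ?thesis using assms by (simp add: preserves_def fscale_def two mult_2_right algebra_simps)
qed

lemma Theta_preserves:
  assumes "m \<noteq> 0"
  shows "preserves t (case_gen (fscale m vx) (fscale (inverse m) vy) vz)"
proof (rule preservesI)
  note r = relations_fscale[of t]
  show "fscale m vx * fscale (inverse m) vy - (fscale (1 + t) 1 + vz * (vz - fscale (1 + t) 1 - 1)) \<in> rel_ideal t"
    "fscale (inverse m) vy * fscale m vx - vz * (vz - fscale (1 + t) 1 + 1) \<in> rel_ideal t"
    using r(1,2) assms by simp_all
  show "fscale m vx * vz - (vz - 1) * fscale m vx \<in> rel_ideal t" "fscale (inverse m) vy * vz - (vz + 1) * fscale (inverse m) vy \<in> rel_ideal t"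
    using rel_ideal_fscale[OF r(3), of m] rel_ideal_fscale[OF r(4), of "inverse m"] by simp_all
qed

lemma Omega_preserves: "preserves t (case_gen vy vx (fscale (1 + t) 1 - vz))"
proof (rule preservesI)
  note r = relations_fscale[of t]
  show "vy * vx - (fscale (1 + t) 1 + (fscale (1 + t) 1 - vz) * (fscale (1 + t) 1 - vz - fscale (1 + t) 1 - 1)) \<in> rel_ideal t"
    using r(2) by (simp add: algebra_simps)
  show "vx * vy - (fscale (1 + t) 1 - vz) * (fscale (1 + t) 1 - vz - fscale (1 + t) 1 + 1) \<in> rel_ideal t"
    using r(1) by (simp add: algebra_simps)
  show "vy * (fscale (1 + t) 1 - vz) - (fscale (1 + t) 1 - vz - 1) * vy \<in> rel_ideal t"
    using rel_ideal_uminus[OF r(4)] by (simp add: algebra_simps)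
  show "vx * (fscale (1 + t) 1 - vz) - (fscale (1 + t) 1 - vz + 1) * vx \<in> rel_ideal t"
    using rel_ideal_uminus[OF r(3)] by (simp add: algebra_simps)
qed

lemma Psi_preserves:
  "preserves t (case_gen vx (vy - fscale l vz - fscale l vz + fscale (l * l) vx + fscale (l * (1 + t)) 1) (vz - fscale l vx))"
  (is "preserves t (case_gen vx ?Y ?Z)")
proof (rule preservesI)
  let ?s = "fscale (1 + t) 1 :: 'a free_poly"
  note r = relations_fscale[of t]
  have "vx * ?Y - (?s + ?Z * (?Z - ?s - 1))
      = (vx * vy - (?s + vz * (vz - ?s - 1))) - fscale l (vx * vz - (vz - 1) * vx)"
    by (simp add: algebra_simps fscale_left)
  then show "vx * ?Y - (?s + ?Z * (?Z - ?s - 1)) \<in> rel_ideal t" using rel_ideal_diff[OF r(1) rel_ideal_fscale[OF r(3)]] by metis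
  have "?Y * vx - ?Z * (?Z - ?s + 1) = (vy * vx - vz * (vz - ?s + 1)) + fscale l (vx * vz - (vz - 1) * vx)"
    by (simp add: algebra_simps fscale_left)
  then show "?Y * vx - ?Z * (?Z - ?s + 1) \<in> rel_ideal t" using rel_ideal_add[OF r(2) rel_ideal_fscale[OF r(3)]] by metis
  have "vx * ?Z - (?Z - 1) * vx = vx * vz - (vz - 1) * vx"
    by (simp add: algebra_simps)
  then show "vx * ?Z - (?Z - 1) * vx \<in> rel_ideal t" using r(3) by metis
  \<comment> \<open>All four relations enter, with the coefficients found by comparing the powers of \<open>l\<close>.\<close>
  have "?Y * ?Z - (?Z + 1) * ?Y = (vy * vz - (vz + 1) * vy) - fscale l (vy * vx - vz * (vz - ?s + 1))
      + fscale l (vx * vy - (?s + vz * (vz - ?s - 1))) - fscale (l * l) (vx * vz - (vz - 1) * vx)"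
    by (simp add: algebra_simps fscale_left)
  then show "?Y * ?Z - (?Z + 1) * ?Y \<in> rel_ideal t"
    using rel_ideal_diff[OF rel_ideal_add[OF rel_ideal_diff[OF r(4) rel_ideal_fscale[OF r(2)]] rel_ideal_fscale[OF r(1)]] rel_ideal_fscale[OF r(3)]] by metis
qed

lemma endo_acts:
  fixes t :: "'k::field"
  assumes im: "preserves t (case_gen X Y Z)" and X: "X = lin t v1" and Y: "Y = lin t v3"
    and H: "Z + Z - fscale (1 + t) 1 = lin t v2"
  shows "acts t (endo t (case_gen X Y Z)) (comb v1 v2 v3)"
proof (rule actsI)
  show "endo t (case_gen X Y Z) \<in> alg_endos (R_alg t)" by (rule endo_alg_endo[OF im])
qed (simp_all add: endo_cls[OF im] subst_var lin_class_def X[symmetric] Y[symmetric] h_elem_def subst_diff subst_add subst_fscale subst_one H[symmetric])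

lemma R_gen_cls: "R_gen t g = cls t (var g)" by (simp add: R_gen_def cls_def)

lemma acts_cong: "acts t \<phi> f \<Longrightarrow> (\<And>v. f v = g v) \<Longrightarrow> acts t \<phi> g" by (simp add: acts_def)

lemma Theta_acts:
  assumes "m \<noteq> 0"
  shows "acts t (Theta_aut t m) (f_Theta m)"
proof -
  have "Theta_aut t m = endo t (case_gen (fscale m vx) (fscale (inverse m) vy) vz)"
    unfolding Theta_aut_def Let_def R_gen_cls
    by (rule R_map_endo[OF Theta_preserves[OF assms]]) (simp_all add: R_alg_fscale)
  moreover have "acts t (endo t (case_gen (fscale m vx) (fscale (inverse m) vy) vz)) (comb (m, 0, 0) (0, 1, 0) (0, 0, inverse m))"
    by (rule endo_acts[OF Theta_preserves[OF assms]]) (simp_all add: h_elem_def)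
  ultimately show ?thesis by (auto elim!: acts_cong simp: mult.commute)
qed

lemma Omega_acts: "acts t (Omega_aut t) f_Omega"
proof -
  have "Omega_aut t = endo t (case_gen vy vx (fscale (1 + t) 1 - vz))"
    unfolding Omega_aut_def Let_def R_gen_cls
    by (rule R_map_endo[OF Omega_preserves]) (simp_all add: R_alg_fscale R_alg_minus R_alg_simps(2))
  moreover have "acts t (endo t (case_gen vy vx (fscale (1 + t) 1 - vz))) (comb (0, 0, 1) (0, - 1, 0) (1, 0, 0))"
    by (rule endo_acts[OF Omega_preserves]) (simp_all add: h_elem_def fscale_left)
  ultimately show ?thesis by (auto elim!: acts_cong)
qed

lemma Psi_acts: "acts t (Psi_aut t l) (f_Psi l)"
proof -
  let ?im = "case_gen vx (vy - fscale l vz - fscale l vz + fscale (l * l) vx + fscale (l * (1 + t)) 1) (vz - fscale l vx)"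
  have two: "fscale (2 * l) p = fscale l p + fscale l p" for p by (simp only: mult_2 fscale_left)
  have "Psi_aut t l = endo t ?im"
    unfolding Psi_aut_def Let_def R_gen_cls
    by (rule R_map_endo[OF Psi_preserves])
      (simp_all add: R_alg_fscale R_alg_minus R_alg_simps(2,5) two power2_eq_square add.commute[of t] diff_diff_eq)
  moreover have "acts t (endo t ?im) (comb (1, 0, 0) (- 2 * l, 1, 0) (l * l, - l, 1))"
    by (rule endo_acts[OF Psi_preserves]) (simp_all add: h_elem_def fscale_left two distrib_left)
  ultimately show ?thesis by (auto elim!: acts_cong simp: algebra_simps)
qed

text \<open>
  \<open>\<Phi>\<close> is the conjugate of \<open>\<Psi>\<close> by \<open>\<Omega>\<close>, so no relations have to be checked again.
\<close>
lemma Phi_acts: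
  fixes t :: "'k::field_char_0"
  shows "acts t (Phi_aut t l) (f_Phi l)"
proof -
  let ?c = "compose (carrier (R_alg t))"
  define \<phi> where "\<phi> = ?c (Omega_aut t) (?c (Psi_aut t l) (Omega_aut t))"
  have \<phi>: "acts t \<phi> (f_Omega \<circ> (f_Psi l \<circ> f_Omega))"
    unfolding \<phi>_def by (intro acts_compose Omega_acts Psi_acts)
  then have \<phi>': "acts t \<phi> (f_Phi l)" by (auto elim!: acts_cong simp: algebra_simps)
  then have en: "\<phi> \<in> alg_endos (R_alg t)" and e: "\<And>v. \<phi> (lin_class t v) = lin_class t (f_Phi l v)" by (auto simp: acts_def)
  note D = alg_endosD[OF en]
  have two: "fscale (2 * l) p = fscale l p + fscale l p" for p by (simp only: mult_2 fscale_left)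
  have x: "\<phi> (cls t vx) = cls t (vx + fscale l (h_elem t) + fscale (l * l) vy)" using e[of "(1, 0, 0)"] by (simp add: lin_class_def)
  have y: "\<phi> (cls t vy) = cls t vy" using e[of "(0, 0, 1)"] by (simp add: lin_class_def)
  have h: "\<phi> (cls t (h_elem t)) = cls t (h_elem t + fscale (2 * l) vy)" using e[of "(0, 1, 0)"] by (simp add: lin_class_def)
  have "\<phi> (cls t (fscale (1 / 2) (h_elem t + fscale (1 + t) 1))) = cls t (fscale (1 / 2) (h_elem t + fscale (2 * l) vy + fscale (1 + t) 1))"
    by (simp add: D R_alg_fscale R_alg_simps(5) h add.assoc add.commute add.left_commute)
  moreover have "fscale (1 / 2) (h_elem t + fscale (2 * l) vy + fscale (1 + t) 1) = fscale (1 / 2) (h_elem t + fscale (1 + t) 1) + fscale l vy"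
    by (simp add: add.assoc add.commute add.left_commute)
  ultimately have z: "\<phi> (cls t vz) = cls t (vz + fscale l vy)" unfolding half by metis
  have "Phi_aut t l = \<phi>"
    unfolding Phi_aut_def Let_def R_gen_cls R_map_def
  proof (rule the_equality)
    let ?P = "\<lambda>\<phi>. \<phi> \<in> alg_endos (R_alg t) \<and>
      \<phi> (cls t vx) = cls t vx \<oplus>\<^bsub>R_alg t\<^esub> (2 * l) \<odot>\<^bsub>R_alg t\<^esub> cls t vz \<oplus>\<^bsub>R_alg t\<^esub> l\<^sup>2 \<odot>\<^bsub>R_alg t\<^esub> cls t vy \<ominus>\<^bsub>R_alg t\<^esub> (l * (t + 1)) \<odot>\<^bsub>R_alg t\<^esub> \<one>\<^bsub>R_alg t\<^esub> \<and>
      \<phi> (cls t vy) = cls t vy \<and> \<phi> (cls t vz) = cls t vz \<oplus>\<^bsub>R_alg t\<^esub> l \<odot>\<^bsub>R_alg t\<^esub> cls t vy"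
    have E: "vx + fscale l (h_elem t) + fscale (l * l) vy = vx + fscale (2 * l) vz + fscale (l\<^sup>2) vy - fscale (l * (t + 1)) 1"
      by (simp add: h_elem_def two power2_eq_square add.commute[of t])
    show P: "?P \<phi>" by (simp add: en x[unfolded E] y z R_alg_fscale R_alg_minus R_alg_simps(2,5))
    fix \<psi> assume "?P \<psi>"
    then have eq: "\<psi> (cls t vx) = \<phi> (cls t vx)" "\<psi> (cls t vy) = \<phi> (cls t vy)" "\<psi> (cls t vz) = \<phi> (cls t vz)" "\<psi> \<in> alg_endos (R_alg t)"
      using P by simp_all
    show "\<psi> = \<phi>"
    proof (rule endo_ext[OF eq(4) en])
      fix g show "\<psi> (cls t (var g)) = \<phi> (cls t (var g))" using eq by (cases g) auto
    qed
  qed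
  then show ?thesis using \<phi>' by simp
qed

section \<open>The Lie algebra of linear elements\<close>

lemma shorter_one: "1 \<in> shorter 1"
  using shorter_const[of 1] by simp

lemma shorter_fscale: "p \<in> shorter n \<Longrightarrow> fscale c p \<in> shorter n"
  using shorter_mult(2)[of p n "const_fp c" 0] shorter_const[of c] by (simp add: fscale_def)

lemma linear_shorter: "fscale k 1 + lin t v \<in> shorter 2"
proof -
  have 1: "(1 :: 'a free_poly) \<in> shorter 2" using shorter_mono[OF shorter_one, of 2] by simp
  obtain a b c where v: "v = (a, b, c)" by (metis prod_cases3)
  show ?thesis unfolding v lin.simps h_elem_def by (intro shorter_add shorter_fscale shorter_diff shorter_var 1)
qed

lemma top_coeff_linear: "top_coeff l q (p + p') = top_coeff l q p + top_coeff l q p'" "top_coeff l q (fscale c p) = c * top_coeff l q p"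
proof -
  show add: "top_coeff l q (p + p') = top_coeff l q p + top_coeff l q p'" for p p' :: "'a free_poly"
    unfolding top_coeff_def by (rule lext_add) (rule distrib_right)
  show "top_coeff l q (fscale c p) = c * top_coeff l q p"
    by (rule fp_additive_eqI[of "\<lambda>p. top_coeff l q (fscale c p)" "\<lambda>p. c * top_coeff l q p"])
      (simp_all add: add distrib_left, simp add: fscale_single top_coeff_def lext_single)
qed

lemma top_coeff_values:
  "top_coeff 1 q (var g :: 'a::field free_poly) = (if q_weight g = q then 1 else 0)" "top_coeff 1 q (1 :: 'a free_poly) = 0"
  "top_coeff 0 0 (1 :: 'a free_poly) = 1"
proof -
  have 1: "(1 :: 'a free_poly) = Poly_Mapping.single 0 1" by simp
  show "top_coeff 1 q (var g :: 'a free_poly) = (if q_weight g = q then 1 else 0)"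
    by (simp add: top_coeff_def var_def lext_single q_word_def)
  show "top_coeff 1 q (1 :: 'a free_poly) = 0" "top_coeff 0 0 (1 :: 'a free_poly) = 1"
    unfolding 1 by (simp_all add: top_coeff_def lext_single letters_plus q_word_def del: single_one)
qed

text \<open>
  The coefficients are read off from the symbols of degree one and then zero.
\<close>
lemma linear_independent:
  fixes t :: "'k::field_char_0"
  assumes p: "fscale k 1 + lin t (a, b, c) \<in> rel_ideal t"
  shows "k = 0 \<and> a = 0 \<and> b = 0 \<and> c = 0"
proof -
  have z: "top_coeff 1 q (fscale k 1 + lin t (a, b, c)) = 0" for q
    using top_coeff_rel_ideal[OF p, of 1 q] linear_shorter[of k t "(a, b, c)"] by (simp add: numeral_2_eq_2)
  have h: "top_coeff 1 q (h_elem t) = 2 * top_coeff 1 q vz" for q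
  proof -
    have "h_elem t = vz + vz + fscale (- (1 + t)) 1" unfolding h_elem_def by (simp only: fscale_left) simp
    then show ?thesis by (simp only: top_coeff_linear top_coeff_values) simp
  qed
  have abc: "a = 0" "b = 0" "c = 0"
    using z[of 0] z[of 1] z[of 2] by (simp_all del: One_nat_def add: top_coeff_linear h top_coeff_values)
  have "top_coeff 0 0 (fscale k 1 :: 'k free_poly) = 0"
    using top_coeff_rel_ideal[of "fscale k 1" t 0 0] p shorter_fscale[OF shorter_one, of k] by (simp add: abc)
  then show ?thesis using abc by (simp add: top_coeff_linear top_coeff_values)
qed

fun scale3 :: "'k::field \<Rightarrow> 'k triple \<Rightarrow> 'k triple" where
  "scale3 s (a, b, c) = (s * a, s * b, s * c)"

lemma lin_scale3: "lin t (scale3 s v) = fscale s (lin t v)"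
  by (cases v) simp

lemma lin_class_scale3: "lin_class t (scale3 s v) = s \<odot>\<^bsub>R_alg t\<^esub> lin_class t v"
  by (simp add: lin_class_def lin_scale3 R_alg_fscale)

lemma lin_class_inj:
  fixes t :: "'k::field_char_0"
  assumes "lin_class t u = lin_class t v"
  shows "u = v"
proof -
  obtain a b c a' b' c' where uv: "u = (a, b, c)" "v = (a', b', c')" by (metis prod_cases3)
  have "lin t u - lin t v = fscale 0 1 + lin t (a - a', b - b', c - c')"
    unfolding uv by (simp add: fscale_left)
  moreover have "lin t u - lin t v \<in> rel_ideal t" using assms by (simp add: lin_class_def cls_eq_iff)
  ultimately have "fscale 0 1 + lin t (a - a', b - b', c - c') \<in> rel_ideal t" by metis
  from linear_independent[OF this] show ?thesis by (simp add: uv)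
qed

lemma affine_of_Lt2:
  fixes t :: "'k::field_char_0"
  assumes "p \<in> shorter 2"
  shows "\<exists>k v. p = fscale k 1 + lin t v"
proof -
  define S where "S = {p. \<exists>k v. p = fscale k 1 + lin t v}"
  have add: "p + q \<in> S" if mem: "p \<in> S" "q \<in> S" for p q
  proof -
    obtain k u l v where pq: "p = fscale k 1 + lin t u" "q = fscale l 1 + lin t v" using mem unfolding S_def by blast
    moreover obtain a b c a' b' c' where "u = (a, b, c)" "v = (a', b', c')" by (metis prod_cases3)
    ultimately have "p = fscale k 1 + lin t (a, b, c)" "q = fscale l 1 + lin t (a', b', c')" by simp_all
    then have "p + q = fscale (k + l) 1 + lin t (a + a', b + b', c + c')" by (simp add: fscale_left)
    then show ?thesis unfolding S_def by blast
  qed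
  have single: "Poly_Mapping.single w c \<in> S" if "len w < 2" for w c
  proof (cases "letters w")
    case Nil
    then have w: "w = 0" by (metis word.collapse zero_word_def)
    have "Poly_Mapping.single w c = fscale c 1 + lin t (0, 0, 0)"
      by (simp add: w fscale_def const_fp_def)
    then show ?thesis unfolding S_def by blast
  next
    case (Cons g ls)
    then have w: "w = Word [g]" using that by (metis One_nat_def Suc_1 Suc_less_eq length_0_conv length_Cons less_one word.collapse)
    have e: "Poly_Mapping.single w c = fscale c (var g)" by (simp add: w var_def fscale_single)
    have "\<exists>k v. fscale c (var g) = fscale k 1 + lin t v"
    proof (cases g)
      case GX
      have "fscale c vx = fscale 0 1 + lin t (c, 0, 0)" by simp
      then show ?thesis using GX by blast
    next
      case GY
      have "fscale c vy = fscale 0 1 + lin t (0, 0, c)" by simp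
      then show ?thesis using GY by blast
    next
      case GZ
      have "fscale c (fscale (1 / 2) (h_elem t + fscale (1 + t) 1)) = fscale (c * ((1 / 2) * (1 + t))) 1 + lin t (0, c * (1 / 2), 0)"
        by (simp add: add.commute)
      then show ?thesis unfolding half GZ by blast
    qed
    then show ?thesis unfolding S_def e by blast
  qed
  have "(\<Sum>w\<in>W. Poly_Mapping.single w (Poly_Mapping.lookup p w)) \<in> S" if "W \<subseteq> Poly_Mapping.keys p" for W
    using finite_subset[OF that finite_keys] that
  proof (induction W rule: finite_induct)
    case empty
    have "0 = fscale 0 1 + lin t (0, 0, 0)" by simp
    then show ?case unfolding S_def sum.empty by blast
  next
    case (insert w W)
    have "len w < 2" using insert.prems assms by (auto simp: shorter_def)
    then show ?case using insert add single by simp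
  qed
  from this[OF order_refl] have "p \<in> S" by (simp flip: fp_sum_singles)
  then show ?thesis by (simp add: S_def)
qed

text \<open>
  The commutator of two elements of the span of \<open>x, h, y\<close>, in coordinates.
\<close>
fun bracket :: "'k::field triple \<Rightarrow> 'k triple \<Rightarrow> 'k triple" where
  "bracket (a, b, c) (a', b', c') = (2 * (b * a' - a * b'), c * a' - a * c', - 2 * (b * c' - c * b'))"

lemma sl2_relations:
  "h_elem t * vx - vx * h_elem t - (vx + vx) \<in> rel_ideal t" "h_elem t * vy - vy * h_elem t + (vy + vy) \<in> rel_ideal t"
  "vy * vx - vx * vy - h_elem t \<in> rel_ideal t"
proof -
  note r = relations_fscale[of t]
  have "h_elem t * vx - vx * h_elem t - (vx + vx) = - ((vx * vz - (vz - 1) * vx) + (vx * vz - (vz - 1) * vx))"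
    by (simp add: h_elem_def algebra_simps)
  then show "h_elem t * vx - vx * h_elem t - (vx + vx) \<in> rel_ideal t" using rel_ideal_uminus[OF rel_ideal_add[OF r(3) r(3)]] by metis
  have "h_elem t * vy - vy * h_elem t + (vy + vy) = - ((vy * vz - (vz + 1) * vy) + (vy * vz - (vz + 1) * vy))"
    by (simp add: h_elem_def algebra_simps)
  then show "h_elem t * vy - vy * h_elem t + (vy + vy) \<in> rel_ideal t" using rel_ideal_uminus[OF rel_ideal_add[OF r(4) r(4)]] by metis
  have "vy * vx - vx * vy - h_elem t = (vy * vx - vz * (vz - fscale (1 + t) 1 + 1)) - (vx * vy - (fscale (1 + t) 1 + vz * (vz - fscale (1 + t) 1 - 1)))"
    by (simp add: h_elem_def algebra_simps)
  then show "vy * vx - vx * vy - h_elem t \<in> rel_ideal t" using rel_ideal_diff[OF r(2) r(1)] by metis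
qed

lemma commutator:
  "(fscale k 1 + lin t u) * (fscale l 1 + lin t v) - (fscale l 1 + lin t v) * (fscale k 1 + lin t u) - lin t (bracket u v) \<in> rel_ideal t"
proof -
  obtain a b c a' b' c' where uv: "u = (a, b, c)" "v = (a', b', c')" by (metis prod_cases3)
  note r = sl2_relations[of t]
  have two: "fscale (2 * s) p = fscale s p + fscale s p" for s and p :: "'a free_poly" by (simp only: mult_2 fscale_left)
  have bb: "bracket u v = (2 * (b * a' - a * b'), c * a' - a * c', - (2 * (b * c' - c * b')))" by (simp add: uv)
  have "(fscale k 1 + lin t u) * (fscale l 1 + lin t v) - (fscale l 1 + lin t v) * (fscale k 1 + lin t u) - lin t (bracket u v)
      = fscale (b * a' - a * b') (h_elem t * vx - vx * h_elem t - (vx + vx)) + fscale (c * a' - a * c') (vy * vx - vx * vy - h_elem t)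
        + fscale (b * c' - c * b') (h_elem t * vy - vy * h_elem t + (vy + vy))"
    unfolding bb unfolding uv lin.simps
    by (simp only: two fscale_left, simp add: distrib_left distrib_right algebra_simps)
  then show ?thesis using rel_ideal_add[OF rel_ideal_add[OF rel_ideal_fscale[OF r(1)] rel_ideal_fscale[OF r(3)]] rel_ideal_fscale[OF r(2)]] by metis
qed

text \<open>
  A commutator has no constant term, and coordinates are unique. With \<open>s \<noteq> 0\<close> this is what removes the constant
  terms from the images of \<open>x, h, y\<close>.
\<close>
lemma commutator_rel:
  fixes t :: "'k::field_char_0"
  assumes "(fscale k 1 + lin t u) * (fscale l 1 + lin t v) - (fscale l 1 + lin t v) * (fscale k 1 + lin t u)
      - fscale s (fscale m 1 + lin t w) \<in> rel_ideal t"
  shows "s * m = 0 \<and> bracket u v = scale3 s w"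
proof -
  obtain a b c a' b' c' where bw: "bracket u v = (a, b, c)" "scale3 s w = (a', b', c')" by (metis prod_cases3)
  have "((fscale k 1 + lin t u) * (fscale l 1 + lin t v) - (fscale l 1 + lin t v) * (fscale k 1 + lin t u) - fscale s (fscale m 1 + lin t w))
      - ((fscale k 1 + lin t u) * (fscale l 1 + lin t v) - (fscale l 1 + lin t v) * (fscale k 1 + lin t u) - lin t (bracket u v))
      = lin t (bracket u v) - (fscale s (fscale m 1) + lin t (scale3 s w))"
    by (simp add: lin_scale3)
  also have "\<dots> = fscale (- (s * m)) 1 + lin t (a - a', b - b', c - c')"
    unfolding bw by (simp add: fscale_left)
  finally have "fscale (- (s * m)) 1 + lin t (a - a', b - b', c - c') \<in> rel_ideal t"
    using rel_ideal_diff[OF assms commutator] by metis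
  from linear_independent[OF this] show ?thesis by (simp add: bw)
qed

lemma acts_bracket:
  fixes t :: "'k::field_char_0"
  assumes "acts t \<phi> f"
  shows "bracket (f u) (f v) = f (bracket u v)"
proof -
  have en: "\<phi> \<in> alg_endos (R_alg t)" and e: "\<And>v. \<phi> (cls t (lin t v)) = cls t (lin t (f v))"
    using assms by (simp_all add: acts_def lin_class_def del: split_paired_All)
  note D = alg_endosD[OF en]
  have "lin t u * lin t v - (lin t v * lin t u + lin t (bracket u v)) \<in> rel_ideal t"
    using commutator[of 0 t u 0 v] by (simp add: diff_diff_eq)
  then have "cls t (lin t u * lin t v) = cls t (lin t v * lin t u + lin t (bracket u v))" by (simp add: cls_eq_iff)
  then have "\<phi> (cls t (lin t u * lin t v)) = \<phi> (cls t (lin t v * lin t u + lin t (bracket u v)))" by (rule arg_cong)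
  then have "cls t (lin t (f u) * lin t (f v)) = cls t (lin t (f v) * lin t (f u) + lin t (f (bracket u v)))"
    by (simp add: D e R_alg_simps)
  then have "lin t (f u) * lin t (f v) - lin t (f v) * lin t (f u) - lin t (f (bracket u v)) \<in> rel_ideal t"
    by (simp add: cls_eq_iff diff_diff_eq)
  then show ?thesis using commutator_rel[of 0 t "f u" 0 "f v" 1 0 "f (bracket u v)"] by (cases "f (bracket u v)") simp
qed

lemma acts_scale3:
  fixes t :: "'k::field_char_0"
  assumes "acts t \<phi> f"
  shows "f (scale3 s v) = scale3 s (f v)"
proof (rule lin_class_inj)
  have "\<phi> (s \<odot>\<^bsub>R_alg t\<^esub> lin_class t v) = s \<odot>\<^bsub>R_alg t\<^esub> \<phi> (lin_class t v)"
    using assms lin_class_carrier[of t v] by (auto simp: acts_def alg_endos_def)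
  moreover have "\<phi> (lin_class t v) = lin_class t (f v)" for v using assms unfolding acts_def by blast
  ultimately show "lin_class t (f (scale3 s v)) = lin_class t (scale3 s (f v))" by (metis lin_class_scale3)
qed

section \<open>Filtered automorphisms\<close>

abbreviation comp_R :: "'k::field \<Rightarrow> ('k free_poly set \<Rightarrow> 'k free_poly set) \<Rightarrow> ('k free_poly set \<Rightarrow> 'k free_poly set) \<Rightarrow> 'k free_poly set \<Rightarrow> 'k free_poly set" where
  "comp_R t \<equiv> compose (carrier (R_alg t))"

abbreviation id_R :: "'k::field \<Rightarrow> 'k free_poly set \<Rightarrow> 'k free_poly set" where
  "id_R t \<equiv> (\<lambda>r\<in>carrier (R_alg t). r)"

abbreviation fauts :: "'k::field \<Rightarrow> ('k free_poly set \<Rightarrow> 'k free_poly set) set" where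
  "fauts t \<equiv> filtered_auts (R_alg t) (R_filt t)"

text \<open>
  The images of the letters lie in the piece of degree \<open>2\<close>, so substitution does not lengthen words.
\<close>
lemma acts_filtered:
  fixes t :: "'k::field_char_0"
  assumes "acts t \<phi> f"
  shows "\<phi> ` R_filt t n \<subseteq> R_filt t n"
proof -
  have en: "\<phi> \<in> alg_endos (R_alg t)" and e: "\<And>v. \<phi> (cls t (lin t v)) = cls t (lin t (f v))"
    using assms by (simp_all add: acts_def lin_class_def del: split_paired_All)
  note D = alg_endosD[OF en]
  have Ll: "lin t v \<in> shorter 2" for v using linear_shorter[of 0 t v] by simp
  have "\<exists>q\<in>shorter 2. \<phi> (cls t (var g)) = cls t q" for g
  proof (cases g)
    case GX
    moreover have "\<phi> (cls t vx) = cls t (lin t (f (1, 0, 0)))" using e[of "(1, 0, 0)"] by simp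
    ultimately show ?thesis using Ll by blast
  next
    case GY
    moreover have "\<phi> (cls t vy) = cls t (lin t (f (0, 0, 1)))" using e[of "(0, 0, 1)"] by simp
    ultimately show ?thesis using Ll by blast
  next
    case GZ
    let ?q = "fscale (1 / 2) (fscale (1 + t) 1 + lin t (f (0, 1, 0)))"
    have h: "\<phi> (cls t (h_elem t)) = cls t (lin t (f (0, 1, 0)))" using e[of "(0, 1, 0)"] by simp
    have "\<phi> (cls t (fscale (1 / 2) (h_elem t + fscale (1 + t) 1))) = cls t ?q"
      by (simp add: D h R_alg_fscale R_alg_simps(5) add.commute)
    then show ?thesis using GZ shorter_fscale[OF linear_shorter] unfolding half by blast
  qed
  then obtain im where im: "\<And>g. im g \<in> shorter 2" "\<And>g. \<phi> (cls t (var g)) = cls t (im g)" by metis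
  have word: "prod_list (map im ls) \<in> shorter (Suc (length ls))" for ls
  proof (induction ls)
    case (Cons g ls)
    then show ?case using shorter_mult(2)[OF Cons.IH, of "im g" 1] im(1)[of g] by (simp add: numeral_2_eq_2)
  qed (use shorter_one in simp)
  have "subst im p \<in> shorter (Suc m)" if "p \<in> shorter (Suc m)" for p m
    unfolding subst_def lext_def
  proof (intro shorter_sum shorter_fscale)
    fix w assume "w \<in> Poly_Mapping.keys p"
    then have "len w < Suc m" using that by (auto simp: shorter_def)
    then show "prod_list (map im (letters w)) \<in> shorter (Suc m)" using shorter_mono[OF word] by simp
  qed
  then show ?thesis unfolding R_filt_eq using endo_subst[OF en im(2)] by auto
qed

lemma acts_filtered_aut:
  fixes t :: "'k::field_char_0"
  assumes \<phi>: "acts t \<phi> f" and \<psi>: "acts t \<psi> f'" and inv: "\<And>v. f (f' v) = v" "\<And>v. f' (f v) = v"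
  shows "\<phi> \<in> fauts t"
proof -
  have "comp_R t \<phi> \<psi> = id_R t" "comp_R t \<psi> \<phi> = id_R t"
    by (rule acts_unique[OF acts_cong[OF acts_compose[OF \<phi> \<psi>]] acts_id], simp add: inv)
      (rule acts_unique[OF acts_cong[OF acts_compose[OF \<psi> \<phi>]] acts_id], simp add: inv)
  then have pq: "\<phi> (\<psi> r) = r" "\<psi> (\<phi> r) = r" if "r \<in> carrier (R_alg t)" for r
    using that by (metis compose_eq restrict_apply')+
  have en: "\<phi> \<in> alg_endos (R_alg t)" "\<psi> \<in> alg_endos (R_alg t)" using \<phi> \<psi> by (auto simp: acts_def)
  have cls: "\<phi> r \<in> carrier (R_alg t)" "\<psi> r \<in> carrier (R_alg t)" if "r \<in> carrier (R_alg t)" for r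
    using that alg_endosD(5)[OF en(1)] alg_endosD(5)[OF en(2)] by (auto simp: R_alg_simps)
  have "bij_betw \<phi> (carrier (R_alg t)) (carrier (R_alg t))"
    by (rule bij_betw_byWitness[of _ \<psi>]) (auto simp: pq cls)
  moreover have "\<phi> r \<in> R_filt t n \<longleftrightarrow> r \<in> R_filt t n" if "r \<in> carrier (R_alg t)" for r n
    using acts_filtered[OF \<phi>, of n] acts_filtered[OF \<psi>, of n] pq(2)[OF that] by (metis image_subset_iff)
  ultimately show ?thesis using en(1)
    by (auto simp: filtered_auts_def alg_auts_def Bij_def fdeg_def alg_endos_def)
qed

lemma generator_filtered:
  fixes t :: "'k::field_char_0"
  shows "Omega_aut t \<in> fauts t" "m \<noteq> 0 \<Longrightarrow> Theta_aut t m \<in> fauts t" "Psi_aut t l \<in> fauts t" "Phi_aut t l \<in> fauts t"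
proof -
  show "Omega_aut t \<in> fauts t"
    by (rule acts_filtered_aut[OF Omega_acts Omega_acts]) auto
  show "Theta_aut t m \<in> fauts t" if "m \<noteq> 0"
    by (rule acts_filtered_aut[OF Theta_acts Theta_acts[of "inverse m"]]) (use that in auto)
  show "Psi_aut t l \<in> fauts t"
    by (rule acts_filtered_aut[OF Psi_acts Psi_acts[of _ "- l"]]) (auto simp: algebra_simps)
  show "Phi_aut t l \<in> fauts t"
    by (rule acts_filtered_aut[OF Phi_acts Phi_acts[of _ "- l"]]) (auto simp: algebra_simps)
qed

lemma alg_aut_inverse:
  assumes \<phi>: "\<phi> \<in> alg_auts (R_alg t)"
  defines "\<psi> \<equiv> restrict (inv_into (carrier (R_alg t)) \<phi>) (carrier (R_alg t))"
  shows "\<psi> \<in> alg_auts (R_alg t)" "r \<in> carrier (R_alg t) \<Longrightarrow> \<phi> (\<psi> r) = r"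
    "r \<in> carrier (R_alg t) \<Longrightarrow> \<psi> r \<in> carrier (R_alg t)" "comp_R t \<psi> \<phi> = id_R t"
proof -
  let ?C = "carrier (R_alg t)"
  interpret ring "R_alg t" by (rule ring_R_alg)
  have B: "\<phi> \<in> Bij ?C" and h: "\<phi> \<in> ring_hom (R_alg t) (R_alg t)"
    and s: "\<And>c r. r \<in> ?C \<Longrightarrow> \<phi> (c \<odot>\<^bsub>R_alg t\<^esub> r) = c \<odot>\<^bsub>R_alg t\<^esub> \<phi> r"
    using \<phi> by (auto simp: alg_auts_def alg_endos_def)
  have B': "\<psi> \<in> Bij ?C" unfolding \<psi>_def by (rule restrict_inv_into_Bij[OF B])
  have inj: "inj_on \<phi> ?C" using B by (simp add: Bij_def bij_betw_def)
  show pq: "\<phi> (\<psi> r) = r" if "r \<in> ?C" for r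
    using that B by (simp add: \<psi>_def Bij_def bij_betw_def f_inv_into_f)
  show c: "\<psi> r \<in> ?C" if "r \<in> ?C" for r using that B' Bij_imp_funcset by blast
  have sc: "k \<odot>\<^bsub>R_alg t\<^esub> r \<in> ?C" if "r \<in> ?C" for k r using that by (auto simp: R_alg_simps)
  show "comp_R t \<psi> \<phi> = id_R t" unfolding \<psi>_def by (rule Bij_compose_restrict_eq[OF B])
  have eqI: "\<psi> r = s" if "r \<in> ?C" "s \<in> ?C" "\<phi> s = r" for r s
    using inj_onD[OF inj, of "\<psi> r" s] that c pq by simp
  have "\<psi> \<in> ring_hom (R_alg t) (R_alg t)"
  proof (rule ring_hom_memI)
    fix x y assume xy: "x \<in> ?C" "y \<in> ?C"
    show "\<psi> x \<in> ?C" using c xy by blast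
    show "\<psi> (x \<otimes>\<^bsub>R_alg t\<^esub> y) = \<psi> x \<otimes>\<^bsub>R_alg t\<^esub> \<psi> y"
      by (rule eqI) (use xy in \<open>simp_all add: c pq ring_hom_mult[OF h]\<close>)
    show "\<psi> (x \<oplus>\<^bsub>R_alg t\<^esub> y) = \<psi> x \<oplus>\<^bsub>R_alg t\<^esub> \<psi> y"
      by (rule eqI) (use xy in \<open>simp_all add: c pq ring_hom_add[OF h]\<close>)
  qed (rule eqI, simp_all add: ring_hom_one[OF h])
  moreover have "\<psi> (k \<odot>\<^bsub>R_alg t\<^esub> r) = k \<odot>\<^bsub>R_alg t\<^esub> \<psi> r" if "r \<in> ?C" for k r
    using that by (intro eqI) (simp_all add: sc c s pq)
  ultimately show "\<psi> \<in> alg_auts (R_alg t)" using B' by (simp add: alg_auts_def alg_endos_def Bij_def)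
qed

lemma alg_aut_group_simps:
  "carrier (alg_aut_group (R_alg t)) = alg_auts (R_alg t)" "\<one>\<^bsub>alg_aut_group (R_alg t)\<^esub> = id_R t"
  "\<phi> \<in> alg_auts (R_alg t) \<Longrightarrow> \<psi> \<in> alg_auts (R_alg t) \<Longrightarrow> \<phi> \<otimes>\<^bsub>alg_aut_group (R_alg t)\<^esub> \<psi> = comp_R t \<phi> \<psi>"
  by (simp_all add: alg_aut_group_def BijGroup_def alg_auts_def)

lemma alg_auts_compose: "\<phi> \<in> alg_auts (R_alg t) \<Longrightarrow> \<psi> \<in> alg_auts (R_alg t) \<Longrightarrow> comp_R t \<phi> \<psi> \<in> alg_auts (R_alg t)"
  by (simp add: alg_auts_def alg_endos_compose compose_Bij)

lemma group_alg_aut: "group (alg_aut_group (R_alg t))"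
proof (rule groupI)
  show one: "\<one>\<^bsub>alg_aut_group (R_alg t)\<^esub> \<in> carrier (alg_aut_group (R_alg t))"
    by (simp add: alg_aut_group_simps alg_auts_def id_alg_endo id_Bij)
  fix f assume f: "f \<in> carrier (alg_aut_group (R_alg t))"
  then have fB: "f \<in> Bij (carrier (R_alg t))" by (simp add: alg_aut_group_simps alg_auts_def)
  show "\<one>\<^bsub>alg_aut_group (R_alg t)\<^esub> \<otimes>\<^bsub>alg_aut_group (R_alg t)\<^esub> f = f"
    using one f fB by (simp add: alg_aut_group_simps Bij_imp_funcset Bij_imp_extensional)
  show "\<exists>g\<in>carrier (alg_aut_group (R_alg t)). g \<otimes>\<^bsub>alg_aut_group (R_alg t)\<^esub> f = \<one>\<^bsub>alg_aut_group (R_alg t)\<^esub>"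
    using f alg_aut_inverse(1,4)[of f t] by (auto simp: alg_aut_group_simps)
  fix g h assume g: "g \<in> carrier (alg_aut_group (R_alg t))" and h: "h \<in> carrier (alg_aut_group (R_alg t))"
  show "f \<otimes>\<^bsub>alg_aut_group (R_alg t)\<^esub> g \<in> carrier (alg_aut_group (R_alg t))"
    using f g by (simp add: alg_aut_group_simps alg_auts_compose)
  have "h \<in> carrier (R_alg t) \<rightarrow> carrier (R_alg t)" using h by (simp add: alg_aut_group_simps alg_auts_def Bij_imp_funcset)
  then show "f \<otimes>\<^bsub>alg_aut_group (R_alg t)\<^esub> g \<otimes>\<^bsub>alg_aut_group (R_alg t)\<^esub> h = f \<otimes>\<^bsub>alg_aut_group (R_alg t)\<^esub> (g \<otimes>\<^bsub>alg_aut_group (R_alg t)\<^esub> h)"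
    using f g h by (simp add: alg_aut_group_simps alg_auts_compose compose_assoc)
qed

lemma fauts_alg_auts: "\<phi> \<in> fauts t \<Longrightarrow> \<phi> \<in> alg_auts (R_alg t)" by (simp add: filtered_auts_def)

lemma fauts_compose: "\<phi> \<in> fauts t \<Longrightarrow> \<psi> \<in> fauts t \<Longrightarrow> comp_R t \<phi> \<psi> \<in> fauts t"
  using alg_auts_compose[of \<phi> t \<psi>] Bij_imp_funcset[of \<psi> "carrier (R_alg t)"]
  by (auto simp: filtered_auts_def compose_eq alg_auts_def Pi_iff)

lemma fauts_id: "id_R t \<in> fauts t"
  by (simp add: filtered_auts_def alg_auts_def id_alg_endo id_Bij)

lemma subgroup_fauts: "subgroup (fauts t) (alg_aut_group (R_alg t))"
proof (rule group.subgroupI[OF group_alg_aut])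
  show "fauts t \<subseteq> carrier (alg_aut_group (R_alg t))" by (auto simp: alg_aut_group_simps fauts_alg_auts)
  show "fauts t \<noteq> {}" using fauts_id by blast
  fix \<phi> assume \<phi>: "\<phi> \<in> fauts t"
  then have \<phi>': "\<phi> \<in> alg_auts (R_alg t)" by (rule fauts_alg_auts)
  let ?\<psi> = "restrict (inv_into (carrier (R_alg t)) \<phi>) (carrier (R_alg t))"
  note I = alg_aut_inverse[OF \<phi>']
  have "inv\<^bsub>alg_aut_group (R_alg t)\<^esub> \<phi> = ?\<psi>"
    by (rule group.inv_equality[OF group_alg_aut]) (use \<phi>' I(1,4) in \<open>simp_all add: alg_aut_group_simps\<close>)
  moreover have "fdeg (R_filt t) (?\<psi> r) = fdeg (R_filt t) r" if r: "r \<in> carrier (R_alg t)" for r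
  proof -
    have "fdeg (R_filt t) (\<phi> (?\<psi> r)) = fdeg (R_filt t) (?\<psi> r)"
      using \<phi> I(3)[OF r] unfolding filtered_auts_def by blast
    then show ?thesis unfolding I(2)[OF r] by simp
  qed
  then have "?\<psi> \<in> fauts t" using I(1) unfolding filtered_auts_def by blast
  ultimately show "inv\<^bsub>alg_aut_group (R_alg t)\<^esub> \<phi> \<in> fauts t" by simp
  fix \<psi> assume "\<psi> \<in> fauts t"
  then show "\<phi> \<otimes>\<^bsub>alg_aut_group (R_alg t)\<^esub> \<psi> \<in> fauts t"
    using \<phi> by (simp add: alg_aut_group_simps fauts_alg_auts fauts_compose)
qed

abbreviation gen_group :: "'k::field \<Rightarrow> ('k free_poly set \<Rightarrow> 'k free_poly set) set" where
  "gen_group t \<equiv> generate (alg_aut_group (R_alg t)) (G_gens t)"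

lemma gen_group_fauts:
  fixes t :: "'k::field_char_0"
  shows "gen_group t \<subseteq> fauts t"
  by (rule group.generate_subgroup_incl[OF group_alg_aut _ subgroup_fauts])
    (auto simp: G_gens_def generator_filtered)

lemma gen_group_compose:
  fixes t :: "'k::field_char_0"
  assumes "\<phi> \<in> gen_group t" "\<psi> \<in> gen_group t"
  shows "comp_R t \<phi> \<psi> \<in> gen_group t"
proof -
  have "\<phi> \<in> alg_auts (R_alg t)" "\<psi> \<in> alg_auts (R_alg t)" using assms gen_group_fauts[of t] by (auto dest: fauts_alg_auts)
  then show ?thesis using generate.eng[OF assms] by (simp add: alg_aut_group_simps)
qed

text \<open>
  Each of \<open>x, h, y\<close> is a nonzero multiple of a commutator of two of them, and commutators of elements of the piece of
  degree \<open>2\<close> have no constant term.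
\<close>
lemma filtered_aut_acts:
  fixes t :: "'k::field_char_0"
  assumes g: "g \<in> fauts t"
  obtains f where "acts t g f"
proof -
  have en: "g \<in> alg_endos (R_alg t)" using g by (simp add: filtered_auts_def alg_auts_def)
  note D = alg_endosD[OF en]
  have aff: "\<exists>k v. g (cls t p) = cls t (fscale k 1 + lin t v)" if "p \<in> shorter 2" for p
  proof -
    have "cls t p \<in> R_filt t 2" using that by (simp add: R_filt_eq numeral_2_eq_2)
    then have "g (cls t p) \<in> R_filt t 2" using symbols.filtered_autsD(4)[OF symbols_R g, of 2] by blast
    then obtain q where "q \<in> shorter 2" "g (cls t p) = cls t q" by (auto simp: R_filt_eq numeral_2_eq_2)
    then show ?thesis using affine_of_Lt2[of q t] by metis
  qed
  have hL: "h_elem t \<in> shorter 2" using linear_shorter[of 0 t "(0, 1, 0)"] by simp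
  obtain k1 v1 where 1: "g (cls t vx) = cls t (fscale k1 1 + lin t v1)" using aff[OF shorter_var] by blast
  obtain k2 v2 where 2: "g (cls t (h_elem t)) = cls t (fscale k2 1 + lin t v2)" using aff[OF hL] by blast
  obtain k3 v3 where 3: "g (cls t vy) = cls t (fscale k3 1 + lin t v3)" using aff[OF shorter_var] by blast
  let ?p1 = "fscale k1 1 + lin t v1" and ?p2 = "fscale k2 1 + lin t v2" and ?p3 = "fscale k3 1 + lin t v3"
  note r = sl2_relations[of t]
  have rel: "P * Q - Q * P - fscale s S \<in> rel_ideal t"
    if "g (cls t p) = cls t P" "g (cls t q) = cls t Q" "g (cls t u) = cls t S" "p * q - q * p - fscale s u \<in> rel_ideal t" for p q u P Q S s
  proof -
    have "cls t (p * q) = cls t (q * p + fscale s u)" using that(4) by (simp add: cls_eq_iff diff_diff_eq)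
    then have "g (cls t (p * q)) = g (cls t (q * p + fscale s u))" by simp
    then have "cls t (P * Q) = cls t (Q * P + fscale s S)" using that(1-3) by (simp add: D R_alg_simps(4,5) R_alg_fscale)
    then show ?thesis by (simp add: cls_eq_iff diff_diff_eq)
  qed
  have two: "fscale 2 p = p + p" "fscale (- 2) p = - (p + p)" for p :: "'k free_poly"
    by (simp_all only: fscale_left one_add_one[symmetric]) simp_all
  have r2: "h_elem t * vy - vy * h_elem t - fscale (- 2) vy \<in> rel_ideal t" using r(2) by (simp only: two diff_minus_eq_add)
  have "2 * k1 = 0" using commutator_rel[OF rel[OF 2 1 1, of 2]] r(1) by (simp only: two, simp?)
  moreover have "- 2 * k3 = 0" using commutator_rel[OF rel[OF 2 3 3 r2]] by blast
  moreover have "1 * k2 = 0" using commutator_rel[OF rel[OF 3 1 2, of 1]] r(3) by (simp only: fscale_simps, simp?)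
  ultimately have "k1 = 0" "k2 = 0" "k3 = 0" by simp_all
  then have "acts t g (comb v1 v2 v3)"
    using 1 2 3 by (intro actsI[OF en]) (simp_all add: lin_class_def)
  then show thesis by (rule that)
qed

lemma acts_nonzero:
  fixes t :: "'k::field_char_0"
  assumes g: "g \<in> fauts t" and f: "acts t g f"
  shows "f (1, 0, 0) \<noteq> (0, 0, 0)"
proof
  assume z: "f (1, 0, 0) = (0, 0, 0)"
  have "f (0, 0, 0) = (0, 0, 0)" using acts_scale3[OF f, of 0 "(1, 0, 0)"] z by simp
  then have "g (lin_class t (1, 0, 0)) = g (lin_class t (0, 0, 0))" using f z by (simp add: acts_def)
  moreover have "inj_on g (carrier (R_alg t))"
    using symbols.filtered_autsD(1)[OF symbols_R g] by (rule bij_betw_imp_inj_on)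
  ultimately have "lin_class t (1, 0, 0) = lin_class t (0, 0, 0)" by (meson lin_class_carrier inj_onD)
  then show False using lin_class_inj[of t "(1, 0, 0)" "(0, 0, 0)"] by simp
qed

lemma generators_in_gen_group: "Omega_aut t \<in> gen_group t" "m \<noteq> 0 \<Longrightarrow> Theta_aut t m \<in> gen_group t" "Psi_aut t l \<in> gen_group t" "Phi_aut t l \<in> gen_group t"
  by (auto intro!: generate.incl simp: G_gens_def)

text \<open>
  The image \<open>(a, b, c)\<close> of \<open>x\<close> is isotropic, \<open>b\<^sup>2 = a c\<close>, because the image \<open>(p, q, r)\<close> of \<open>h\<close> satisfies
  \<open>[(p, q, r), (a, b, c)] = 2 (a, b, c)\<close>. Isotropic vectors form one orbit: if \<open>a \<noteq> 0\<close>, then \<open>\<Phi>\<close> with parameter \<open>- b / a\<close> clears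
  \<open>b\<close> and with it \<open>c\<close>; if \<open>a = 0\<close>, then \<open>b = 0\<close> and \<open>\<Omega>\<close> moves \<open>c\<close> to the front. A torus element normalizes the rest.
\<close>
lemma highest_weight_normal_form:
  fixes t :: "'k::field_char_0"
  assumes g: "g \<in> fauts t" and f: "acts t g f"
  obtains \<phi> s where "\<phi> \<in> gen_group t" "acts t \<phi> s" "s (f (1, 0, 0)) = (1, 0, 0)"
proof -
  obtain a b c p q r where v: "f (1, 0, 0) = (a, b, c)" "f (0, 1, 0) = (p, q, r)" by (metis prod_cases3)
  have E: "bracket (p, q, r) (a, b, c) = scale3 2 (a, b, c)"
    using acts_bracket[OF f, of "(0, 1, 0)" "(1, 0, 0)"] acts_scale3[OF f, of 2 "(1, 0, 0)"] by (simp add: v)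
  then have "2 * (q * a - p * b) = 2 * a" and "- 2 * (q * c - r * b) = 2 * c" and e2: "r * a - p * c = 2 * b"
    by (simp_all only: bracket.simps scale3.simps prod.inject)
  then have "2 * (q * a - p * b) = 2 * a" "2 * (r * b - q * c) = 2 * c" by (simp_all add: algebra_simps)
  then have "q * a - p * b = a" "r * b - q * c = c" by (simp_all only: mult_cancel_left) simp_all
  note e = this(1) e2 this(2)
  \<comment> \<open>Eliminate \<open>r\<close> between the second and the third equation.\<close>
  have "2 * (b * b) - a * c = c * (q * a - p * b)"
    using arg_cong[OF e(2), of "\<lambda>x. b * x"] arg_cong[OF e(3), of "\<lambda>x. a * x"] by (simp add: algebra_simps)
  then have "2 * (b * b) = 2 * (a * c)" unfolding e(1) by (simp add: algebra_simps)
  then have bac: "b * b = a * c" by simp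
  show thesis
  proof (cases "a = 0")
    case False
    have \<phi>: "acts t (comp_R t (Theta_aut t (inverse a)) (Phi_aut t (- b / a))) (f_Theta (inverse a) \<circ> f_Phi (- b / a))"
      using False by (intro acts_compose Theta_acts Phi_acts) simp
    have "b * (b * a) + a * (a * c) = 2 * (a * (b * b))" using bac by (simp add: algebra_simps)
    then have "(f_Theta (inverse a) \<circ> f_Phi (- b / a)) (f (1, 0, 0)) = (1, 0, 0)"
      using False bac by (simp add: v field_simps)
    then show thesis
      using that[OF _ \<phi>] False by (simp add: gen_group_compose generators_in_gen_group)
  next
    case True
    then have b: "b = 0" using bac by simp
    then have c: "c \<noteq> 0" using True acts_nonzero[OF g f] v by simp
    have \<phi>: "acts t (comp_R t (Theta_aut t (inverse c)) (Omega_aut t)) (f_Theta (inverse c) \<circ> f_Omega)"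
      using c by (intro acts_compose Theta_acts Omega_acts) simp
    have "(f_Theta (inverse c) \<circ> f_Omega) (f (1, 0, 0)) = (1, 0, 0)" using True b c by (simp add: v)
    then show thesis
      using that[OF _ \<phi>] c by (simp add: gen_group_compose generators_in_gen_group)
  qed
qed

text \<open>
  After \<open>x\<close> has been fixed, \<open>[h, x] = 2 x\<close> forces \<open>h\<close> to go to \<open>h + p x\<close>, and \<open>\<Psi>\<close> with parameter \<open>p / 2\<close> fixes \<open>h\<close> while
  keeping \<open>x\<close>. Then \<open>[y, x] = h\<close> and \<open>[h, y] = - 2 y\<close> leave only \<open>y\<close> as the image of \<open>y\<close>.
\<close>
lemma fauts_gen_group:
  fixes t :: "'k::field_char_0"
  assumes g: "g \<in> fauts t"
  shows "g \<in> gen_group t"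
proof -
  obtain f where f: "acts t g f" by (rule filtered_aut_acts[OF g])
  obtain \<phi> s where \<phi>: "\<phi> \<in> gen_group t" and s: "acts t \<phi> s" and s1: "s (f (1, 0, 0)) = (1, 0, 0)"
    by (rule highest_weight_normal_form[OF g f])
  define f1 where "f1 = s \<circ> f"
  have f1: "acts t (comp_R t \<phi> g) f1" unfolding f1_def by (rule acts_compose[OF s f])
  have x1: "f1 (1, 0, 0) = (1, 0, 0)" by (simp add: f1_def s1)
  obtain p q r where h1: "f1 (0, 1, 0) = (p, q, r)" by (metis prod_cases3)
  have "bracket (p, q, r) (1, 0, 0) = scale3 2 (1, 0, 0)"
    using acts_bracket[OF f1, of "(0, 1, 0)" "(1, 0, 0)"] acts_scale3[OF f1, of 2 "(1, 0, 0)"] by (simp add: x1 h1)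
  then have qr: "q = 1" "r = 0" by simp_all
  define f2 where "f2 = f_Psi (p / 2) \<circ> f1"
  have f2: "acts t (comp_R t (Psi_aut t (p / 2)) (comp_R t \<phi> g)) f2"
    unfolding f2_def by (rule acts_compose[OF Psi_acts f1])
  have x2: "f2 (1, 0, 0) = (1, 0, 0)" and h2: "f2 (0, 1, 0) = (0, 1, 0)" by (simp_all add: f2_def x1 h1 qr)
  obtain p' q' r' where y2: "f2 (0, 0, 1) = (p', q', r')" by (metis prod_cases3)
  have qr': "q' = 0" "r' = 1"
    using acts_bracket[OF f2, of "(0, 0, 1)" "(1, 0, 0)"] by (simp_all add: x2 h2 y2)
  have "bracket (0, 1, 0) (p', q', r') = scale3 (- 2) (p', q', r')"
    using acts_bracket[OF f2, of "(0, 1, 0)" "(0, 0, 1)"] acts_scale3[OF f2, of "- 2" "(0, 0, 1)"] by (simp add: h2 y2)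
  then have "4 * p' = 0" by simp
  then have p': "p' = 0" by simp
  let ?k = "comp_R t (Psi_aut t (p / 2)) \<phi>"
  have k: "?k \<in> gen_group t" by (rule gen_group_compose[OF generators_in_gen_group(3) \<phi>])
  have e: "comp_R t (Psi_aut t (p / 2)) (comp_R t \<phi> g) (lin_class t v) = lin_class t (f2 v)" for v
    using f2 unfolding acts_def by blast
  have "acts t (comp_R t (Psi_aut t (p / 2)) (comp_R t \<phi> g)) (comb (1, 0, 0) (0, 1, 0) (0, 0, 1))"
  proof (rule actsI)
    show "comp_R t (Psi_aut t (p / 2)) (comp_R t \<phi> g) \<in> alg_endos (R_alg t)" using f2 by (simp add: acts_def)
  qed (use e[of "(1, 0, 0)"] e[of "(0, 1, 0)"] e[of "(0, 0, 1)"] in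
      \<open>simp_all add: x2 h2 y2 qr' p', simp_all add: lin_class_def\<close>)
  then have "acts t (comp_R t (Psi_aut t (p / 2)) (comp_R t \<phi> g)) id" by (rule acts_cong) auto
  then have "comp_R t (Psi_aut t (p / 2)) (comp_R t \<phi> g) = id_R t" by (rule acts_unique[OF _ acts_id])
  moreover have "g \<in> carrier (R_alg t) \<rightarrow> carrier (R_alg t)"
    using symbols.filtered_autsD(1)[OF symbols_R g] by (auto dest: bij_betwE)
  ultimately have kg: "comp_R t ?k g = id_R t" by (simp add: compose_assoc)
  interpret G: group "alg_aut_group (R_alg t)" by (rule group_alg_aut)
  have ka: "?k \<in> alg_auts (R_alg t)" and ga: "g \<in> alg_auts (R_alg t)" using k g gen_group_fauts fauts_alg_auts by blast+
  have "?k \<otimes>\<^bsub>alg_aut_group (R_alg t)\<^esub> g = \<one>\<^bsub>alg_aut_group (R_alg t)\<^esub>"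
    using kg ka ga by (simp add: alg_aut_group_simps)
  then have "g = inv\<^bsub>alg_aut_group (R_alg t)\<^esub> ?k"
    using ka ga by (metis G.inv_equality G.inv_inv G.inv_closed alg_aut_group_simps(1))
  moreover have "inv\<^bsub>alg_aut_group (R_alg t)\<^esub> ?k \<in> gen_group t"
    using k gen_group_fauts fauts_alg_auts by (intro G.generate_m_inv_closed)
      (auto simp: alg_aut_group_simps G_gens_def generator_filtered fauts_alg_auts)
  ultimately show ?thesis by simp
qed

section \<open>Triviality of the homological determinant\<close>

abbreviation chi :: "'k::field \<Rightarrow> ('k free_poly set \<Rightarrow> 'k free_poly set) \<Rightarrow> 'k" where
  "chi t \<equiv> filtered_hdet (R_alg t) (R_filt t)"

lemma chi_mult:
  fixes t :: "'k::field_char_0"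
  assumes "g \<in> fauts t" "h \<in> fauts t"
  shows "chi t (comp_R t g h) = chi t g * chi t h"
  by (rule symbols.filtered_hdet_mult(1)[OF symbols_R assms fauts_compose[OF assms]])

lemma chi_nonzero:
  fixes t :: "'k::field_char_0"
  assumes "g \<in> fauts t"
  shows "chi t g \<noteq> 0"
  by (rule symbols.filtered_hdet_mult(2)[OF symbols_R assms assms fauts_compose[OF assms assms]])

text \<open>
  Identities in the group are verified on the coordinates of the span of \<open>x, h, y\<close>.
\<close>
lemma chi_eqI:
  fixes t :: "'k::field_char_0"
  assumes "g \<in> fauts t" "h \<in> fauts t" "g' \<in> fauts t" "h' \<in> fauts t"
    and "acts t g f" "acts t h e" "acts t g' f'" "acts t h' e'" "\<And>v. f (e v) = f' (e' v)"
  shows "chi t g * chi t h = chi t g' * chi t h'"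
proof -
  have "acts t (comp_R t g h) (f' \<circ> e')" using acts_compose[OF assms(5,6)] by (rule acts_cong) (simp add: assms(9))
  then have "comp_R t g h = comp_R t g' h'" using acts_compose[OF assms(7,8)] by (rule acts_unique)
  then show ?thesis using chi_mult assms by metis
qed

lemma chi_id: "chi t (id_R t) = 1" for t :: "'k::field_char_0"
proof -
  have "chi t (id_R t) * chi t (id_R t) = chi t (comp_R t (id_R t) (id_R t))" using chi_mult[OF fauts_id fauts_id, of t] by simp
  also have "comp_R t (id_R t) (id_R t) = id_R t" by (rule ext) (simp add: compose_def)
  finally show ?thesis using chi_nonzero[OF fauts_id, of t] by (metis mult_cancel_left2)
qed

text \<open>
  The identities used are \<open>\<Theta>\<^sub>2 \<Psi>\<^sub>l = \<Psi>\<^sub>2\<^sub>l \<Theta>\<^sub>2\<close>, \<open>\<Psi>\<^sub>l \<Psi>\<^sub>l = \<Psi>\<^sub>2\<^sub>l\<close>, \<open>\<Omega> \<Phi>\<^sub>l = \<Psi>\<^sub>l \<Omega>\<close>, \<open>\<Omega> = \<Phi>\<^sub>1 \<Psi>\<^sub>1 \<Phi>\<^sub>1\<close>,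
  \<open>\<Omega> \<Theta>\<^sub>n = \<Theta>\<^sub>1\<^sub>/\<^sub>n \<Omega>\<close> and \<open>\<Theta>\<^sub>n \<Theta>\<^sub>n = \<Theta>\<^sub>m\<close> for \<open>n\<^sup>2 = m\<close>. The last one uses that the field is algebraically closed.
\<close>
lemma chi_generators:
  fixes t :: "'k::{alg_closed_field, field_char_0}"
  shows "chi t (Omega_aut t) = 1" "m \<noteq> 0 \<Longrightarrow> chi t (Theta_aut t m) = 1" "chi t (Psi_aut t l) = 1" "chi t (Phi_aut t l) = 1"
proof -
  note F = generator_filtered[where t = t]
  have F': "Theta_aut t 2 \<in> fauts t" "acts t (Theta_aut t 2) (f_Theta 2)"
    using F(2)[of 2] Theta_acts[of 2 t] by simp_all
  show Psi: "chi t (Psi_aut t l) = 1" for l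
  proof -
    have "chi t (Theta_aut t 2) * chi t (Psi_aut t l) = chi t (Psi_aut t (2 * l)) * chi t (Theta_aut t 2)"
      by (rule chi_eqI[OF F'(1) F(3) F(3) F'(1) F'(2) Psi_acts Psi_acts F'(2)]) (auto simp: algebra_simps)
    moreover have "chi t (Psi_aut t l) * chi t (Psi_aut t l) = chi t (Psi_aut t (2 * l)) * chi t (id_R t)"
      by (rule chi_eqI[OF F(3) F(3) F(3) fauts_id Psi_acts Psi_acts Psi_acts acts_id]) (auto simp: algebra_simps)
    ultimately show ?thesis using chi_nonzero[OF F'(1)] chi_nonzero[OF F(3), of l] by (simp add: chi_id)
  qed
  have OO: "chi t (Omega_aut t) * chi t (Omega_aut t) = 1"
    using chi_eqI[OF F(1) F(1) fauts_id fauts_id Omega_acts Omega_acts acts_id acts_id] by (auto simp: chi_id)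
  show Phi: "chi t (Phi_aut t l) = 1" for l
  proof -
    have "chi t (Omega_aut t) * chi t (Phi_aut t l) = chi t (Psi_aut t l) * chi t (Omega_aut t)"
      by (rule chi_eqI[OF F(1) F(4) F(3) F(1) Omega_acts Phi_acts Psi_acts Omega_acts]) (auto simp: algebra_simps)
    then show ?thesis using chi_nonzero[OF F(1)] by (simp add: Psi)
  qed
  show O: "chi t (Omega_aut t) = 1"
  proof -
    have "chi t (Omega_aut t) * chi t (id_R t) = chi t (Phi_aut t 1) * chi t (comp_R t (Psi_aut t 1) (Phi_aut t 1))"
      by (rule chi_eqI[OF F(1) fauts_id F(4) fauts_compose[OF F(3) F(4)] Omega_acts acts_id Phi_acts acts_compose[OF Psi_acts Phi_acts]])
        (auto simp: algebra_simps)
    then show ?thesis by (simp add: chi_id Phi Psi chi_mult F)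
  qed
  have sq: "chi t (Theta_aut t n) * chi t (Theta_aut t n) = 1" if n: "n \<noteq> 0" for n
  proof -
    have i: "inverse n \<noteq> 0" using n by simp
    have "chi t (Omega_aut t) * chi t (Theta_aut t n) = chi t (Theta_aut t (inverse n)) * chi t (Omega_aut t)"
      by (rule chi_eqI[OF F(1) F(2)[OF n] F(2)[OF i] F(1) Omega_acts Theta_acts[OF n] Theta_acts[OF i] Omega_acts]) auto
    moreover have "chi t (Theta_aut t n) * chi t (Theta_aut t (inverse n)) = chi t (id_R t) * chi t (id_R t)"
      by (rule chi_eqI[OF F(2)[OF n] F(2)[OF i] fauts_id fauts_id Theta_acts[OF n] Theta_acts[OF i] acts_id acts_id]) (use n in auto)
    ultimately show ?thesis by (simp add: O chi_id)
  qed
  show "chi t (Theta_aut t m) = 1" if m: "m \<noteq> 0"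
  proof -
    obtain n where n: "n ^ 2 = m" using nth_root_exists[of 2 m] by auto
    then have n0: "n \<noteq> 0" using m by auto
    have "chi t (Theta_aut t n) * chi t (Theta_aut t n) = chi t (Theta_aut t m) * chi t (id_R t)"
      by (rule chi_eqI[OF F(2)[OF n0] F(2)[OF n0] F(2)[OF m] fauts_id Theta_acts[OF n0] Theta_acts[OF n0] Theta_acts[OF m] acts_id])
        (auto simp: power2_eq_square mult.assoc simp flip: n)
    then show ?thesis by (simp add: sq[OF n0] chi_id)
  qed
qed

lemma chi_gen_group:
  fixes t :: "'k::{alg_closed_field, field_char_0}"
  assumes "g \<in> gen_group t"
  shows "chi t g = 1"
  using assms
proof (induction rule: generate.induct)
  case one
  then show ?case unfolding alg_aut_group_simps by (rule chi_id)
next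
  case (incl h)
  then show ?case by (auto simp: G_gens_def chi_generators)
next
  case (inv h)
  interpret G: group "alg_aut_group (R_alg t)" by (rule group_alg_aut)
  have h: "h \<in> fauts t" and ih: "inv\<^bsub>alg_aut_group (R_alg t)\<^esub> h \<in> fauts t"
    using generate.incl[OF inv] generate.inv[OF inv] gen_group_fauts by blast+
  have "inv\<^bsub>alg_aut_group (R_alg t)\<^esub> h \<otimes>\<^bsub>alg_aut_group (R_alg t)\<^esub> h = id_R t"
    using G.l_inv[of h] h by (simp add: alg_aut_group_simps fauts_alg_auts)
  then have "comp_R t (inv\<^bsub>alg_aut_group (R_alg t)\<^esub> h) h = id_R t"
    using h ih by (simp add: alg_aut_group_simps fauts_alg_auts)
  moreover have "chi t h = 1" using inv by (auto simp: G_gens_def chi_generators)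
  ultimately show ?case using chi_mult[OF ih h] by (simp add: chi_id)
next
  case (eng h1 h2)
  have "h1 \<in> fauts t" "h2 \<in> fauts t" using eng.hyps gen_group_fauts by blast+
  then show ?case using eng.IH by (simp add: alg_aut_group_simps fauts_alg_auts chi_mult)
qed

theorem theorem2p6:
  fixes t :: "'k :: {alg_closed_field, field_char_0}"
  shows "filtered_auts (R_alg t) (R_filt t) = generate (alg_aut_group (R_alg t)) (G_gens t)
    \<and> (\<forall>g \<in> filtered_auts (R_alg t) (R_filt t). filtered_hdet (R_alg t) (R_filt t) g = 1)"
  using fauts_gen_group[of _ t] gen_group_fauts[of t] chi_gen_group[of _ t] by blast

end
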